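(* Let $n\ge 1$, $\alpha>\frac12$ and $H=(-\Delta)^{\alpha}$ on $L^2(\mathbb{R}^n)$. Let $E,F\subset\mathbb{R}^n$ be two measurable sets of finite Lebesgue measure, and if $\alpha<1$ assume in addition that $$\int_{\mathbb{R}^n\times\mathbb{R}^n}\mathbf{1}_F(x)\,|x-y|^{2\gamma}\,\mathbf{1}_E(y)\,dx\,dy<+\infty,\qquad \gamma=\frac{n(1-\alpha)}{2\alpha-1}.$$ Then for every real $T\neq0$ there is a constant $C=C(E,F,T,n,\alpha)$ such that every solution $u(t)=e^{-itH}u(0)$, $u(0)\in L^2(\mathbb{R}^n)$, of $i\partial_t u=Hu$ satisfies $$\|u(t)\|_{L^2(\mathbb{R}^n)}\le C\left(\|u(0)\|_{L^2(E^c)}+\|u(T)\|_{L^2(F^c)}\right)\qquad\text{for all } t\in\mathbb{R}.$$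
   Context: For $\alpha>0$, $(-\Delta)^\alpha$ is the nonnegative selfadjoint operator on $L^2(\mathbb{R}^n)$ with Fourier multiplier $|\xi|^{2\alpha}$, so that $u(t)=e^{-itH}u_0$ means $\widehat{u}(t,\xi)=e^{-it|\xi|^{2\alpha}}\widehat{u_0}(\xi)$. $\mathbf{1}_E$ is the indicator function of $E$ and $E^c=\mathbb{R}^n\setminus E$. *)

theory Defs
  imports "HOL-Analysis.Analysis"
begin

text \<open>Elements of \<open>L\<^sup>2\<close> are represented by functions; every notion below is insensitive to
  changes on null sets.\<close>

definition L2 :: "('a::euclidean_space \<Rightarrow> complex) set" where
  "L2 = {f \<in> borel_measurable lebesgue. integrable lebesgue (\<lambda>x. (cmod (f x))\<^sup>2)}"

definition L2_norm_on :: "'a::euclidean_space set \<Rightarrow> ('a \<Rightarrow> complex) \<Rightarrow> real" where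
  "L2_norm_on A f = sqrt (LINT x:A|lebesgue. (cmod (f x))\<^sup>2)"

text \<open>The unitary normalisation, with kernel \<open>e\<^bsup>-i x\<cdot>\<xi>\<^esup>\<close>, so that \<open>-\<Delta>\<close> has symbol \<open>|\<xi>|\<^sup>2\<close>.\<close>

definition truncated_fourier ::
    "real \<Rightarrow> ('a::euclidean_space \<Rightarrow> complex) \<Rightarrow> 'a \<Rightarrow> complex" where
  "truncated_fourier R f \<xi> =
     complex_of_real ((2 * pi) powr (- real DIM('a) / 2)) *
     (LINT x:cball 0 R|lebesgue. cis (- (x \<bullet> \<xi>)) * f x)"

text \<open>\<open>g\<close> is (a representative of) the Fourier-Plancherel transform of \<open>f\<close>: the limit in \<open>L\<^sup>2\<close> of
  the Fourier integrals over balls. By Plancherel's theorem every \<open>f \<in> L2\<close> has such a \<open>g\<close>, unique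
  up to null sets. The limit is expressed by a nonnegative integral because the Bochner
  integral is \<open>0\<close> on nonintegrable functions.\<close>

definition has_fourier_transform ::
    "('a::euclidean_space \<Rightarrow> complex) \<Rightarrow> ('a \<Rightarrow> complex) \<Rightarrow> bool" where
  "has_fourier_transform f g \<longleftrightarrow> f \<in> L2 \<and> g \<in> L2 \<and>
     ((\<lambda>R. \<integral>\<^sup>+ \<xi>. ennreal ((cmod (truncated_fourier R f \<xi> - g \<xi>))\<^sup>2) \<partial>lebesgue) \<longlongrightarrow> 0) at_top"

text \<open>The graph of the operator on \<open>L\<^sup>2\<close> with Fourier multiplier \<open>m\<close>, on its maximal domain.\<close>

definition fourier_multiplier ::
    "('a::euclidean_space \<Rightarrow> complex) \<Rightarrow> ('a \<Rightarrow> complex) \<Rightarrow> ('a \<Rightarrow> complex) \<Rightarrow> bool" where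
  "fourier_multiplier m f g \<longleftrightarrow>
     (\<exists>h. has_fourier_transform f h \<and> has_fourier_transform g (\<lambda>\<xi>. m \<xi> * h \<xi>))"

definition frac_laplacian_symbol :: "real \<Rightarrow> 'a::euclidean_space \<Rightarrow> real" where
  "frac_laplacian_symbol \<alpha> \<xi> = norm \<xi> powr (2 * \<alpha>)"

text \<open>\<open>u t = e\<^bsup>-itH\<^esup> (u 0)\<close> for all \<open>t\<close>, where \<open>H = (-\<Delta>)\<^sup>\<alpha>\<close> and \<open>u 0 \<in> L2\<close>.\<close>

definition frac_schrodinger_solution ::
    "real \<Rightarrow> (real \<Rightarrow> 'a::euclidean_space \<Rightarrow> complex) \<Rightarrow> bool" where
  "frac_schrodinger_solution \<alpha> u \<longleftrightarrow>
     (\<forall>t. fourier_multiplier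
            (\<lambda>\<xi>. exp (- \<i> * complex_of_real (t * frac_laplacian_symbol \<alpha> \<xi>))) (u 0) (u t))"

end

theory Submission
  imports Defs "HOL-Complex_Analysis.Complex_Analysis" "HOL-Probability.Probability" "HOL-Real_Asymp.Real_Asymp"
begin

text \<open>Let \<open>U\<close> be the propagator at time \<open>T\<close>. Its kernel, regularised by the factor \<open>exp (- \<epsilon> |\<xi>|\<^sup>2\<^sup>\<alpha>)\<close>, reduces to an
  integral over the radius \<open>|\<xi>|\<close> and splits into an incoming and an outgoing wave. Only the outgoing wave has a saddle
  point, and deforming the contour through it bounds the kernel by \<open>C (1 + |x - y|) powr g\<close> uniformly in \<open>\<epsilon>\<close>, where
  \<open>g = \<gamma>\<close> if \<open>\<alpha> < 1\<close> and \<open>g = 0\<close> otherwise. Hence \<open>1\<^sub>F U 1\<^sub>E\<close> is a Hilbert-Schmidt operator, and by compactness the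
  inequality can only fail if some \<open>f \<noteq> 0\<close> satisfies \<open>f = 1\<^sub>E f\<close> and \<open>U f = 1\<^sub>F U f\<close>. In that case arbitrarily many small
  translates of \<open>f\<close> are linearly independent and, as \<open>U\<close> commutes with translations, localised in sets slightly larger
  than \<open>E\<close> and \<open>F\<close>, whose Hilbert-Schmidt norm stays bounded. That norm bounds the number of such functions, a
  contradiction (the argument of Amrein and Berthier).\<close>

section \<open>Gaussian integrals and Laplace transforms\<close>

text \<open>As \<epsilon> tends to 0 absolute convergence is lost, so every bound that survives must
  come from contours on which c = \<epsilon> + iT enters only through a lower bound for |c|. Bessel
  functions are avoided: integrating over the hyperplanes orthogonal to x leaves a one-dimensional
  Fourier integral, whose amplitude is again an integral along a ray and therefore extends
  holomorphically to a sector of complex frequencies. With r = |x| the stationary frequency solves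
  2\<alpha> |c| k0^(2\<alpha> - 1) = r, and here \<alpha> > 1/2 is essential. For \<alpha> < 1 the
  amplitude is at most of order k0^((n - 1)(1 - \<alpha>)), and the width of the saddle contributes
  k0^(1 - \<alpha>). Together they give r^(n(1 - \<alpha>)/(2\<alpha> - 1)) = r^\<gamma>, so the
  weight in the hypothesis is the square of the kernel bound. The contradiction at the end requires
  a Hilbert-Schmidt bound that does not grow with the number of translates; strong continuity of
  translations on the product space provides it, because the step can be chosen after the
  number.\<close>

lemma has_bochner_integral_powr_exp:
 fixes a p :: real
 assumes a: "a > 0" and p: "p > -1"
 shows "has_bochner_integral lborel (\<lambda>s. indicator {0..} s * (s powr p * exp (- (a * s))))
      (Gamma (p + 1) / a powr (p + 1))"
proof -
 have 1: "((\<lambda>t. t powr p / exp t) has_integral Gamma (p + 1)) {0..}"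
  using Gamma_integral_real[of "p + 1"] p by simp
 have "(\<integral>\<^sup>+ t. ennreal (indicator {0..} t * (t powr p / exp t)) \<partial>lborel) = ennreal (Gamma (p + 1))"
  using nn_integral_has_integral_lebesgue[OF _ 1] by (simp add: nn_integral_completion mult_ac)
 hence "has_bochner_integral lborel (\<lambda>t. indicator {0..} t * (t powr p / exp t)) (Gamma (p + 1))"
  by (intro has_bochner_integral_nn_integral) (use p in \<open>auto intro!: Gamma_real_pos less_imp_le\<close>)
 hence "has_bochner_integral lborel (\<lambda>s. indicator {0..} (0 + a * s) * ((0 + a * s) powr p / exp (0 + a * s)))
      (Gamma (p + 1) /\<^sub>R \<bar>a\<bar>)"
  using a by (subst (asm) lborel_has_bochner_integral_real_affine_iff[where c=a and t=0]) auto
 hence "has_bochner_integral lborel (\<lambda>s. a powr (- p) * (indicator {0..} (0 + a * s) * ((0 + a * s) powr p / exp (0 + a * s))))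
      (a powr (- p) * (Gamma (p + 1) /\<^sub>R \<bar>a\<bar>))"
  by (intro has_bochner_integral_mult_right) auto
 moreover have "(\<lambda>s. a powr (- p) * (indicator {0..} (0 + a * s) * ((0 + a * s) powr p / exp (0 + a * s)))) =
  (\<lambda>s. indicator {0..} s * (s powr p * exp (- (a * s))))"
  using a by (auto simp: fun_eq_iff indicator_def zero_le_mult_iff powr_mult powr_minus exp_minus field_simps)
 moreover have "a powr (- p) * (Gamma (p + 1) /\<^sub>R \<bar>a\<bar>) = Gamma (p + 1) / a powr (p + 1)"
  using a by (simp add: powr_minus powr_add field_simps)
 ultimately show ?thesis by simp
qed

lemma has_bochner_integral_exp_tail:
 fixes a b :: real
 assumes a: "a > 0"
 shows "has_bochner_integral lborel (\<lambda>s. indicator {b..} s * exp (- (a * s))) (exp (- (a * b)) / a)"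
proof -
 have *: "((\<lambda>s. - (exp (- (a * s)) / a)) \<longlongrightarrow> 0) at_top"
  using a by real_asymp
 have "(\<integral>\<^sup>+ t. ennreal (exp (- (a * t))) * indicator {b..} t \<partial>lborel) = ennreal (0 - (- (exp (- (a * b)) / a)))"
  by (rule nn_integral_FTC_atLeast[OF _ _ _ *]) (use a in \<open>auto intro!: derivative_eq_intros\<close>)
 also have "(\<integral>\<^sup>+ t. ennreal (exp (- (a * t))) * indicator {b..} t \<partial>lborel) =
  (\<integral>\<^sup>+ t. ennreal (indicator {b..} t * exp (- (a * t))) \<partial>lborel)"
  by (intro nn_integral_cong) (auto simp: indicator_def)
 finally show ?thesis
  using a by (intro has_bochner_integral_nn_integral) auto
qed

text \<open>The substitution v = exp(- s) turns the Laplace transform at the integers into moments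
  of a function on [0, 1], and by Weierstrass approximation a continuous function there is
  determined by its moments.\<close>

lemma lerch:
 fixes h :: "real \<Rightarrow> real"
 assumes cont: "continuous_on {0..} h" and bd: "\<And>s. s \<ge> 0 \<Longrightarrow> \<bar>h s\<bar> \<le> C * exp (s / 2)"
  and L: "\<And>j::nat. j \<ge> 1 \<Longrightarrow> (LINT s|lborel. indicator {0..} s * (exp (- (real j * s)) * h s)) = 0"
  and s0: "s0 \<ge> 0"
 shows "h s0 = 0"
proof -
 have C0: "C \<ge> 0" using bd[of 0] by simp
 have meas: "(\<lambda>s. indicator {0..} s * h s) \<in> borel_measurable borel"
  using borel_measurable_continuous_on_indicator[OF _ cont] by simp
 have meas': "(\<lambda>s. indicator {0..} s * (g s * h s)) \<in> borel_measurable borel"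
  if "g \<in> borel_measurable borel" for g :: "real \<Rightarrow> real"
 proof -
  have "(\<lambda>s. g s * (indicator {0..} s * h s)) \<in> borel_measurable borel" using that meas by measurable
  thus ?thesis by (simp add: mult_ac)
 qed
 have int: "integrable lborel (\<lambda>s. indicator {0..} s * (exp (- (real j * s)) * h s))" if "j \<ge> 1" for j :: nat
 proof (rule Bochner_Integration.integrable_bound)
  show "integrable lborel (\<lambda>s. C * (indicator {0..} s * exp (- (1 / 2 * s))))"
   using has_bochner_integral_exp_tail[of "1/2" 0]
   by (intro integrable_mult_right) (auto simp: has_bochner_integral_iff)
  show "AE s in lborel. norm (indicator {0..} s * (exp (- (real j * s)) * h s)) \<le> norm (C * (indicator {0..} s * exp (- (1 / 2 * s))))"
  proof (intro AE_I2)
   fix s :: real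
   have "exp (- (real j * s)) * \<bar>h s\<bar> \<le> C * exp (- (1 / 2 * s))" if "s \<ge> 0"
   proof -
    have "real j * s \<ge> s" using that \<open>j \<ge> 1\<close> by (simp add: mult_le_cancel_right1)
    hence "exp (- (real j * s)) * \<bar>h s\<bar> \<le> exp (- s) * (C * exp (s / 2))"
     using bd[OF that] by (intro mult_mono) auto
    also have "\<dots> = C * exp (- (1 / 2 * s))" by (simp add: mult_exp_exp mult.left_commute[of _ C])
    finally show ?thesis .
   qed
   thus "norm (indicator {0..} s * (exp (- (real j * s)) * h s)) \<le> norm (C * (indicator {0..} s * exp (- (1 / 2 * s))))"
    using C0 by (auto simp: indicator_def abs_mult)
  qed
 qed (use meas'[of "\<lambda>s. exp (- (real j * s))"] in auto)
 \<comment> \<open>The extra factor exp(- s) makes \<open>k\<close> decay like exp(- s / 2), so that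
   \<open>K\<close>, which is \<open>k\<close> in the variable v = exp(- s), extends continuously to
   v = 0 with value 0.\<close>
 define k where "k s = exp (- s) * h s" for s
 define K where "K v = (if v \<le> 0 then 0 else k (- ln v))" for v
 have kbd: "\<bar>k s\<bar> \<le> C * exp (- (s / 2))" if "s \<ge> 0" for s
 proof -
  have "\<bar>k s\<bar> \<le> exp (- s) * (C * exp (s / 2))"
   unfolding k_def using bd[OF that] by (simp add: abs_mult)
  also have "\<dots> = C * exp (- (s / 2))" by (simp add: mult_exp_exp mult.left_commute[of _ C])
  finally show ?thesis .
 qed
 have contk: "continuous_on {0..} k" unfolding k_def by (intro continuous_intros cont)
 have "continuous_on {0..1} K"
  unfolding continuous_on_eq_continuous_within
 proof
  fix v :: real assume v: "v \<in> {0..1}"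
  show "continuous (at v within {0..1}) K"
  proof (cases "v = 0")
   case True
   have "(K \<longlongrightarrow> 0) (at 0 within {0..1})"
   proof (rule tendsto_0_le[where K=1])
    show "((\<lambda>v. C * sqrt v) \<longlongrightarrow> 0) (at 0 within {0..1})"
     by (auto intro!: tendsto_eq_intros)
    show "\<forall>\<^sub>F x in at 0 within {0..1}. norm (K x) \<le> norm (C * sqrt x) * 1"
    proof (intro eventually_at_filter[THEN iffD2] always_eventually allI impI)
     fix x :: real assume "x \<noteq> 0" "x \<in> {0..1}"
     hence x: "0 < x" "x \<le> 1" by auto
     have "\<bar>k (- ln x)\<bar> \<le> C * exp (ln x / 2)" using kbd[of "- ln x"] x by simp
     also have "exp (ln x / 2) = sqrt x" using x by (simp flip: ln_sqrt)
     finally show "norm (K x) \<le> norm (C * sqrt x) * 1" using x C0 by (simp add: K_def)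
    qed
   qed
   thus ?thesis using True by (simp add: continuous_within K_def)
  next
   case False
   hence v: "0 < v" "v \<le> 1" using v by auto
   have "continuous_on {0<..1} (\<lambda>v. k (- ln v))"
    by (rule continuous_on_compose2[OF contk]) (auto intro!: continuous_intros)
   hence "continuous_on {0<..1} K" by (rule continuous_on_eq) (auto simp: K_def)
   hence "continuous (at v within {0<..1}) K" using v by (auto simp: continuous_on_eq_continuous_within)
   moreover have "at v within {0<..1} = at v within {0..1}"
    by (rule at_within_nhd[of _ "{0<..}"]) (use v in auto)
   ultimately show ?thesis by (simp add: continuous_within)
  qed
 qed
 note contK = this
 \<comment> \<open>In the variable v this is the integral of the square of \<open>K\<close> over
   [0, 1], the weight exp(- s) being the Jacobian.\<close>
 define I where "I = (LINT s|lborel. indicator {0..} s * (exp (- s) * (k s)\<^sup>2))"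
 define J where "J = (LINT s|lborel. indicator {0..} s * (exp (- s) * C))"
 have intJ: "integrable lborel (\<lambda>s. indicator {0..} s * (exp (- s) * C))"
  using has_bochner_integral_exp_tail[of 1 0] integrable_mult_left[of C lborel "\<lambda>s. indicator {0..} s * exp (- s)"]
  by (auto simp: has_bochner_integral_iff mult.assoc)
 have intI: "integrable lborel (\<lambda>s. indicator {0..} s * (exp (- s) * (k s)\<^sup>2))"
 proof (rule Bochner_Integration.integrable_bound[OF integrable_mult_right[OF intJ, of C]])
  have "(\<lambda>s. indicator {0..} s * ((exp (- s) * (exp (-s))\<^sup>2) * ((indicator {0..} s * h s) * (indicator {0..} s * h s)))) \<in> borel_measurable borel"
   using meas by measurable
  also have "(\<lambda>s. indicator {0..} s * ((exp (- s) * (exp (-s))\<^sup>2) * ((indicator {0..} s * h s) * (indicator {0..} s * h s)))) =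
    (\<lambda>s. indicator {0..} s * (exp (- s) * (k s)\<^sup>2))"
   by (auto simp: fun_eq_iff indicator_def k_def power2_eq_square)
  finally show "(\<lambda>s. indicator {0..} s * (exp (- s) * (k s)\<^sup>2)) \<in> borel_measurable lborel" by simp
  show "AE s in lborel. norm (indicator {0..} s * (exp (- s) * (k s)\<^sup>2)) \<le> norm (C * (indicator {0..} s * (exp (- s) * C)))"
  proof (intro AE_I2)
   fix s :: real
   have "(k s)\<^sup>2 \<le> C\<^sup>2" if "s \<ge> 0"
   proof -
    have "\<bar>k s\<bar> \<le> C * 1" using kbd[OF that] that C0
     by (elim order_trans) (intro mult_left_mono, auto)
    thus ?thesis by (simp add: abs_le_square_iff[symmetric] C0)
   qed
   thus "norm (indicator {0..} s * (exp (- s) * (k s)\<^sup>2)) \<le> norm (C * (indicator {0..} s * (exp (- s) * C)))"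
    using C0 mult_left_mono[of "(k s)\<^sup>2" "C\<^sup>2" "exp (- s)"]
    by (auto simp: indicator_def power2_eq_square abs_mult mult_ac)
  qed
 qed
 have Ie: "I \<le> e * J" if "e > 0" for e
 proof -
  obtain g where g: "real_polynomial_function g" "\<And>v. v \<in> {0..1} \<Longrightarrow> \<bar>K v - g v\<bar> < e"
   using Stone_Weierstrass_real_polynomial_function[OF compact_Icc contK \<open>e > 0\<close>] by blast
  obtain a n where gn: "g = (\<lambda>x. \<Sum>i\<le>n. a i * x ^ i)" using g(1) real_polynomial_function_imp_sum by blast
  have gk: "\<bar>k s - g (exp (- s))\<bar> \<le> e" if "s \<ge> 0" for s
   using g(2)[of "exp (- s)"] that by (auto simp: K_def)
  \<comment> \<open>Two factors exp(- s), one from \<open>k\<close> and one from the Jacobian, turn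
    the i-th moment into the Laplace transform at i + 2, which vanishes by assumption. Thus
    \<open>k\<close> is orthogonal to every polynomial in exp(- s) for the weight exp(- s).\<close>
  have eq: "indicator {0..} s * (exp (- s) * k s * g (exp (- s))) =
    (\<Sum>i\<le>n. a i * (indicator {0..} s * (exp (- (real (i + 2) * s)) * h s)))" for s
  proof -
   have "exp (- s) * k s * (exp (- s)) ^ i = exp (- (real (i + 2) * s)) * h s" for i
   proof -
    have "exp (- (real (i + 2) * s)) = exp (- s) * exp (- s) * exp (- s) ^ i"
     by (simp add: exp_add[symmetric] exp_of_nat_mult[symmetric] algebra_simps)
    thus ?thesis by (simp add: k_def mult_ac)
   qed
   note * = this[symmetric]
   show ?thesis unfolding * by (simp add: gn sum_distrib_left mult_ac)
  qed
  have int2: "integrable lborel (\<lambda>s. indicator {0..} s * (exp (- s) * k s * g (exp (- s))))"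
   unfolding eq by (intro Bochner_Integration.integrable_sum integrable_mult_right int) auto
  have z: "(LINT s|lborel. indicator {0..} s * (exp (- s) * k s * g (exp (- s)))) = 0"
   unfolding eq
   by (subst Bochner_Integration.integral_sum; (intro integrable_mult_right int)?)
     (auto simp: L simp del: of_nat_add of_nat_Suc)
  have "I = (LINT s|lborel. indicator {0..} s * (exp (- s) * (k s)\<^sup>2) - indicator {0..} s * (exp (- s) * k s * g (exp (- s))))"
   using z by (simp add: I_def Bochner_Integration.integral_diff[OF intI int2])
  also have "\<dots> \<le> (LINT s|lborel. e * (indicator {0..} s * (exp (- s) * C)))"
  proof (intro integral_mono Bochner_Integration.integrable_diff intI int2 integrable_mult_right intJ)
   fix s :: real
   have "exp (- s) * (k s)\<^sup>2 - exp (- s) * k s * g (exp (- s)) \<le> e * (exp (- s) * C)" if "s \<ge> 0"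
   proof -
    have "k s * (k s - g (exp (- s))) \<le> \<bar>k s\<bar> * \<bar>k s - g (exp (- s))\<bar>" by (metis abs_ge_self abs_mult)
    also have "\<dots> \<le> C * e"
    proof (intro mult_mono gk that)
     show "\<bar>k s\<bar> \<le> C" using kbd[OF that] that C0 mult_left_le[of "exp (- (s / 2))" C] by auto
    qed (use C0 in auto)
    finally have "exp (- s) * (k s * (k s - g (exp (- s)))) \<le> exp (- s) * (C * e)" by simp
    thus ?thesis by (simp add: algebra_simps power2_eq_square)
   qed
   thus "indicator {0..} s * (exp (- s) * (k s)\<^sup>2) - indicator {0..} s * (exp (- s) * k s * g (exp (- s))) \<le> e * (indicator {0..} s * (exp (- s) * C))"
    by (auto simp: indicator_def)
  qed
  also have "\<dots> = e * J" by (simp add: J_def)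
  finally show ?thesis .
 qed
 have J0: "J \<ge> 0" unfolding J_def using C0 by (intro integral_nonneg_AE AE_I2) auto
 have "I \<le> 0"
 proof (rule field_le_epsilon)
  fix e :: real assume "e > 0"
  hence "I \<le> e / (J + 1) * J" using J0 by (intro Ie) auto
  also have "\<dots> \<le> e" using J0 \<open>e > 0\<close> by (simp add: field_simps)
  finally show "I \<le> 0 + e" by simp
 qed
 have "I \<ge> 0" unfolding I_def by (intro integral_nonneg_AE AE_I2) auto
 have I0: "(LINT s|lborel. indicator {0..} s * (exp (- s) * (k s)\<^sup>2)) = 0"
  using antisym[OF \<open>I \<le> 0\<close> \<open>I \<ge> 0\<close>] unfolding I_def .
 have AE0: "AE s in lborel. indicator {0..} s * (exp (- s) * (k s)\<^sup>2) = 0"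
  by (rule integral_nonneg_eq_0_iff_AE[OF intI, THEN iffD1, OF _ I0]) auto
 have "k s = 0" if "s > 0" for s
 proof (rule ccontr)
  assume "k s \<noteq> 0"
  have "continuous_on {0<..} k" using contk by (rule continuous_on_subset) auto
  hence "open (k -` (- {0}) \<inter> {0<..})"
   by (subst (asm) continuous_on_open_vimage) auto
  moreover have "s \<in> k -` (- {0}) \<inter> {0<..}" using that \<open>k s \<noteq> 0\<close> by auto
  ultimately obtain d where d: "d > 0" "ball s d \<subseteq> k -` (- {0}) \<inter> {0<..}"
   using open_contains_ball by blast
  have "AE x in lborel. x \<notin> ball s d"
   using AE0
  proof eventually_elim
   case (elim x)
   show ?case
   proof
    assume "x \<in> ball s d"
    hence "k x \<noteq> 0" "x > 0" using d by auto
    thus False using elim by auto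
   qed
  qed
  hence "ball s d \<in> null_sets lborel" by (subst AE_iff_null_sets) auto
  hence "negligible (ball s d)" by (simp add: negligible_iff_null_sets null_sets_completionI)
  thus False using d(1) open_not_negligible[of "ball s d"] by auto
 qed
 hence *: "\<forall>x\<in>{0<..}. h x = 0" by (simp add: k_def)
 have "\<forall>x\<in>closure {0<..}. h x = 0"
  using continuous_constant_on_closure[of "{0<..}" h 0] * cont
  by (auto simp: closure_greaterThan)
 thus ?thesis using s0 by (simp add: closure_greaterThan)
qed

section \<open>Fourier transforms of Gaussians, leading to that of a ball\<close>

lemma gaussian_fourier_real:
 fixes t r :: real
 assumes t: "t > 0"
 shows "integrable lborel (\<lambda>k. cis (k * r) * complex_of_real (exp (- (t * k\<^sup>2))))"
  "(LINT k|lborel. cis (k * r) * complex_of_real (exp (- (t * k\<^sup>2)))) =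
    complex_of_real (sqrt (pi / t) * exp (- (r\<^sup>2 / (4 * t))))"
proof -
 \<comment> \<open>This scale turns the weight exp(- t k^2) into the standard normal density, whose
   characteristic function is known.\<close>
 define s where "s = sqrt (2 * t)"
 have s: "s > 0" "s\<^sup>2 = 2 * t" using t by (auto simp: s_def)
 have "complex_of_real (exp (- ((r / s)\<^sup>2) / 2)) = char std_normal_distribution (r / s)"
  by (simp add: char_std_normal_distribution)
 also have "\<dots> = (LINT x|lborel. std_normal_density x *\<^sub>R iexp (r / s * x))"
  unfolding char_def by (subst integral_density) (auto simp: normal_density_nonneg)
 finally have 1: "(LINT x|lborel. std_normal_density x *\<^sub>R iexp (r / s * x)) = complex_of_real (exp (- ((r / s)\<^sup>2) / 2))" ..
 have 2: "integrable lborel (\<lambda>x. std_normal_density x *\<^sub>R iexp (r / s * x))"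
  by (rule Bochner_Integration.integrable_bound[OF integrable_normal_density[of 1 0]]) auto
 from 1 2 have "has_bochner_integral lborel (\<lambda>x. std_normal_density x *\<^sub>R iexp (r / s * x)) (complex_of_real (exp (- ((r / s)\<^sup>2) / 2)))"
  by (simp add: has_bochner_integral_iff)
 hence "has_bochner_integral lborel (\<lambda>x. std_normal_density (0 + s * x) *\<^sub>R iexp (r / s * (0 + s * x)))
      (complex_of_real (exp (- ((r / s)\<^sup>2) / 2)) /\<^sub>R \<bar>s\<bar>)"
  using s by (subst (asm) lborel_has_bochner_integral_real_affine_iff[where c=s and t=0]) auto
 hence 3: "has_bochner_integral lborel (\<lambda>x. complex_of_real (sqrt (2 * pi)) * (std_normal_density (0 + s * x) *\<^sub>R iexp (r / s * (0 + s * x))))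
      (complex_of_real (sqrt (2 * pi)) * (complex_of_real (exp (- ((r / s)\<^sup>2) / 2)) /\<^sub>R \<bar>s\<bar>))"
  by (intro has_bochner_integral_mult_right) auto
 have 4: "complex_of_real (sqrt (2 * pi)) * (std_normal_density (0 + s * x) *\<^sub>R iexp (r / s * (0 + s * x))) =
  cis (x * r) * complex_of_real (exp (- (t * x\<^sup>2)))" for x
 proof -
  have e: "- (s * x)\<^sup>2 / 2 = - (t * x\<^sup>2)" using s by (simp add: power_mult_distrib)
  have "sqrt (2 * pi) * std_normal_density (s * x) = exp (- (t * x\<^sup>2))"
   by (simp add: std_normal_density_def e[symmetric])
  hence "complex_of_real (sqrt (2 * pi)) * complex_of_real (std_normal_density (s * x)) = complex_of_real (exp (- (t * x\<^sup>2)))"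
   by (metis of_real_mult)
  moreover have "iexp (r / s * (s * x)) = cis (x * r)" using s(1) by (simp add: cis_conv_exp mult_ac)
  ultimately show ?thesis by (simp add: scaleR_conv_of_real mult_ac)
 qed
 have 5: "complex_of_real (sqrt (2 * pi)) * (complex_of_real (exp (- ((r / s)\<^sup>2) / 2)) /\<^sub>R \<bar>s\<bar>) =
  complex_of_real (sqrt (pi / t) * exp (- (r\<^sup>2 / (4 * t))))"
 proof -
  have "(r / s)\<^sup>2 / 2 = r\<^sup>2 / (4 * t)" using s by (simp add: power_divide)
  moreover have "sqrt (2 * pi) / s = sqrt (pi / t)"
   unfolding s_def by (simp add: real_sqrt_divide real_sqrt_mult)
  ultimately show ?thesis using s(1)
   by (simp add: scaleR_conv_of_real field_simps flip: of_real_mult of_real_divide)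
 qed
 from 3 show "integrable lborel (\<lambda>k. cis (k * r) * complex_of_real (exp (- (t * k\<^sup>2))))"
  "(LINT k|lborel. cis (k * r) * complex_of_real (exp (- (t * k\<^sup>2)))) =
    complex_of_real (sqrt (pi / t) * exp (- (r\<^sup>2 / (4 * t))))"
  unfolding 4 5 by (auto simp: has_bochner_integral_iff)
qed

lemma gaussian_fourier:
 fixes x :: "'a::euclidean_space" and t :: real
 assumes t: "t > 0"
 shows "integrable lborel (\<lambda>\<xi>::'a. cis (x \<bullet> \<xi>) * complex_of_real (exp (- (t * (norm \<xi>)\<^sup>2))))"
  "(LINT \<xi>|lborel. cis (x \<bullet> \<xi>) * complex_of_real (exp (- (t * (norm \<xi>)\<^sup>2)))) =
    complex_of_real ((pi / t) powr (DIM('a) / 2) * exp (- ((norm x)\<^sup>2 / (4 * t))))"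
proof -
 define g where "g b k = cis (k * (x \<bullet> b)) * complex_of_real (exp (- (t * k\<^sup>2)))" for b :: 'a and k
 interpret L: product_sigma_finite "\<lambda>_::'a. lborel :: real measure" ..
 have eq: "cis (x \<bullet> (\<Sum>b\<in>Basis. f b *\<^sub>R b)) * complex_of_real (exp (- (t * (norm (\<Sum>b\<in>Basis. f b *\<^sub>R b :: 'a))\<^sup>2)))
   = (\<Prod>b\<in>Basis. g b (f b))" for f
 proof -
  have "x \<bullet> (\<Sum>b\<in>Basis. f b *\<^sub>R b) = (\<Sum>b\<in>Basis. f b * (x \<bullet> b))"
   by (simp add: inner_sum_right)
  moreover have "cis (\<Sum>b\<in>A. f b * (x \<bullet> b)) = (\<Prod>b\<in>A. cis (f b * (x \<bullet> b)))" for A :: "'a set"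
   by (induction A rule: infinite_finite_induct) (auto simp: cis_mult[symmetric])
  moreover have "(norm (\<Sum>b\<in>Basis. f b *\<^sub>R b :: 'a))\<^sup>2 = (\<Sum>b\<in>Basis. (f b)\<^sup>2)"
   unfolding power2_norm_eq_inner by (subst euclidean_inner) (simp add: power2_eq_square)
  ultimately show ?thesis
   by (simp add: g_def prod.distrib sum_distrib_left exp_sum sum_negf[symmetric])
 qed
 have 1: "integrable lborel (g b)" "integral\<^sup>L lborel (g b) = complex_of_real (sqrt (pi / t) * exp (- ((x \<bullet> b)\<^sup>2 / (4 * t))))" for b
  using gaussian_fourier_real[OF t, of "x \<bullet> b"] by (simp_all add: g_def[abs_def])
 have 2: "integrable (Pi\<^sub>M Basis (\<lambda>_. lborel)) (\<lambda>f. \<Prod>b\<in>Basis. g b (f b))"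
  by (rule L.product_integrable_prod) (auto intro: 1)
 have 3: "integral\<^sup>L (Pi\<^sub>M Basis (\<lambda>_. lborel)) (\<lambda>f. \<Prod>b\<in>Basis. g b (f b)) = (\<Prod>b\<in>Basis. integral\<^sup>L lborel (g b))"
  by (rule L.product_integral_prod) (auto intro: 1)
 have m: "(\<lambda>f. \<Sum>b\<in>Basis. f b *\<^sub>R b :: 'a) \<in> measurable (Pi\<^sub>M Basis (\<lambda>b. lborel)) borel" by measurable
 have m2: "(\<lambda>\<xi>::'a. cis (x \<bullet> \<xi>) * complex_of_real (exp (- (t * (norm \<xi>)\<^sup>2)))) \<in> borel_measurable borel"
  by (intro borel_measurable_continuous_onI continuous_intros)
 show "integrable lborel (\<lambda>\<xi>::'a. cis (x \<bullet> \<xi>) * complex_of_real (exp (- (t * (norm \<xi>)\<^sup>2))))"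
  by (subst lborel_eq, subst integrable_distr_eq[OF m m2]) (use 2 in \<open>simp only: eq\<close>)
 have "(LINT \<xi>|lborel. cis (x \<bullet> \<xi>) * complex_of_real (exp (- (t * (norm \<xi>)\<^sup>2)))) = (\<Prod>b\<in>Basis. integral\<^sup>L lborel (g b))"
  by (subst lborel_eq, subst integral_distr[OF m m2]) (use 3 in \<open>simp only: eq\<close>)
 also have "\<dots> = complex_of_real (\<Prod>b\<in>(Basis::'a set). sqrt (pi / t) * exp (- ((x \<bullet> b)\<^sup>2 / (4 * t))))"
  by (simp add: 1)
 also have "(\<Prod>b\<in>(Basis::'a set). sqrt (pi / t) * exp (- ((x \<bullet> b)\<^sup>2 / (4 * t)))) =
   sqrt (pi / t) ^ DIM('a) * exp (- ((norm x)\<^sup>2 / (4 * t)))"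
  by (simp add: prod.distrib exp_sum[symmetric] sum_negf sum_divide_distrib[symmetric] norm_eq_sqrt_inner euclidean_inner[of x x] sum_nonneg power2_eq_square)
 also have "sqrt (pi / t) ^ DIM('a) = (pi / t) powr (DIM('a) / 2)"
  using t by (simp add: powr_half_sqrt[symmetric] powr_realpow[symmetric] powr_powr)
 finally show "(LINT \<xi>|lborel. cis (x \<bullet> \<xi>) * complex_of_real (exp (- (t * (norm \<xi>)\<^sup>2)))) =
    complex_of_real ((pi / t) powr (DIM('a) / 2) * exp (- ((norm x)\<^sup>2 / (4 * t))))" .
qed

lemma powr_le_exp:
 fixes p d :: real
 assumes "p \<ge> 0" "d > 0"
 obtains C where "C > 0" "\<And>u. u \<ge> 0 \<Longrightarrow> u powr p \<le> C * exp (d * u)"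
proof
 \<comment> \<open>For p > 0 the maximum of u^p exp(- d u), attained at u = p / d; the bound is ln x
   \<le> x - 1 at x = u d / p.\<close>
 define C where "C = exp (p * ln (p / d) - p)"
 show "C > 0" by (simp add: C_def)
 show "u powr p \<le> C * exp (d * u)" if "u \<ge> 0" for u
 proof (cases "u = 0 \<or> p = 0")
  case True
  thus ?thesis using that assms by (auto simp: C_def)
 next
  case False
  hence u: "u > 0" "p > 0" using that assms by auto
  have "ln (u * d / p) \<le> u * d / p - 1" using u assms by (intro ln_le_minus_one) auto
  hence "p * ln (u * d / p) \<le> p * (u * d / p - 1)" using u by (intro mult_left_mono) auto
  hence "p * (ln u + ln d - ln p) \<le> d * u - p" using u assms by (simp add: ln_mult ln_div algebra_simps)
  hence "p * ln u \<le> (p * ln (p / d) - p) + d * u" using u assms by (simp add: ln_div algebra_simps)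
  hence "exp (p * ln u) \<le> exp ((p * ln (p / d) - p) + d * u)" by (simp only: exp_le_cancel_iff)
  thus ?thesis using u by (simp add: powr_def C_def exp_add mult_ac)
 qed
qed

lemma lerch_complex:
 fixes h :: "real \<Rightarrow> complex"
 assumes cont: "continuous_on {0..} h" and bd: "\<And>s. s \<ge> 0 \<Longrightarrow> cmod (h s) \<le> C * exp (s / 2)"
  and int: "\<And>j::nat. j \<ge> 1 \<Longrightarrow> integrable lborel (\<lambda>s. indicator {0..} s *\<^sub>R (exp (- (real j * s)) *\<^sub>R h s))"
  and L: "\<And>j::nat. j \<ge> 1 \<Longrightarrow> (LINT s|lborel. indicator {0..} s *\<^sub>R (exp (- (real j * s)) *\<^sub>R h s)) = 0"
  and s0: "s0 \<ge> 0"
 shows "h s0 = 0"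
proof -
 have "Re (h s0) = 0"
 proof (rule lerch[where h="\<lambda>s. Re (h s)", OF _ _ _ s0])
  show "continuous_on {0..} (\<lambda>s. Re (h s))" by (intro continuous_intros cont)
  show "\<bar>Re (h s)\<bar> \<le> C * exp (s / 2)" if "s \<ge> 0" for s
   using bd[OF that] abs_Re_le_cmod order_trans by blast
  show "(LINT s|lborel. indicator {0..} s * (exp (- (real j * s)) * Re (h s))) = 0" if "j \<ge> 1" for j :: nat
   using integral_Re[OF int[OF that]] L[OF that] by (simp add: mult.assoc)
 qed
 moreover have "Im (h s0) = 0"
 proof (rule lerch[where h="\<lambda>s. Im (h s)", OF _ _ _ s0])
  show "continuous_on {0..} (\<lambda>s. Im (h s))" by (intro continuous_intros cont)
  show "\<bar>Im (h s)\<bar> \<le> C * exp (s / 2)" if "s \<ge> 0" for s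
   using bd[OF that] abs_Im_le_cmod order_trans by blast
  show "(LINT s|lborel. indicator {0..} s * (exp (- (real j * s)) * Im (h s))) = 0" if "j \<ge> 1" for j :: nat
   using integral_Im[OF int[OF that]] L[OF that] by (simp add: mult.assoc)
 qed
 ultimately show ?thesis by (simp add: complex_eq_iff)
qed

text \<open>A function of the form \<open>s \<mapsto> \<integral> w(y) \<phi>(s - q(y)) dy\<close>, with \<open>\<phi>\<close> vanishing on the negative axis,
 has Laplace transform \<open>\<integral> w(y) exp (- j q(y)) dy\<close> times that of \<open>\<phi>\<close>.\<close>

lemma laplace_superposition:
 fixes w :: "'a::euclidean_space \<Rightarrow> complex" and q :: "'a \<Rightarrow> real" and \<phi> :: "real \<Rightarrow> real"
 assumes w[measurable]: "w \<in> borel_measurable borel" and wb: "\<And>y. cmod (w y) \<le> 1"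
  and q[measurable]: "q \<in> borel_measurable borel" and q0: "\<And>y. q y \<ge> 0"
  and qnull: "\<And>s. {y. q y = s} \<in> null_sets lborel"
  and \<phi>[measurable]: "\<phi> \<in> borel_measurable borel" and \<phi>0: "\<And>u. u < 0 \<Longrightarrow> \<phi> u = 0"
  and \<phi>b: "\<And>u. 0 \<le> \<phi> u" "\<And>u. \<phi> u \<le> C * exp (u / 2)"
  and \<phi>c: "\<And>u. u > 0 \<Longrightarrow> isCont \<phi> u"
  and gauss: "\<And>t. t > 0 \<Longrightarrow> integrable lborel (\<lambda>y. exp (- (t * q y)))"
  and L\<phi>: "\<And>j::nat. j \<ge> 1 \<Longrightarrow> has_bochner_integral lborel (\<lambda>s. exp (- (real j * s)) * \<phi> s) (L j)"
 defines "\<Phi> \<equiv> \<lambda>s. (LINT y|lborel. w y * complex_of_real (\<phi> (s - q y)))"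
 shows "continuous_on {0..} \<Phi>"
  and "\<exists>D. \<forall>s. cmod (\<Phi> s) \<le> D * exp (s / 2)"
  and "j \<ge> 1 \<Longrightarrow> integrable lborel (\<lambda>s. indicator {0..} s *\<^sub>R (exp (- (real j * s)) *\<^sub>R \<Phi> s))"
  and "j \<ge> 1 \<Longrightarrow> (LINT s|lborel. indicator {0..} s *\<^sub>R (exp (- (real j * s)) *\<^sub>R \<Phi> s)) =
    complex_of_real (L j) * (LINT y|lborel. w y * complex_of_real (exp (- (real j * q y))))"
proof -
 have C0: "C \<ge> 0" using \<phi>b(1)[of 0] \<phi>b(2)[of 0] by simp
 have dom: "norm (w y * complex_of_real (\<phi> (s - q y))) \<le> C * exp (S / 2) * exp (- (1/2 * q y))" if "s \<le> S" for s S y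
 proof -
  have "norm (w y * complex_of_real (\<phi> (s - q y))) \<le> 1 * \<phi> (s - q y)"
   unfolding norm_mult using wb[of y] \<phi>b(1) by (intro mult_mono) auto
  also have "\<dots> \<le> C * exp ((s - q y) / 2)" using \<phi>b(2) by simp
  also have "\<dots> \<le> C * (exp (S / 2) * exp (- (1/2 * q y)))"
   unfolding exp_add[symmetric] using C0 that by (intro mult_left_mono) (auto simp: field_simps)
  finally show ?thesis by (simp add: mult.assoc)
 qed
 have domint: "integrable lborel (\<lambda>y. C * exp (S / 2) * exp (- (1/2 * q y)))" for S
  by (intro integrable_mult_right gauss) auto
 show "continuous_on {0..} \<Phi>"
  unfolding continuous_on_sequentially
 proof (intro allI ballI impI, elim conjE)
  fix x :: "nat \<Rightarrow> real" and a assume x: "\<forall>n. x n \<in> {0..}" "x \<longlonglongrightarrow> a" "a \<in> {0..}"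
  obtain S where S: "\<And>n. \<bar>x n\<bar> \<le> S"
   using convergent_imp_Bseq[OF convergentI[OF x(2)]] by (auto simp: Bseq_def)
  show "(\<Phi> \<circ> x) \<longlonglongrightarrow> \<Phi> a"
   unfolding \<Phi>_def o_def
  proof (rule integral_dominated_convergence[OF _ _ domint[of S]])
   \<comment> \<open>\<open>\<phi>\<close> may jump at 0, but the limit evaluates it there only on
     the level set q = a, which is a null set.\<close>
   show "AE y in lborel. (\<lambda>n. w y * complex_of_real (\<phi> (x n - q y))) \<longlonglongrightarrow> w y * complex_of_real (\<phi> (a - q y))"
    using AE_not_in[OF qnull[of a]]
   proof eventually_elim
    case (elim y)
    have lim: "(\<lambda>n. x n - q y) \<longlonglongrightarrow> a - q y" by (intro tendsto_intros x)
    have "(\<lambda>n. \<phi> (x n - q y)) \<longlonglongrightarrow> \<phi> (a - q y)"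
    proof (cases "a - q y > 0")
     case True
     thus ?thesis using isCont_tendsto_compose[OF \<phi>c lim] by blast
    next
     case False
     with elim have neg: "a - q y < 0" by auto
     have "\<forall>\<^sub>F n in sequentially. \<phi> (x n - q y) = 0"
      using order_tendstoD(2)[OF lim neg] by eventually_elim (rule \<phi>0)
     thus ?thesis using \<phi>0[OF neg] by (simp add: tendsto_eventually)
    qed
    thus ?case by (intro tendsto_intros)
   qed
   show "AE y in lborel. norm (w y * complex_of_real (\<phi> (x n - q y))) \<le> C * exp (S / 2) * exp (- (1/2 * q y))" for n
    by (intro AE_I2 dom) (use S[of n] in auto)
  qed measurable
 qed
 show "\<exists>D. \<forall>s. cmod (\<Phi> s) \<le> D * exp (s / 2)"
 proof (intro exI allI)
  fix s :: real
  have "cmod (\<Phi> s) \<le> (LINT y|lborel. C * exp (s / 2) * exp (- (1/2 * q y)))"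
   unfolding \<Phi>_def by (rule Bochner_Integration.integral_norm_bound_integral[OF Bochner_Integration.integrable_bound[OF domint[of s]] domint])
    (use dom[of s s] C0 in auto)
  thus "cmod (\<Phi> s) \<le> (C * (LINT y|lborel. exp (- (1/2 * q y)))) * exp (s / 2)" by (simp add: mult_ac)
 qed
 assume j: "j \<ge> 1"
 define G where "G = (\<lambda>(y, s). (exp (- (real j * s)) * \<phi> (s - q y)) *\<^sub>R w y)"
 have shift: "has_bochner_integral lborel (\<lambda>s. exp (- (real j * s)) * \<phi> (s - q y)) (exp (- (real j * q y)) * L j)" for y
 proof -
  have "has_bochner_integral lborel (\<lambda>s. exp (- (real j * (- q y + 1 * s))) * \<phi> (- q y + 1 * s)) (L j /\<^sub>R \<bar>1\<bar>)"
   using L\<phi>[OF j] by (subst (asm) lborel_has_bochner_integral_real_affine_iff[where c=1 and t="- q y"]) auto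
  hence "has_bochner_integral lborel (\<lambda>s. exp (- (real j * q y)) * (exp (- (real j * (- q y + 1 * s))) * \<phi> (- q y + 1 * s)))
    (exp (- (real j * q y)) * (L j /\<^sub>R \<bar>1\<bar>))"
   by (intro has_bochner_integral_mult_right) auto
  moreover have "exp (- (real j * q y)) * (exp (- (real j * (- q y + 1 * s))) * \<phi> (- q y + 1 * s)) = exp (- (real j * s)) * \<phi> (s - q y)" for s
  proof -
   have "exp (- (real j * q y)) * exp (- (real j * (- q y + 1 * s))) = exp (- (real j * s))"
    by (simp add: mult_exp_exp algebra_simps)
   thus ?thesis by (metis add.commute mult.assoc mult_1 uminus_add_conv_diff)
  qed
  ultimately show ?thesis by (simp only: abs_one inverse_1 scaleR_one)
 qed
 have intG: "integrable (lborel \<Otimes>\<^sub>M lborel) G"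
 proof (rule lborel_pair.Fubini_integrable)
  show "G \<in> borel_measurable (lborel \<Otimes>\<^sub>M lborel)" unfolding G_def by measurable
  have "(LINT s|lborel. norm (G (y, s))) = cmod (w y) * (exp (- (real j * q y)) * L j)" for y
   using has_bochner_integral_integral_eq[OF has_bochner_integral_mult_left[OF shift[of y], of "cmod (w y)"]] \<phi>b(1)
   by (simp add: G_def abs_mult mult.commute)
  thus "integrable lborel (\<lambda>y. LINT s|lborel. norm (G (y, s)))"
  proof (simp, intro Bochner_Integration.integrable_bound[OF integrable_mult_right[OF gauss[of "real j"], of "\<bar>L j\<bar>"]] AE_I2)
   show "norm (cmod (w y) * (exp (- (real j * q y)) * L j)) \<le> norm (\<bar>L j\<bar> * exp (- (real j * q y)))" for y
    using mult_right_mono[OF wb[of y], of "\<bar>L j\<bar> * exp (- (real j * q y))"] by (simp add: abs_mult mult_ac)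
  qed (use j in auto)
  show "AE y in lborel. integrable lborel (\<lambda>s. G (y, s))"
   unfolding G_def using shift by (auto simp: has_bochner_integral_iff intro!: AE_I2)
 qed
 have eq: "(LINT y|lborel. G (y, s)) = indicator {0..} s *\<^sub>R (exp (- (real j * s)) *\<^sub>R \<Phi> s)" for s
 proof -
  have *: "G (y, s) = indicator {0..} s *\<^sub>R (exp (- (real j * s)) *\<^sub>R (w y * complex_of_real (\<phi> (s - q y))))" for y
   using \<phi>0[of "s - q y"] q0[of y] by (auto simp: G_def indicator_def scaleR_conv_of_real mult_ac)
  show ?thesis unfolding * \<Phi>_def by simp
 qed
 show "integrable lborel (\<lambda>s. indicator {0..} s *\<^sub>R (exp (- (real j * s)) *\<^sub>R \<Phi> s))"
  using lborel_pair.integrable_snd[of "\<lambda>y s. G (y, s)"] intG unfolding eq by simp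
 have inner: "(LINT s|lborel. G (y, s)) = complex_of_real (L j) * (w y * complex_of_real (exp (- (real j * q y))))" for y
  unfolding G_def using has_bochner_integral_integral_eq[OF has_bochner_integral_scaleR_left[OF shift[of y], of "w y"]]
  by (simp add: scaleR_conv_of_real mult_ac)
 have "(LINT s|lborel. indicator {0..} s *\<^sub>R (exp (- (real j * s)) *\<^sub>R \<Phi> s)) = (LINT y|lborel. LINT s|lborel. G (y, s))"
  unfolding eq[symmetric] using lborel_pair.Fubini_integral[of "\<lambda>y s. G (y, s)"] intG by simp
 also have "\<dots> = (LINT y|lborel. complex_of_real (L j) * (w y * complex_of_real (exp (- (real j * q y)))))"
  unfolding inner ..
 finally show "(LINT s|lborel. indicator {0..} s *\<^sub>R (exp (- (real j * s)) *\<^sub>R \<Phi> s)) =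
    complex_of_real (L j) * (LINT y|lborel. w y * complex_of_real (exp (- (real j * q y))))"
  by simp
qed

lemma sphere_null: "{\<xi>::'a::euclidean_space. (norm \<xi>)\<^sup>2 = s} \<in> null_sets lborel"
proof -
 have "{\<xi>::'a. (norm \<xi>)\<^sup>2 = s} \<subseteq> sphere 0 (sqrt s)" by auto
 hence "negligible {\<xi>::'a. (norm \<xi>)\<^sup>2 = s}" using negligible_sphere negligible_subset by blast
 moreover have "{\<xi>::'a. (norm \<xi>)\<^sup>2 = s} \<in> sets borel" by measurable
 ultimately show ?thesis by (auto simp: negligible_iff_null_sets null_sets_def)
qed

lemma integrable_gaussian:
 "t > 0 \<Longrightarrow> integrable lborel (\<lambda>y::'a::euclidean_space. exp (- (t * (norm y)\<^sup>2)))"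
 using integrable_norm[OF gaussian_fourier(1)[of t "0::'a"]] by simp

text \<open>Geometrically, the slice of the ball of radius sqrt s by a hyperplane at distance |k|
  from the origin is a ball of dimension m and radius sqrt (s - k^2). The proof does not slice: as
  functions of s both sides have Laplace transforms given by Gaussian integrals, these agree at the
  positive integers, and Lerch's theorem identifies the two sides.\<close>

lemma fourier_ball:
 fixes x :: "'a::euclidean_space"
 defines "m \<equiv> real DIM('a) - 1"
 assumes s0: "s \<ge> 0"
 shows "(LINT \<xi>|lborel. cis (x \<bullet> \<xi>) * indicator {\<xi>. (norm \<xi>)\<^sup>2 \<le> s} \<xi>) =
  complex_of_real (unit_ball_vol m) * (LINT k|lborel. cis (k * norm x) * complex_of_real (max 0 (s - k\<^sup>2) powr (m / 2)))"
proof -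
 have m0: "m \<ge> 0" by (simp add: m_def)
 define A where "A s = (LINT \<xi>|lborel. cis (x \<bullet> \<xi>) * complex_of_real (indicator {0..} (s - (norm \<xi>)\<^sup>2)))" for s
 \<comment> \<open>For m = 0 the convention \<open>0 powr 0 = 0\<close> makes the power the
   indicator function of k^2 < s, so dimension one is covered by the same formula.\<close>
 define B where "B s = (LINT k|lborel. cis (k * norm x) * complex_of_real (max 0 (s - k\<^sup>2) powr (m / 2)))" for s
 define b where "b = unit_ball_vol m"
 define g where "g j = sqrt (pi / j) * exp (- ((norm x)\<^sup>2 / (4 * j)))" for j
 have cA: "(\<lambda>\<xi>::'a. cis (x \<bullet> \<xi>)) \<in> borel_measurable borel" "(\<lambda>k. cis (k * norm x)) \<in> borel_measurable borel"
  by (intro borel_measurable_continuous_onI continuous_intros)+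
 have LA: "has_bochner_integral lborel (\<lambda>s. exp (- (real j * s)) * indicator {0..} s) (1 / real j)" if "j \<ge> 1" for j :: nat
  using has_bochner_integral_exp_tail[of "real j" 0] that by (simp add: mult.commute)
 note gA = integrable_gaussian[where 'a='a]

 have isA: "isCont (indicator {0..} :: real \<Rightarrow> real) u" if "u > 0" for u
 proof -
  have "isCont (indicator {0..} :: real \<Rightarrow> real) u \<longleftrightarrow> isCont (\<lambda>_. 1 :: real) u"
   by (rule isCont_cong) (use eventually_nhds_in_open[of "{0<..}" u] that in \<open>auto elim!: eventually_mono\<close>)
  thus ?thesis by simp
 qed
 have bA: "indicator {0..} u \<le> 1 * exp (u / 2)" for u :: real by (auto simp: indicator_def)
 note A = laplace_superposition[where w="\<lambda>\<xi>. cis (x \<bullet> \<xi>)" and q="\<lambda>\<xi>::'a. (norm \<xi>)\<^sup>2" and \<phi>="indicator {0..}" and C=1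
   and L="\<lambda>j. 1 / real j", OF cA(1) _ _ _ sphere_null _ _ _ bA isA gA LA, folded A_def]
 obtain C where C: "C > 0" "\<And>u. u \<ge> 0 \<Longrightarrow> u powr (m / 2) \<le> C * exp (1 / 2 * u)"
  using powr_le_exp[of "m / 2" "1 / 2"] m0 by auto
 have bB: "max 0 u powr (m / 2) \<le> C * exp (u / 2)" for u
  using C(1) C(2)[of u] by (cases "u \<ge> 0") (auto simp: max_def)
 have isB: "isCont (\<lambda>u. max 0 u powr (m / 2)) u" if "u > 0" for u
  using that by (intro continuous_intros) auto
 have LB: "has_bochner_integral lborel (\<lambda>s. exp (- (real j * s)) * max 0 s powr (m / 2)) (Gamma (m / 2 + 1) / real j powr (m / 2 + 1))" if "j \<ge> 1" for j :: nat
 proof -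
  have "has_bochner_integral lborel (\<lambda>s. indicator {0..} s * (s powr (m / 2) * exp (- (real j * s)))) (Gamma (m / 2 + 1) / real j powr (m / 2 + 1))"
   using that m0 by (intro has_bochner_integral_powr_exp) auto
  also have "(\<lambda>s. indicator {0..} s * (s powr (m / 2) * exp (- (real j * s)))) = (\<lambda>s. exp (- (real j * s)) * max 0 s powr (m / 2))"
   by (auto simp: fun_eq_iff indicator_def max_def)
  finally show ?thesis .
 qed
 have gB: "integrable lborel (\<lambda>y::real. exp (- (t * y\<^sup>2)))" if "t > 0" for t
  using integrable_gaussian[OF that, where 'a=real] by simp
 have nB: "{k::real. k\<^sup>2 = s} \<in> null_sets lborel" for s
  using sphere_null[where 'a=real, of s] by simp
 note B = laplace_superposition[where w="\<lambda>k. cis (k * norm x)" and q="\<lambda>k::real. k\<^sup>2" and \<phi>="\<lambda>u. max 0 u powr (m / 2)" and C=C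
   and L="\<lambda>j. Gamma (m / 2 + 1) / real j powr (m / 2 + 1)", OF cA(2) _ _ _ nB _ _ _ bB isB gB LB, folded B_def]
 have A1: "continuous_on {0..} A" by (rule A(1)) auto
 have B1: "continuous_on {0..} B" by (rule B(1)) auto
 obtain DA where DA: "\<And>s. cmod (A s) \<le> DA * exp (s / 2)" using A(2) by force
 obtain DB where DB: "\<And>s. cmod (B s) \<le> DB * exp (s / 2)" using B(2) by force
 define h where "h s = A s - complex_of_real b * B s" for s
 have intA: "integrable lborel (\<lambda>s. indicator {0..} s *\<^sub>R (exp (- (real j * s)) *\<^sub>R A s))" if "j \<ge> 1" for j :: nat
  by (rule A(3)) (use that in auto)
 have intB: "integrable lborel (\<lambda>s. indicator {0..} s *\<^sub>R (exp (- (real j * s)) *\<^sub>R B s))" if "j \<ge> 1" for j :: nat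
  by (rule B(3)) (use that in auto)
 have hsplit: "indicator {0..} s *\<^sub>R (exp (- (real j * s)) *\<^sub>R h s) = indicator {0..} s *\<^sub>R (exp (- (real j * s)) *\<^sub>R A s)
   - complex_of_real b * (indicator {0..} s *\<^sub>R (exp (- (real j * s)) *\<^sub>R B s))" for s and j :: nat
  by (simp add: h_def algebra_simps scaleR_conv_of_real)
 have "h s = 0"
 proof (rule lerch_complex[of _ "DA + \<bar>b\<bar> * DB"])
  show "continuous_on {0..} h" unfolding h_def by (intro continuous_intros A1 B1)
  show "cmod (h s) \<le> (DA + \<bar>b\<bar> * DB) * exp (s / 2)" if "s \<ge> 0" for s
  proof -
   have "cmod (h s) \<le> cmod (A s) + \<bar>b\<bar> * cmod (B s)"
    unfolding h_def by (rule order_trans[OF norm_triangle_ineq4]) (simp add: norm_mult)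
   also have "\<dots> \<le> DA * exp (s / 2) + \<bar>b\<bar> * (DB * exp (s / 2))"
    by (intro add_mono mult_left_mono DA DB) auto
   finally show ?thesis by (simp add: algebra_simps)
  qed
  show "integrable lborel (\<lambda>s. indicator {0..} s *\<^sub>R (exp (- (real j * s)) *\<^sub>R h s))" if "j \<ge> 1" for j :: nat
   unfolding hsplit by (intro Bochner_Integration.integrable_diff integrable_mult_right intA intB that)
  show "(LINT s|lborel. indicator {0..} s *\<^sub>R (exp (- (real j * s)) *\<^sub>R h s)) = 0" if j: "j \<ge> 1" for j :: nat
  proof -
   have jr: "real j > 0" using j by simp
   have "(LINT s|lborel. indicator {0..} s *\<^sub>R (exp (- (real j * s)) *\<^sub>R A s)) =
     complex_of_real (1 / real j) * (LINT y|lborel. cis (x \<bullet> y) * complex_of_real (exp (- (real j * (norm y)\<^sup>2))))"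
    by (rule A(4)) (use j in auto)
   also have "\<dots> = complex_of_real (1 / real j * ((pi / real j) powr (DIM('a) / 2) * exp (- ((norm x)\<^sup>2 / (4 * real j)))))"
    by (subst gaussian_fourier(2)[OF jr]) simp
   finally have a: "(LINT s|lborel. indicator {0..} s *\<^sub>R (exp (- (real j * s)) *\<^sub>R A s)) = \<dots>" .
   have "(LINT s|lborel. indicator {0..} s *\<^sub>R (exp (- (real j * s)) *\<^sub>R B s)) =
     complex_of_real (Gamma (m / 2 + 1) / real j powr (m / 2 + 1)) * (LINT k|lborel. cis (k * norm x) * complex_of_real (exp (- (real j * k\<^sup>2))))"
    by (rule B(4)) (use j in auto)
   also have "\<dots> = complex_of_real (Gamma (m / 2 + 1) / real j powr (m / 2 + 1) * (sqrt (pi / real j) * exp (- ((norm x)\<^sup>2 / (4 * real j)))))"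
    by (subst gaussian_fourier_real(2)[OF jr]) simp
   finally have b: "(LINT s|lborel. indicator {0..} s *\<^sub>R (exp (- (real j * s)) *\<^sub>R B s)) = \<dots>" .
   have G: "Gamma (m / 2 + 1) > 0" using m0 by (intro Gamma_real_pos) auto
   have n: "DIM('a) / 2 = m / 2 + 1 / 2" by (simp add: m_def diff_divide_distrib)
   have p1: "(pi / real j) powr (m / 2 + 1 / 2) = pi powr (m / 2) / real j powr (m / 2) * sqrt (pi / real j)"
    using jr by (simp add: powr_add powr_half_sqrt powr_divide real_sqrt_divide)
   have p2: "real j powr (m / 2 + 1) = real j powr (m / 2) * real j"
    using jr by (simp add: powr_add)
   have alg: "P / g * (g / (Q * J) * (S * E)) = 1 / J * (P / Q * S * E)"
    if "g \<noteq> 0" "J \<noteq> 0" for P g Q J S E :: real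
    using that by (simp add: mult_ac)
   \<comment> \<open>The constants agree because \<open>unit_ball_vol m\<close> is pi^(m/2) /
     Gamma(m/2 + 1), and the Gamma value cancels the one in the Laplace transform of
     s^(m/2).\<close>
   have ab: "b * (Gamma (m / 2 + 1) / real j powr (m / 2 + 1) * (sqrt (pi / real j) * exp (- ((norm x)\<^sup>2 / (4 * real j)))))
     = 1 / real j * ((pi / real j) powr (DIM('a) / 2) * exp (- ((norm x)\<^sup>2 / (4 * real j))))"
    unfolding n p1 p2 b_def unit_ball_vol_def by (rule alg) (use G jr in auto)
   have "(LINT s|lborel. indicator {0..} s *\<^sub>R (exp (- (real j * s)) *\<^sub>R h s)) =
    (LINT s|lborel. indicator {0..} s *\<^sub>R (exp (- (real j * s)) *\<^sub>R A s)) - complex_of_real b * (LINT s|lborel. indicator {0..} s *\<^sub>R (exp (- (real j * s)) *\<^sub>R B s))"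
    unfolding hsplit
    by (subst Bochner_Integration.integral_diff[OF intA[OF j] integrable_mult_right[OF intB[OF j]]]) (simp only: integral_mult_right_zero)
   also have "\<dots> = 0" unfolding a b of_real_mult[symmetric] ab by simp
   finally show ?thesis .
  qed
 qed fact
 hence AB: "A s = complex_of_real b * B s" by (simp add: h_def)
 have "complex_of_real (indicator {0..} (s - (norm \<xi>)\<^sup>2)) = indicator {\<xi>. (norm \<xi>)\<^sup>2 \<le> s} \<xi>" for \<xi> :: 'a
  by (simp add: indicator_def)
 hence "A s = (LINT \<xi>|lborel. cis (x \<bullet> \<xi>) * indicator {\<xi>. (norm \<xi>)\<^sup>2 \<le> s} \<xi>)"
  unfolding A_def by presburger
 thus ?thesis using AB unfolding B_def b_def by simp
qed

section \<open>Radial kernels as integrals along rays\<close>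

text \<open>Read from right to left this is a layer-cake formula with complex density: exp(- c b)
  becomes a superposition of the indicator functions of b \<le> v.\<close>

lemma has_bochner_integral_exp_tail_complex:
 fixes c :: complex
 assumes c: "Re c > 0"
 shows "has_bochner_integral lborel (\<lambda>v. indicator {b..} v *\<^sub>R (c * exp (- (c * of_real v)))) (exp (- (c * of_real b)))"
proof -
 have ne: "norm (exp (- (c * of_real v))) = exp (- (Re c * v))" for v by simp
 have int: "integrable lborel (\<lambda>v. indicator {b..} v *\<^sub>R (c * exp (- (c * of_real v))))"
 proof (rule Bochner_Integration.integrable_bound)
  show "integrable lborel (\<lambda>v. cmod c * (indicator {b..} v * exp (- (Re c * v))))"
   using has_bochner_integral_exp_tail[OF c, of b] by (intro integrable_mult_right) (auto simp: has_bochner_integral_iff)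
  show "AE v in lborel. norm (indicator {b..} v *\<^sub>R (c * exp (- (c * of_real v)))) \<le> norm (cmod c * (indicator {b..} v * exp (- (Re c * v))))"
   by (intro AE_I2) (auto simp: norm_mult indicator_def)
 qed measurable
 have "(LBINT v=ereal b..\<infinity>. c * exp (- (c * of_real v))) = 0 - (- exp (- (c * of_real b)))"
 proof (rule interval_integral_FTC_integrable[where F="\<lambda>v. - exp (- (c * of_real v))"])
  show "((\<lambda>v. - exp (- (c * of_real v))) has_vector_derivative c * exp (- (c * of_real v))) (at v)" for v
  proof -
   have "((\<lambda>z. - exp (- (c * z))) has_field_derivative c * exp (- (c * of_real v))) (at (of_real v))"
    by (auto intro!: derivative_eq_intros)
   thus ?thesis by (rule has_vector_derivative_real_field)
  qed
  show "isCont (\<lambda>v. c * exp (- (c * of_real v))) v" for v :: real by (intro continuous_intros)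
  show "set_integrable lborel (einterval (ereal b) \<infinity>) (\<lambda>v. c * exp (- (c * of_real v)))"
  proof (rule set_integrable_subset[of _ "{b..}"])
   show "set_integrable lborel {b..} (\<lambda>v. c * exp (- (c * of_real v)))" using int by (simp add: set_integrable_def)
  qed (auto simp: einterval_def)
  show "(((\<lambda>v. - exp (- (c * of_real v))) \<circ> real_of_ereal) \<longlongrightarrow> - exp (- (c * of_real b))) (at_right (ereal b))"
   by (simp add: ereal_tendsto_simps) (auto intro!: tendsto_eq_intros)
  have "((\<lambda>v. exp (- (c * of_real v))) \<longlongrightarrow> 0) at_top"
  proof (rule tendsto_norm_zero_cancel, unfold ne)
   show "((\<lambda>v. exp (- (Re c * v))) \<longlongrightarrow> 0) at_top" using c by real_asymp
  qed
  hence "((\<lambda>v. - exp (- (c * of_real v))) \<longlongrightarrow> - 0) at_top" by (rule tendsto_minus)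
  thus "(((\<lambda>v. - exp (- (c * of_real v))) \<circ> real_of_ereal) \<longlongrightarrow> 0) (at_left \<infinity>)"
   by (simp add: ereal_tendsto_simps)
 qed auto
 moreover have "(LBINT v=ereal b..\<infinity>. c * exp (- (c * of_real v))) = (LINT v|lborel. indicator {b..} v *\<^sub>R (c * exp (- (c * of_real v))))"
  unfolding interval_lebesgue_integral_def set_lebesgue_integral_def
  by (simp, intro integral_cong_AE, measurable, rule AE_mp[OF AE_lborel_singleton[of b]], rule AE_I2)
    (auto simp: einterval_def indicator_def)
 ultimately show ?thesis using int by (simp add: has_bochner_integral_iff)
qed

text \<open>Writing the integrand as the integral of a exp(- a v) over v \<ge> |\<xi>|^\<beta> and
  exchanging the order of integration leaves the volumes of balls of radius v^(1/\<beta>), which a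
  Gamma integral absorbs.\<close>

lemma integrable_exp_powr:
 fixes a \<beta> :: real
 assumes a: "a > 0" and \<beta>: "\<beta> > 0"
 shows "integrable lborel (\<lambda>\<xi>::'a::euclidean_space. exp (- (a * norm \<xi> powr \<beta>)))"
proof (rule integrableI_bounded)
 define V where "V = unit_ball_vol (real DIM('a))"
 define q where "q = real DIM('a) / \<beta>"
 have q: "q > 0" using \<beta> by (simp add: q_def)
 have V: "V \<ge> 0" by (simp add: V_def)
 have 1: "ennreal (norm (exp (- (a * norm \<xi> powr \<beta>)))) = (\<integral>\<^sup>+ v. ennreal (a * (indicator {norm \<xi> powr \<beta>..} v * exp (- (a * v)))) \<partial>lborel)" for \<xi> :: 'a
 proof -
  have "has_bochner_integral lborel (\<lambda>v. a * (indicator {norm \<xi> powr \<beta>..} v * exp (- (a * v)))) (a * (exp (- (a * norm \<xi> powr \<beta>)) / a))"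
   by (intro has_bochner_integral_mult_right has_bochner_integral_exp_tail a)
  thus ?thesis using a by (subst nn_integral_eq_integral) (auto simp: has_bochner_integral_iff)
 qed
 have "(\<integral>\<^sup>+ \<xi>. ennreal (norm (exp (- (a * norm \<xi> powr \<beta>)))) \<partial>(lborel :: 'a measure)) =
  (\<integral>\<^sup>+ v. (\<integral>\<^sup>+ \<xi>. ennreal (a * (indicator {norm \<xi> powr \<beta>..} v * exp (- (a * v)))) \<partial>(lborel :: 'a measure)) \<partial>lborel)"
  unfolding 1
 proof (rule lborel_pair.Fubini'[symmetric])
  show "(\<lambda>(\<xi>::'a, v). ennreal (a * (indicator {norm \<xi> powr \<beta>..} v * exp (- (a * v))))) \<in> borel_measurable (lborel \<Otimes>\<^sub>M lborel)"
   unfolding indicator_def atLeast_iff case_prod_beta by measurable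
 qed
 also have "\<dots> \<le> (\<integral>\<^sup>+ v. ennreal (a * V * (indicator {0..} v * (v powr q * exp (- (a * v))))) \<partial>lborel)"
 proof (rule nn_integral_mono)
  fix v :: real
  show "(\<integral>\<^sup>+ \<xi>. ennreal (a * (indicator {norm \<xi> powr \<beta>..} v * exp (- (a * v)))) \<partial>(lborel :: 'a measure)) \<le> ennreal (a * V * (indicator {0..} v * (v powr q * exp (- (a * v)))))"
  proof (cases "v \<ge> 0")
   case True
   have "(\<integral>\<^sup>+ \<xi>. ennreal (a * (indicator {norm \<xi> powr \<beta>..} v * exp (- (a * v)))) \<partial>(lborel :: 'a measure)) \<le>
     (\<integral>\<^sup>+ \<xi>. ennreal (a * exp (- (a * v))) * indicator (cball 0 (v powr (1 / \<beta>))) \<xi> \<partial>(lborel :: 'a measure))"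
   proof (rule nn_integral_mono)
    fix \<xi> :: 'a
    have "norm \<xi> \<le> v powr (1 / \<beta>)" if "norm \<xi> powr \<beta> \<le> v"
    proof -
     have "(norm \<xi> powr \<beta>) powr (1 / \<beta>) \<le> v powr (1 / \<beta>)" using that \<beta> by (intro powr_mono2) auto
     thus ?thesis using \<beta> by (simp add: powr_powr)
    qed
    thus "ennreal (a * (indicator {norm \<xi> powr \<beta>..} v * exp (- (a * v)))) \<le> ennreal (a * exp (- (a * v))) * indicator (cball 0 (v powr (1 / \<beta>))) \<xi>"
     by (auto simp: indicator_def)
   qed
   also have "\<dots> = ennreal (a * exp (- (a * v))) * ennreal (V * (v powr (1 / \<beta>)) ^ DIM('a))"
    by (subst nn_integral_cmult_indicator) (auto simp: emeasure_cball V_def)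
   also have "\<dots> = ennreal (a * V * (indicator {0..} v * (v powr q * exp (- (a * v)))))"
   proof -
    have "(v powr (1 / \<beta>)) ^ DIM('a) = v powr q"
     using True by (cases "v = 0") (auto simp: powr_powr q_def powr_realpow[symmetric])
    thus ?thesis using True a V by (simp add: ennreal_mult[symmetric] mult_ac)
   qed
   finally show ?thesis .
  next
   case False
   have "norm \<xi> powr \<beta> \<ge> 0" for \<xi> :: 'a by simp
   hence "indicator {norm \<xi> powr \<beta>..} v = (0::real)" for \<xi> :: 'a using False by (auto simp: indicator_def not_le intro: less_le_trans)
   thus ?thesis by simp
  qed
 qed
 also have "\<dots> < \<infinity>"
 proof -
  have "integrable lborel (\<lambda>v. a * V * (indicator {0..} v * (v powr q * exp (- (a * v)))))"
   using has_bochner_integral_powr_exp[OF a, of q] q by (intro integrable_mult_right) (auto simp: has_bochner_integral_iff)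
  thus ?thesis using V a by (subst nn_integral_eq_integral) auto
 qed
 finally show "(\<integral>\<^sup>+ \<xi>. ennreal (norm (exp (- (a * norm \<xi> powr \<beta>)))) \<partial>(lborel :: 'a measure)) < \<infinity>" .
qed measurable

text \<open>Up to the factor \<open>unit_ball_vol m\<close> this is the integral of exp(- c
  |\<xi>|^(2\<alpha>)) over a hyperplane of dimension m at distance |k| from the origin, written as
  a superposition of slice volumes.\<close>

definition radial_amp :: "real \<Rightarrow> real \<Rightarrow> complex \<Rightarrow> real \<Rightarrow> complex" where
 "radial_amp \<alpha> m c k = (LINT v|lborel. indicator {0..} v *\<^sub>R
   ((c * exp (- (c * of_real v))) * of_real (max 0 (v powr (1 / \<alpha>) - k\<^sup>2) powr (m / 2))))"

text \<open>The exponential is a superposition, with density c exp(- c v), of indicator functions of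
  the balls |\<xi>|^2 \<le> v^(1/\<alpha>). Each ball is reduced to one dimension by
  \<open>fourier_ball\<close>, and exchanging v with k collects the slices into
  \<open>radial_amp\<close>.\<close>

lemma fourier_kernel_radial:
 fixes x :: "'a::euclidean_space" and c :: complex
 assumes \<alpha>: "\<alpha> > 0" and c: "Re c > 0"
 defines "m \<equiv> real DIM('a) - 1"
 shows "integrable lborel (\<lambda>\<xi>::'a. cis (x \<bullet> \<xi>) * exp (- (c * of_real (norm \<xi> powr (2 * \<alpha>)))))"
  and "integrable lborel (\<lambda>k. cis (k * norm x) * radial_amp \<alpha> m c k)"
  and "(LINT \<xi>|lborel. cis (x \<bullet> \<xi>) * exp (- (c * of_real (norm \<xi> powr (2 * \<alpha>))))) =
   complex_of_real (unit_ball_vol m) * (LINT k|lborel. cis (k * norm x) * radial_amp \<alpha> m c k)"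
proof -
 have m0: "m \<ge> 0" by (simp add: m_def)
 have [measurable]: "(\<lambda>\<xi>::'a. cis (x \<bullet> \<xi>)) \<in> borel_measurable borel" "(\<lambda>k. cis (k * norm x)) \<in> borel_measurable borel"
  by (intro borel_measurable_continuous_onI continuous_intros)+
 define E where "E v = c * exp (- (c * of_real v))" for v :: real
 have [measurable]: "E \<in> borel_measurable borel" unfolding E_def by measurable
 have nE: "norm (E v) = cmod c * exp (- (Re c * v))" for v by (simp add: E_def norm_mult)
 define F where "F = (\<lambda>(\<xi>::'a, v). indicator {norm \<xi> powr (2 * \<alpha>)..} v *\<^sub>R (cis (x \<bullet> \<xi>) * E v))"
 have tail: "has_bochner_integral lborel (\<lambda>v. F (\<xi>, v)) (cis (x \<bullet> \<xi>) * exp (- (c * of_real (norm \<xi> powr (2 * \<alpha>)))))" for \<xi>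
 proof -
  have "has_bochner_integral lborel (\<lambda>v. cis (x \<bullet> \<xi>) * (indicator {norm \<xi> powr (2 * \<alpha>)..} v *\<^sub>R (c * exp (- (c * of_real v)))))
    (cis (x \<bullet> \<xi>) * exp (- (c * of_real (norm \<xi> powr (2 * \<alpha>)))))"
   by (intro has_bochner_integral_mult_right has_bochner_integral_exp_tail_complex c)
  thus ?thesis by (simp add: F_def E_def)
 qed
 have tailn: "has_bochner_integral lborel (\<lambda>v. norm (F (\<xi>, v))) (cmod c / Re c * exp (- (Re c * norm \<xi> powr (2 * \<alpha>))))" for \<xi>
 proof -
  have "has_bochner_integral lborel (\<lambda>v. cmod c * (indicator {norm \<xi> powr (2 * \<alpha>)..} v * exp (- (Re c * v))))
    (cmod c * (exp (- (Re c * norm \<xi> powr (2 * \<alpha>))) / Re c))"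
   by (intro has_bochner_integral_mult_right has_bochner_integral_exp_tail c)
  moreover have "(\<lambda>v. cmod c * (indicator {norm \<xi> powr (2 * \<alpha>)..} v * exp (- (Re c * v)))) = (\<lambda>v. norm (F (\<xi>, v)))"
   by (auto simp: F_def nE norm_mult)
  ultimately show ?thesis by (simp add: mult_ac)
 qed
 have intF: "integrable (lborel \<Otimes>\<^sub>M lborel) F"
 proof (rule lborel_pair.Fubini_integrable)
  show "F \<in> borel_measurable (lborel \<Otimes>\<^sub>M lborel)" unfolding F_def indicator_def atLeast_iff case_prod_beta by measurable
  show "integrable lborel (\<lambda>\<xi>. LINT v|lborel. norm (F (\<xi>, v)))"
   unfolding has_bochner_integral_integral_eq[OF tailn] using \<alpha> c
   by (intro integrable_mult_right integrable_exp_powr) auto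
  show "AE \<xi> in lborel. integrable lborel (\<lambda>v. F (\<xi>, v))"
   using tail by (auto simp: has_bochner_integral_iff)
 qed
 show "integrable lborel (\<lambda>\<xi>::'a. cis (x \<bullet> \<xi>) * exp (- (c * of_real (norm \<xi> powr (2 * \<alpha>)))))"
  using lborel_pair.integrable_fst'[OF intF] unfolding has_bochner_integral_integral_eq[OF tail] by simp
 define H where "H = (\<lambda>(v::real, k). indicator {0..} v *\<^sub>R (cis (k * norm x) * (E v * of_real (max 0 (v powr (1 / \<alpha>) - k\<^sup>2) powr (m / 2)))))"
 \<comment> \<open>The slices are bounded by v^(m/(2\<alpha>)), and integration over k multiplies
   this by an interval length proportional to v^(1/(2\<alpha>)).\<close>
 define q where "q = (m + 1) / (2 * \<alpha>)"
 have q: "q > 0" using m0 \<alpha> by (simp add: q_def)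
 have Hb: "norm (H (v, k)) \<le> (cmod c * (indicator {0..} v * (v powr (m / (2 * \<alpha>)) * exp (- (Re c * v))))) * indicator {- (v powr (1 / (2 * \<alpha>)))..v powr (1 / (2 * \<alpha>))} k" for v k
 proof (cases "v \<ge> 0 \<and> k\<^sup>2 < v powr (1 / \<alpha>)")
  case True
  have sq: "v powr (1 / \<alpha>) = (v powr (1 / (2 * \<alpha>)))\<^sup>2" using True \<alpha> by (cases "v = 0") (auto simp: power2_eq_square powr_add[symmetric])
  have "\<bar>k\<bar> \<le> v powr (1 / (2 * \<alpha>))" using True unfolding sq by (metis abs_le_square_iff abs_of_nonneg less_imp_le powr_ge_zero)
  hence k: "k \<in> {- (v powr (1 / (2 * \<alpha>)))..v powr (1 / (2 * \<alpha>))}" by auto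
  have "(v powr (1 / \<alpha>) - k\<^sup>2) powr (m / 2) \<le> (v powr (1 / \<alpha>)) powr (m / 2)" using True m0 by (intro powr_mono2) auto
  also have "\<dots> = v powr (m / (2 * \<alpha>))" using \<alpha> by (simp add: powr_powr mult_ac)
  finally have "max 0 (v powr (1 / \<alpha>) - k\<^sup>2) powr (m / 2) \<le> v powr (m / (2 * \<alpha>))" using True by simp
  hence "norm (E v) * max 0 (v powr (1 / \<alpha>) - k\<^sup>2) powr (m / 2) \<le> norm (E v) * v powr (m / (2 * \<alpha>))" by (intro mult_left_mono) auto
  thus ?thesis using True k by (simp add: H_def norm_mult nE mult_ac)
 next
  case False
  hence "norm (H (v, k)) = 0" by (auto simp: H_def indicator_def)
  thus ?thesis by simp
 qed
 have intk: "has_bochner_integral lborel (\<lambda>k. C * indicator {- s..s} k) (C * (2 * s))" if "s \<ge> 0" for C s :: real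
  using that by (intro has_bochner_integral_mult_right) (auto simp: has_bochner_integral_iff)
 have intH: "integrable (lborel \<Otimes>\<^sub>M lborel) H"
 proof (rule lborel_pair.Fubini_integrable)
  show Hm: "H \<in> borel_measurable (lborel \<Otimes>\<^sub>M lborel)" unfolding H_def by measurable
  have Hk: "integrable lborel (\<lambda>k. H (v, k))" for v
  proof (rule Bochner_Integration.integrable_bound)
   show "integrable lborel (\<lambda>k. (cmod c * (indicator {0..} v * (v powr (m / (2 * \<alpha>)) * exp (- (Re c * v))))) * indicator {- (v powr (1 / (2 * \<alpha>)))..v powr (1 / (2 * \<alpha>))} k)"
    using intk[of "v powr (1 / (2 * \<alpha>))"] by (simp add: has_bochner_integral_iff)
   show "(\<lambda>k. H (v, k)) \<in> borel_measurable lborel" using Hm by measurable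
  qed (use Hb in \<open>auto simp: abs_mult\<close>)
  thus "AE v in lborel. integrable lborel (\<lambda>k. H (v, k))" by simp
  show "integrable lborel (\<lambda>v. LINT k|lborel. norm (H (v, k)))"
  proof (rule Bochner_Integration.integrable_bound)
   show "integrable lborel (\<lambda>v. 2 * cmod c * (indicator {0..} v * (v powr q * exp (- (Re c * v)))))"
    using has_bochner_integral_powr_exp[OF c, of q] q by (intro integrable_mult_right) (auto simp: has_bochner_integral_iff)
   show "(\<lambda>v. LINT k|lborel. norm (H (v, k))) \<in> borel_measurable lborel" using Hm by measurable
   show "AE v in lborel. norm (LINT k|lborel. norm (H (v, k))) \<le> norm (2 * cmod c * (indicator {0..} v * (v powr q * exp (- (Re c * v)))))"
   proof (intro AE_I2)
    fix v :: real
    have "(LINT k|lborel. norm (H (v, k))) \<le> (LINT k|lborel. (cmod c * (indicator {0..} v * (v powr (m / (2 * \<alpha>)) * exp (- (Re c * v))))) * indicator {- (v powr (1 / (2 * \<alpha>)))..v powr (1 / (2 * \<alpha>))} k)"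
     using intk[of "v powr (1 / (2 * \<alpha>))"] by (intro integral_mono integrable_norm Hk Hb) (simp add: has_bochner_integral_iff)
    also have "\<dots> = (cmod c * (indicator {0..} v * (v powr (m / (2 * \<alpha>)) * exp (- (Re c * v))))) * (2 * v powr (1 / (2 * \<alpha>)))"
     using intk[of "v powr (1 / (2 * \<alpha>))"] by (simp only: has_bochner_integral_iff powr_ge_zero)
    also have "\<dots> = 2 * cmod c * (indicator {0..} v * ((v powr (m / (2 * \<alpha>)) * v powr (1 / (2 * \<alpha>))) * exp (- (Re c * v))))" by simp
    also have "v powr (m / (2 * \<alpha>)) * v powr (1 / (2 * \<alpha>)) = v powr q" by (simp add: powr_add[symmetric] q_def add_divide_distrib)
    finally show "norm (LINT k|lborel. norm (H (v, k))) \<le> norm (2 * cmod c * (indicator {0..} v * (v powr q * exp (- (Re c * v)))))"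
     by (simp add: abs_mult)
   qed
  qed
 qed
 have snd: "(LINT v|lborel. H (v, k)) = cis (k * norm x) * radial_amp \<alpha> m c k" for k
  unfolding radial_amp_def E_def H_def by (simp flip: integral_mult_right_zero)
 show "integrable lborel (\<lambda>k. cis (k * norm x) * radial_amp \<alpha> m c k)"
  using lborel_pair.integrable_snd[of "\<lambda>v k. H (v, k)"] intH unfolding snd by simp
 have sl: "(LINT \<xi>|lborel. F (\<xi>, v)) = of_real (unit_ball_vol m) * (LINT k|lborel. H (v, k))" for v
 proof (cases "v \<ge> 0")
  case True
  have iff: "norm \<xi> powr (2 * \<alpha>) \<le> v \<longleftrightarrow> (norm \<xi>)\<^sup>2 \<le> v powr (1 / \<alpha>)" for \<xi> :: 'a
  proof -
   have *: "(norm \<xi> powr (2 * \<alpha>)) powr (1 / \<alpha>) = (norm \<xi>)\<^sup>2" using \<alpha> by (simp add: powr_powr)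
   have **: "((norm \<xi>)\<^sup>2) powr \<alpha> = norm \<xi> powr (2 * \<alpha>)" by (simp add: powr_powr flip: powr_numeral)
   have ***: "(v powr (1 / \<alpha>)) powr \<alpha> = v" using \<alpha> True by (simp add: powr_powr)
   show ?thesis using powr_mono2[of "1 / \<alpha>" "norm \<xi> powr (2 * \<alpha>)" v] powr_mono2[of \<alpha> "(norm \<xi>)\<^sup>2" "v powr (1 / \<alpha>)"] * ** *** \<alpha> by auto
  qed
  have "(LINT \<xi>|lborel. F (\<xi>, v)) = (LINT \<xi>|lborel. E v * (cis (x \<bullet> \<xi>) * indicator {\<xi>. (norm \<xi>)\<^sup>2 \<le> v powr (1 / \<alpha>)} \<xi>))"
   by (intro Bochner_Integration.integral_cong) (auto simp: F_def iff indicator_def)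
  also have "\<dots> = E v * (of_real (unit_ball_vol m) * (LINT k|lborel. cis (k * norm x) * complex_of_real (max 0 (v powr (1 / \<alpha>) - k\<^sup>2) powr (m / 2))))"
   unfolding m_def by (subst fourier_ball[symmetric]) auto
  also have "\<dots> = of_real (unit_ball_vol m) * (LINT k|lborel. E v * (cis (k * norm x) * complex_of_real (max 0 (v powr (1 / \<alpha>) - k\<^sup>2) powr (m / 2))))"
   by simp
  also have "(\<lambda>k. E v * (cis (k * norm x) * complex_of_real (max 0 (v powr (1 / \<alpha>) - k\<^sup>2) powr (m / 2)))) = (\<lambda>k. H (v, k))"
   using True by (auto simp: H_def fun_eq_iff)
  finally show ?thesis .
 next
  case False
  have "norm \<xi> powr (2 * \<alpha>) \<ge> 0" for \<xi> :: 'a by simp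
  hence "indicator {norm \<xi> powr (2 * \<alpha>)..} v = (0::real)" for \<xi> :: 'a using False by (auto simp: indicator_def not_le intro: less_le_trans)
  thus ?thesis using False by (simp add: F_def H_def)
 qed
 have "(LINT \<xi>|lborel. cis (x \<bullet> \<xi>) * exp (- (c * of_real (norm \<xi> powr (2 * \<alpha>))))) = (LINT \<xi>|lborel. LINT v|lborel. F (\<xi>, v))"
  unfolding has_bochner_integral_integral_eq[OF tail] ..
 also have "\<dots> = (LINT v|lborel. LINT \<xi>|lborel. F (\<xi>, v))"
  using lborel_pair.Fubini_integral[of "\<lambda>\<xi> v. F (\<xi>, v)"] intF by simp
 also have "\<dots> = of_real (unit_ball_vol m) * (LINT v|lborel. LINT k|lborel. H (v, k))"
  unfolding sl by simp
 also have "(LINT v|lborel. LINT k|lborel. H (v, k)) = (LINT k|lborel. LINT v|lborel. H (v, k))"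
  using lborel_pair.Fubini_integral[of "\<lambda>v k. H (v, k)"] intH by simp
 finally show "(LINT \<xi>|lborel. cis (x \<bullet> \<xi>) * exp (- (c * of_real (norm \<xi> powr (2 * \<alpha>))))) =
   complex_of_real (unit_ball_vol m) * (LINT k|lborel. cis (k * norm x) * radial_amp \<alpha> m c k)"
  unfolding snd .
qed

section \<open>Contour deformation by primitives on convex open sets\<close>

lemma segment_has_integral:
 fixes F g :: "complex \<Rightarrow> complex"
 assumes g: "\<And>z. z \<in> S \<Longrightarrow> (g has_field_derivative F z) (at z within S)"
  and S: "open S" and ab: "a \<le> b" and p: "\<And>t. t \<in> {a..b} \<Longrightarrow> p + of_real t * v \<in> S"
 shows "((\<lambda>t. F (p + of_real t * v) * v) has_integral g (p + of_real b * v) - g (p + of_real a * v)) {a..b}"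
proof (rule fundamental_theorem_of_calculus[OF ab, of "\<lambda>t. g (p + of_real t * v)"])
 fix t assume t: "t \<in> {a..b}"
 have "(g has_field_derivative F (p + of_real t * v)) (at (p + of_real t * v))"
  using g[OF p[OF t]] at_within_open[OF p[OF t] S] by simp
 hence "((\<lambda>z. g (p + z * v)) has_field_derivative F (p + of_real t * v) * v) (at (of_real t))"
  by (rule DERIV_chain2) (auto intro!: derivative_eq_intros)
 thus "((\<lambda>t. g (p + of_real t * v)) has_vector_derivative F (p + of_real t * v) * v) (at t within {a..b})"
  using has_vector_derivative_real_field has_vector_derivative_at_within by blast
qed

lemma segment_bound:
 fixes F g :: "complex \<Rightarrow> complex"
 assumes g: "\<And>z. z \<in> S \<Longrightarrow> (g has_field_derivative F z) (at z within S)"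
  and S: "open S" and ab: "a \<le> b" and p: "\<And>t. t \<in> {a..b} \<Longrightarrow> p + of_real t * v \<in> S"
  and B: "B integrable_on {a..b}" "\<And>t. t \<in> {a..b} \<Longrightarrow> cmod (F (p + of_real t * v) * v) \<le> B t"
 shows "cmod (g (p + of_real b * v) - g (p + of_real a * v)) \<le> integral {a..b} B"
proof -
 note * = segment_has_integral[OF g S ab p]
 show ?thesis
  using Henstock_Kurzweil_Integration.integral_norm_bound_integral[OF has_integral_integrable[OF *] B] integral_unique[OF *] by simp
qed

lemma segment_bound_const:
 fixes F g :: "complex \<Rightarrow> complex"
 assumes g: "\<And>z. z \<in> S \<Longrightarrow> (g has_field_derivative F z) (at z within S)"
  and S: "open S" "convex S" and pq: "p \<in> S" "q \<in> S"
  and B: "\<And>u. u \<in> {0..1} \<Longrightarrow> cmod (F (p + of_real u * (q - p))) \<le> B"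
 shows "cmod (g q - g p) \<le> B * cmod (q - p)"
proof -
 have "cmod (g (p + of_real 1 * (q - p)) - g (p + of_real 0 * (q - p))) \<le> integral {0..1} (\<lambda>_::real. B * cmod (q - p))"
 proof (rule segment_bound[OF g S(1), where p=p and v="q - p" and a=0 and b=1])
  show "p + of_real t * (q - p) \<in> S" if "t \<in> {0..1}" for t
  proof -
   have "(1 - t) *\<^sub>R p + t *\<^sub>R q \<in> S" using that S(2) pq by (intro convexD_alt) auto
   thus ?thesis by (simp add: scaleR_conv_of_real algebra_simps)
  qed
  show "cmod (F (p + of_real t * (q - p)) * (q - p)) \<le> B * cmod (q - p)" if "t \<in> {0..1}" for t
   using B[OF that] by (simp add: norm_mult mult_right_mono)
 qed auto
 thus ?thesis by simp
qed

text \<open>In the applications the origin is only a boundary point of S, so the ray is cut off near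
  0 as well as near infinity; dominated convergence removes both cuts.\<close>

lemma ray_tendsto:
 fixes F g :: "complex \<Rightarrow> complex"
 assumes g: "\<And>z. z \<in> S \<Longrightarrow> (g has_field_derivative F z) (at z within S)"
  and S: "open S" and w: "\<And>t. t > 0 \<Longrightarrow> of_real t * w \<in> S"
  and int: "integrable lborel (\<lambda>t. indicator {0<..} t *\<^sub>R (F (of_real t * w) * w))"
 shows "(\<lambda>n. g (of_real (real (Suc n)) * w) - g (of_real (1 / real (Suc n)) * w))
   \<longlonglongrightarrow> (LINT t|lborel. indicator {0<..} t *\<^sub>R (F (of_real t * w) * w))"
proof -
 define G where "G = (\<lambda>t. indicator {0<..} t *\<^sub>R (F (of_real t * w) * w))"
 have eq: "g (of_real (real (Suc n)) * w) - g (of_real (1 / real (Suc n)) * w) = (LINT t|lborel. indicator {1 / real (Suc n)..real (Suc n)} t *\<^sub>R G t)" for n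
 proof -
  have "((\<lambda>t. F (0 + of_real t * w) * w) has_integral g (0 + of_real (real (Suc n)) * w) - g (0 + of_real (1 / real (Suc n)) * w)) {1 / real (Suc n)..real (Suc n)}"
  proof (rule segment_has_integral[OF g S])
   have "1 / real (Suc n) \<le> 1" "1 \<le> real (Suc n)" by auto
   thus "1 / real (Suc n) \<le> real (Suc n)" by linarith
   show "0 + of_real t * w \<in> S" if "t \<in> {1 / real (Suc n)..real (Suc n)}" for t
    using w[of t] less_le_trans[of 0 "1 / real (Suc n)" t] that by simp
  qed
  hence "((\<lambda>t. F (of_real t * w) * w) has_integral g (of_real (real (Suc n)) * w) - g (of_real (1 / real (Suc n)) * w)) {1 / real (Suc n)..real (Suc n)}"
   by (simp only: add_0)
  hence 1: "(G has_integral g (of_real (real (Suc n)) * w) - g (of_real (1 / real (Suc n)) * w)) {1 / real (Suc n)..real (Suc n)}"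
   by (rule has_integral_eq[rotated]) (auto simp: G_def indicator_def intro: less_le_trans[of 0 "1 / real (Suc n)"] simp del: of_nat_Suc)
  have "set_integrable lborel {1 / real (Suc n)..real (Suc n)} G"
   unfolding set_integrable_def by (intro integrable_mult_indicator) (use int in \<open>auto simp: G_def\<close>)
  from set_borel_integral_eq_integral(2)[OF this] integral_unique[OF 1] show ?thesis
   by (simp add: set_lebesgue_integral_def)
 qed
 show ?thesis unfolding eq G_def[symmetric]
 proof (rule integral_dominated_convergence[where w="\<lambda>t. norm (G t)"])
  show "integrable lborel (\<lambda>t. norm (G t))" unfolding G_def by (rule integrable_norm[OF int])
  show "AE t in lborel. (\<lambda>n. indicator {1 / real (Suc n)..real (Suc n)} t *\<^sub>R G t) \<longlonglongrightarrow> G t"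
  proof (intro AE_I2)
   fix t :: real
   show "(\<lambda>n. indicator {1 / real (Suc n)..real (Suc n)} t *\<^sub>R G t) \<longlonglongrightarrow> G t"
   proof (cases "t > 0")
    case True
    have "\<forall>\<^sub>F n in sequentially. t \<ge> 1 / real (Suc n)" "\<forall>\<^sub>F n in sequentially. t \<le> real (Suc n)"
     using True by real_asymp+
    hence "\<forall>\<^sub>F n in sequentially. indicator {1 / real (Suc n)..real (Suc n)} t *\<^sub>R G t = G t"
     by eventually_elim auto
    thus ?thesis by (simp add: tendsto_eventually)
   qed (simp add: G_def)
  qed
  show "G \<in> borel_measurable lborel" using int by (auto simp: G_def)
  thus "(\<lambda>t. indicator {1 / real (Suc n)..real (Suc n)} t *\<^sub>R G t) \<in> borel_measurable lborel" for n by measurable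
 qed (auto simp: indicator_def)
qed

text \<open>Differences of one primitive compare the two rays; what remains are the chords joining
  them at radii 1/N and N. The first has length O(1/N) and a bounded integrand, the second length
  O(N) and an integrand O(1/N^2).\<close>

lemma rotate_ray:
 assumes S: "open S" "convex S" and F: "F holomorphic_on S"
  and w: "\<And>t. t > 0 \<Longrightarrow> of_real t * w1 \<in> S" "\<And>t. t > 0 \<Longrightarrow> of_real t * w2 \<in> S"
  and int: "integrable lborel (\<lambda>t. indicator {0<..} t *\<^sub>R (F (of_real t * w1) * w1))"
       "integrable lborel (\<lambda>t. indicator {0<..} t *\<^sub>R (F (of_real t * w2) * w2))"
  and near: "\<And>t u. 0 < t \<Longrightarrow> t \<le> 1 \<Longrightarrow> u \<in> {0..1} \<Longrightarrow> cmod (F (of_real t * (w1 + of_real u * (w2 - w1)))) \<le> D"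
  and far: "\<And>t u. t \<ge> 1 \<Longrightarrow> u \<in> {0..1} \<Longrightarrow> cmod (F (of_real t * (w1 + of_real u * (w2 - w1)))) \<le> D / t\<^sup>2"
 shows "(LINT t|lborel. indicator {0<..} t *\<^sub>R (F (of_real t * w1) * w1)) = (LINT t|lborel. indicator {0<..} t *\<^sub>R (F (of_real t * w2) * w2))"
proof -
 obtain g where g: "\<And>z. z \<in> S \<Longrightarrow> (g has_field_derivative F z) (at z within S)"
  using holomorphic_convex_primitive'[OF S(2,1) F] by blast
 have arc: "cmod (g (of_real t * w2) - g (of_real t * w1)) \<le> B * (t * cmod (w2 - w1))"
  if "t > 0" "\<And>u. u \<in> {0..1} \<Longrightarrow> cmod (F (of_real t * (w1 + of_real u * (w2 - w1)))) \<le> B" for t B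
 proof -
  have "cmod (g (of_real t * w2) - g (of_real t * w1)) \<le> B * cmod (of_real t * w2 - of_real t * w1)"
   by (rule segment_bound_const[OF g S w(1) w(2)]) (use that in \<open>auto simp: algebra_simps\<close>)
  also have "cmod (of_real t * w2 - of_real t * w1) = t * cmod (w2 - w1)"
   using that(1) by (simp add: norm_mult flip: right_diff_distrib)
  finally show ?thesis .
 qed
 define L1 L2 where "L1 = (LINT t|lborel. indicator {0<..} t *\<^sub>R (F (of_real t * w1) * w1))"
   and "L2 = (LINT t|lborel. indicator {0<..} t *\<^sub>R (F (of_real t * w2) * w2))"
 have lim: "(\<lambda>n. (g (of_real (real (Suc n)) * w2) - g (of_real (1 / real (Suc n)) * w2)) -
   (g (of_real (real (Suc n)) * w1) - g (of_real (1 / real (Suc n)) * w1))) \<longlonglongrightarrow> L2 - L1"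
  unfolding L1_def L2_def by (intro tendsto_diff ray_tendsto[OF g S(1)] w int)
 have "(\<lambda>n. (g (of_real (real (Suc n)) * w2) - g (of_real (1 / real (Suc n)) * w2)) -
   (g (of_real (real (Suc n)) * w1) - g (of_real (1 / real (Suc n)) * w1))) \<longlonglongrightarrow> 0"
 proof (rule tendsto_0_le[where K=1])
  show "(\<lambda>n. 2 * \<bar>D\<bar> * cmod (w2 - w1) * (1 / real (Suc n))) \<longlonglongrightarrow> 0" by real_asymp
  show "\<forall>\<^sub>F n in sequentially. norm ((g (of_real (real (Suc n)) * w2) - g (of_real (1 / real (Suc n)) * w2)) -
   (g (of_real (real (Suc n)) * w1) - g (of_real (1 / real (Suc n)) * w1))) \<le> norm (2 * \<bar>D\<bar> * cmod (w2 - w1) * (1 / real (Suc n))) * 1"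
  proof (intro always_eventually allI)
   fix n :: nat
   define N where "N = real (Suc n)"
   have N: "N \<ge> 1" by (simp add: N_def)
   have "cmod (g (of_real N * w2) - g (of_real N * w1)) \<le> D / N\<^sup>2 * (N * cmod (w2 - w1))"
    by (rule arc) (use N far in auto)
   also have "\<dots> = D * cmod (w2 - w1) * (1 / N)" using N by (simp add: power2_eq_square)
   finally have 1: "cmod (g (of_real N * w2) - g (of_real N * w1)) \<le> \<bar>D\<bar> * cmod (w2 - w1) * (1 / N)"
    by (rule order_trans) (use N in \<open>auto intro!: mult_right_mono divide_right_mono\<close>)
   have "cmod (g (of_real (1 / N) * w2) - g (of_real (1 / N) * w1)) \<le> D * (1 / N * cmod (w2 - w1))"
    by (rule arc) (use N near[of "1 / N"] in auto)
   also have "\<dots> \<le> \<bar>D\<bar> * (1 / N * cmod (w2 - w1))" using N by (intro mult_right_mono) auto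
   finally have 2: "cmod (g (of_real (1 / N) * w2) - g (of_real (1 / N) * w1)) \<le> \<bar>D\<bar> * cmod (w2 - w1) * (1 / N)" by (simp add: mult_ac)
   have "cmod ((g (of_real N * w2) - g (of_real (1 / N) * w2)) - (g (of_real N * w1) - g (of_real (1 / N) * w1))) =
     cmod ((g (of_real N * w2) - g (of_real N * w1)) - (g (of_real (1 / N) * w2) - g (of_real (1 / N) * w1)))" by (simp add: algebra_simps)
   also have "\<dots> \<le> cmod (g (of_real N * w2) - g (of_real N * w1)) + cmod (g (of_real (1 / N) * w2) - g (of_real (1 / N) * w1))" by (rule norm_triangle_ineq4)
   also have "\<dots> \<le> 2 * \<bar>D\<bar> * cmod (w2 - w1) * (1 / N)" using 1 2 by simp
   finally show "norm ((g (of_real (real (Suc n)) * w2) - g (of_real (1 / real (Suc n)) * w2)) -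
   (g (of_real (real (Suc n)) * w1) - g (of_real (1 / real (Suc n)) * w1))) \<le> norm (2 * \<bar>D\<bar> * cmod (w2 - w1) * (1 / real (Suc n))) * 1"
    unfolding N_def by simp
  qed
 qed
 from LIMSEQ_unique[OF lim this] show ?thesis by (simp add: L1_def L2_def)
qed

text \<open>The positive axis is replaced by the path from 0 to q, from q to 1 and from 1 to
  infinity in the direction v; in the application 1 is the saddle point. The constant D controls
  only the segments that close the path near 0 and near infinity, so it does not enter the
  bound.\<close>

lemma polyline_bound:
 assumes S: "open S" "convex S" and F: "F holomorphic_on S"
  and pt: "\<And>t. t > 0 \<Longrightarrow> of_real t \<in> S" "\<And>t. t > 0 \<Longrightarrow> of_real t * q \<in> S" "\<And>t. t \<ge> 0 \<Longrightarrow> 1 + of_real t * v \<in> S"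
  and int: "integrable lborel (\<lambda>t. indicator {0<..} t *\<^sub>R F (of_real t))"
  and near: "\<And>t u. 0 < t \<Longrightarrow> t \<le> 1 \<Longrightarrow> u \<in> {0..1} \<Longrightarrow> cmod (F (of_real t * (1 + of_real u * (q - 1)))) \<le> D"
  and far: "\<And>t u. t \<ge> 1 \<Longrightarrow> u \<in> {0..1} \<Longrightarrow> cmod (F (of_real t + of_real u * (1 + of_real t * v - of_real t))) \<le> D / t\<^sup>2"
  and b1: "b1 integrable_on {0..1}" "\<And>t. 0 < t \<Longrightarrow> t \<le> 1 \<Longrightarrow> cmod (F (of_real t * q) * q) \<le> b1 t" "\<And>t. b1 t \<ge> 0"
  and b2: "b2 integrable_on {0..1}" "\<And>t. 0 \<le> t \<Longrightarrow> t \<le> 1 \<Longrightarrow> cmod (F (1 + of_real t * (q - 1)) * (q - 1)) \<le> b2 t"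
  and b3: "b3 integrable_on {0..}" "\<And>t. 0 \<le> t \<Longrightarrow> cmod (F (1 + of_real t * v) * v) \<le> b3 t" "\<And>t. b3 t \<ge> 0"
 shows "cmod (LINT t|lborel. indicator {0<..} t *\<^sub>R F (of_real t)) \<le> integral {0..1} b1 + integral {0..1} b2 + integral {0..} b3"
proof -
 obtain g where g: "\<And>z. z \<in> S \<Longrightarrow> (g has_field_derivative F z) (at z within S)"
  using holomorphic_convex_primitive'[OF S(2,1) F] by blast
 define L where "L = (LINT t|lborel. indicator {0<..} t *\<^sub>R F (of_real t))"
 define B where "B = integral {0..1} b1 + integral {0..1} b2 + integral {0..} b3"
 \<comment> \<open>M / N bounds the two closing segments, from N to 1 + N v and from 1/N to
   q/N.\<close>
 define M where "M = \<bar>D\<bar> * (2 + cmod v) + \<bar>D\<bar> * cmod (q - 1)"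
 have lim: "(\<lambda>n. cmod (g (of_real (real (Suc n))) - g (of_real (1 / real (Suc n))))) \<longlonglongrightarrow> cmod L"
  using ray_tendsto[OF g S(1), of 1] pt(1) int by (intro tendsto_norm) (simp add: L_def)
 have q: "q \<in> S" "1 \<in> S" using pt(1,2)[of 1] by auto
 have 2: "cmod (g q - g 1) \<le> integral {0..1} b2"
 proof -
  have "cmod (g (1 + of_real 1 * (q - 1)) - g (1 + of_real 0 * (q - 1))) \<le> integral {0..1} b2"
  proof (rule segment_bound[OF g S(1) _ _ b2(1)])
   show "1 + of_real t * (q - 1) \<in> S" if "t \<in> {0..1}" for t
   proof -
    have "(1 - t) *\<^sub>R 1 + t *\<^sub>R q \<in> S" using that S(2) q by (intro convexD_alt) auto
    thus ?thesis by (simp add: scaleR_conv_of_real algebra_simps)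
   qed
  qed (use b2(2) in auto)
  thus ?thesis by simp
 qed
 have step: "cmod (g (of_real (real (Suc n))) - g (of_real (1 / real (Suc n)))) \<le> B + M * (1 / real (Suc n))" for n
 proof -
  define N where "N = real (Suc n)"
  have N: "N \<ge> 1" by (simp add: N_def)
  have 1: "cmod (g q - g (of_real (1 / N) * q)) \<le> integral {0..1} b1"
  proof -
   have "cmod (g (0 + of_real 1 * q) - g (0 + of_real (1 / N) * q)) \<le> integral {1 / N..1} b1"
   proof (rule segment_bound[OF g S(1)])
    show "b1 integrable_on {1 / N..1}" using b1(1) by (rule integrable_on_subinterval) (use N in auto)
    fix t assume "t \<in> {1 / N..1}"
    hence t: "t > 0" "t \<le> 1" using N by (auto intro: less_le_trans[of 0 "1 / N"])
    show "0 + of_real t * q \<in> S" using pt(2)[OF t(1)] by simp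
    show "cmod (F (0 + of_real t * q) * q) \<le> b1 t" using b1(2)[OF t] by simp
   qed (use N in auto)
   also have "\<dots> \<le> integral {0..1} b1"
    using b1 N by (intro integral_subset_le integrable_on_subinterval[OF b1(1)]) auto
   finally show ?thesis by simp
  qed
  have 3: "cmod (g (1 + of_real N * v) - g 1) \<le> integral {0..} b3"
  proof -
   have i: "b3 integrable_on {0..N}" using b3(1) by (rule integrable_on_subinterval) auto
   have "cmod (g (1 + of_real N * v) - g (1 + of_real 0 * v)) \<le> integral {0..N} b3"
    by (rule segment_bound[OF g S(1) _ _ i]) (use N pt(3) b3 in auto)
   also have "\<dots> \<le> integral {0..} b3" using b3 by (intro integral_subset_le i) auto
   finally show ?thesis by simp
  qed
  have 4: "cmod (g (1 + of_real N * v) - g (of_real N)) \<le> \<bar>D\<bar> * (2 + cmod v) * (1 / N)"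
  proof -
   have **: "cmod (g (1 + of_real N * v) - g (of_real N)) \<le> D / N\<^sup>2 * cmod (1 + of_real N * v - of_real N)"
    by (rule segment_bound_const[OF g S]) (use N far pt in auto)
   have "cmod (1 + of_real N * v - of_real N) \<le> cmod (1 + of_real N * v) + cmod (of_real N)" by (rule norm_triangle_ineq4)
   also have "cmod (1 + of_real N * v) \<le> 1 + N * cmod v" using N norm_triangle_ineq[of 1 "of_real N * v"] by (simp add: norm_mult)
   also have "1 + N * cmod v + cmod (of_real N) \<le> N * (2 + cmod v)" using N by (simp add: algebra_simps)
   finally have *: "cmod (1 + of_real N * v - of_real N) \<le> N * (2 + cmod v)" by simp
   have "cmod (g (1 + of_real N * v) - g (of_real N)) \<le> \<bar>D\<bar> / N\<^sup>2 * (N * (2 + cmod v))"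
    by (rule order_trans[OF **]) (intro mult_mono divide_right_mono *, auto)
   thus ?thesis using N by (simp add: power2_eq_square)
  qed
  have 5: "cmod (g (of_real (1 / N) * q) - g (of_real (1 / N))) \<le> \<bar>D\<bar> * cmod (q - 1) * (1 / N)"
  proof -
   have "cmod (g (of_real (1 / N) * q) - g (of_real (1 / N))) \<le> D * cmod (of_real (1 / N) * q - of_real (1 / N))"
   proof (rule segment_bound_const[OF g S])
    show "cmod (F (of_real (1 / N) + of_real u * (of_real (1 / N) * q - of_real (1 / N)))) \<le> D" if "u \<in> {0..1}" for u
    proof -
     have "of_real (1 / N) + of_real u * (of_real (1 / N) * q - of_real (1 / N)) = of_real (1 / N) * (1 + of_real u * (q - 1))"
      by algebra
     thus ?thesis using near[of "1 / N" u] that N by simp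
    qed
   qed (use N pt(1)[of "1 / N"] pt(2)[of "1 / N"] in auto)
   also have "of_real (1 / N) * q - of_real (1 / N) = of_real (1 / N) * (q - 1)" by algebra
   also have "cmod (of_real (1 / N) * (q - 1)) = (1 / N) * cmod (q - 1)" using N by (simp add: norm_mult norm_divide)
   also have "D * (1 / N * cmod (q - 1)) \<le> \<bar>D\<bar> * (1 / N * cmod (q - 1))" using N by (intro mult_right_mono) auto
   finally show ?thesis by (simp add: mult_ac)
  qed
  have tri: "cmod (- a + b + (- c) + d + e) \<le> cmod a + cmod b + cmod c + cmod d + cmod e" for a b c d e :: complex
   using norm_triangle_ineq[of "- a + b + (- c) + d" e] norm_triangle_ineq[of "- a + b + (- c)" d]
    norm_triangle_ineq[of "- a + b" "- c"] norm_triangle_ineq[of "- a" b] unfolding norm_minus_cancel by linarith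
  have "g (of_real N) - g (of_real (1 / N)) = - (g (1 + of_real N * v) - g (of_real N)) + (g (1 + of_real N * v) - g 1)
    + (- (g q - g 1)) + (g q - g (of_real (1 / N) * q)) + (g (of_real (1 / N) * q) - g (of_real (1 / N)))" by simp
  also have "cmod \<dots> \<le> cmod (g (1 + of_real N * v) - g (of_real N)) + cmod (g (1 + of_real N * v) - g 1)
    + cmod (g q - g 1) + cmod (g q - g (of_real (1 / N) * q)) + cmod (g (of_real (1 / N) * q) - g (of_real (1 / N)))"
   by (rule tri)
  also have "\<dots> \<le> B + M * (1 / N)" using 1 2 3 4 5 by (simp add: B_def M_def algebra_simps)
  finally show ?thesis by (simp add: N_def)
 qed
 have "cmod L \<le> B"
 proof (rule LIMSEQ_le[OF lim])
  show "(\<lambda>n. B + M * (1 / real (Suc n))) \<longlonglongrightarrow> B" by real_asymp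
 qed (use step in auto)
 thus ?thesis by (simp add: L_def B_def)
qed

section \<open>The amplitude as an integral along a turned ray\<close>

lemma cmod_powr_of_real: "z \<noteq> 0 \<Longrightarrow> cmod (z powr of_real a) = cmod z powr a"
 by (simp add: powr_def)

text \<open>Arises from v^(1/\<alpha>) - k^2 by the substitution v = k^(2\<alpha>) (1 + \<tau>) with
  \<beta> = 1/\<alpha>: a factor k^2 comes out and leaves (1 + \<tau>)^\<beta> - 1.\<close>

definition mid_amp :: "real \<Rightarrow> real \<Rightarrow> complex \<Rightarrow> complex" where
 "mid_amp \<beta> m \<tau> = ((1 + \<tau>) powr of_real \<beta> - 1) powr of_real (m / 2)"

text \<open>Here \<beta> < 2, that is \<alpha> > 1/2, is decisive: the argument of 1 + \<tau> is
  below pi/2 in modulus, so that of its \<beta>-th power is below pi, and the power can be real only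
  for real \<tau>, where it exceeds 1.\<close>

lemma mid_amp_slit:
 assumes \<beta>: "0 < \<beta>" "\<beta> < 2" and \<tau>: "Re \<tau> > 0"
 shows "(1 + \<tau>) powr of_real \<beta> - 1 \<notin> \<real>\<^sub>\<le>\<^sub>0"
proof
 define \<theta> where "\<theta> = Im (Ln (1 + \<tau>))"
 assume "(1 + \<tau>) powr of_real \<beta> - 1 \<in> \<real>\<^sub>\<le>\<^sub>0"
 hence im: "Im ((1 + \<tau>) powr of_real \<beta>) = 0" and re: "Re ((1 + \<tau>) powr of_real \<beta>) \<le> 1"
  by (auto simp: complex_nonpos_Reals_iff)
 have \<tau>': "Re (1 + \<tau>) > 1" "1 + \<tau> \<noteq> 0" using \<tau> by (auto simp: complex_eq_iff)
 have \<theta>: "\<bar>\<theta>\<bar> < pi / 2" unfolding \<theta>_def using Re_Ln_pos_lt[of "1 + \<tau>"] \<tau>' by simp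
 have "Im ((1 + \<tau>) powr of_real \<beta>) = cmod (1 + \<tau>) powr \<beta> * sin (\<beta> * \<theta>)"
  using \<tau>' by (simp add: powr_def Im_exp \<theta>_def)
 hence s0: "sin (\<beta> * \<theta>) = 0" using im \<tau>' by simp
 have "\<bar>\<beta> * \<theta>\<bar> < pi"
 proof -
  have "\<bar>\<beta> * \<theta>\<bar> = \<beta> * \<bar>\<theta>\<bar>" using \<beta> by (simp add: abs_mult)
  also have "\<dots> \<le> 2 * \<bar>\<theta>\<bar>" using \<beta> by (intro mult_right_mono) auto
  finally show ?thesis using \<theta> by simp
 qed
 hence "\<beta> * \<theta> = 0" using s0 sin_eq_0_pi[of "\<beta> * \<theta>"] by auto
 hence th0: "\<theta> = 0" using \<beta> by simp
 have "Re ((1 + \<tau>) powr of_real \<beta>) = cmod (1 + \<tau>) powr \<beta> * cos (\<beta> * \<theta>)"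
  using \<tau>' by (simp add: powr_def Re_exp \<theta>_def)
 also have "\<dots> = cmod (1 + \<tau>) powr \<beta>" by (simp add: th0)
 also have "\<dots> > 1" using \<tau>' complex_Re_le_cmod[of "1 + \<tau>"] \<beta> by (intro gr_one_powr) auto
 finally show False using re by simp
qed

lemma mid_amp_holomorphic:
 assumes "0 < \<beta>" "\<beta> < 2"
 shows "mid_amp \<beta> m holomorphic_on {\<tau>. Re \<tau> > 0}"
proof -
 have "1 + \<tau> \<notin> \<real>\<^sub>\<le>\<^sub>0" if "Re \<tau> > 0" for \<tau> using that by (auto simp: complex_nonpos_Reals_iff)
 thus ?thesis unfolding mid_amp_def using mid_amp_slit[OF assms] by (intro holomorphic_intros) auto
qed

text \<open>For |\<tau>| \<le> 1 the mean value inequality gives a bound linear in |\<tau>|, and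
  |\<tau>| \<le> |\<tau>|^(min 1 \<beta>); for larger \<tau> the power itself dominates. For \<beta>
  < 1 the minimum gives up some smallness at \<tau> = 0 on purpose: the resulting bound for the
  amplitude then stays finite at low frequencies.\<close>

lemma mid_amp_bound:
 assumes \<beta>: "0 < \<beta>" "\<beta> < 2" and \<tau>: "Re \<tau> > 0" and m: "m \<ge> 0"
 shows "cmod (mid_amp \<beta> m \<tau>) \<le> 10 powr (m / 2) * (cmod \<tau> powr (min 1 \<beta> * m / 2) + cmod \<tau> powr (\<beta> * m / 2))"
proof -
 have \<tau>0: "cmod \<tau> > 0" "Re \<tau> > 0" "1 + \<tau> \<noteq> 0" using \<tau> by (auto simp: complex_eq_iff)
 define M where "M = max (cmod \<tau> powr min 1 \<beta>) (cmod \<tau> powr \<beta>)"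
 have M0: "M > 0" using \<tau>0 by (auto simp: M_def less_max_iff_disj)
 have "cmod ((1 + \<tau>) powr of_real \<beta> - 1) \<le> 10 * M"
 proof (cases "cmod \<tau> \<le> 1")
  case True
  \<comment> \<open>A convex set containing 1 and 1 + \<tau> on which |z|^(\<beta> - 1) \<le> 2, so
    that the derivative is at most 2 times 2.\<close>
  define S where "S = {z. Re z \<ge> 1} \<inter> cball (0::complex) 2"
  have S: "z \<notin> \<real>\<^sub>\<le>\<^sub>0" "1 \<le> cmod z" "cmod z \<le> 2" if "z \<in> S" for z
   using that complex_Re_le_cmod[of z] by (auto simp: S_def complex_nonpos_Reals_iff)
  have "convex S" unfolding S_def by (intro convex_Int convex_halfspace_Re_ge convex_cball)
  have "cmod ((1 + \<tau>) powr of_real \<beta> - 1 powr of_real \<beta>) \<le> 4 * cmod (1 + \<tau> - 1)"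
  proof (rule field_differentiable_bound[OF \<open>convex S\<close>])
   fix z assume z: "z \<in> S"
   have nz: "z \<noteq> 0" using S[OF z] by auto
   show "((\<lambda>z. z powr of_real \<beta>) has_field_derivative (of_real \<beta> * z powr (of_real \<beta> - 1))) (at z within S)"
    using S(1)[OF z] by (auto intro!: derivative_eq_intros)
   have "cmod (z powr (of_real \<beta> - 1)) = cmod z powr (\<beta> - 1)"
    using cmod_powr_of_real[OF nz, of "\<beta> - 1"] by simp
   also have "\<dots> \<le> 2 powr 1"
   proof (cases "\<beta> \<ge> 1")
    case True
    have "cmod z powr (\<beta> - 1) \<le> 2 powr (\<beta> - 1)" using S[OF z] True by (intro powr_mono2) auto
    also have "\<dots> \<le> 2 powr 1" using \<beta> by (intro powr_mono) auto
    finally show ?thesis .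
   next
    case False
    have "cmod z powr (\<beta> - 1) \<le> cmod z powr 0" using S[OF z] False by (intro powr_mono) auto
    thus ?thesis using nz by simp
   qed
   finally show "cmod (of_real \<beta> * z powr (of_real \<beta> - 1)) \<le> 4"
    using \<beta> mult_mono[of \<beta> 2 "cmod (z powr (of_real \<beta> - 1))" 2] by (simp add: norm_mult)
  qed (use True \<tau> norm_triangle_ineq[of 1 \<tau>] in \<open>auto simp: S_def\<close>)
  moreover have "cmod \<tau> \<le> M"
  proof -
   have "cmod \<tau> powr 1 \<le> cmod \<tau> powr min 1 \<beta>" using True \<tau>0 by (intro powr_mono') auto
   thus ?thesis using \<tau>0 by (simp add: M_def)
  qed
  ultimately show ?thesis using M0 by simp
 next
  case False
  have "cmod ((1 + \<tau>) powr of_real \<beta> - 1) \<le> cmod ((1 + \<tau>) powr of_real \<beta>) + 1"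
   using norm_triangle_ineq4[of "(1 + \<tau>) powr of_real \<beta>" 1] by simp
  also have "cmod ((1 + \<tau>) powr of_real \<beta>) = cmod (1 + \<tau>) powr \<beta>" using \<tau>0 by (simp add: cmod_powr_of_real)
  also have "\<dots> \<le> (2 * cmod \<tau>) powr \<beta>" using False \<beta> norm_triangle_ineq[of 1 \<tau>] by (intro powr_mono2) auto
  also have "\<dots> = 2 powr \<beta> * cmod \<tau> powr \<beta>" by (simp add: powr_mult)
  also have "\<dots> \<le> 4 * cmod \<tau> powr \<beta>" using \<beta> powr_mono[of \<beta> 2 2] by (intro mult_right_mono) auto
  also have "1 \<le> cmod \<tau> powr \<beta>" using False \<beta> by (intro ge_one_powr_ge_zero) auto
  finally show ?thesis using M0 by (simp add: M_def)
 qed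
 hence 1: "cmod ((1 + \<tau>) powr of_real \<beta> - 1) powr (m / 2) \<le> (10 * M) powr (m / 2)"
  using m by (intro powr_mono2) auto
 have nz: "(1 + \<tau>) powr of_real \<beta> - 1 \<noteq> 0" using mid_amp_slit[OF \<beta> \<tau>] by auto
 have "cmod (mid_amp \<beta> m \<tau>) = cmod ((1 + \<tau>) powr of_real \<beta> - 1) powr (m / 2)"
  unfolding mid_amp_def by (rule cmod_powr_of_real[OF nz])
 also have "\<dots> \<le> (10 * M) powr (m / 2)" by (rule 1)
 also have "\<dots> = 10 powr (m / 2) * M powr (m / 2)" using M0 by (simp add: powr_mult)
 also have "M powr (m / 2) \<le> cmod \<tau> powr (min 1 \<beta> * m / 2) + cmod \<tau> powr (\<beta> * m / 2)"
  by (auto simp: M_def max_def powr_powr)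
 finally show ?thesis by simp
qed

text \<open>The regularised time c has argument in [pi/4, pi/2), so turning the \<tau>-axis by -
  pi/4 makes exp(- c \<tau>) decay at a rate comparable to |c|, uniformly as the regularisation
  vanishes.\<close>

definition ray_dir :: complex where "ray_dir = cis (- (pi / 4))"

text \<open>A Laplace integral of \<open>mid_amp\<close> along the turned ray. Unlike the one along
  the positive axis it also converges for \<zeta> on the positive imaginary axis.\<close>

definition ray_amp :: "real \<Rightarrow> real \<Rightarrow> complex \<Rightarrow> complex" where
 "ray_amp \<beta> m \<zeta> = \<zeta> * (LINT t|lborel. indicator {0<..} t *\<^sub>R
   (exp (- (\<zeta> * (of_real t * ray_dir))) * mid_amp \<beta> m (of_real t * ray_dir) * ray_dir))"

lemma ray_dir: "Re ray_dir = sqrt 2 / 2" "Im ray_dir = - sqrt 2 / 2" "cmod ray_dir = 1"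
 by (simp_all add: ray_dir_def cos_45 sin_45)

context
 fixes \<beta> m :: real
 assumes \<beta>: "0 < \<beta>" "\<beta> < 2" and m: "m \<ge> 0"
begin

definition growth :: "real \<Rightarrow> real" where
 "growth t = 10 powr (m / 2) * (t powr (min 1 \<beta> * m / 2) + t powr (\<beta> * m / 2))"

lemma growth_has_integral:
 assumes \<delta>: "\<delta> > 0"
 shows "has_bochner_integral lborel (\<lambda>t. indicator {0..} t * (growth t * exp (- (\<delta> * t))))
  (10 powr (m / 2) * (Gamma (min 1 \<beta> * m / 2 + 1) / \<delta> powr (min 1 \<beta> * m / 2 + 1) + Gamma (\<beta> * m / 2 + 1) / \<delta> powr (\<beta> * m / 2 + 1)))"
proof -
 have "min 1 \<beta> * m \<ge> 0" "\<beta> * m \<ge> 0" using \<beta> m by auto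
 hence "min 1 \<beta> * m / 2 > - 1" "\<beta> * m / 2 > -1" by linarith+
 from has_bochner_integral_mult_right[OF has_bochner_integral_add[OF has_bochner_integral_powr_exp[OF \<delta> this(1)] has_bochner_integral_powr_exp[OF \<delta> this(2)]], of "10 powr (m / 2)"]
 show ?thesis by (simp add: growth_def algebra_simps)
qed

lemma growth_integrable:
 assumes "\<delta> > 0"
 shows "integrable lborel (\<lambda>t. indicator {0<..} t * (growth t * exp (- (\<delta> * t))))"
proof -
 have "integrable lborel (\<lambda>t. indicator {0<..} t *\<^sub>R (indicator {0..} t * (growth t * exp (- (\<delta> * t)))))"
  using growth_has_integral[OF assms] by (intro integrable_mult_indicator) (auto simp: has_bochner_integral_iff)
 also have "(\<lambda>t. indicator {0<..} t *\<^sub>R (indicator {0..} t * (growth t * exp (- (\<delta> * t))))) = (\<lambda>t. indicator {0<..} t * (growth t * exp (- (\<delta> * t))))"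
  by (auto simp: fun_eq_iff indicator_def)
 finally show ?thesis .
qed

lemma growth_nonneg: "growth t \<ge> 0" by (simp add: growth_def)

lemma mid_amp_growth: "Re \<tau> > 0 \<Longrightarrow> cmod (mid_amp \<beta> m \<tau>) \<le> growth (cmod \<tau>)"
 unfolding growth_def by (rule mid_amp_bound[OF \<beta> _ m])

lemma growth_mono: "0 \<le> s \<Longrightarrow> s \<le> t \<Longrightarrow> growth s \<le> growth t"
 unfolding growth_def using \<beta> m by (intro mult_left_mono add_mono powr_mono2) auto

lemma ray_integrand_bound:
 assumes "t > 0" "\<delta> \<le> Re (\<zeta> * w)" "cmod w \<le> 1" "Re w > 0"
 shows "cmod (exp (- (\<zeta> * (of_real t * w))) * mid_amp \<beta> m (of_real t * w)) \<le> growth t * exp (- (\<delta> * t))"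
proof -
 have "cmod (exp (- (\<zeta> * (of_real t * w)))) = exp (- (Re (\<zeta> * w) * t))" by (simp add: algebra_simps)
 also have "\<dots> \<le> exp (- (\<delta> * t))" using assms by (simp add: mult_right_mono)
 finally have 1: "cmod (exp (- (\<zeta> * (of_real t * w)))) \<le> exp (- (\<delta> * t))" .
 have "cmod (mid_amp \<beta> m (of_real t * w)) \<le> growth (cmod (of_real t * w))"
  using assms by (intro mid_amp_growth) simp
 also have "\<dots> \<le> growth t" using assms by (intro growth_mono) (auto simp: norm_mult mult_left_le)
 finally show ?thesis unfolding norm_mult using 1 by (subst mult.commute) (intro mult_mono growth_nonneg, auto)
qed

lemma ray_continuous:
 assumes "Re w > 0"
 shows "continuous_on {0<..} (\<lambda>t. exp (- (\<zeta> * (of_real t * w))) * mid_amp \<beta> m (of_real t * w) * w)"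
proof -
 have "continuous_on {\<tau>. Re \<tau> > 0} (mid_amp \<beta> m)" using mid_amp_holomorphic[OF \<beta>] by (rule holomorphic_on_imp_continuous_on)
 hence "continuous_on {0<..} (\<lambda>t. mid_amp \<beta> m (of_real t * w))"
  by (rule continuous_on_compose2) (use assms in \<open>auto intro!: continuous_intros\<close>)
 thus ?thesis by (intro continuous_intros)
qed

lemma ray_integrable:
 assumes "Re (\<zeta> * w) > 0" "cmod w \<le> 1" "Re w > 0"
 shows "integrable lborel (\<lambda>t. indicator {0<..} t *\<^sub>R (exp (- (\<zeta> * (of_real t * w))) * mid_amp \<beta> m (of_real t * w) * w))"
proof (rule Bochner_Integration.integrable_bound[OF growth_integrable[OF assms(1)]])
 show "(\<lambda>t. indicator {0<..} t *\<^sub>R (exp (- (\<zeta> * (of_real t * w))) * mid_amp \<beta> m (of_real t * w) * w)) \<in> borel_measurable lborel"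
  using borel_measurable_continuous_on_indicator[OF _ ray_continuous[OF assms(3)]] by simp
 show "AE t in lborel. norm (indicator {0<..} t *\<^sub>R (exp (- (\<zeta> * (of_real t * w))) * mid_amp \<beta> m (of_real t * w) * w)) \<le> norm (indicator {0<..} t * (growth t * exp (- (Re (\<zeta> * w) * t))))"
 proof (intro AE_I2)
  fix t :: real
  have "cmod (exp (- (\<zeta> * (of_real t * w))) * mid_amp \<beta> m (of_real t * w) * w) \<le> growth t * exp (- (Re (\<zeta> * w) * t))" if "t > 0"
   using mult_mono[OF ray_integrand_bound[OF that order_refl assms(2,3)] assms(2)] growth_nonneg[of t] unfolding norm_mult[of _ w] by simp
  thus "norm (indicator {0<..} t *\<^sub>R (exp (- (\<zeta> * (of_real t * w))) * mid_amp \<beta> m (of_real t * w) * w)) \<le> norm (indicator {0<..} t * (growth t * exp (- (Re (\<zeta> * w) * t))))"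
   using growth_nonneg[of t] by (auto simp: indicator_def simp del: minus_complex.simps times_complex.simps)
 qed
qed

text \<open>Gamma integrals of the two powers in \<open>growth\<close> with decay rate \<eta>
  |\<zeta>|; the powers of |\<zeta>| follow by homogeneity. Only the direction of \<zeta> relative
  to \<open>ray_dir\<close> matters, hence the uniformity up to the imaginary axis.\<close>

lemma ray_amp_bound:
 assumes \<eta>: "\<eta> > 0"
 obtains C where "C \<ge> 0" "\<And>\<zeta>. \<zeta> \<noteq> 0 \<Longrightarrow> Re (\<zeta> * ray_dir) \<ge> \<eta> * cmod \<zeta> \<Longrightarrow>
   cmod (ray_amp \<beta> m \<zeta>) \<le> C * (cmod \<zeta> powr (- (min 1 \<beta> * m / 2)) + cmod \<zeta> powr (- (\<beta> * m / 2)))"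
proof
 define G1 G2 where "G1 = Gamma (min 1 \<beta> * m / 2 + 1) / \<eta> powr (min 1 \<beta> * m / 2 + 1)"
  and "G2 = Gamma (\<beta> * m / 2 + 1) / \<eta> powr (\<beta> * m / 2 + 1)"
 have p: "min 1 \<beta> * m / 2 + 1 > 0" "\<beta> * m / 2 + 1 > 0" using \<beta> m by (auto intro!: add_nonneg_pos)
 have G: "G1 \<ge> 0" "G2 \<ge> 0" unfolding G1_def G2_def using \<eta> p by (auto intro!: divide_nonneg_nonneg less_imp_le[OF Gamma_real_pos])
 define C where "C = 10 powr (m / 2) * (G1 + G2)"
 show "C \<ge> 0" using G by (simp add: C_def)
 fix \<zeta> :: complex assume z0: "\<zeta> \<noteq> 0" and re: "Re (\<zeta> * ray_dir) \<ge> \<eta> * cmod \<zeta>"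
 define \<delta> where "\<delta> = \<eta> * cmod \<zeta>"
 have \<delta>: "\<delta> > 0" "Re (\<zeta> * ray_dir) \<ge> \<delta>" using z0 \<eta> re by (auto simp: \<delta>_def)
 have w: "cmod ray_dir \<le> 1" "Re ray_dir > 0" "Re (\<zeta> * ray_dir) > 0" using \<delta> by (auto simp: ray_dir)
 have "cmod (LINT t|lborel. indicator {0<..} t *\<^sub>R (exp (- (\<zeta> * (of_real t * ray_dir))) * mid_amp \<beta> m (of_real t * ray_dir) * ray_dir))
   \<le> (LINT t|lborel. indicator {0..} t * (growth t * exp (- (\<delta> * t))))"
 proof (rule Bochner_Integration.integral_norm_bound_integral[OF ray_integrable[OF w(3,1,2)]])
  show "integrable lborel (\<lambda>t. indicator {0..} t * (growth t * exp (- (\<delta> * t))))"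
   using growth_has_integral[OF \<delta>(1)] by (simp add: has_bochner_integral_iff)
  fix t :: real
  have "cmod (exp (- (\<zeta> * (of_real t * ray_dir))) * mid_amp \<beta> m (of_real t * ray_dir) * ray_dir) \<le> growth t * exp (- (\<delta> * t))" if "t > 0"
   using ray_integrand_bound[OF that \<delta>(2) w(1,2)] unfolding norm_mult[of _ ray_dir] ray_dir(3) by simp
  thus "norm (indicator {0<..} t *\<^sub>R (exp (- (\<zeta> * (of_real t * ray_dir))) * mid_amp \<beta> m (of_real t * ray_dir) * ray_dir)) \<le> indicator {0..} t * (growth t * exp (- (\<delta> * t)))"
   using growth_nonneg[of t] by (auto simp: indicator_def simp del: minus_complex.simps times_complex.simps)
 qed
 also have "\<dots> = 10 powr (m / 2) * (Gamma (min 1 \<beta> * m / 2 + 1) / \<delta> powr (min 1 \<beta> * m / 2 + 1) + Gamma (\<beta> * m / 2 + 1) / \<delta> powr (\<beta> * m / 2 + 1))"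
  using growth_has_integral[OF \<delta>(1)] by (simp add: has_bochner_integral_iff)
 also have "\<dots> = 10 powr (m / 2) * (G1 / cmod \<zeta> powr (min 1 \<beta> * m / 2 + 1) + G2 / cmod \<zeta> powr (\<beta> * m / 2 + 1))"
  using \<eta> by (simp add: G1_def G2_def \<delta>_def powr_mult)
 finally have "cmod (ray_amp \<beta> m \<zeta>) \<le> cmod \<zeta> * (10 powr (m / 2) * (G1 / cmod \<zeta> powr (min 1 \<beta> * m / 2 + 1) + G2 / cmod \<zeta> powr (\<beta> * m / 2 + 1)))"
  unfolding ray_amp_def norm_mult by (intro mult_left_mono) auto
 also have "\<dots> = 10 powr (m / 2) * (G1 * cmod \<zeta> powr (- (min 1 \<beta> * m / 2)) + G2 * cmod \<zeta> powr (- (\<beta> * m / 2)))"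
 proof -
  have h: "cmod \<zeta> * (G / cmod \<zeta> powr (p + 1)) = G * cmod \<zeta> powr (- p)" for G p
   using z0 by (simp add: powr_add powr_minus field_simps)
  show ?thesis unfolding h[symmetric] by (simp only: distrib_left mult.left_commute)
 qed
 also have "\<dots> \<le> C * (cmod \<zeta> powr (- (min 1 \<beta> * m / 2)) + cmod \<zeta> powr (- (\<beta> * m / 2)))"
 proof -
  have "G1 * a + G2 * b \<le> (G1 + G2) * (a + b)" if "a \<ge> 0" "b \<ge> 0" for a b
   using mult_nonneg_nonneg[OF G(1) that(2)] mult_nonneg_nonneg[OF G(2) that(1)] by (simp add: algebra_simps)
  thus ?thesis unfolding C_def mult.assoc by (intro mult_left_mono) auto
 qed
 finally show "cmod (ray_amp \<beta> m \<zeta>) \<le> C * (cmod \<zeta> powr (- (min 1 \<beta> * m / 2)) + cmod \<zeta> powr (- (\<beta> * m / 2)))" .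
qed

lemma ray_rotation:
 assumes \<zeta>: "Re \<zeta> > 0" "Im \<zeta> > 0"
 shows "\<zeta> * (LINT t|lborel. indicator {0<..} t *\<^sub>R (exp (- (\<zeta> * of_real t)) * mid_amp \<beta> m (of_real t))) = ray_amp \<beta> m \<zeta>"
proof -
 define F where "F \<tau> = exp (- (\<zeta> * \<tau>)) * mid_amp \<beta> m \<tau>" for \<tau>
 \<comment> \<open>The decay rate is linear in the direction, so the smaller of the two values at
   the endpoints is a lower bound along the whole chord.\<close>
 define \<delta> where "\<delta> = min (Re \<zeta>) (Re (\<zeta> * ray_dir))"
 have rw: "Re (\<zeta> * ray_dir) > 0" using \<zeta> by (simp add: ray_dir add_pos_pos)
 have \<delta>: "\<delta> > 0" using rw \<zeta> by (simp add: \<delta>_def)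
 have mid: "Re (1 + of_real u * (ray_dir - 1)) > 0" "cmod (1 + of_real u * (ray_dir - 1)) \<le> 1" "\<delta> \<le> Re (\<zeta> * (1 + of_real u * (ray_dir - 1)))"
  if u: "u \<in> {0..1}" for u
 proof -
  have 1: "u * (1 - sqrt 2 / 2) \<le> 1 * (1 - sqrt 2 / 2)" using u real_sqrt_le_mono[of 2 4] by (intro mult_right_mono) auto
  have 2: "sqrt 2 > (0::real)" by simp
  have "Re (1 + of_real u * (ray_dir - 1)) = 1 - u * (1 - sqrt 2 / 2)" by (simp add: ray_dir algebra_simps)
  moreover have "u * (1 - sqrt 2 / 2) < 1" by (rule le_less_trans[OF 1]) (use 2 in simp)
  ultimately show "Re (1 + of_real u * (ray_dir - 1)) > 0" by (simp only: diff_gt_0_iff_gt)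
  have e: "1 + of_real u * (ray_dir - 1) = of_real (1 - u) + of_real u * ray_dir" by (simp add: algebra_simps)
  have "cmod (of_real (1 - u) + of_real u * ray_dir) \<le> (1 - u) + u * 1"
   using u by (intro norm_triangle_le) (simp add: norm_mult ray_dir del: of_real_diff)
  thus "cmod (1 + of_real u * (ray_dir - 1)) \<le> 1" unfolding e by simp
  have "Re (\<zeta> * (1 + of_real u * (ray_dir - 1))) = (1 - u) * Re \<zeta> + u * Re (\<zeta> * ray_dir)" by (simp add: algebra_simps)
  also have "\<dots> \<ge> (1 - u) * \<delta> + u * \<delta>" using u by (intro add_mono mult_left_mono) (auto simp: \<delta>_def)
  finally show "\<delta> \<le> Re (\<zeta> * (1 + of_real u * (ray_dir - 1)))" by (simp add: algebra_simps)
 qed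
 have Fb: "cmod (F (of_real t * (1 + of_real u * (ray_dir - 1)))) \<le> growth t * exp (- (\<delta> * t))" if "t > 0" "u \<in> {0..1}" for t u
  unfolding F_def by (rule ray_integrand_bound[OF that(1) mid(3,2,1)]) (use that in auto)
 obtain C1 where C1: "C1 > 0" "\<And>u. u \<ge> 0 \<Longrightarrow> u powr (min 1 \<beta> * m / 2 + 2) \<le> C1 * exp (\<delta> * u)"
  using powr_le_exp[of "min 1 \<beta> * m / 2 + 2" \<delta>] \<delta> \<beta> m by auto
 obtain C2 where C2: "C2 > 0" "\<And>u. u \<ge> 0 \<Longrightarrow> u powr (\<beta> * m / 2 + 2) \<le> C2 * exp (\<delta> * u)"
  using powr_le_exp[of "\<beta> * m / 2 + 2" \<delta>] \<delta> \<beta> m by auto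
 \<comment> \<open>\<open>C1\<close> and \<open>C2\<close> absorb t^2 times the two powers into
   exp(\<delta> t), which yields the O(1/t^2) required on the far chord.\<close>
 define D where "D = growth 1 + 10 powr (m / 2) * (C1 + C2)"
 have "(LINT t|lborel. indicator {0<..} t *\<^sub>R (F (of_real t * 1) * 1)) = (LINT t|lborel. indicator {0<..} t *\<^sub>R (F (of_real t * ray_dir) * ray_dir))"
 proof (rule rotate_ray[where S="{\<tau>. Re \<tau> > 0}" and D=D])
  show "F holomorphic_on {\<tau>. Re \<tau> > 0}" unfolding F_def by (intro holomorphic_intros mid_amp_holomorphic[OF \<beta>])
  show "open {\<tau>. 0 < Re \<tau>}" "convex {\<tau>. 0 < Re \<tau>}" by (simp_all add: open_halfspace_Re_gt convex_halfspace_Re_gt)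
  show "of_real t * 1 \<in> {\<tau>. 0 < Re \<tau>}" "of_real t * ray_dir \<in> {\<tau>. 0 < Re \<tau>}" if "t > 0" for t
   using that by (auto simp: ray_dir)
  show "integrable lborel (\<lambda>t. indicator {0<..} t *\<^sub>R (F (of_real t * 1) * 1))"
   unfolding F_def by (rule ray_integrable) (use \<zeta> in auto)
  show "integrable lborel (\<lambda>t. indicator {0<..} t *\<^sub>R (F (of_real t * ray_dir) * ray_dir))"
   unfolding F_def by (rule ray_integrable) (use rw in \<open>auto simp: ray_dir\<close>)
  show "cmod (F (of_real t * (1 + of_real u * (ray_dir - 1)))) \<le> D" if "0 < t" "t \<le> 1" "u \<in> {0..1}" for t u
  proof -
   have "cmod (F (of_real t * (1 + of_real u * (ray_dir - 1)))) \<le> growth t * exp (- (\<delta> * t))" by (rule Fb) (use that in auto)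
   also have "\<dots> \<le> growth 1 * 1" using that \<delta> by (intro mult_mono growth_mono growth_nonneg) auto
   finally have "cmod (F (of_real t * (1 + of_real u * (ray_dir - 1)))) \<le> growth 1" by simp
   moreover have "0 \<le> 10 powr (m / 2) * (C1 + C2)" using C1(1) C2(1) by simp
   ultimately show ?thesis by (simp only: D_def add_increasing2)
  qed
  show "cmod (F (of_real t * (1 + of_real u * (ray_dir - 1)))) \<le> D / t\<^sup>2" if "1 \<le> t" "u \<in> {0..1}" for t u
  proof -
   have "cmod (F (of_real t * (1 + of_real u * (ray_dir - 1)))) \<le> growth t * exp (- (\<delta> * t))" by (rule Fb) (use that in auto)
   also have "\<dots> = 10 powr (m / 2) * (t powr (min 1 \<beta> * m / 2 + 2) * exp (- (\<delta> * t)) + t powr (\<beta> * m / 2 + 2) * exp (- (\<delta> * t))) / t\<^sup>2"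
   proof -
    have h: "t powr (p + 2) = t powr p * t\<^sup>2" for p using that by (simp add: powr_add powr_numeral)
    have "A * (a + b) * E = A * (a * s * E + b * s * E) / s" if "s \<noteq> 0" for A a b E s :: real
     using that by (simp add: field_simps)
    thus ?thesis unfolding h growth_def using that by auto
   qed
   also have "\<dots> \<le> 10 powr (m / 2) * (C1 * exp (\<delta> * t) * exp (- (\<delta> * t)) + C2 * exp (\<delta> * t) * exp (- (\<delta> * t))) / t\<^sup>2"
    using C1(2)[of t] C2(2)[of t] that by (intro divide_right_mono mult_left_mono add_mono mult_right_mono) auto
   also have "\<dots> = 10 powr (m / 2) * (C1 + C2) / t\<^sup>2" by (simp add: mult.assoc exp_minus_inverse)
   also have "\<dots> \<le> D / t\<^sup>2" using growth_nonneg[of 1] by (intro divide_right_mono) (auto simp: D_def)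
   finally show ?thesis .
  qed
 qed
 thus ?thesis by (simp add: ray_amp_def F_def)
qed

end

text \<open>Integrals over compact intervals are holomorphic by differentiation under the integral
  sign, and the tails are small uniformly near each point, because Re (\<zeta> ray_dir) stays above
  a positive \<delta> there.\<close>

lemma ray_amp_holomorphic:
 assumes \<beta>: "0 < \<beta>" "\<beta> < 2" and m: "m \<ge> 0"
 shows "ray_amp \<beta> m holomorphic_on {\<zeta>. Re (\<zeta> * ray_dir) > 0}"
proof -
 define U where "U = {\<zeta>. Re (\<zeta> * ray_dir) > 0}"
 have U: "U = {\<zeta>. Re ray_dir * Re \<zeta> - Im ray_dir * Im \<zeta> > 0}" by (auto simp: U_def mult.commute)
 have "U = {\<zeta>. inner (cnj ray_dir) \<zeta> > 0}" by (auto simp: U inner_complex_def)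
 hence convU: "convex U" and openU: "open U" by (simp_all add: convex_halfspace_gt open_halfspace_gt)
 have wpos: "Re ray_dir > 0" "cmod ray_dir \<le> 1" by (auto simp: ray_dir)
 define I where "I \<zeta> t = exp (- (\<zeta> * (of_real t * ray_dir))) * mid_amp \<beta> m (of_real t * ray_dir) * ray_dir" for \<zeta> t
 define J where "J \<zeta> = (LINT t|lborel. indicator {0<..} t *\<^sub>R I \<zeta> t)" for \<zeta>
 define f where "f n \<zeta> = integral (cbox (1 / real (Suc n)) (real (Suc n))) (I \<zeta>)" for n \<zeta>
 have contmid: "continuous_on {0<..} (\<lambda>t. mid_amp \<beta> m (of_real t * ray_dir))"
 proof (rule continuous_on_compose2[OF holomorphic_on_imp_continuous_on[OF mid_amp_holomorphic[OF \<beta>]]])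
  show "continuous_on {0<..} (\<lambda>t. of_real t * ray_dir)" by (intro continuous_intros)
 qed (use wpos in auto)
 have contI: "continuous_on {0<..} (I \<zeta>)" for \<zeta> unfolding I_def by (intro continuous_intros contmid)
 have pos: "0 < 1 / real (Suc n)" for n by simp
 have sub: "cbox (1 / real (Suc n)) (real (Suc n)) \<subseteq> {0<..}" for n
  using less_le_trans[OF pos] by (auto simp: cbox_interval simp del: of_nat_Suc)
 have holf: "f n holomorphic_on U" for n
  unfolding f_def
 proof (rule leibniz_rule_holomorphic[where fx="\<lambda>\<zeta> t. - (of_real t * ray_dir) * I \<zeta> t", OF _ _ _ convU])
  show "((\<lambda>\<zeta>. I \<zeta> t) has_field_derivative - (of_real t * ray_dir) * I \<zeta> t) (at \<zeta> within U)" for \<zeta> t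
   unfolding I_def by (auto intro!: derivative_eq_intros)
  show "I \<zeta> integrable_on cbox (1 / real (Suc n)) (real (Suc n))" for \<zeta>
   by (rule integrable_continuous[OF continuous_on_subset[OF contI sub]])
  have "continuous_on (U \<times> cbox (1 / real (Suc n)) (real (Suc n))) (\<lambda>x. mid_amp \<beta> m (of_real (snd x) * ray_dir))"
   by (rule continuous_on_compose2[OF contmid continuous_on_snd[OF continuous_on_id]]) (use sub in auto)
  thus "continuous_on (U \<times> cbox (1 / real (Suc n)) (real (Suc n))) (\<lambda>(\<zeta>, t). - (of_real t * ray_dir) * I \<zeta> t)"
   unfolding I_def case_prod_beta by (intro continuous_intros)
 qed
 have "J holomorphic_on U"
 proof (rule holomorphic_uniform_sequence[OF openU holf])
  fix \<zeta>0 assume \<zeta>0: "\<zeta>0 \<in> U"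
  define \<delta> where "\<delta> = Re (\<zeta>0 * ray_dir) / 2"
  have \<delta>: "\<delta> > 0" using \<zeta>0 by (simp add: \<delta>_def U_def)
  have ball: "\<delta> \<le> Re (\<zeta> * ray_dir)" if "\<zeta> \<in> cball \<zeta>0 \<delta>" for \<zeta>
  proof -
   have "\<bar>Re ((\<zeta>0 - \<zeta>) * ray_dir)\<bar> \<le> cmod ((\<zeta>0 - \<zeta>) * ray_dir)" by (rule abs_Re_le_cmod)
   also have "\<dots> \<le> \<delta>" using that by (simp add: norm_mult ray_dir(3) dist_norm)
   finally have "\<bar>Re (\<zeta>0 * ray_dir) - Re (\<zeta> * ray_dir)\<bar> \<le> \<delta>"
    by (simp only: left_diff_distrib minus_complex.sel)
   thus ?thesis unfolding \<delta>_def by linarith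
  qed
  define g where "g t = indicator {0<..} t * (growth \<beta> m t * exp (- (\<delta> * t)))" for t
  have gint: "integrable lborel g" unfolding g_def by (rule growth_integrable[OF \<beta> m \<delta>])
  have g0: "g t \<ge> 0" for t by (auto simp: g_def growth_nonneg[OF \<beta> m])
  define e where "e n = (LINT t|lborel. indicator (- cbox (1 / real (Suc n)) (real (Suc n))) t * g t)" for n
  have eint: "integrable lborel (\<lambda>t. indicator (- cbox (1 / real (Suc n)) (real (Suc n))) t * g t)" for n
   using integrable_mult_indicator[OF _ gint, of "- cbox (1 / real (Suc n)) (real (Suc n))"] by simp
  have "e \<longlonglongrightarrow> (LINT t::real|lborel. (0::real))"
   unfolding e_def
  proof (rule integral_dominated_convergence[OF _ _ gint])
   show "AE t in lborel. (\<lambda>n. indicator (- cbox (1 / real (Suc n)) (real (Suc n))) t * g t) \<longlonglongrightarrow> 0"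
   proof (intro AE_I2)
    fix t :: real
    show "(\<lambda>n. indicator (- cbox (1 / real (Suc n)) (real (Suc n))) t * g t) \<longlonglongrightarrow> 0"
    proof (cases "t > 0")
     case True
     have "\<forall>\<^sub>F n in sequentially. t \<ge> 1 / real (Suc n)" "\<forall>\<^sub>F n in sequentially. t \<le> real (Suc n)"
      using True by real_asymp+
     hence "\<forall>\<^sub>F n in sequentially. indicator (- cbox (1 / real (Suc n)) (real (Suc n))) t * g t = 0"
      by eventually_elim (auto simp: indicator_def)
     thus ?thesis by (simp add: tendsto_eventually)
    qed (simp add: g_def)
   qed
  qed (use g0 gint in \<open>auto simp: indicator_def\<close>)
  hence elim: "e \<longlonglongrightarrow> 0" by simp
  have dist: "dist (f n \<zeta>) (J \<zeta>) \<le> e n" if \<zeta>: "\<zeta> \<in> cball \<zeta>0 \<delta>" for n \<zeta>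
  proof -
   have re: "\<delta> \<le> Re (\<zeta> * ray_dir)" "Re (\<zeta> * ray_dir) > 0" using ball[OF \<zeta>] \<delta> by auto
   have Iint: "integrable lborel (\<lambda>t. indicator {0<..} t *\<^sub>R I \<zeta> t)"
    unfolding I_def by (rule ray_integrable[OF \<beta> m re(2) wpos(2,1)])
   have Iint2: "integrable lborel (\<lambda>t. indicator (cbox (1 / real (Suc n)) (real (Suc n))) t *\<^sub>R (indicator {0<..} t *\<^sub>R I \<zeta> t))"
    by (intro integrable_mult_indicator Iint) auto
   have eq: "indicator (cbox (1 / real (Suc n)) (real (Suc n))) t *\<^sub>R (indicator {0<..} t *\<^sub>R I \<zeta> t) = indicator (cbox (1 / real (Suc n)) (real (Suc n))) t *\<^sub>R I \<zeta> t" for t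
    using sub[of n] by (auto simp: indicator_def)
   have "f n \<zeta> = (LINT t|lborel. indicator (cbox (1 / real (Suc n)) (real (Suc n))) t *\<^sub>R I \<zeta> t)"
    unfolding f_def using set_borel_integral_eq_integral(2)[of "cbox (1 / real (Suc n)) (real (Suc n))" "I \<zeta>"] Iint2
    unfolding eq by (simp add: set_integrable_def set_lebesgue_integral_def)
   hence "J \<zeta> - f n \<zeta> = (LINT t|lborel. indicator {0<..} t *\<^sub>R I \<zeta> t - indicator (cbox (1 / real (Suc n)) (real (Suc n))) t *\<^sub>R (indicator {0<..} t *\<^sub>R I \<zeta> t))"
    unfolding J_def eq by (simp only: Bochner_Integration.integral_diff[OF Iint Iint2, unfolded eq])
   also have "cmod \<dots> \<le> e n"
    unfolding e_def
   proof (rule Bochner_Integration.integral_norm_bound_integral[OF _ eint])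
    show "integrable lborel (\<lambda>t. indicator {0<..} t *\<^sub>R I \<zeta> t - indicator (cbox (1 / real (Suc n)) (real (Suc n))) t *\<^sub>R (indicator {0<..} t *\<^sub>R I \<zeta> t))"
     by (intro Bochner_Integration.integrable_diff Iint Iint2)
    fix t :: real
    have "cmod (I \<zeta> t) \<le> growth \<beta> m t * exp (- (\<delta> * t))" if "t > 0"
     using ray_integrand_bound[OF \<beta> m that re(1) wpos(2,1)] by (simp add: I_def norm_mult ray_dir(3))
    thus "norm (indicator {0<..} t *\<^sub>R I \<zeta> t - indicator (cbox (1 / real (Suc n)) (real (Suc n))) t *\<^sub>R (indicator {0<..} t *\<^sub>R I \<zeta> t))
     \<le> indicator (- cbox (1 / real (Suc n)) (real (Suc n))) t * g t"
     by (auto simp: g_def indicator_def)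
   qed
   finally show ?thesis by (simp add: dist_norm norm_minus_commute)
  qed
  have "uniform_limit (cball \<zeta>0 \<delta>) f J sequentially"
   unfolding uniform_limit_iff
  proof (intro allI impI)
   fix r :: real assume "r > 0"
   have "\<forall>\<^sub>F n in sequentially. e n < r" using order_tendstoD(2)[OF elim \<open>r > 0\<close>] .
   thus "\<forall>\<^sub>F n in sequentially. \<forall>\<zeta>\<in>cball \<zeta>0 \<delta>. dist (f n \<zeta>) (J \<zeta>) < r"
    by eventually_elim (use dist le_less_trans in blast)
  qed
  moreover have "cball \<zeta>0 \<delta> \<subseteq> U" using ball \<delta> by (fastforce simp: U_def)
  ultimately show "\<exists>d>0. cball \<zeta>0 d \<subseteq> U \<and> uniform_limit (cball \<zeta>0 d) f J sequentially" using \<delta> by blast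
 qed
 hence "(\<lambda>\<zeta>. \<zeta> * J \<zeta>) holomorphic_on U" by (intro holomorphic_intros)
 thus ?thesis by (simp add: ray_amp_def[abs_def] J_def I_def U_def)
qed

text \<open>The substitution v = k^(2\<alpha>) (1 + \<tau>), followed by the rotation of the ray.
  The right-hand side makes sense for complex k, which opens the way to deforming the contour in the
  frequency.\<close>

lemma radial_amp_eq:
 assumes \<alpha>: "\<alpha> > 1/2" and m: "m \<ge> 0" and k: "k > 0" and c: "Re c > 0" "Im c > 0"
 shows "radial_amp \<alpha> m c k = of_real (k powr m) * (exp (- (c * of_real (k powr (2 * \<alpha>)))) * ray_amp (1 / \<alpha>) m (c * of_real (k powr (2 * \<alpha>))))"
proof -
 define \<kappa> where "\<kappa> = k powr (2 * \<alpha>)"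
 define \<zeta> where "\<zeta> = c * of_real \<kappa>"
 have \<kappa>: "\<kappa> > 0" using k by (simp add: \<kappa>_def)
 have \<beta>: "0 < 1 / \<alpha>" "1 / \<alpha> < 2" using \<alpha> by (auto simp: field_simps)
 have \<kappa>': "\<kappa> powr (1 / \<alpha>) = k\<^sup>2" using \<alpha> k by (simp add: \<kappa>_def powr_powr powr_numeral)
 have \<zeta>: "Re \<zeta> > 0" "Im \<zeta> > 0" using c \<kappa> by (auto simp: \<zeta>_def)
 define f where "f v = indicator {0..} v *\<^sub>R ((c * exp (- (c * of_real v))) * of_real (max 0 (v powr (1 / \<alpha>) - k\<^sup>2) powr (m / 2)))" for v
 have eq: "\<kappa> *\<^sub>R f (\<kappa> + \<kappa> * \<tau>) = of_real (k powr m) * exp (- \<zeta>) * (\<zeta> * (indicator {0<..} \<tau> *\<^sub>R (exp (- (\<zeta> * of_real \<tau>)) * mid_amp (1 / \<alpha>) m (of_real \<tau>))))" for \<tau>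
 proof (cases "\<tau> > 0")
  case True
  have 1: "(\<kappa> * (1 + \<tau>)) powr (1 / \<alpha>) - k\<^sup>2 = k\<^sup>2 * ((1 + \<tau>) powr (1 / \<alpha>) - 1)"
  proof -
   have "(\<kappa> * (1 + \<tau>)) powr (1 / \<alpha>) = k\<^sup>2 * (1 + \<tau>) powr (1 / \<alpha>)"
    unfolding \<kappa>'[symmetric] by (rule powr_mult)
   thus ?thesis by (simp only: right_diff_distrib mult_1_right)
  qed
  have 2: "(1 + \<tau>) powr (1 / \<alpha>) - 1 \<ge> 0" using True \<alpha> ge_one_powr_ge_zero[of "1 + \<tau>" "1 / \<alpha>"] by simp
  have 3: "(k\<^sup>2 * ((1 + \<tau>) powr (1 / \<alpha>) - 1)) powr (m / 2) = k powr m * ((1 + \<tau>) powr (1 / \<alpha>) - 1) powr (m / 2)"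
   using k 2 by (simp add: powr_mult powr_powr flip: powr_numeral)
  have 4: "mid_amp (1 / \<alpha>) m (of_real \<tau>) = of_real (((1 + \<tau>) powr (1 / \<alpha>) - 1) powr (m / 2))"
  proof -
   have "(1 + of_real \<tau>) powr of_real (1 / \<alpha>) - 1 = complex_of_real ((1 + \<tau>) powr (1 / \<alpha>) - 1)"
    using True powr_of_real[of "1 + \<tau>" "1 / \<alpha>"] by simp
   thus ?thesis unfolding mid_amp_def using powr_of_real[OF 2, of "m / 2"] by simp
  qed
  have 5: "exp (- (c * of_real (\<kappa> * (1 + \<tau>)))) = exp (- \<zeta>) * exp (- (\<zeta> * of_real \<tau>))"
   by (simp add: \<zeta>_def exp_add[symmetric] algebra_simps)
  have 6: "\<kappa> + \<kappa> * \<tau> = \<kappa> * (1 + \<tau>)" by (simp add: algebra_simps)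
  have 7: "k\<^sup>2 * ((1 + \<tau>) powr (1 / \<alpha>) - 1) \<ge> 0" using 2 by simp
  have 8: "\<kappa> * (1 + \<tau>) \<ge> 0" using \<kappa> True by simp
  show ?thesis unfolding f_def 6 1 5 4 max_absorb2[OF 7] 3 using True 8
   by (simp add: \<zeta>_def scaleR_conv_of_real mult_ac)
 next
  case False
  have "f (\<kappa> + \<kappa> * \<tau>) = 0"
  proof (cases "\<kappa> + \<kappa> * \<tau> \<ge> 0")
   case True
   have "\<kappa> + \<kappa> * \<tau> \<le> \<kappa>" using False \<kappa> by (simp add: mult_nonneg_nonpos)
   hence "(\<kappa> + \<kappa> * \<tau>) powr (1 / \<alpha>) \<le> \<kappa> powr (1 / \<alpha>)" using True \<alpha> by (intro powr_mono2) auto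
   thus ?thesis unfolding f_def \<kappa>' by (simp add: max_absorb1)
  qed (simp add: f_def)
  thus ?thesis using False by simp
 qed
 have "radial_amp \<alpha> m c k = integral\<^sup>L lborel f" by (simp add: radial_amp_def f_def[abs_def])
 also have "\<dots> = (LINT \<tau>|lborel. \<kappa> *\<^sub>R f (\<kappa> + \<kappa> * \<tau>))"
  using lborel_integral_real_affine[of \<kappa> f \<kappa>] \<kappa> by simp
 also have "\<dots> = of_real (k powr m) * exp (- \<zeta>) * (\<zeta> * (LINT \<tau>|lborel. indicator {0<..} \<tau> *\<^sub>R (exp (- (\<zeta> * of_real \<tau>)) * mid_amp (1 / \<alpha>) m (of_real \<tau>))))"
  unfolding eq by (simp only: integral_mult_right_zero)
 also have "\<dots> = of_real (k powr m) * exp (- \<zeta>) * ray_amp (1 / \<alpha>) m \<zeta>"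
  unfolding ray_rotation[OF \<beta> m \<zeta>] ..
 finally show ?thesis by (simp add: \<zeta>_def \<kappa>_def mult.assoc)
qed

section \<open>The contour through the saddle point\<close>

lemma taylor2_upper:
 fixes f f' f'' :: "real \<Rightarrow> real"
 assumes ab: "a \<le> b"
  and f: "\<And>t. a \<le> t \<Longrightarrow> t \<le> b \<Longrightarrow> (f has_real_derivative f' t) (at t)"
  and f': "\<And>t. a \<le> t \<Longrightarrow> t \<le> b \<Longrightarrow> (f' has_real_derivative f'' t) (at t)"
  and f'': "\<And>t. a \<le> t \<Longrightarrow> t \<le> b \<Longrightarrow> f'' t \<le> - K"
 shows "f b \<le> f a + f' a * (b - a) - K * (b - a)\<^sup>2 / 2" "f' b \<le> f' a - K * (b - a)"
proof -
 have 1: "f' t \<le> f' a - K * (t - a)" if "a \<le> t" "t \<le> b" for t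
 proof -
  have "(\<lambda>s. f' s + K * (s - a)) t \<le> (\<lambda>s. f' s + K * (s - a)) a"
  proof (rule DERIV_nonpos_imp_nonincreasing[OF that(1)])
   fix s assume "a \<le> s" "s \<le> t"
   thus "\<exists>y. ((\<lambda>s. f' s + K * (s - a)) has_real_derivative y) (at s) \<and> y \<le> 0"
    using f'[of s] f''[of s] that by (intro exI[of _ "f'' s + K"]) (auto intro!: derivative_eq_intros)
  qed
  thus ?thesis by simp
 qed
 show "f' b \<le> f' a - K * (b - a)" using 1 ab by simp
 have "(\<lambda>s. f s - f' a * (s - a) + K * (s - a)\<^sup>2 / 2) b \<le> (\<lambda>s. f s - f' a * (s - a) + K * (s - a)\<^sup>2 / 2) a"
 proof (rule DERIV_nonpos_imp_nonincreasing[OF ab])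
  fix s assume "a \<le> s" "s \<le> b"
  thus "\<exists>y. ((\<lambda>s. f s - f' a * (s - a) + K * (s - a)\<^sup>2 / 2) has_real_derivative y) (at s) \<and> y \<le> 0"
   using f[of s] 1[of s] by (intro exI[of _ "f' s - f' a + K * (s - a)"]) (auto intro!: derivative_eq_intros)
 qed
 thus "f b \<le> f a + f' a * (b - a) - K * (b - a)\<^sup>2 / 2" by simp
qed

lemma Re_Im_polar:
 assumes "z \<noteq> 0"
 shows "Re z = cmod z * cos (Im (Ln z))" "Im z = cmod z * sin (Im (Ln z))"
 using exp_Ln[OF assms] Re_exp[of "Ln z"] Im_exp[of "Ln z"] assms by simp_all

lemma powr_polar:
 assumes "z \<noteq> 0"
 shows "z powr of_real a = of_real (cmod z powr a) * cis (a * Im (Ln z))"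
 using assms Re_Ln[OF assms] by (simp add: powr_def exp_eq_polar)

text \<open>Chosen such that 2\<alpha> times it is pi/8: on the sector of this half-angle the
  argument of z^(2\<alpha>) stays below pi/8 in modulus, so that of c z^(2\<alpha>) lies in
  [pi/8, 5 pi/8], within 3 pi/8 of pi/4.\<close>

definition aperture :: "real \<Rightarrow> real" where "aperture \<alpha> = pi / (16 * \<alpha>)"

text \<open>The linear form of the inequality gives openness and convexity directly;
  \<open>sector_iff\<close> restores the description by angles.\<close>

definition sector :: "real \<Rightarrow> complex set" where
 "sector \<alpha> = {z. \<bar>Im z\<bar> < tan (aperture \<alpha>) * Re z}"

text \<open>At the saddle point 1 the second derivative of the phase is -2i\<alpha>(2\<alpha> - 1),
  so every direction cis(- k) with 0 < k < pi/2 is one of descent. The steepest one, cis(- pi/4),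
  would leave the sector.\<close>

definition tilt :: "real \<Rightarrow> complex" where "tilt \<alpha> = cis (- (aperture \<alpha> / 2))"

text \<open>Along the line \<open>1 + w tilt\<close> the phase \<open>i(2\<alpha>z - z\<^bsup>2\<alpha>\<^esup>)\<close> with its saddle point at \<open>1\<close> has
 decreasing real part away from \<open>w = 0\<close>; to the left of the saddle we leave this line at
 \<open>w = -setback \<alpha>\<close> and go straight to the origin.\<close>

definition setback :: "real \<Rightarrow> real" where
 "setback \<alpha> = (let s = tan (aperture \<alpha> / (4 * \<alpha>)) in s / (1 + s))"

definition turn :: "real \<Rightarrow> complex" where "turn \<alpha> = 1 - of_real (setback \<alpha>) * tilt \<alpha>"

definition phase :: "real \<Rightarrow> complex \<Rightarrow> complex" where
 "phase \<alpha> z = \<i> * (of_real (2 * \<alpha>) * z - z powr of_real (2 * \<alpha>))"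

context
 fixes \<alpha> :: real
 assumes \<alpha>: "\<alpha> > 1 / 2"
begin

lemma aperture: "0 < aperture \<alpha>" "aperture \<alpha> < pi / 8" "2 * \<alpha> * aperture \<alpha> = pi / 8"
 using \<alpha> pi_gt_zero by (auto simp: aperture_def field_simps)

lemma sector_iff:
 "z \<in> sector \<alpha> \<longleftrightarrow> Re z > 0 \<and> \<bar>Im (Ln z)\<bar> < aperture \<alpha>"
proof -
 have t: "tan (aperture \<alpha>) > 0" using aperture by (intro tan_gt_zero) auto
 show ?thesis
 proof (cases "Re z > 0")
  case True
  hence z: "z \<noteq> 0" "cmod z > 0" by auto
  define \<theta> where "\<theta> = Im (Ln z)"
  have \<theta>: "\<bar>\<theta>\<bar> < pi / 2" using Re_Ln_pos_lt[OF z(1)] True by (simp add: \<theta>_def)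
  have "z \<in> sector \<alpha> \<longleftrightarrow> cmod z * \<bar>sin \<theta>\<bar> < cmod z * (tan (aperture \<alpha>) * cos \<theta>)"
   unfolding sector_def mem_Collect_eq Re_Im_polar[OF z(1)] \<theta>_def[symmetric] abs_mult by (simp add: mult_ac)
  also have "\<dots> \<longleftrightarrow> \<bar>sin \<theta>\<bar> < tan (aperture \<alpha>) * cos \<theta>" using z by simp
  also have "\<dots> \<longleftrightarrow> \<bar>tan \<theta>\<bar> < tan (aperture \<alpha>)"
  proof -
   have c: "cos \<theta> > 0" using cos_gt_zero_pi[of \<theta>] \<theta> by auto
   have "\<bar>tan \<theta>\<bar> = \<bar>sin \<theta>\<bar> / cos \<theta>" using c by (simp add: tan_def abs_divide)
   thus ?thesis by (simp only: pos_divide_less_eq[OF c])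
  qed
  also have "\<bar>tan \<theta>\<bar> = tan \<bar>\<theta>\<bar>"
  proof (cases "\<theta> \<ge> 0")
   case True
   thus ?thesis using \<theta> tan_pos_pi2_le[of \<theta>] by auto
  next
   case False
   thus ?thesis using \<theta> tan_gt_zero[of "- \<theta>"] by auto
  qed
  also have "tan \<bar>\<theta>\<bar> < tan (aperture \<alpha>) \<longleftrightarrow> \<bar>\<theta>\<bar> < aperture \<alpha>"
   using \<theta> aperture by (intro tan_mono_lt_eq) auto
  finally show ?thesis using True by (simp add: \<theta>_def)
 next
  case False
  hence "tan (aperture \<alpha>) * Re z \<le> 0" using t by (simp add: mult_nonneg_nonpos)
  thus ?thesis using False by (auto simp: sector_def)
 qed
qed

lemma sector_nonzero: "z \<in> sector \<alpha> \<Longrightarrow> z \<noteq> 0" "z \<in> sector \<alpha> \<Longrightarrow> z \<notin> \<real>\<^sub>\<le>\<^sub>0"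
 by (auto simp: sector_iff complex_nonpos_Reals_iff)

lemma sector_open: "open (sector \<alpha>)"
 unfolding sector_def by (intro open_Collect_less continuous_intros)

lemma sector_convex: "convex (sector \<alpha>)"
proof -
 have "sector \<alpha> = {z. inner (Complex (- tan (aperture \<alpha>)) 1) z < 0} \<inter> {z. inner (Complex (- tan (aperture \<alpha>)) (- 1)) z < 0}"
  by (auto simp: sector_def inner_complex_def abs_less_iff)
 thus ?thesis by (simp add: convex_Int convex_halfspace_lt)
qed

lemma sector_scale: "t > 0 \<Longrightarrow> z \<in> sector \<alpha> \<Longrightarrow> of_real t * z \<in> sector \<alpha>"
 by (simp add: sector_def abs_mult mult.left_commute)

lemma one_in_sector: "1 \<in> sector \<alpha>" using aperture by (simp add: sector_iff)

lemma Ln_scale: "t > 0 \<Longrightarrow> z \<noteq> 0 \<Longrightarrow> Im (Ln (of_real t * z)) = Im (Ln z)"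
 by (simp add: Ln_times_of_real)

lemma tilt_sector: "tilt \<alpha> \<in> sector \<alpha>" "Im (Ln (tilt \<alpha>)) = - (aperture \<alpha> / 2)"
proof -
 show 1: "Im (Ln (tilt \<alpha>)) = - (aperture \<alpha> / 2)"
  unfolding tilt_def cis_conv_exp by (subst Ln_exp) (use aperture pi_gt_zero in auto)
 show "tilt \<alpha> \<in> sector \<alpha>" using aperture cos_gt_zero[of "aperture \<alpha> / 2"] pi_gt_zero
  unfolding sector_iff 1 by (auto simp: tilt_def)
qed

lemma line_forward:
 assumes w: "w \<ge> 0"
 defines "z \<equiv> 1 + of_real w * tilt \<alpha>"
 shows "z \<in> sector \<alpha>" "- (aperture \<alpha> / 2) \<le> Im (Ln z)" "Im (Ln z) \<le> 0" "cmod z \<ge> 1" "cmod z \<ge> w" "cmod z \<le> 1 + w"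
proof -
 define k where "k = aperture \<alpha> / 2"
 have k: "0 < k" "k < pi / 16" using aperture by (auto simp: k_def)
 have ck: "cos k > 0" "sin k > 0" using k pi_gt_zero by (auto intro!: cos_gt_zero sin_gt_zero)
 have ReIm: "Re z = 1 + w * cos k" "Im z = - (w * sin k)" by (auto simp: z_def tilt_def k_def)
 have re: "Re z \<ge> 1" using ReIm w ck by simp
 hence z0: "z \<noteq> 0" "cmod z > 0" by auto
 define \<theta> where "\<theta> = Im (Ln z)"
 have \<theta>: "\<bar>\<theta>\<bar> < pi / 2" using Re_Ln_pos_lt[OF z0(1)] re by (simp add: \<theta>_def)
 have "cmod z * sin \<theta> = - (w * sin k)" using Re_Im_polar(2)[OF z0(1)] ReIm(2) by (simp add: \<theta>_def)
 hence "cmod z * sin \<theta> \<le> 0" using w ck by simp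
 hence "sin \<theta> \<le> 0" using z0 by (simp add: mult_le_0_iff)
 hence le: "\<theta> \<le> 0" using sin_gt_zero[of \<theta>] \<theta> by (cases "\<theta> > 0") auto
 \<comment> \<open>The imaginary part of z cis(k) is constant along the line, namely sin k; its
   positivity keeps \<theta> above - k.\<close>
 have "cmod z * sin (\<theta> + k) = Im z * cos k + Re z * sin k"
  unfolding sin_add using Re_Im_polar[OF z0(1)] by (simp add: \<theta>_def algebra_simps)
 also have "\<dots> = sin k" by (simp add: ReIm algebra_simps)
 finally have "sin (\<theta> + k) > 0" using ck z0 by (metis zero_less_mult_pos)
 hence ge: "\<theta> + k \<ge> 0" using sin_gt_zero[of "- (\<theta> + k)"] sin_minus[of "\<theta> + k"] \<theta> k pi_gt_zero by (cases "\<theta> + k < 0") auto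
 show "- (aperture \<alpha> / 2) \<le> Im (Ln z)" "Im (Ln z) \<le> 0" using ge le by (auto simp: \<theta>_def k_def)
 show "z \<in> sector \<alpha>" unfolding sector_iff using re ge le k by (auto simp: \<theta>_def k_def)
 show "cmod z \<ge> 1" using re complex_Re_le_cmod[of z] by simp
 have "cmod z ^ 2 = 1 + 2 * w * cos k + w\<^sup>2 * ((cos k)\<^sup>2 + (sin k)\<^sup>2)"
  unfolding cmod_power2 ReIm by algebra
 hence "w\<^sup>2 \<le> (cmod z)\<^sup>2" using w ck by simp
 thus "cmod z \<ge> w" by (rule power2_le_imp_le) simp
 show "cmod z \<le> 1 + w" unfolding z_def using norm_triangle_ineq[of 1 "of_real w * tilt \<alpha>"] w by (simp add: norm_mult tilt_def)
qed

lemma setback: "0 < setback \<alpha>" "setback \<alpha> < 1 / 2"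
proof -
 define s where "s = tan (aperture \<alpha> / (4 * \<alpha>))"
 have a: "0 < aperture \<alpha> / (4 * \<alpha>)" "aperture \<alpha> / (4 * \<alpha>) < pi / 4"
 proof -
  have "aperture \<alpha> / (4 * \<alpha>) \<le> aperture \<alpha> / 1" using \<alpha> aperture by (intro divide_left_mono) auto
  thus "aperture \<alpha> / (4 * \<alpha>) < pi / 4" using aperture pi_gt_zero by linarith
 qed (use \<alpha> aperture in auto)
 have "0 < s" unfolding s_def using a pi_gt_zero by (intro tan_gt_zero) auto
 moreover have "s < 1" unfolding s_def tan_45[symmetric] using a pi_gt_zero by (intro tan_monotone) auto
 moreover have "setback \<alpha> = s / (1 + s)" by (simp add: setback_def s_def Let_def)
 moreover have "0 < s / (1 + s)" "s / (1 + s) < 1 / 2" using \<open>0 < s\<close> \<open>s < 1\<close> by (auto simp: field_simps)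
 ultimately show "0 < setback \<alpha>" "setback \<alpha> < 1 / 2" by simp_all
qed

text \<open>The quotient of imaginary and real part of z is at most s / (1 - s), and
  \<open>setback\<close> is the value of s for which this equals the tangent of aperture /
  (4\<alpha>). So small an angle is wanted because the second derivative along the line multiplies
  it by 2\<alpha> - 2.\<close>

lemma line_backward:
 assumes s: "0 \<le> s" "s \<le> setback \<alpha>"
 defines "z \<equiv> 1 - of_real s * tilt \<alpha>"
 shows "z \<in> sector \<alpha>" "0 \<le> Im (Ln z)" "Im (Ln z) \<le> aperture \<alpha> / (4 * \<alpha>)" "cmod z \<ge> 1 / 2" "cmod z \<le> 1"
proof -
 define k where "k = aperture \<alpha> / 2"
 define e where "e = aperture \<alpha> / (4 * \<alpha>)"
 have k: "0 < k" "k < pi / 16" using aperture by (auto simp: k_def)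
 have e: "0 < e" "e < k * 1"
 proof -
  have "e = k * (1 / (2 * \<alpha>))" by (simp add: e_def k_def)
  also have "\<dots> < k * 1" using \<alpha> k by (intro mult_strict_left_mono) auto
  finally show "e < k * 1" .
 qed (use \<alpha> aperture in \<open>auto simp: e_def\<close>)
 have ck: "cos k > 0" "sin k > 0" "cos e > 0" "sin e > 0" using k e pi_gt_zero by (auto intro!: cos_gt_zero sin_gt_zero)
 have ReIm: "Re z = 1 - s * cos k" "Im z = s * sin k" by (auto simp: z_def tilt_def k_def)
 have s2: "s < 1 / 2" using s setback by auto
 have "s * cos k \<le> s * 1" using s by (intro mult_left_mono) auto
 hence re: "Re z \<ge> 1 - s" "Re z \<ge> 1 / 2" using ReIm s2 by auto
 hence z0: "z \<noteq> 0" "cmod z > 0" by auto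
 define \<theta> where "\<theta> = Im (Ln z)"
 have \<theta>: "\<bar>\<theta>\<bar> < pi / 2" using Re_Ln_pos_lt[OF z0(1)] re by (simp add: \<theta>_def)
 have "cmod z * sin \<theta> = s * sin k" using Re_Im_polar(2)[OF z0(1)] ReIm(2) by (simp add: \<theta>_def)
 hence "cmod z * sin \<theta> \<ge> 0" using s ck by simp
 hence "sin \<theta> \<ge> 0" using z0 by (simp add: zero_le_mult_iff)
 hence ge: "\<theta> \<ge> 0" using sin_gt_zero[of "- \<theta>"] \<theta> by (cases "\<theta> < 0") auto
 have t: "tan e > 0" using ck by (simp add: tan_def)
 have "s \<le> tan e * (1 - s)"
 proof -
  have "s \<le> tan e / (1 + tan e)" using s by (simp add: setback_def Let_def e_def)
  hence "s * (1 + tan e) \<le> tan e" using t by (simp add: field_simps)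
  thus ?thesis by (simp add: algebra_simps)
 qed
 also have "\<dots> \<le> tan e * Re z" using t re by (intro mult_left_mono) auto
 finally have "s * cos e \<le> sin e * Re z" using ck by (simp add: tan_def field_simps)
 moreover have "s * sin k * cos e \<le> s * 1 * cos e" using s ck by (intro mult_right_mono mult_left_mono) auto
 ultimately have 1: "Im z * cos e \<le> sin e * Re z" by (simp add: ReIm)
 have "cmod z * sin (e - \<theta>) = sin e * Re z - Im z * cos e"
  unfolding sin_diff using Re_Im_polar[OF z0(1)] by (simp add: \<theta>_def algebra_simps)
 hence "cmod z * sin (e - \<theta>) \<ge> 0" using 1 by simp
 hence "sin (e - \<theta>) \<ge> 0" using z0 by (simp add: zero_le_mult_iff)
 hence le: "\<theta> \<le> e" using sin_gt_zero[of "\<theta> - e"] sin_minus[of "e - \<theta>"] \<theta> e pi_gt_zero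
  by (cases "\<theta> > e") auto
 show "0 \<le> Im (Ln z)" "Im (Ln z) \<le> aperture \<alpha> / (4 * \<alpha>)" using ge le by (auto simp: \<theta>_def e_def)
 show "z \<in> sector \<alpha>" unfolding sector_iff using re ge le e k by (auto simp: \<theta>_def k_def)
 show "cmod z \<ge> 1 / 2" using re complex_Re_le_cmod[of z] by simp
 have "(cmod z)\<^sup>2 = 1 - 2 * s * cos k + s\<^sup>2 * ((cos k)\<^sup>2 + (sin k)\<^sup>2)"
  unfolding cmod_power2 ReIm by algebra
 also have "\<dots> = 1 - s * (2 * cos k - s)" by (simp add: power2_eq_square algebra_simps)
 also have "\<dots> \<le> 1"
 proof -
  have "cos (pi / 3) \<le> cos k" using k pi_gt_zero by (intro cos_monotone_0_pi_le) auto
  hence "2 * cos k - s \<ge> 0" using s2 by (simp add: cos_60)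
  thus ?thesis using s by simp
 qed
 finally show "cmod z \<le> 1" using power2_le_imp_le[of "cmod z" 1] by simp
qed

definition line_exp :: "real \<Rightarrow> real" where "line_exp w = Re (phase \<alpha> (1 + of_real w * tilt \<alpha>))"

text \<open>Value and slope vanish at w = 0, the saddle point, and the second derivative is at most
  a negative multiple of |Z|^(2\<alpha> - 2); Taylor's formula does the rest.\<close>

lemma line_exp_bounds:
 obtains c where "c > 0" "\<And>w. - setback \<alpha> \<le> w \<Longrightarrow> w \<le> 1 \<Longrightarrow> line_exp w \<le> - c * w\<^sup>2"
  "\<And>w. w \<ge> 1 \<Longrightarrow> line_exp w \<le> - c * w powr (2 * \<alpha>)"
proof -
 define k where "k = aperture \<alpha> / 2"
 have k: "0 < k" "k < pi / 16" "4 * \<alpha> * k = pi / 8" using aperture by (auto simp: k_def)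
 define Z where "Z w = 1 + of_real w * tilt \<alpha>" for w :: real
 define f1 where "f1 w = Re (\<i> * (of_real (2 * \<alpha>) - of_real (2 * \<alpha>) * Z w powr of_real (2 * \<alpha> - 1)) * tilt \<alpha>)" for w
 define f2 where "f2 w = Re (\<i> * (- of_real (2 * \<alpha> * (2 * \<alpha> - 1)) * Z w powr of_real (2 * \<alpha> - 2)) * (tilt \<alpha>)\<^sup>2)" for w
 have ZS: "Z w \<in> sector \<alpha>" if "w \<ge> - setback \<alpha>" for w
  using line_forward(1)[of w] line_backward(1)[of "- w"] that by (cases "w \<ge> 0") (auto simp: Z_def)
 have arg: "- k \<le> Im (Ln (Z w))" "Im (Ln (Z w)) \<le> k / (2 * \<alpha>)" if "w \<ge> - setback \<alpha>" for w
  using line_forward(2,3)[of w] line_backward(2,3)[of "- w"] that k \<alpha>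
  by (cases "w \<ge> 0"; force simp: Z_def k_def intro: order_trans[of _ 0])+
 have dZ: "(Z has_vector_derivative tilt \<alpha>) (at w)" for w
  unfolding Z_def[abs_def] by (auto intro!: derivative_eq_intros has_vector_derivative_mult_left)
 have d1: "(line_exp has_real_derivative f1 w) (at w)" if "w \<ge> - setback \<alpha>" for w
 proof -
  have "(phase \<alpha> has_field_derivative \<i> * (of_real (2 * \<alpha>) - of_real (2 * \<alpha>) * Z w powr (of_real (2 * \<alpha>) - 1))) (at (Z w))"
   unfolding phase_def[abs_def] using sector_nonzero(2)[OF ZS[OF that]] by (auto intro!: derivative_eq_intros)
  hence "((phase \<alpha> \<circ> Z) has_vector_derivative (tilt \<alpha> * (\<i> * (of_real (2 * \<alpha>) - of_real (2 * \<alpha>) * Z w powr (of_real (2 * \<alpha>) - 1))))) (at w)"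
   by (rule field_vector_diff_chain_at[OF dZ])
  hence "((\<lambda>w. Re ((phase \<alpha> \<circ> Z) w)) has_vector_derivative Re (tilt \<alpha> * (\<i> * (of_real (2 * \<alpha>) - of_real (2 * \<alpha>) * Z w powr (of_real (2 * \<alpha>) - 1))))) (at w)"
   by (rule bounded_linear.has_vector_derivative[OF bounded_linear_Re])
  thus ?thesis unfolding has_real_derivative_iff_has_vector_derivative line_exp_def[abs_def] Z_def[symmetric] f1_def
   by (simp add: o_def mult_ac)
 qed
 have d2: "(f1 has_real_derivative f2 w) (at w)" if "w \<ge> - setback \<alpha>" for w
 proof -
  define g where "g z = \<i> * (of_real (2 * \<alpha>) - of_real (2 * \<alpha>) * z powr of_real (2 * \<alpha> - 1)) * tilt \<alpha>" for z
  have "(g has_field_derivative \<i> * (- of_real (2 * \<alpha> * (2 * \<alpha> - 1)) * Z w powr (of_real (2 * \<alpha> - 1) - 1)) * tilt \<alpha>) (at (Z w))"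
   unfolding g_def[abs_def] using sector_nonzero(2)[OF ZS[OF that]] by (auto intro!: derivative_eq_intros)
  also have "(of_real (2 * \<alpha> - 1) - 1 :: complex) = of_real (2 * \<alpha> - 2)" by simp
  finally have "((g \<circ> Z) has_vector_derivative (tilt \<alpha> * (\<i> * (- of_real (2 * \<alpha> * (2 * \<alpha> - 1)) * Z w powr of_real (2 * \<alpha> - 2)) * tilt \<alpha>))) (at w)"
   by (rule field_vector_diff_chain_at[OF dZ])
  hence "((\<lambda>w. Re ((g \<circ> Z) w)) has_vector_derivative Re (tilt \<alpha> * (\<i> * (- of_real (2 * \<alpha> * (2 * \<alpha> - 1)) * Z w powr of_real (2 * \<alpha> - 2)) * tilt \<alpha>))) (at w)"
   by (rule bounded_linear.has_vector_derivative[OF bounded_linear_Re])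
  moreover have "tilt \<alpha> * (\<i> * (- of_real (2 * \<alpha> * (2 * \<alpha> - 1)) * Z w powr of_real (2 * \<alpha> - 2)) * tilt \<alpha>) = \<i> * (- of_real (2 * \<alpha> * (2 * \<alpha> - 1)) * Z w powr of_real (2 * \<alpha> - 2)) * (tilt \<alpha>)\<^sup>2"
   by (simp add: power2_eq_square)
  ultimately show ?thesis unfolding has_real_derivative_iff_has_vector_derivative f1_def[abs_def] f2_def
   by (simp only: o_def g_def)
 qed
 \<comment> \<open>The sign comes from the angle x below: it stays between k and pi/2, so its sine
   is at least sin k. For \<alpha> \<ge> 1 it is the upper limit k / (2\<alpha>) for the argument
   that keeps x above k, for \<alpha> < 1 the lower limit - k.\<close>
 have f2: "f2 w \<le> - (2 * \<alpha> * (2 * \<alpha> - 1) * sin k) * cmod (Z w) powr (2 * \<alpha> - 2)" if w: "w \<ge> - setback \<alpha>" for w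
 proof -
  define \<theta> where "\<theta> = Im (Ln (Z w))"
  define x where "x = 2 * k - (2 * \<alpha> - 2) * \<theta>"
  have z0: "Z w \<noteq> 0" using sector_nonzero(1)[OF ZS[OF w]] .
  have t2: "(tilt \<alpha>)\<^sup>2 = cis (- (2 * k))" by (simp add: tilt_def power2_eq_square cis_mult k_def)
  have "\<i> * (- of_real (2 * \<alpha> * (2 * \<alpha> - 1)) * Z w powr of_real (2 * \<alpha> - 2)) * (tilt \<alpha>)\<^sup>2 =
   of_real (2 * \<alpha> * (2 * \<alpha> - 1) * cmod (Z w) powr (2 * \<alpha> - 2)) * (- \<i> * cis ((2 * \<alpha> - 2) * \<theta> - 2 * k))"
   unfolding powr_polar[OF z0] t2 \<theta>_def by (simp add: cis_mult mult_ac)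
  also have "Re \<dots> = (2 * \<alpha> * (2 * \<alpha> - 1) * cmod (Z w) powr (2 * \<alpha> - 2)) * sin ((2 * \<alpha> - 2) * \<theta> - 2 * k)"
   by simp
  also have "sin ((2 * \<alpha> - 2) * \<theta> - 2 * k) = - sin x" unfolding x_def sin_minus[symmetric] by simp
  finally have 1: "f2 w = - (2 * \<alpha> * (2 * \<alpha> - 1) * cmod (Z w) powr (2 * \<alpha> - 2)) * sin x" by (simp add: f2_def)
  have th: "- k \<le> \<theta>" "\<theta> \<le> k / (2 * \<alpha>)" using arg[OF w] by (auto simp: \<theta>_def)
  have x: "k \<le> x" "x \<le> pi / 2 - 0"
  proof -
   have "x = 2 * k + 2 * \<theta> - 2 * \<alpha> * \<theta>" by (simp add: x_def algebra_simps)
   show "k \<le> x"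
   proof (cases "\<alpha> \<ge> 1")
    case True
    have "(2 * \<alpha> - 2) * \<theta> \<le> (2 * \<alpha> - 2) * (k / (2 * \<alpha>))" using th True by (intro mult_left_mono) auto
    also have "\<dots> \<le> (2 * \<alpha>) * (k / (2 * \<alpha>))" using k True by (intro mult_right_mono) auto
    also have "\<dots> = k" using True by simp
    finally show ?thesis by (simp add: x_def)
   next
    case False
    have "(2 - 2 * \<alpha>) * (- \<theta>) \<le> (2 - 2 * \<alpha>) * k" using th False by (intro mult_left_mono) auto
    also have "\<dots> \<le> 1 * k" using k \<alpha> by (intro mult_right_mono) auto
    finally show ?thesis by (simp add: x_def algebra_simps)
   qed
   show "x \<le> pi / 2 - 0"
   proof (cases "\<alpha> \<ge> 1")
    case True
    have "(2 * \<alpha> - 2) * (- \<theta>) \<le> (2 * \<alpha> - 2) * k" using th True by (intro mult_left_mono) auto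
    also have "\<dots> \<le> (4 * \<alpha>) * k" using k \<alpha> by (intro mult_right_mono) auto
    finally show ?thesis using k pi_gt_zero by (simp add: x_def algebra_simps)
   next
    case False
    have "\<theta> \<le> k" using th k \<alpha> by (elim order_trans) (simp add: field_simps)
    hence "(2 - 2 * \<alpha>) * \<theta> \<le> (2 - 2 * \<alpha>) * k" using False by (intro mult_left_mono) auto
    also have "\<dots> \<le> 1 * k" using k \<alpha> by (intro mult_right_mono) auto
    finally show ?thesis using k pi_gt_zero by (simp add: x_def algebra_simps)
   qed
  qed
  have "sin k \<le> sin x" using x k pi_gt_zero by (intro sin_monotone_2pi_le) auto
  hence "(2 * \<alpha> * (2 * \<alpha> - 1) * cmod (Z w) powr (2 * \<alpha> - 2)) * sin k \<le> (2 * \<alpha> * (2 * \<alpha> - 1) * cmod (Z w) powr (2 * \<alpha> - 2)) * sin x"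
   using \<alpha> by (intro mult_left_mono) auto
  thus ?thesis unfolding 1 by (simp add: mult_ac)
 qed
 define A where "A = 2 * \<alpha> * (2 * \<alpha> - 1) * sin k"
 have A: "A > 0" unfolding A_def using \<alpha> k pi_gt_zero by (intro mult_pos_pos sin_gt_zero) auto
 \<comment> \<open>Covers both signs of the exponent 2\<alpha> - 2 when |Z| agrees with S up to a
   factor 2.\<close>
 define B where "B = min ((1/2) powr (2 * \<alpha> - 2)) (2 powr (2 * \<alpha> - 2))"
 have B: "B > 0" by (simp add: B_def)
 have pw: "B * S powr (2 * \<alpha> - 2) \<le> x powr (2 * \<alpha> - 2)" if "S > 0" "S / 2 \<le> x" "x \<le> 2 * S" for S x
 proof (cases "\<alpha> \<ge> 1")
  case True
  have "B * S powr (2 * \<alpha> - 2) \<le> (1/2) powr (2 * \<alpha> - 2) * S powr (2 * \<alpha> - 2)" by (intro mult_right_mono) (auto simp: B_def)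
  also have "\<dots> = (S / 2) powr (2 * \<alpha> - 2)" using powr_mult[of "1/2" S "2 * \<alpha> - 2"] by simp
  also have "\<dots> \<le> x powr (2 * \<alpha> - 2)" using True that by (intro powr_mono2) auto
  finally show ?thesis .
 next
  case False
  have "B * S powr (2 * \<alpha> - 2) \<le> 2 powr (2 * \<alpha> - 2) * S powr (2 * \<alpha> - 2)" by (intro mult_right_mono) (auto simp: B_def)
  also have "\<dots> = (2 * S) powr (2 * \<alpha> - 2)" using powr_mult[of 2 S "2 * \<alpha> - 2"] by simp
  also have "\<dots> \<le> x powr (2 * \<alpha> - 2)" using False that by (intro powr_mono2') auto
  finally show ?thesis .
 qed
 have Zn: "1 / 2 \<le> cmod (Z w)" "cmod (Z w) \<le> 2 * 1" if "w \<ge> - setback \<alpha>" "w \<le> 1" for w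
  using line_forward(4,6)[of w] line_backward(4,5)[of "- w"] that by (cases "w \<ge> 0"; force simp: Z_def)+
 have f2a: "f2 w \<le> - (A * B)" if "w \<ge> - setback \<alpha>" "w \<le> 1" for w
 proof -
  have "A * B \<le> A * cmod (Z w) powr (2 * \<alpha> - 2)" using pw[of 1 "cmod (Z w)"] Zn[OF that] A by (intro mult_left_mono) auto
  thus ?thesis using f2[OF that(1)] by (simp add: A_def)
 qed
 have f00: "line_exp 0 = 0" "f1 0 = 0" by (auto simp: line_exp_def phase_def f1_def Z_def)
 have near: "line_exp w \<le> - (A * B / 2) * w\<^sup>2" if w: "- setback \<alpha> \<le> w" "w \<le> 1" for w
 proof (cases "w \<ge> 0")
  case True
  have "line_exp w \<le> line_exp 0 + f1 0 * (w - 0) - (A * B) * (w - 0)\<^sup>2 / 2"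
   by (rule taylor2_upper[OF True, of _ _ f2]) (use setback w in \<open>auto intro!: d1 d2 f2a\<close>)
  thus ?thesis by (simp add: f00)
 next
  case False
  have "(\<lambda>s. line_exp (- s)) (- w) \<le> (\<lambda>s. line_exp (- s)) 0 + (\<lambda>s. - f1 (- s)) 0 * (- w - 0) - (A * B) * (- w - 0)\<^sup>2 / 2"
  proof (rule taylor2_upper(1)[where f''="\<lambda>s. f2 (- s)"])
   fix t assume t: "0 \<le> t" "t \<le> - w"
   have t': "- t \<ge> - setback \<alpha>" "- t \<le> 1" using t w by auto
   have "((\<lambda>s. line_exp (- s)) has_real_derivative f1 (- t) * (- 1)) (at t)"
    by (rule DERIV_chain2[where f=line_exp and g=uminus, OF d1[OF t'(1)]]) (auto intro!: derivative_eq_intros)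
   thus "((\<lambda>s. line_exp (- s)) has_real_derivative - f1 (- t)) (at t)" by simp
   have "((\<lambda>s. f1 (- s)) has_real_derivative f2 (- t) * (- 1)) (at t)"
    by (rule DERIV_chain2[where f=f1 and g=uminus, OF d2[OF t'(1)]]) (auto intro!: derivative_eq_intros)
   thus "((\<lambda>s. - f1 (- s)) has_real_derivative f2 (- t)) (at t)" using DERIV_minus by fastforce
   show "f2 (- t) \<le> - (A * B)" by (rule f2a[OF t'])
  qed (use False in auto)
  thus ?thesis by (simp add: f00)
 qed
 have far: "line_exp w \<le> - (A * B / 8) * w powr (2 * \<alpha>)" if w: "w \<ge> 1" for w
 proof -
  have neg: "f2 t \<le> - 0" if "t \<ge> 0" for t
  proof -
   have "A * cmod (Z t) powr (2 * \<alpha> - 2) \<ge> 0" using A by simp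
   thus ?thesis using f2[of t, folded A_def] that setback by simp
  qed
  have "line_exp (w / 2) \<le> line_exp 0 + f1 0 * (w / 2 - 0) - 0 * (w / 2 - 0)\<^sup>2 / 2" "f1 (w / 2) \<le> f1 0 - 0 * (w / 2 - 0)"
   by (rule taylor2_upper[of 0 "w / 2" line_exp f1 f2 0]; use setback w in \<open>auto intro!: d1 d2 neg[simplified]\<close>)+
  hence 1: "line_exp (w / 2) \<le> 0" "f1 (w / 2) \<le> 0" by (simp_all add: f00)
  define K where "K = A * (B * w powr (2 * \<alpha> - 2))"
  \<comment> \<open>Expanding at w / 2 keeps |Z| comparable to w on the whole interval, so the
    second derivative is at most a negative multiple of w^(2\<alpha> - 2) there; value and slope at
    w / 2 are already nonpositive.\<close>
  have "line_exp w \<le> line_exp (w / 2) + f1 (w / 2) * (w - w / 2) - K * (w - w / 2)\<^sup>2 / 2"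
  proof (rule taylor2_upper(1)[where f''=f2])
   fix t assume t: "w / 2 \<le> t" "t \<le> w"
   have t': "t \<ge> - setback \<alpha>" using t w setback by auto
   show "(line_exp has_real_derivative f1 t) (at t)" "(f1 has_real_derivative f2 t) (at t)" by (intro d1 d2 t')+
   have "K \<le> A * cmod (Z t) powr (2 * \<alpha> - 2)"
    unfolding K_def using A w t line_forward(5,6)[of t] by (intro mult_left_mono pw) (auto simp: Z_def)
   thus "f2 t \<le> - K" using f2[OF t'] by (simp add: A_def)
  qed (use w in auto)
  also have "\<dots> \<le> - K * (w / 2)\<^sup>2 / 2"
  proof -
   have "f1 (w / 2) * (w - w / 2) \<le> 0" using 1 w by (intro mult_nonpos_nonneg) auto
   thus ?thesis using 1 by simp
  qed
  also have "\<dots> = - (A * B / 8) * (w powr (2 * \<alpha> - 2) * w\<^sup>2)" by (simp add: K_def power2_eq_square)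
  also have "w powr (2 * \<alpha> - 2) * w\<^sup>2 = w powr (2 * \<alpha>)"
   using w by (simp add: powr_numeral[symmetric] powr_add[symmetric] del: powr_numeral)
  finally show ?thesis .
 qed
 show thesis
 proof (rule that[of "A * B / 8"])
  show "A * B / 8 > 0" using A B by simp
  show "line_exp w \<le> - (A * B / 8) * w\<^sup>2" if "- setback \<alpha> \<le> w" "w \<le> 1" for w
  proof -
   have "0 \<le> (A * B / 2 - A * B / 8) * w\<^sup>2" using A B by simp
   thus ?thesis using near[OF that] by (simp add: algebra_simps)
  qed
 qed (use far in auto)
qed

lemma Re_phase: "Re (phase \<alpha> z) = - (2 * \<alpha> * Im z) + Im (z powr of_real (2 * \<alpha>))"
 by (simp add: phase_def)

text \<open>The linear part of the phase scales with t, the other part with t^(2\<alpha>) \<le> t.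
  The latter contributes the imaginary part of the 2\<alpha>-th power of
  \<open>turn \<alpha>\<close>, which is nonnegative because its argument lies in [0, pi].\<close>

lemma turn_segment:
 assumes "0 < t" "t \<le> 1"
 shows "Re (phase \<alpha> (of_real t * turn \<alpha>)) \<le> t * Re (phase \<alpha> (turn \<alpha>))"
proof -
 have b: "0 \<le> setback \<alpha>" "setback \<alpha> \<le> setback \<alpha>" using setback by auto
 note T = line_backward[OF b, folded turn_def]
 have z0: "turn \<alpha> \<noteq> 0" using sector_nonzero(1)[OF T(1)] .
 have "0 \<le> 2 * \<alpha> * Im (Ln (turn \<alpha>))" using T(2) \<alpha> by simp
 moreover have "2 * \<alpha> * Im (Ln (turn \<alpha>)) \<le> pi"
 proof -
  have "2 * \<alpha> * Im (Ln (turn \<alpha>)) \<le> 2 * \<alpha> * (aperture \<alpha> / (4 * \<alpha>))" using T(3) \<alpha> by (intro mult_left_mono) auto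
  also have "\<dots> = aperture \<alpha> / 2" using \<alpha> by simp
  finally show ?thesis using aperture pi_gt_zero by linarith
 qed
 ultimately have s: "sin (2 * \<alpha> * Im (Ln (turn \<alpha>))) \<ge> 0" by (rule sin_ge_zero)
 have im: "Im (turn \<alpha> powr of_real (2 * \<alpha>)) \<ge> 0"
  unfolding powr_polar[OF z0] using s by simp
 have p: "(of_real t * turn \<alpha>) powr of_real (2 * \<alpha>) = of_real (t powr (2 * \<alpha>)) * turn \<alpha> powr of_real (2 * \<alpha>)"
 proof -
  have nz: "of_real t * turn \<alpha> \<noteq> 0" using assms z0 by simp
  show ?thesis unfolding powr_polar[OF nz] powr_polar[OF z0] Ln_scale[OF assms(1) z0]
   using assms by (simp add: norm_mult powr_mult)
 qed
 have "t powr (2 * \<alpha>) \<le> t powr 1" using assms \<alpha> by (intro powr_mono') auto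
 hence "t powr (2 * \<alpha>) * Im (turn \<alpha> powr of_real (2 * \<alpha>)) \<le> t * Im (turn \<alpha> powr of_real (2 * \<alpha>))"
  using im assms by (intro mult_right_mono) auto
 moreover have "Re (phase \<alpha> (of_real t * turn \<alpha>)) = - (t * (2 * \<alpha> * Im (turn \<alpha>))) + t powr (2 * \<alpha>) * Im (turn \<alpha> powr of_real (2 * \<alpha>))"
  unfolding Re_phase p by simp
 ultimately show ?thesis unfolding Re_phase by (simp only: distrib_left mult_minus_right add_left_mono)
qed

end

section \<open>Powers against exponentials of powers\<close>

lemma poly_le_exp_powr:
 fixes M b q :: real
 assumes "M \<ge> 0" "b > 0" "q \<ge> 1"
 obtains K where "K > 0" "\<And>t. t \<ge> 0 \<Longrightarrow> (1 + 2 * t) powr M \<le> K * exp (b * t powr q)"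
proof -
 obtain K where K: "K > 0" "\<And>u. u \<ge> 0 \<Longrightarrow> u powr M \<le> K * exp (b / 2 * u)"
  using powr_le_exp[of M "b / 2"] assms by auto
 show thesis
 proof (rule that[of "K * exp (2 * b)"])
  show "(1 + 2 * t) powr M \<le> K * exp (2 * b) * exp (b * t powr q)" if t: "t \<ge> 0" for t
  proof -
   have "t \<le> 1 + t powr q"
   proof (cases "t \<ge> 1")
    case True
    have "t powr 1 \<le> t powr q" using True assms by (intro powr_mono) auto
    thus ?thesis using True by simp
   next
    case False
    have "t powr q \<ge> 0" by simp
    thus ?thesis using False by linarith
   qed
   hence "b * t \<le> b * (1 + t powr q)" using assms by (intro mult_left_mono) auto
   hence "b / 2 * (1 + 2 * t) \<le> 2 * b + b * t powr q" using assms by (simp add: algebra_simps)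
   hence "K * exp (b / 2 * (1 + 2 * t)) \<le> K * exp (2 * b + b * t powr q)" using K by simp
   thus ?thesis using K(2)[of "1 + 2 * t"] t by (simp add: exp_add mult.assoc)
  qed
 qed (use K in auto)
qed

lemma linear_le_powr:
 fixes a b q :: real
 assumes "a \<ge> 0" "b > 0" "q > 1"
 obtains K where "\<And>t. t > 0 \<Longrightarrow> a * t \<le> b * t powr q + K"
proof -
 \<comment> \<open>Beyond this point b t^q exceeds a t; before it a t is at most a s.\<close>
 define s where "s = (a / b) powr (1 / (q - 1))"
 show thesis
 proof (rule that[of "a * s"])
  fix t :: real assume t: "t > 0"
  show "a * t \<le> b * t powr q + a * s"
  proof (cases "t \<le> s")
   case True
   thus ?thesis using assms by (simp add: add_increasing mult_left_mono)
  next
   case False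
   have "a / b \<le> t powr (q - 1)"
   proof -
    have "s powr (q - 1) \<le> t powr (q - 1)" using False assms by (intro powr_mono2) (auto simp: s_def)
    thus ?thesis using assms by (simp add: s_def powr_powr)
   qed
   hence "a \<le> b * t powr (q - 1)" using assms by (simp add: field_simps)
   hence "a * t \<le> b * t powr (q - 1) * t" using t by simp
   also have "\<dots> = b * t powr q" using t by (simp add: powr_diff)
   finally show ?thesis using assms by (simp add: s_def add_increasing2)
  qed
 qed
qed

lemma integrable_poly_exp_powr:
 fixes M b q :: real
 assumes "M \<ge> 0" "b > 0" "q \<ge> 1"
 shows "integrable lborel (\<lambda>t::real. indicator {0..} t * ((1 + 2 * t) powr M * exp (- (b * t powr q))))"
proof -
 obtain K where K: "K > 0" "\<And>t. t \<ge> 0 \<Longrightarrow> (1 + 2 * t) powr M \<le> K * exp (b / 2 * t powr q)"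
  using poly_le_exp_powr[of M "b / 2" q] assms by auto
 show ?thesis
 proof (rule Bochner_Integration.integrable_bound)
  show "integrable lborel (\<lambda>t::real. K * exp (- (b / 2 * norm t powr q)))"
   using assms by (intro integrable_mult_right integrable_exp_powr) auto
  show "AE t in lborel. norm (indicator {0..} t * ((1 + 2 * t) powr M * exp (- (b * t powr q)))) \<le> norm (K * exp (- (b / 2 * norm t powr q)))"
  proof (intro AE_I2)
   fix t :: real
   show "norm (indicator {0..} t * ((1 + 2 * t) powr M * exp (- (b * t powr q)))) \<le> norm (K * exp (- (b / 2 * norm t powr q)))"
   proof (cases "t \<ge> 0")
    case True
    have "(1 + 2 * t) powr M * exp (- (b * t powr q)) \<le> K * exp (b / 2 * t powr q) * exp (- (b * t powr q))"
     using K(2)[OF True] by (intro mult_right_mono) auto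
    also have "\<dots> = K * exp (- (b / 2 * t powr q))" by (simp add: mult.assoc exp_add[symmetric])
    finally show ?thesis using True K by (simp add: abs_mult)
   qed auto
  qed
 qed measurable
qed

lemma cosine_comparison:
 assumes "0 \<le> x" "x \<le> y" "y \<le> pi"
 shows "cos y \<le> cos x"
 using assms by (intro cos_monotone_0_pi_le) auto

text \<open>The constant c stands for \<epsilon> + iT with 0 < \<epsilon> \<le> T. The second
  inequality keeps its argument above pi/4; as the argument may approach pi/2, bounds that are to
  survive the limit must not depend on \<open>Re c\<close>.\<close>

locale oscillatory =
 fixes \<alpha> :: real and c :: complex
 assumes \<alpha>: "\<alpha> > 1 / 2" and c: "Re c > 0" "Re c \<le> Im c"
begin

lemma c_arg: "pi / 4 \<le> Im (Ln c)" "Im (Ln c) < pi / 2" "c \<noteq> 0"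
proof -
 show c0: "c \<noteq> 0" using c by auto
 show 1: "Im (Ln c) < pi / 2" using Re_Ln_pos_lt[OF c0] c by auto
 have "cmod c * (sin (Im (Ln c)) - cos (Im (Ln c))) \<ge> 0" using Re_Im_polar[OF c0] c by (simp add: algebra_simps)
 hence "sin (Im (Ln c)) - cos (Im (Ln c)) \<ge> 0" using c0 by (simp add: zero_le_mult_iff)
 hence "sin (Im (Ln c) - pi / 4) \<ge> 0" by (simp add: sin_diff sin_45 cos_45 algebra_simps)
 moreover have "- (pi / 2) < Im (Ln c)" using Re_Ln_pos_lt[OF c0] c by auto
 ultimately show "pi / 4 \<le> Im (Ln c)"
  using sin_gt_zero[of "- (Im (Ln c) - pi / 4)"] sin_minus[of "Im (Ln c) - pi / 4"] Re_Ln_pos_lt[OF c0] c pi_gt_zero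
  by (cases "Im (Ln c) < pi / 4") auto
qed

lemma c_powr:
 assumes z: "z \<in> sector \<alpha>"
 defines "y \<equiv> Im (Ln c) + 2 * \<alpha> * Im (Ln z)"
 shows "c * z powr of_real (2 * \<alpha>) = of_real (cmod c * cmod z powr (2 * \<alpha>)) * cis y"
  "pi / 8 \<le> y" "y \<le> 5 * pi / 8" "\<bar>2 * \<alpha> * Im (Ln z)\<bar> \<le> pi / 8"
proof -
 note ap = aperture[OF \<alpha>]
 have z0: "z \<noteq> 0" using sector_nonzero(1)[OF \<alpha> z] .
 have "c = of_real (cmod c) * cis (Im (Ln c))" by (rule complex_eqI) (use Re_Im_polar[OF c_arg(3)] in auto)
 hence "c * z powr of_real (2 * \<alpha>) = of_real (cmod c) * cis (Im (Ln c)) * (of_real (cmod z powr (2 * \<alpha>)) * cis (2 * \<alpha> * Im (Ln z)))"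
  using powr_polar[OF z0, of "2 * \<alpha>"] by simp
 thus "c * z powr of_real (2 * \<alpha>) = of_real (cmod c * cmod z powr (2 * \<alpha>)) * cis y"
  by (simp add: y_def cis_mult[symmetric] mult_ac)
 have "\<bar>2 * \<alpha> * Im (Ln z)\<bar> = 2 * \<alpha> * \<bar>Im (Ln z)\<bar>" using \<alpha> by (simp add: abs_mult)
 also have "\<dots> \<le> 2 * \<alpha> * aperture \<alpha>" using z \<alpha> by (intro mult_left_mono) (auto simp: sector_iff[OF \<alpha>])
 finally show 1: "\<bar>2 * \<alpha> * Im (Ln z)\<bar> \<le> pi / 8" using ap(3) by simp
 show "pi / 8 \<le> y" "y \<le> 5 * pi / 8" using 1 c_arg by (auto simp: y_def abs_le_iff)
qed

text \<open>The argument of c z^(2\<alpha>) is within 3 pi/8 of pi/4, the angle that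
  \<open>ray_dir\<close> undoes; this is the condition of \<open>ray_amp_bound\<close> with \<eta> =
  cos (3 pi/8).\<close>

lemma c_powr_ray:
 assumes z: "z \<in> sector \<alpha>"
 shows "Re (c * z powr of_real (2 * \<alpha>) * ray_dir) \<ge> cos (3 * pi / 8) * cmod (c * z powr of_real (2 * \<alpha>))"
proof -
 define y where "y = Im (Ln c) + 2 * \<alpha> * Im (Ln z)"
 note Y = c_powr[OF z, folded y_def]
 have "c * z powr of_real (2 * \<alpha>) * ray_dir = of_real (cmod c * cmod z powr (2 * \<alpha>)) * cis (y - pi / 4)"
  unfolding Y(1) ray_dir_def by (simp add: cis_mult mult.assoc)
 hence 1: "Re (c * z powr of_real (2 * \<alpha>) * ray_dir) = (cmod c * cmod z powr (2 * \<alpha>)) * cos (y - pi / 4)" by simp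
 have 2: "cmod (c * z powr of_real (2 * \<alpha>)) = cmod c * cmod z powr (2 * \<alpha>)" unfolding Y(1) by (simp add: norm_mult)
 have "\<bar>y - pi / 4\<bar> \<le> 3 * pi / 8" unfolding abs_le_iff using Y(2,3) pi_gt_zero by linarith
 hence "cos (3 * pi / 8) \<le> cos \<bar>y - pi / 4\<bar>" by (intro cosine_comparison) auto
 hence "cos (3 * pi / 8) \<le> cos (y - pi / 4)" by simp
 hence "(cmod c * cmod z powr (2 * \<alpha>)) * cos (3 * pi / 8) \<le> (cmod c * cmod z powr (2 * \<alpha>)) * cos (y - pi / 4)"
  by (intro mult_left_mono) auto
 thus ?thesis unfolding 1 2 by (simp add: mult.commute)
qed

text \<open>The first bound compares c with i |c|, the worst case as its argument tends to pi/2; it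
  is free of \<open>Re c\<close> and matches the real part of \<open>phase\<close>. The second one,
  for the lower half of the sector, serves to close contours at infinity.\<close>

lemma c_powr_lower:
 assumes z: "z \<in> sector \<alpha>"
 shows "Re (c * z powr of_real (2 * \<alpha>)) \<ge> - (cmod c * Im (z powr of_real (2 * \<alpha>)))"
  and "Im z \<le> 0 \<Longrightarrow> Re (c * z powr of_real (2 * \<alpha>)) \<ge> Re c * cmod z powr (2 * \<alpha>)"
proof -
 have z0: "z \<noteq> 0" using sector_nonzero(1)[OF \<alpha> z] .
 define x where "x = 2 * \<alpha> * Im (Ln z)"
 define y where "y = Im (Ln c) + 2 * \<alpha> * Im (Ln z)"
 note Y = c_powr[OF z, folded y_def x_def]
 have R: "Re (c * z powr of_real (2 * \<alpha>)) = (cmod c * cmod z powr (2 * \<alpha>)) * cos y" unfolding Y(1) by simp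
 have I: "Im (z powr of_real (2 * \<alpha>)) = cmod z powr (2 * \<alpha>) * sin x" unfolding powr_polar[OF z0] x_def by simp
 have "cos (pi / 2 + x) \<le> cos y"
  using Y c_arg pi_gt_zero by (intro cosine_comparison) (auto simp: y_def x_def abs_le_iff)
 hence "- sin x \<le> cos y" by (simp add: cos_add)
 hence "(cmod c * cmod z powr (2 * \<alpha>)) * (- sin x) \<le> (cmod c * cmod z powr (2 * \<alpha>)) * cos y" by (intro mult_left_mono) auto
 thus "Re (c * z powr of_real (2 * \<alpha>)) \<ge> - (cmod c * Im (z powr of_real (2 * \<alpha>)))" unfolding R I by simp
 assume im: "Im z \<le> 0"
 have "cmod z * sin (Im (Ln z)) \<le> 0" using Re_Im_polar(2)[OF z0] im by simp
 hence "sin (Im (Ln z)) \<le> 0" using z0 by (simp add: mult_le_0_iff)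
 hence "Im (Ln z) \<le> 0" using sin_gt_zero[of "Im (Ln z)"] Re_Ln_pos_lt[OF z0] z sector_iff[OF \<alpha>, of z] pi_gt_zero by (cases "Im (Ln z) > 0") auto
 hence "x \<le> 0" using \<alpha> by (simp add: x_def mult_nonneg_nonpos)
 hence "cos (Im (Ln c)) \<le> cos y" using Y c_arg pi_gt_zero by (intro cosine_comparison) (auto simp: y_def x_def)
 hence "(cmod c * cmod z powr (2 * \<alpha>)) * cos (Im (Ln c)) \<le> (cmod c * cmod z powr (2 * \<alpha>)) * cos y" by (intro mult_left_mono) auto
 thus "Re (c * z powr of_real (2 * \<alpha>)) \<ge> Re c * cmod z powr (2 * \<alpha>)" unfolding R Re_Im_polar(1)[OF c_arg(3)] by (simp add: mult_ac)
qed

text \<open>The lower half of the sector, where \<open>exp (- c z\<^bsup>2\<alpha>\<^esup>)\<close> beats every \<open>exp (i s z)\<close>.\<close>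

lemma lower_decay:
 fixes B :: "complex \<Rightarrow> complex"
 assumes B: "\<And>z. z \<in> sector \<alpha> \<Longrightarrow> cmod (B z) \<le> C * (1 + cmod z) powr M" and C: "C \<ge> 0" "M \<ge> 0"
 obtains D where
  "\<And>z. z \<in> sector \<alpha> \<Longrightarrow> cmod z \<le> 1 \<Longrightarrow> cmod (exp (\<i> * of_real s * z - c * z powr of_real (2 * \<alpha>)) * B z) \<le> D"
  "\<And>z t. z \<in> sector \<alpha> \<Longrightarrow> Im z \<le> 0 \<Longrightarrow> t \<ge> 1 \<Longrightarrow> t / 2 \<le> cmod z \<Longrightarrow> cmod z \<le> 2 * t \<Longrightarrow>
    cmod (exp (\<i> * of_real s * z - c * z powr of_real (2 * \<alpha>)) * B z) \<le> D / t\<^sup>2"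
proof -
 define b where "b = Re c * (1 / 2) powr (2 * \<alpha>)"
 have b: "b > 0" using c by (simp add: b_def)
 obtain K where K: "K > 0" "\<And>t. t \<ge> 0 \<Longrightarrow> (1 + 2 * t) powr (M + 2) \<le> K * exp (b / 2 * t powr (2 * \<alpha>))"
  using poly_le_exp_powr[of "M + 2" "b / 2" "2 * \<alpha>"] b \<alpha> C by auto
 obtain L where L: "\<And>t. t > 0 \<Longrightarrow> (2 * \<bar>s\<bar>) * t \<le> b / 2 * t powr (2 * \<alpha>) + L"
  using linear_le_powr[of "2 * \<bar>s\<bar>" "b / 2" "2 * \<alpha>"] b \<alpha> by auto
 \<comment> \<open>D depends on \<open>Re c\<close> and s and may blow up in the limit; it is meant
   only for segments that vanish when contours are closed.\<close>
 define D where "D = exp (\<bar>s\<bar> + cmod c) * (C * 2 powr M) + C * K * exp L"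
 have D1: "exp (\<bar>s\<bar> + cmod c) * (C * 2 powr M) \<le> D" "C * K * exp L \<le> D" using K C by (auto simp: D_def)
 have Ims: "- (s * Im z) \<le> \<bar>s\<bar> * cmod z" for z
 proof -
  have "- (s * Im z) \<le> \<bar>s * Im z\<bar>" by simp
  also have "\<dots> \<le> \<bar>s\<bar> * cmod z" by (simp add: abs_mult abs_Im_le_cmod mult_left_mono)
  finally show ?thesis .
 qed
 show thesis
 proof (rule that[of D])
  fix z assume z: "z \<in> sector \<alpha>" "cmod z \<le> 1"
  have "cmod (exp (\<i> * of_real s * z - c * z powr of_real (2 * \<alpha>))) = exp (- (s * Im z) - Re (c * z powr of_real (2 * \<alpha>)))" by simp
  also have "\<dots> \<le> exp (\<bar>s\<bar> + cmod c)"
  proof (subst exp_le_cancel_iff, rule diff_le_eq[THEN iffD2])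
   have z0: "z \<noteq> 0" using sector_nonzero(1)[OF \<alpha> z(1)] .
   have "- Re (c * z powr of_real (2 * \<alpha>)) \<le> cmod (c * z powr of_real (2 * \<alpha>))" by (metis abs_Re_le_cmod abs_le_D2)
   also have "\<dots> = cmod c * cmod z powr (2 * \<alpha>)" using cmod_powr_of_real[OF z0, of "2 * \<alpha>"] by (simp add: norm_mult)
   also have "\<dots> \<le> cmod c * 1" using z \<alpha> z0 powr_mono2[of "2 * \<alpha>" "cmod z" 1] by (intro mult_left_mono) auto
   finally have "- Re (c * z powr of_real (2 * \<alpha>)) \<le> cmod c" by simp
   moreover have "- (s * Im z) \<le> \<bar>s\<bar>" using Ims[of z] mult_left_mono[OF z(2), of "\<bar>s\<bar>"] by simp
   ultimately show "- (s * Im z) \<le> \<bar>s\<bar> + cmod c + Re (c * z powr of_real (2 * \<alpha>))" by linarith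
  qed
  finally have 1: "cmod (exp (\<i> * of_real s * z - c * z powr of_real (2 * \<alpha>))) \<le> exp (\<bar>s\<bar> + cmod c)" .
  have "cmod (B z) \<le> C * (1 + cmod z) powr M" by (rule B[OF z(1)])
  also have "\<dots> \<le> C * 2 powr M" using z C by (intro mult_left_mono powr_mono2) auto
  finally have "cmod (exp (\<i> * of_real s * z - c * z powr of_real (2 * \<alpha>)) * B z) \<le> exp (\<bar>s\<bar> + cmod c) * (C * 2 powr M)"
   unfolding norm_mult using 1 by (intro mult_mono) auto
  thus "cmod (exp (\<i> * of_real s * z - c * z powr of_real (2 * \<alpha>)) * B z) \<le> D" using D1(1) by linarith
 next
  fix z t assume z: "z \<in> sector \<alpha>" "Im z \<le> 0" and t: "t \<ge> 1" "t / 2 \<le> cmod z" "cmod z \<le> 2 * t"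
  have "Re (c * z powr of_real (2 * \<alpha>)) \<ge> Re c * cmod z powr (2 * \<alpha>)" by (rule c_powr_lower(2)[OF z])
  moreover have "Re c * cmod z powr (2 * \<alpha>) \<ge> b * t powr (2 * \<alpha>)"
  proof -
   have "(1 / 2 * t) powr (2 * \<alpha>) \<le> cmod z powr (2 * \<alpha>)" using t \<alpha> by (intro powr_mono2) auto
   thus ?thesis using c unfolding b_def mult.assoc powr_mult[symmetric] by (intro mult_left_mono) auto
  qed
  moreover have "- (s * Im z) \<le> (2 * \<bar>s\<bar>) * t" using Ims[of z] mult_left_mono[OF t(3), of "\<bar>s\<bar>"] by simp
  moreover have "(2 * \<bar>s\<bar>) * t \<le> b / 2 * t powr (2 * \<alpha>) + L" using L t by simp
  ultimately have "- (s * Im z) - Re (c * z powr of_real (2 * \<alpha>)) \<le> L - b / 2 * t powr (2 * \<alpha>)" by linarith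
  hence 1: "cmod (exp (\<i> * of_real s * z - c * z powr of_real (2 * \<alpha>))) \<le> exp L * exp (- (b / 2 * t powr (2 * \<alpha>)))"
   by (simp add: exp_add[symmetric])
  have "cmod (B z) * t\<^sup>2 \<le> C * (1 + 2 * t) powr M * (1 + 2 * t)\<^sup>2"
   using B[OF z(1)] mult_left_mono[OF powr_mono2[of M "1 + cmod z" "1 + 2 * t"], of C] t C
   by (intro mult_mono power_mono) auto
  also have "\<dots> = C * (1 + 2 * t) powr (M + 2)" using t by (simp add: powr_add powr_numeral)
  also have "\<dots> \<le> C * (K * exp (b / 2 * t powr (2 * \<alpha>)))" using K t C by (intro mult_left_mono) auto
  finally have 2: "cmod (B z) * t\<^sup>2 \<le> C * (K * exp (b / 2 * t powr (2 * \<alpha>)))" .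
  have "cmod (exp (\<i> * of_real s * z - c * z powr of_real (2 * \<alpha>)) * B z) * t\<^sup>2 \<le>
    (exp L * exp (- (b / 2 * t powr (2 * \<alpha>)))) * (C * (K * exp (b / 2 * t powr (2 * \<alpha>))))"
   unfolding norm_mult mult.assoc[of _ _ "t\<^sup>2"] by (rule mult_mono[OF 1 2]) auto
  also have "\<dots> = C * K * exp L * (exp (- (b / 2 * t powr (2 * \<alpha>))) * exp (b / 2 * t powr (2 * \<alpha>)))" by (simp only: mult_ac)
  also have "\<dots> = C * K * exp L" by (simp add: exp_add[symmetric])
  finally show "cmod (exp (\<i> * of_real s * z - c * z powr of_real (2 * \<alpha>)) * B z) \<le> D / t\<^sup>2"
   using D1(2) t by (simp add: field_simps)
 qed
qed

text \<open>The condition on \<open>Im v\<close> keeps exp(i s z) bounded along the ray, and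
  homogeneity turns the decay rate b at v into b t^(2\<alpha>) at t v. The bound depends on c only
  through b.\<close>

lemma ray_integrable_sector:
 fixes B :: "complex \<Rightarrow> complex"
 assumes B: "\<And>z. z \<in> sector \<alpha> \<Longrightarrow> cmod (B z) \<le> C * (1 + cmod z) powr M" and C: "C \<ge> 0" "M \<ge> 0"
  and h: "B holomorphic_on sector \<alpha>"
  and v: "v \<in> sector \<alpha>" "cmod v = 1" "- (s * Im v) \<le> 0" "Re (c * v powr of_real (2 * \<alpha>)) \<ge> b" "b > 0"
 defines "f \<equiv> \<lambda>t. indicator {0<..} t *\<^sub>R (exp (\<i> * of_real s * (of_real t * v) - c * (of_real t * v) powr of_real (2 * \<alpha>)) * B (of_real t * v) * v)"
 shows "integrable lborel f"
  and "cmod (LINT t|lborel. f t) \<le> C * (LINT t|lborel. indicator {0..} t * ((1 + 2 * t) powr M * exp (- (b * t powr (2 * \<alpha>)))))"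
proof -
 define g where "g t = C * (indicator {0..} t * ((1 + 2 * t) powr M * exp (- (b * t powr (2 * \<alpha>)))))" for t
 have gint: "integrable lborel g" unfolding g_def using v C \<alpha> by (intro integrable_mult_right integrable_poly_exp_powr) auto
 have bd: "norm (f t) \<le> g t" for t
 proof (cases "t > 0")
  case True
  have tv: "of_real t * v \<in> sector \<alpha>" by (rule sector_scale[OF \<alpha> True v(1)])
  have v0: "v \<noteq> 0" using v(2) by auto
  have "(of_real t * v) powr of_real (2 * \<alpha>) = of_real (t powr (2 * \<alpha>)) * v powr of_real (2 * \<alpha>)"
  proof -
   have nz: "of_real t * v \<noteq> 0" using True v0 by simp
   show ?thesis unfolding powr_polar[OF nz] powr_polar[OF v0] Ln_scale[OF \<alpha> True v0]
    using True by (simp add: norm_mult powr_mult)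
  qed
  hence "Re (c * (of_real t * v) powr of_real (2 * \<alpha>)) = t powr (2 * \<alpha>) * Re (c * v powr of_real (2 * \<alpha>))"
   by (simp add: algebra_simps)
  also have "\<dots> \<ge> t powr (2 * \<alpha>) * b" using v(4) by (intro mult_left_mono) auto
  finally have 1: "b * t powr (2 * \<alpha>) \<le> Re (c * (of_real t * v) powr of_real (2 * \<alpha>))" by (simp add: mult.commute)
  have 2: "- (s * Im (of_real t * v)) \<le> 0" using v(3) mult_left_mono[of "- (s * Im v)" 0 t] True by (simp add: mult_ac)
  have "cmod (exp (\<i> * of_real s * (of_real t * v) - c * (of_real t * v) powr of_real (2 * \<alpha>))) = exp (- (s * Im (of_real t * v)) - Re (c * (of_real t * v) powr of_real (2 * \<alpha>)))" by simp
  also have "\<dots> \<le> exp (- (b * t powr (2 * \<alpha>)))" using 1 2 by simp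
  finally have 3: "cmod (exp (\<i> * of_real s * (of_real t * v) - c * (of_real t * v) powr of_real (2 * \<alpha>))) \<le> exp (- (b * t powr (2 * \<alpha>)))" .
  have "cmod (B (of_real t * v)) \<le> C * (1 + t) powr M" using B[OF tv] v(2) True by (simp add: norm_mult)
  also have "\<dots> \<le> C * (1 + 2 * t) powr M" using C True by (intro mult_left_mono powr_mono2) auto
  finally have "cmod (exp (\<i> * of_real s * (of_real t * v) - c * (of_real t * v) powr of_real (2 * \<alpha>)) * B (of_real t * v) * v) \<le> exp (- (b * t powr (2 * \<alpha>))) * (C * (1 + 2 * t) powr M)"
   unfolding norm_mult[of _ v] norm_mult[of "exp _"] v(2) using 3 by (simp only: mult_1_right) (intro mult_mono, auto)
  thus ?thesis using True by (simp add: f_def g_def mult_ac)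
 qed (auto simp: f_def g_def C)
 have cont: "continuous_on {0<..} (\<lambda>t. exp (\<i> * of_real s * (of_real t * v) - c * (of_real t * v) powr of_real (2 * \<alpha>)) * B (of_real t * v) * v)"
 proof -
  have "continuous_on {0<..} (\<lambda>t. B (of_real t * v))"
   by (rule continuous_on_compose2[OF holomorphic_on_imp_continuous_on[OF h]])
     (use sector_scale[OF \<alpha> _ v(1)] in \<open>auto intro!: continuous_intros\<close>)
  moreover have "continuous_on {0<..} (\<lambda>t. (of_real t * v) powr of_real (2 * \<alpha>))"
   by (intro continuous_on_powr_complex continuous_intros)
     (use sector_nonzero(2)[OF \<alpha> sector_scale[OF \<alpha> _ v(1)]] sector_nonzero(1)[OF \<alpha> sector_scale[OF \<alpha> _ v(1)]] in \<open>force simp: complex_nonpos_Reals_iff\<close>)+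
  ultimately show ?thesis
   by (intro continuous_on_mult continuous_on_exp continuous_on_diff continuous_on_const continuous_on_of_real continuous_on_id)
 qed
 show "integrable lborel f"
 proof (rule Bochner_Integration.integrable_bound[OF gint])
  have "f \<in> borel_measurable borel" unfolding f_def by (rule borel_measurable_continuous_on_indicator[OF _ cont]) simp
  thus "f \<in> borel_measurable lborel" by simp
  have "norm (f t) \<le> norm (g t)" for t using bd[of t] unfolding real_norm_def by linarith
  thus "AE t in lborel. norm (f t) \<le> norm (g t)" by simp
 qed
 hence "cmod (LINT t|lborel. f t) \<le> (LINT t|lborel. g t)"
  by (rule Bochner_Integration.integral_norm_bound_integral[OF _ gint]) (rule bd)
 thus "cmod (LINT t|lborel. f t) \<le> C * (LINT t|lborel. indicator {0..} t * ((1 + 2 * t) powr M * exp (- (b * t powr (2 * \<alpha>)))))"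
  unfolding g_def by simp
qed

end

section \<open>Bounds for the kernel of the propagator\<close>

text \<open>Both upper bounds are needed: 1 when the saddle frequency is small, sqrt (pi / a) when
  it is large.\<close>

lemma gaussian_unit_interval:
 fixes a :: real
 assumes "a > 0"
 shows "(\<lambda>t::real. exp (- (a * t\<^sup>2))) integrable_on {0..1}"
  "integral {0..1} (\<lambda>t::real. exp (- (a * t\<^sup>2))) \<le> 1" "integral {0..1} (\<lambda>t::real. exp (- (a * t\<^sup>2))) \<le> sqrt (pi / a)"
  "integral {0..1} (\<lambda>t::real. exp (- (a * t\<^sup>2))) \<ge> 0"
proof -
 show 1: "(\<lambda>t::real. exp (- (a * t\<^sup>2))) integrable_on {0..1}"
  by (intro integrable_continuous_real continuous_intros)
 show "integral {0..1} (\<lambda>t::real. exp (- (a * t\<^sup>2))) \<ge> 0" by (rule integral_nonneg[OF 1]) auto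
 have "integral {0..1} (\<lambda>t::real. exp (- (a * t\<^sup>2))) \<le> integral {0..1::real} (\<lambda>_. 1)"
  by (rule integral_le[OF 1]) (use assms in auto)
 thus "integral {0..1} (\<lambda>t::real. exp (- (a * t\<^sup>2))) \<le> 1" by simp
 have g: "integrable lborel (\<lambda>t::real. exp (- (a * t\<^sup>2)))" using integrable_gaussian[OF assms, where 'a=real] by simp
 have "set_integrable lborel {0..1} (\<lambda>t::real. exp (- (a * t\<^sup>2)))"
  unfolding set_integrable_def by (intro integrable_mult_indicator g) auto
 from set_borel_integral_eq_integral(2)[OF this]
 have "integral {0..1} (\<lambda>t::real. exp (- (a * t\<^sup>2))) = (LINT t|lborel. indicator {0..1} t * exp (- (a * t\<^sup>2)))"
  by (simp add: set_lebesgue_integral_def)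
 also have "\<dots> \<le> (LINT t|lborel. exp (- (a * t\<^sup>2)))"
  by (rule integral_mono) (use g integrable_mult_indicator[OF _ g, of "{0..1}"] in \<open>auto simp: indicator_def\<close>)
 also have "complex_of_real (LINT t|lborel. exp (- (a * t\<^sup>2))) = complex_of_real (sqrt (pi / a))"
  using gaussian_fourier_real(2)[OF assms, of 0] by (simp add: integral_complex_of_real)
 hence "(LINT t|lborel. exp (- (a * t\<^sup>2))) = sqrt (pi / a)" by (simp only: of_real_eq_iff)
 finally show "integral {0..1} (\<lambda>t::real. exp (- (a * t\<^sup>2))) \<le> sqrt (pi / a)" .
qed

text \<open>What remains of \<open>radial_amp\<close> after splitting off exp(- c k^(2\<alpha>)),
  continued from k > 0 to complex frequencies.\<close>

definition amplitude :: "real \<Rightarrow> real \<Rightarrow> complex \<Rightarrow> complex \<Rightarrow> complex" where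
 "amplitude \<alpha> m c z = z powr of_real m * ray_amp (1 / \<alpha>) m (c * z powr of_real (2 * \<alpha>))"

lemma (in oscillatory) amplitude_holomorphic:
 assumes m: "m \<ge> 0"
 shows "amplitude \<alpha> m c holomorphic_on sector \<alpha>"
proof -
 have \<beta>: "0 < 1 / \<alpha>" "1 / \<alpha> < 2" using \<alpha> by (auto simp: field_simps)
 have 1: "(\<lambda>z. c * z powr of_real (2 * \<alpha>)) holomorphic_on sector \<alpha>"
  using sector_nonzero(2)[OF \<alpha>] by (intro holomorphic_intros) auto
 have 2: "(\<lambda>z. c * z powr of_real (2 * \<alpha>)) ` sector \<alpha> \<subseteq> {\<zeta>. Re (\<zeta> * ray_dir) > 0}"
 proof clarify
  fix z assume z: "z \<in> sector \<alpha>"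
  have "cos (3 * pi / 8) > 0" using pi_gt_zero by (intro cos_gt_zero_pi) linarith+
  moreover have "c * z powr of_real (2 * \<alpha>) \<noteq> 0" using c_arg(3) sector_nonzero(1)[OF \<alpha> z] by simp
  ultimately have "cos (3 * pi / 8) * cmod (c * z powr of_real (2 * \<alpha>)) > 0" by (intro mult_pos_pos zero_less_norm_iff[THEN iffD2])
  thus "0 < Re (c * z powr of_real (2 * \<alpha>) * ray_dir)" using c_powr_ray[OF z] by linarith
 qed
 have "(ray_amp (1 / \<alpha>) m \<circ> (\<lambda>z. c * z powr of_real (2 * \<alpha>))) holomorphic_on sector \<alpha>"
  by (rule holomorphic_on_compose_gen[OF 1 ray_amp_holomorphic[OF \<beta> m] 2])
 moreover have "(\<lambda>z. z powr of_real m) holomorphic_on sector \<alpha>"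
  using sector_nonzero(2)[OF \<alpha>] by (intro holomorphic_intros) auto
 ultimately show ?thesis unfolding amplitude_def[abs_def] by (auto intro: holomorphic_on_mult simp: o_def)
qed

text \<open>The exponent \<open>max 0 (1 - \<alpha>)\<close>: for \<open>\<alpha> < 1\<close> the amplitude grows with the frequency.\<close>

lemma amplitude_bound:
 assumes \<alpha>: "\<alpha> > 1 / 2" and m: "m \<ge> 0" and c1: "c1 > 0"
 obtains C where "C \<ge> 0" "\<And>c z. oscillatory \<alpha> c \<Longrightarrow> c1 \<le> cmod c \<Longrightarrow> z \<in> sector \<alpha> \<Longrightarrow>
  cmod (amplitude \<alpha> m c z) \<le> C * (1 + cmod z) powr (m * max 0 (1 - \<alpha>))"
proof -
 have \<beta>: "0 < 1 / \<alpha>" "1 / \<alpha> < 2" using \<alpha> by (auto simp: field_simps)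
 have \<eta>: "cos (3 * pi / 8) > 0" using pi_gt_zero by (intro cos_gt_zero_pi) linarith+
 define p1 p2 where "p1 = min 1 (1 / \<alpha>) * m / 2" and "p2 = 1 / \<alpha> * m / 2"
 have p: "p1 \<ge> 0" "p2 \<ge> 0" using \<alpha> m by (auto simp: p1_def p2_def)
 obtain C where C: "C \<ge> 0" "\<And>\<zeta>. \<zeta> \<noteq> 0 \<Longrightarrow> Re (\<zeta> * ray_dir) \<ge> cos (3 * pi / 8) * cmod \<zeta> \<Longrightarrow>
   cmod (ray_amp (1 / \<alpha>) m \<zeta>) \<le> C * (cmod \<zeta> powr (- p1) + cmod \<zeta> powr (- p2))"
  using ray_amp_bound[OF \<beta> m \<eta>] unfolding p1_def p2_def by blast
 define M where "M = m * max 0 (1 - \<alpha>)"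
 define C' where "C' = C * (c1 powr (- p1) + c1 powr (- p2))"
 show thesis
 proof (rule that[of C'])
  show "C' \<ge> 0" using C by (simp add: C'_def)
  fix c z assume cc: "oscillatory \<alpha> c" "c1 \<le> cmod c" and z: "z \<in> sector \<alpha>"
  interpret oscillatory \<alpha> c by fact
  have z0: "z \<noteq> 0" "cmod z > 0" using sector_nonzero(1)[OF \<alpha> z] by auto
  define \<zeta> where "\<zeta> = c * z powr of_real (2 * \<alpha>)"
  have nz: "\<zeta> \<noteq> 0" using c_arg(3) z0 by (simp add: \<zeta>_def)
  have n\<zeta>: "cmod \<zeta> = cmod c * cmod z powr (2 * \<alpha>)" using cmod_powr_of_real[OF z0(1), of "2 * \<alpha>"] by (simp add: \<zeta>_def norm_mult)
  \<comment> \<open>Since |\<zeta>| = |c| |z|^(2\<alpha>), each power |\<zeta>|^(-q) contributes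
    |z|^(-2\<alpha>q). With q = \<open>p2\<close> this cancels |z|^m exactly, with q =
    \<open>p1\<close> it leaves |z| to the power \<open>M\<close>.\<close>
  have e: "cmod z powr m * cmod \<zeta> powr (- q) \<le> c1 powr (- q) * cmod z powr (m - 2 * \<alpha> * q)" if "q \<ge> 0" for q
  proof -
   have 1: "cmod \<zeta> powr (- q) = cmod c powr (- q) * cmod z powr (2 * \<alpha> * (- q))" unfolding n\<zeta> by (simp add: powr_mult powr_powr)
   have 2: "cmod z powr m * cmod z powr (2 * \<alpha> * (- q)) = cmod z powr (m - 2 * \<alpha> * q)" by (simp add: powr_add[symmetric])
   have 3: "cmod c powr (- q) \<le> c1 powr (- q)" using cc(2) c1 that by (intro powr_mono2') auto
   have "cmod z powr m * cmod \<zeta> powr (- q) = cmod c powr (- q) * (cmod z powr m * cmod z powr (2 * \<alpha> * (- q)))"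
    unfolding 1 by (simp only: mult_ac)
   also have "\<dots> \<le> c1 powr (- q) * cmod z powr (m - 2 * \<alpha> * q)"
    unfolding 2 by (rule mult_right_mono[OF 3]) simp
   finally show ?thesis .
  qed
  have m1: "m - 2 * \<alpha> * p1 = M"
  proof (cases "\<alpha> \<ge> 1")
   case True
   hence "p1 = 1 / \<alpha> * m / 2" by (simp add: p1_def min_def field_simps)
   thus ?thesis using True \<alpha> by (simp add: M_def)
  next
   case False
   hence "p1 = m / 2" using \<alpha> by (simp add: p1_def min_def field_simps)
   thus ?thesis using False by (simp add: M_def algebra_simps)
  qed
  have m2: "m - 2 * \<alpha> * p2 = 0" using \<alpha> by (simp add: p2_def)
  have M: "M \<ge> 0" using m by (simp add: M_def)
  have g: "cmod z powr M \<le> (1 + cmod z) powr M" "1 \<le> (1 + cmod z) powr M"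
   using M by (auto intro!: powr_mono2 ge_one_powr_ge_zero)
  have "cmod (amplitude \<alpha> m c z) = cmod z powr m * cmod (ray_amp (1 / \<alpha>) m \<zeta>)"
   using cmod_powr_of_real[OF z0(1), of m] by (simp add: amplitude_def norm_mult \<zeta>_def)
  also have "\<dots> \<le> cmod z powr m * (C * (cmod \<zeta> powr (- p1) + cmod \<zeta> powr (- p2)))"
   using c_powr_ray[OF z] nz by (intro mult_left_mono C(2)) (auto simp: \<zeta>_def)
  also have "\<dots> = C * (cmod z powr m * cmod \<zeta> powr (- p1) + cmod z powr m * cmod \<zeta> powr (- p2))" by (simp only: ring_distribs mult_ac)
  also have "\<dots> \<le> C * (c1 powr (- p1) * cmod z powr M + c1 powr (- p2) * 1)"
   using e[OF p(1)] e[OF p(2)] z0 C(1) unfolding m1 m2 by (intro mult_left_mono add_mono) auto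
  also have "\<dots> \<le> C * (c1 powr (- p1) * (1 + cmod z) powr M + c1 powr (- p2) * (1 + cmod z) powr M)"
   using g C(1) by (intro mult_left_mono add_mono) auto
  also have "\<dots> = C' * (1 + cmod z) powr M" by (simp add: C'_def algebra_simps)
  finally show "cmod (amplitude \<alpha> m c z) \<le> C' * (1 + cmod z) powr (m * max 0 (1 - \<alpha>))" unfolding M_def .
 qed
qed

lemma amplitude_radial:
 assumes \<alpha>: "\<alpha> > 1 / 2" and m: "m \<ge> 0" and k: "k > 0" and c: "Re c > 0" "Re c \<le> Im c"
 shows "radial_amp \<alpha> m c k = exp (- (c * of_real k powr of_real (2 * \<alpha>))) * amplitude \<alpha> m c (of_real k)"
proof -
 have h: "of_real k powr of_real a = complex_of_real (k powr a)" for a using k powr_of_real[of k a] by simp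
 have ci: "Im c > 0" using c by linarith
 show ?thesis unfolding amplitude_def h radial_amp_eq[OF \<alpha> m k c(1) ci] by (simp only: mult_ac)
qed

context oscillatory
begin

text \<open>Turning the ray into the lower half-plane makes exp(- i r z) decay, and no stationary
  point is in the way, so the bound is uniform in r \<ge> 0. On the turned ray the argument of c
  z^(2\<alpha>) is at most pi/2 - pi/16, whence the rate sin (pi/16), free of
  \<open>Re c\<close>.\<close>

lemma incoming_bound:
 fixes B :: "complex \<Rightarrow> complex"
 assumes B: "\<And>z. z \<in> sector \<alpha> \<Longrightarrow> cmod (B z) \<le> C * (1 + cmod z) powr M" and C: "C \<ge> 0" "M \<ge> 0"
  and h: "B holomorphic_on sector \<alpha>" and r: "r \<ge> 0" and c1: "0 < c1" "c1 \<le> cmod c"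
 shows "cmod (LINT t|lborel. indicator {0<..} t *\<^sub>R (exp (\<i> * of_real (- r) * of_real t - c * of_real t powr of_real (2 * \<alpha>)) * B (of_real t)))
  \<le> C * (LINT t|lborel. indicator {0..} t * ((1 + 2 * t) powr M * exp (- (c1 * sin (pi / 16) * t powr (2 * \<alpha>)))))"
proof -
 define F where "F z = exp (\<i> * of_real (- r) * z - c * z powr of_real (2 * \<alpha>)) * B z" for z
 define k where "k = aperture \<alpha> / 2"
 have k: "0 < k" "k < pi / 16" "2 * \<alpha> * k = pi / 16" using aperture[OF \<alpha>] by (auto simp: k_def)
 have s: "sin (pi / 16) > 0" using pi_gt_zero by (intro sin_gt_zero) auto
 have ck: "cos k \<ge> 1 / 2" using k pi_gt_zero cosine_comparison[of k "pi / 3"] by (simp add: cos_60)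
 have sk: "sin k \<ge> 0" using k pi_gt_zero by (intro sin_ge_zero) auto
 have v: "tilt \<alpha> \<in> sector \<alpha>" "Im (Ln (tilt \<alpha>)) = - k" "Re (tilt \<alpha>) = cos k" "Im (tilt \<alpha>) = - sin k" "cmod (tilt \<alpha>) = 1"
  using tilt_sector[OF \<alpha>] by (auto simp: tilt_def k_def)
 have v4: "Re (c * tilt \<alpha> powr of_real (2 * \<alpha>)) \<ge> c1 * sin (pi / 16)"
 proof -
  have "Re (c * tilt \<alpha> powr of_real (2 * \<alpha>)) = cmod c * cos (Im (Ln c) - pi / 16)"
  proof -
   have e: "Im (Ln c) + 2 * \<alpha> * (- k) = Im (Ln c) - pi / 16" using k(3) by linarith
   show ?thesis unfolding c_powr(1)[OF v(1)] v(2) v(5) e by simp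
  qed
  moreover have "cos (pi / 2 - pi / 16) \<le> cos (Im (Ln c) - pi / 16)"
   using c_arg pi_gt_zero by (intro cosine_comparison) auto
  hence "sin (pi / 16) \<le> cos (Im (Ln c) - pi / 16)" unfolding cos_sin_eq[symmetric] sin_cos_eq[of "pi / 16"] by simp
  ultimately show ?thesis using c1 s by (auto intro!: mult_mono)
 qed
 obtain D where D: "\<And>z. z \<in> sector \<alpha> \<Longrightarrow> cmod z \<le> 1 \<Longrightarrow> cmod (F z) \<le> D"
  "\<And>z t. z \<in> sector \<alpha> \<Longrightarrow> Im z \<le> 0 \<Longrightarrow> t \<ge> 1 \<Longrightarrow> t / 2 \<le> cmod z \<Longrightarrow> cmod z \<le> 2 * t \<Longrightarrow> cmod (F z) \<le> D / t\<^sup>2"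
  using lower_decay[OF B C, where s="- r"] unfolding F_def by blast
 have mid: "1 + of_real u * (tilt \<alpha> - 1) \<in> sector \<alpha>" "cmod (1 + of_real u * (tilt \<alpha> - 1)) \<le> 1" "1 / 2 \<le> cmod (1 + of_real u * (tilt \<alpha> - 1))"
   "Im (1 + of_real u * (tilt \<alpha> - 1)) \<le> 0" if u: "u \<in> {0..1}" for u
 proof -
  have e: "1 + of_real u * (tilt \<alpha> - 1) = (1 - u) *\<^sub>R 1 + u *\<^sub>R tilt \<alpha>" by (simp add: scaleR_conv_of_real algebra_simps)
  show "1 + of_real u * (tilt \<alpha> - 1) \<in> sector \<alpha>"
   unfolding e using u by (intro convexD_alt sector_convex[OF \<alpha>] one_in_sector[OF \<alpha>] v) auto
  show "cmod (1 + of_real u * (tilt \<alpha> - 1)) \<le> 1"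
   unfolding e using u norm_triangle_ineq[of "(1 - u) *\<^sub>R 1" "u *\<^sub>R tilt \<alpha>"] by (simp add: v(5))
  have "1 / 2 \<le> (1 - u) * 1 + u * cos k" using u ck mult_left_mono[OF ck, of u] by (simp add: algebra_simps)
  also have "\<dots> = Re ((1 - u) *\<^sub>R 1 + u *\<^sub>R tilt \<alpha>)" by (simp add: v)
  also have "\<dots> \<le> cmod ((1 - u) *\<^sub>R 1 + u *\<^sub>R tilt \<alpha>)" by (rule complex_Re_le_cmod)
  finally show "1 / 2 \<le> cmod (1 + of_real u * (tilt \<alpha> - 1))" unfolding e .
  show "Im (1 + of_real u * (tilt \<alpha> - 1)) \<le> 0" unfolding e using u sk by (simp add: v)
 qed
 have one: "c \<noteq> 0" "Re (c * 1 powr of_real (2 * \<alpha>)) \<ge> Re c" "Re c > 0" using c c_arg by auto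
 have "(LINT t|lborel. indicator {0<..} t *\<^sub>R (F (of_real t * 1) * 1)) = (LINT t|lborel. indicator {0<..} t *\<^sub>R (F (of_real t * tilt \<alpha>) * tilt \<alpha>))"
 proof (rule rotate_ray[OF sector_open[OF \<alpha>] sector_convex[OF \<alpha>], where D=D])
  show "F holomorphic_on sector \<alpha>" unfolding F_def
   using sector_nonzero(2)[OF \<alpha>] by (intro holomorphic_intros h) auto
  show "of_real t * 1 \<in> sector \<alpha>" "of_real t * tilt \<alpha> \<in> sector \<alpha>" if "t > 0" for t
   using sector_scale[OF \<alpha> that one_in_sector[OF \<alpha>]] sector_scale[OF \<alpha> that v(1)] by auto
  show "integrable lborel (\<lambda>t. indicator {0<..} t *\<^sub>R (F (of_real t * 1) * 1))"
   unfolding F_def by (rule ray_integrable_sector(1)[OF B C h one_in_sector[OF \<alpha>] _ _ one(2,3)]) auto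
  show "integrable lborel (\<lambda>t. indicator {0<..} t *\<^sub>R (F (of_real t * tilt \<alpha>) * tilt \<alpha>))"
   unfolding F_def by (rule ray_integrable_sector(1)[OF B C h v(1) v(5) _ v4]) (use r sk v c1 s in auto)
  fix t u :: real assume u: "u \<in> {0..1}"
  have sc: "of_real t * (1 + of_real u * (tilt \<alpha> - 1)) \<in> sector \<alpha>" if "t > 0" by (rule sector_scale[OF \<alpha> that mid(1)[OF u]])
  have nm: "cmod (of_real t * (1 + of_real u * (tilt \<alpha> - 1))) = t * cmod (1 + of_real u * (tilt \<alpha> - 1))" if "t > 0" using that by (simp add: norm_mult)
  show "cmod (F (of_real t * (1 + of_real u * (tilt \<alpha> - 1)))) \<le> D" if "0 < t" "t \<le> 1"
   by (rule D(1)[OF sc]) (use that nm mid[OF u] mult_mono[of t 1 "cmod (1 + of_real u * (tilt \<alpha> - 1))" 1] in auto)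
  show "cmod (F (of_real t * (1 + of_real u * (tilt \<alpha> - 1)))) \<le> D / t\<^sup>2" if "1 \<le> t"
  proof (rule D(2)[OF sc _ that])
   show "Im (of_real t * (1 + of_real u * (tilt \<alpha> - 1))) \<le> 0"
    using mult_nonneg_nonpos[of t "Im (1 + of_real u * (tilt \<alpha> - 1))"] mid(4)[OF u] that by simp
   show "t / 2 \<le> cmod (of_real t * (1 + of_real u * (tilt \<alpha> - 1)))"
    using nm that mult_left_mono[OF mid(3)[OF u], of t] by simp
   have "t * cmod (1 + of_real u * (tilt \<alpha> - 1)) \<le> t * 1" using mid(2)[OF u] that by (intro mult_left_mono) auto
   thus "cmod (of_real t * (1 + of_real u * (tilt \<alpha> - 1))) \<le> 2 * t" using nm that by linarith
  qed (use that in auto)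
 qed
 moreover have "cmod (LINT t|lborel. indicator {0<..} t *\<^sub>R (F (of_real t * tilt \<alpha>) * tilt \<alpha>)) \<le> C * (LINT t|lborel. indicator {0..} t * ((1 + 2 * t) powr M * exp (- (c1 * sin (pi / 16) * t powr (2 * \<alpha>)))))"
  unfolding F_def by (rule ray_integrable_sector(2)[OF B C h v(1) v(5) _ v4]) (use r sk v c1 s in auto)
 ultimately show ?thesis by (simp add: F_def)
qed

end

lemma powr_scale:
 fixes z :: complex
 assumes "t > 0" "z \<noteq> 0"
 shows "(of_real t * z) powr of_real a = of_real (t powr a) * z powr of_real a"
proof -
 have nz: "of_real t * z \<noteq> 0" using assms by simp
 have "Im (Ln (of_real t * z)) = Im (Ln z)" using assms by (simp add: Ln_times_of_real)
 thus ?thesis unfolding powr_polar[OF nz] powr_polar[OF assms(2)]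
  using assms by (simp add: norm_mult powr_mult)
qed

text \<open>Scaling the frequency by the saddle point k0 = (r / (2\<alpha> |c|))^(1/(2\<alpha> - 1))
  moves the saddle to 1 and brings out the parameter \<mu> = |c| k0^(2\<alpha>) in front of
  \<open>phase\<close>. The path through 0, \<open>turn \<alpha>\<close>, 1 and on along the tilt
  gives Gaussian decay with a rate proportional to \<mu> on its bounded pieces. In the exponent, M
  comes from the amplitude and max 0 (1 - \<alpha>) from the width of the saddle.\<close>

lemma outgoing_bound:
 fixes \<alpha> C M c1 :: real
 assumes \<alpha>: "\<alpha> > 1 / 2" and C: "C \<ge> 0" "M \<ge> 0" and c1: "c1 > 0"
 obtains C' where "C' \<ge> 0" "\<And>c B r. oscillatory \<alpha> c \<Longrightarrow> c1 \<le> cmod c \<Longrightarrow> (\<And>z. z \<in> sector \<alpha> \<Longrightarrow> cmod (B z) \<le> C * (1 + cmod z) powr M) \<Longrightarrow>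
   B holomorphic_on sector \<alpha> \<Longrightarrow> r > 0 \<Longrightarrow>
   cmod (LINT t|lborel. indicator {0<..} t *\<^sub>R (exp (\<i> * of_real r * of_real t - c * of_real t powr of_real (2 * \<alpha>)) * B (of_real t)))
    \<le> C' * (1 + (r / (2 * \<alpha> * cmod c)) powr (1 / (2 * \<alpha> - 1))) powr (M + max 0 (1 - \<alpha>))"
proof -
 obtain cl where cl: "cl > 0" "\<And>w. - setback \<alpha> \<le> w \<Longrightarrow> w \<le> 1 \<Longrightarrow> line_exp \<alpha> w \<le> - cl * w\<^sup>2"
  "\<And>w. w \<ge> 1 \<Longrightarrow> line_exp \<alpha> w \<le> - cl * w powr (2 * \<alpha>)"
  using line_exp_bounds[OF \<alpha>] by blast
 define w1 where "w1 = setback \<alpha>"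
 have w1: "0 < w1" "w1 < 1 / 2" using setback[OF \<alpha>] by (auto simp: w1_def)
 \<comment> \<open>At distance t times \<open>setback \<alpha>\<close> behind the saddle the
   quadratic bound reads - c' t^2. The same constant serves on the segment from 0 to
   \<open>turn \<alpha>\<close> and, being at most \<open>cl\<close>, on the forward ray.\<close>
 define c' where "c' = cl * w1\<^sup>2"
 have w1sq: "w1\<^sup>2 \<le> 1" using w1 by (simp add: power_le_one)
 have c': "c' > 0" "c' \<le> cl" using cl(1) w1 mult_left_mono[OF w1sq, of cl] by (auto simp: c'_def)
 define J1 where "J1 = (LINT y|lborel. indicator {0..} y * ((1 + 2 * y) powr M * exp (- (c' * c1 * y powr (2 * \<alpha>)))))"
 have J1: "J1 \<ge> 0" unfolding J1_def by (intro integral_nonneg_AE AE_I2) auto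
 define Q where "Q = 1 + sqrt (pi / (c' * c1))"
 have Q: "Q \<ge> 1" using c' c1 by (simp add: Q_def)
 define d where "d = max 0 (1 - \<alpha>)"
 have d: "d \<ge> 0" "1 - \<alpha> \<le> d" by (auto simp: d_def)
 define C' where "C' = C * (2 + 2 powr M) * Q + C * J1"
 show thesis
 proof (rule that[of C'])
  show "C' \<ge> 0" using C J1 Q by (auto simp: C'_def intro!: add_nonneg_nonneg mult_nonneg_nonneg)
  fix c :: complex and B :: "complex \<Rightarrow> complex" and r :: real assume osc: "oscillatory \<alpha> c" and cc: "c1 \<le> cmod c"
   and B: "\<And>z. z \<in> sector \<alpha> \<Longrightarrow> cmod (B z) \<le> C * (1 + cmod z) powr M" and h: "B holomorphic_on sector \<alpha>" and r: "r > 0"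
  interpret oscillatory \<alpha> c by fact
  define k0 where "k0 = (r / (2 * \<alpha> * cmod c)) powr (1 / (2 * \<alpha> - 1))"
  have c0: "cmod c > 0" using c1 cc by linarith
  have k0: "k0 > 0" using r \<alpha> c0 by (simp add: k0_def)
  define \<mu> where "\<mu> = cmod c * k0 powr (2 * \<alpha>)"
  have \<mu>: "\<mu> > 0" using c0 k0 by (simp add: \<mu>_def)
  \<comment> \<open>The stationarity equation: by it the linear term and the power term of the
    exponent share the factor \<mu>.\<close>
  have sad: "r * k0 = 2 * \<alpha> * \<mu>"
  proof -
   have "k0 powr (2 * \<alpha> - 1) = r / (2 * \<alpha> * cmod c)" using r \<alpha> c0 by (simp add: k0_def powr_powr)
   moreover have "k0 powr (2 * \<alpha>) = k0 * k0 powr (2 * \<alpha> - 1)" using k0 powr_add[of k0 1 "2 * \<alpha> - 1"] by simp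
   ultimately show ?thesis using c0 \<alpha> by (simp add: \<mu>_def)
  qed
  define c2 where "c2 = c * of_real (k0 powr (2 * \<alpha>))"
  have nc2: "cmod c2 = \<mu>" using k0 by (simp add: c2_def norm_mult \<mu>_def)
  interpret sc: oscillatory \<alpha> c2
   by unfold_locales (use \<alpha> c k0 in \<open>auto simp: c2_def mult_right_mono\<close>)
  define B2 where "B2 z = B (of_real k0 * z)" for z
  have B2: "cmod (B2 z) \<le> C * (1 + k0 * cmod z) powr M" if "z \<in> sector \<alpha>" for z
   using B[OF sector_scale[OF \<alpha> k0 that]] k0 by (simp add: B2_def norm_mult)
  \<comment> \<open>Serves for closing the contour and for integrability, where the constant may
    depend on k0; the actual estimates use the sharper bound above.\<close>
  have B2': "cmod (B2 z) \<le> (C * (1 + k0) powr M) * (1 + cmod z) powr M" if "z \<in> sector \<alpha>" for z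
  proof -
   have "1 + k0 * cmod z \<le> (1 + k0) * (1 + cmod z)" using k0 by (simp add: algebra_simps)
   hence "(1 + k0 * cmod z) powr M \<le> ((1 + k0) * (1 + cmod z)) powr M" using k0 C by (intro powr_mono2) auto
   also have "\<dots> = (1 + k0) powr M * (1 + cmod z) powr M" by (rule powr_mult)
   finally have "C * (1 + k0 * cmod z) powr M \<le> C * ((1 + k0) powr M * (1 + cmod z) powr M)" using C by (intro mult_left_mono) auto
   thus ?thesis using B2[OF that] by (simp add: mult.assoc)
  qed
  have CC: "C * (1 + k0) powr M \<ge> 0" using C by simp
  have hB2: "B2 holomorphic_on sector \<alpha>"
  proof -
   have "(B \<circ> (\<lambda>z. of_real k0 * z)) holomorphic_on sector \<alpha>"
    by (rule holomorphic_on_compose_gen[OF _ h]) (use sector_scale[OF \<alpha> k0] in \<open>auto intro!: holomorphic_intros\<close>)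
   thus ?thesis by (simp add: B2_def[abs_def] o_def)
  qed
  define E where "E z = exp (\<i> * of_real (r * k0) * z - c2 * z powr of_real (2 * \<alpha>)) * B2 z" for z
  define G where "G z = of_real k0 * E z" for z
  obtain D where D: "\<And>z. z \<in> sector \<alpha> \<Longrightarrow> cmod z \<le> 1 \<Longrightarrow> cmod (E z) \<le> D"
   "\<And>z t. z \<in> sector \<alpha> \<Longrightarrow> Im z \<le> 0 \<Longrightarrow> t \<ge> 1 \<Longrightarrow> t / 2 \<le> cmod z \<Longrightarrow> cmod z \<le> 2 * t \<Longrightarrow> cmod (E z) \<le> D / t\<^sup>2"
   using sc.lower_decay[OF B2' CC C(2), where s="r * k0"] unfolding E_def by blast
  \<comment> \<open>The modulus is compared with the one for i |c| in place of c, which is the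
    exponential of \<mu> times the real part of \<open>phase\<close>; this removes the dependence on
    \<open>Re c\<close>.\<close>
  have ph: "cmod (exp (\<i> * of_real (r * k0) * z - c2 * z powr of_real (2 * \<alpha>))) \<le> exp (\<mu> * Re (phase \<alpha> z))" if z: "z \<in> sector \<alpha>" for z
  proof -
   have "cmod (exp (\<i> * of_real (r * k0) * z - c2 * z powr of_real (2 * \<alpha>))) = exp (- ((r * k0) * Im z) - Re (c2 * z powr of_real (2 * \<alpha>)))" by simp
   also have "\<dots> \<le> exp (\<mu> * Re (phase \<alpha> z))"
    using sc.c_powr_lower(1)[OF z] unfolding nc2 sad Re_phase[OF \<alpha>] exp_le_cancel_iff by (simp only: distrib_left mult_minus_right mult_ac)
   finally show ?thesis .
  qed
  have Gb: "cmod (G z * y) \<le> (k0 * C * (1 + k0 * K) powr M) * exp (\<mu> * e)"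
   if z: "z \<in> sector \<alpha>" "Re (phase \<alpha> z) \<le> e" "cmod z \<le> K" "cmod y \<le> 1" for z y K e
  proof -
   have K: "K \<ge> 0" using z(3) norm_ge_zero order_trans by blast
   have "cmod (exp (\<i> * of_real (r * k0) * z - c2 * z powr of_real (2 * \<alpha>))) \<le> exp (\<mu> * e)"
    using ph[OF z(1)] z(2) \<mu> by (elim order_trans) simp
   moreover have "cmod (B2 z) \<le> C * (1 + k0 * K) powr M"
    using B2[OF z(1)] z(3) k0 C by (elim order_trans) (intro mult_left_mono powr_mono2, auto)
   ultimately have "cmod (E z) \<le> exp (\<mu> * e) * (C * (1 + k0 * K) powr M)"
    unfolding E_def norm_mult by (intro mult_mono) auto
   hence "cmod (E z) * cmod y \<le> (exp (\<mu> * e) * (C * (1 + k0 * K) powr M)) * 1"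
    using z(4) C K k0 by (intro mult_mono) auto
   hence "k0 * (cmod (E z) * cmod y) \<le> k0 * (exp (\<mu> * e) * (C * (1 + k0 * K) powr M))" using k0 by simp
   thus ?thesis using k0 by (simp add: G_def norm_mult mult_ac)
  qed
  define a where "a = c' * \<mu>"
  have a: "a > 0" using c' \<mu> by (simp add: a_def)
  define b1 where "b1 t = (k0 * C * (1 + k0 * 1) powr M) * exp (- (a * t\<^sup>2))" for t
  define f2 where "f2 t = (k0 * C * (1 + k0 * 2) powr M) * exp (- (a * t\<^sup>2))" for t
  define hh where "hh y = indicator {0..} y * ((1 + 2 * y) powr M * exp (- (c' * cmod c * y powr (2 * \<alpha>))))" for y
  \<comment> \<open>In the variable y = k0 t the bound on the far part of the forward ray no longer
    involves k0, so its integral is at most C times \<open>J1\<close>.\<close>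
  define f3 where "f3 t = k0 * C * hh (k0 * t)" for t
  define b3 where "b3 t = (if t \<in> {0..1} then f2 t else 0) + f3 t" for t :: real
  have hint: "integrable lborel hh" unfolding hh_def using C c' c0 \<alpha> by (intro integrable_poly_exp_powr) auto
  have hle: "(LINT y|lborel. hh y) \<le> J1" unfolding J1_def
  proof (rule integral_mono[OF hint])
   show "integrable lborel (\<lambda>y. indicator {0..} y * ((1 + 2 * y) powr M * exp (- (c' * c1 * y powr (2 * \<alpha>)))))"
    using C c' c1 \<alpha> by (intro integrable_poly_exp_powr) auto
   fix y :: real
   have "c' * c1 * y powr (2 * \<alpha>) \<le> c' * cmod c * y powr (2 * \<alpha>)" using cc c' by (intro mult_right_mono mult_left_mono) auto
   thus "hh y \<le> indicator {0..} y * ((1 + 2 * y) powr M * exp (- (c' * c1 * y powr (2 * \<alpha>))))"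
    unfolding hh_def by (intro mult_left_mono) auto
  qed
  have f3int: "integrable lborel f3"
   unfolding f3_def using lborel_integrable_real_affine[OF hint, of k0 0] k0 by (intro integrable_mult_right) auto
  have f3eq: "(LINT t|lborel. f3 t) = C * (LINT y|lborel. hh y)"
   using lborel_integral_real_affine[of k0 hh 0] k0 unfolding f3_def by simp
  have f3supp: "indicator {0..} t *\<^sub>R f3 t = f3 t" for t using k0 by (auto simp: f3_def hh_def indicator_def zero_le_mult_iff)
  have f3hk: "f3 integrable_on {0..}" "integral {0..} f3 = C * (LINT y|lborel. hh y)"
   using set_borel_integral_eq_integral[of "{0..}" f3] f3int f3eq unfolding set_integrable_def set_lebesgue_integral_def f3supp by auto
  have f2hk: "((\<lambda>t. if t \<in> {0..1} then f2 t else 0) has_integral ((k0 * C * (1 + k0 * 2) powr M) * integral {0..1} (\<lambda>t. exp (- (a * t\<^sup>2))))) {0..}"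
   unfolding f2_def by (subst has_integral_restrict) (auto intro!: has_integral_mult_right integrable_integral gaussian_unit_interval(1) a)
  have b1hk: "(b1 has_integral ((k0 * C * (1 + k0 * 1) powr M) * integral {0..1} (\<lambda>t. exp (- (a * t\<^sup>2))))) {0..1}"
   unfolding b1_def by (intro has_integral_mult_right integrable_integral gaussian_unit_interval(1) a)
  have bt: "0 \<le> setback \<alpha>" "setback \<alpha> \<le> setback \<alpha>" using setback[OF \<alpha>] by auto
  note T = line_backward[OF \<alpha> bt, folded turn_def]
  have Gint: "integrable lborel (\<lambda>t. indicator {0<..} t *\<^sub>R G (of_real t))"
  proof -
   have "integrable lborel (\<lambda>t. indicator {0<..} t *\<^sub>R (E (of_real t * 1) * 1))"
    unfolding E_def by (rule sc.ray_integrable_sector(1)[OF B2' CC C(2) hB2 one_in_sector[OF \<alpha>], where b="Re c2"]) (use sc.c in auto)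
   hence "integrable lborel (\<lambda>t. of_real k0 * (indicator {0<..} t *\<^sub>R (E (of_real t * 1) * 1)))" by (intro integrable_mult_right)
   thus ?thesis by (simp add: G_def)
  qed
  have "cmod (LINT t|lborel. indicator {0<..} t *\<^sub>R G (of_real t)) \<le> integral {0..1} b1 + integral {0..1} b1 + integral {0..} b3"
  proof (rule polyline_bound[OF sector_open[OF \<alpha>] sector_convex[OF \<alpha>], where q="turn \<alpha>" and v="tilt \<alpha>" and D="k0 * D"])
   show "G holomorphic_on sector \<alpha>" unfolding G_def E_def
    using sector_nonzero(2)[OF \<alpha>] by (intro holomorphic_intros hB2) auto
   show "of_real t \<in> sector \<alpha>" "of_real t * turn \<alpha> \<in> sector \<alpha>" if "t > 0" for t
    using sector_scale[OF \<alpha> that one_in_sector[OF \<alpha>]] sector_scale[OF \<alpha> that T(1)] by auto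
   show "1 + of_real t * tilt \<alpha> \<in> sector \<alpha>" if "t \<ge> 0" for t by (rule line_forward(1)[OF \<alpha> that])
   show "integrable lborel (\<lambda>t. indicator {0<..} t *\<^sub>R G (of_real t))" by (rule Gint)
   show "cmod (G (of_real t * (1 + of_real u * (turn \<alpha> - 1)))) \<le> k0 * D" if t: "0 < t" "t \<le> 1" "u \<in> {0..1}" for t u
   proof -
    have e: "1 + of_real u * (turn \<alpha> - 1) = 1 - of_real (u * setback \<alpha>) * tilt \<alpha>" by (simp add: turn_def)
    have u: "0 \<le> u * setback \<alpha>" "u * setback \<alpha> \<le> setback \<alpha>" using t(3) setback[OF \<alpha>] mult_right_mono[of u 1 "setback \<alpha>"] by auto
    note U = line_backward[OF \<alpha> u, folded e]
    have "cmod (of_real t * (1 + of_real u * (turn \<alpha> - 1))) \<le> 1" using t U(5) mult_mono[of t 1 "cmod (1 + of_real u * (turn \<alpha> - 1))" 1] by (simp add: norm_mult)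
    thus ?thesis using D(1)[OF sector_scale[OF \<alpha> t(1) U(1)]] k0 by (simp add: G_def norm_mult)
   qed
   show "cmod (G (of_real t + of_real u * (1 + of_real t * tilt \<alpha> - of_real t))) \<le> k0 * D / t\<^sup>2" if t: "1 \<le> t" "u \<in> {0..1}" for t u
   proof -
    define z where "z = of_real t + of_real u * (1 + of_real t * tilt \<alpha> - of_real t)"
    have e: "z = (1 - u) *\<^sub>R of_real t + u *\<^sub>R (1 + of_real t * tilt \<alpha>)" by (simp add: z_def scaleR_conv_of_real algebra_simps)
    have t0: "t \<ge> 0" "t > 0" using t by auto
    note V = line_forward[OF \<alpha> t0(1)]
    have zs: "z \<in> sector \<alpha>" unfolding e
     using sector_scale[OF \<alpha> t0(2) one_in_sector[OF \<alpha>]] t V(1) by (intro convexD_alt sector_convex[OF \<alpha>]) auto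
    have k: "0 < aperture \<alpha> / 2" "aperture \<alpha> / 2 < pi / 16" using aperture[OF \<alpha>] by auto
    have ck: "cos (aperture \<alpha> / 2) \<ge> 1 / 2" using k pi_gt_zero cosine_comparison[of "aperture \<alpha> / 2" "pi / 3"] by (simp add: cos_60)
    have sk: "sin (aperture \<alpha> / 2) \<ge> 0" using k pi_gt_zero by (intro sin_ge_zero) auto
    have "Im z = - (u * (t * sin (aperture \<alpha> / 2)))" unfolding e by (simp add: tilt_def)
    hence im: "Im z \<le> 0" using t sk by simp
    have "Re z = (1 - u) * t + u * (1 + t * cos (aperture \<alpha> / 2))" unfolding e by (simp add: tilt_def)
    also have "(1 - u) * t + u * (1 + t * cos (aperture \<alpha> / 2)) \<ge> (1 - u) * (t / 2) + u * (t / 2)"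
    proof -
     have "t * (1 / 2) \<le> t * cos (aperture \<alpha> / 2)" by (rule mult_left_mono[OF ck t0(1)])
     hence tc: "t / 2 \<le> 1 + t * cos (aperture \<alpha> / 2)" by simp
     show ?thesis using t t0 by (intro add_mono mult_left_mono tc) auto
    qed
    also have "(1 - u) * (t / 2) + u * (t / 2) = t / 2" by (simp only: distrib_right[symmetric] diff_add_cancel mult_1)
    finally have "t / 2 \<le> Re z" .
    hence lo: "t / 2 \<le> cmod z" using complex_Re_le_cmod[of z] by linarith
    have "cmod z \<le> (1 - u) * t + u * cmod (1 + of_real t * tilt \<alpha>)"
     unfolding e using norm_triangle_ineq[of "(1 - u) *\<^sub>R of_real t" "u *\<^sub>R (1 + of_real t * tilt \<alpha>)"] t by simp
    also have "\<dots> \<le> (1 - u) * (2 * t) + u * (2 * t)" using t V(6) by (intro add_mono mult_left_mono) auto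
    finally have hi: "cmod z \<le> 2 * t" by (simp add: algebra_simps)
    have "k0 * cmod (E z) \<le> k0 * (D / t\<^sup>2)" using D(2)[OF zs im t(1) lo hi] k0 by (intro mult_left_mono) auto
    thus ?thesis using k0 unfolding z_def[symmetric] by (simp add: G_def norm_mult)
   qed
   show b1i: "b1 integrable_on {0..1}" using b1hk by (rule has_integral_integrable)
   thus "b1 integrable_on {0..1}" .
   show "b1 t \<ge> 0" for t using k0 C by (simp add: b1_def)
   show "cmod (G (of_real t * turn \<alpha>) * turn \<alpha>) \<le> b1 t" if t: "0 < t" "t \<le> 1" for t
   proof -
    have "Re (phase \<alpha> (of_real t * turn \<alpha>)) \<le> t * Re (phase \<alpha> (turn \<alpha>))" by (rule turn_segment[OF \<alpha> t])
    also have "Re (phase \<alpha> (turn \<alpha>)) = line_exp \<alpha> (- setback \<alpha>)" by (simp add: line_exp_def[OF \<alpha>] turn_def)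
    also have "t * line_exp \<alpha> (- setback \<alpha>) \<le> t * (- c')"
     using cl(2)[of "- setback \<alpha>"] setback[OF \<alpha>] t by (intro mult_left_mono) (auto simp: c'_def w1_def)
    also have "\<dots> \<le> - (c' * t\<^sup>2)" using mult_left_mono[of "t * t" "t * 1" c'] t c' by (simp add: power2_eq_square mult_ac)
    finally have p: "Re (phase \<alpha> (of_real t * turn \<alpha>)) \<le> - (c' * t\<^sup>2)" .
    have n: "cmod (of_real t * turn \<alpha>) \<le> 1" using t T(5) mult_mono[of t 1 "cmod (turn \<alpha>)" 1] by (simp add: norm_mult)
    show ?thesis using Gb[OF sector_scale[OF \<alpha> t(1) T(1)] p n T(5)] by (simp add: b1_def a_def mult_ac)
   qed
   show "cmod (G (1 + of_real t * (turn \<alpha> - 1)) * (turn \<alpha> - 1)) \<le> b1 t" if t: "0 \<le> t" "t \<le> 1" for t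
   proof -
    have e: "1 + of_real t * (turn \<alpha> - 1) = 1 - of_real (t * setback \<alpha>) * tilt \<alpha>" by (simp add: turn_def)
    have u: "0 \<le> t * setback \<alpha>" "t * setback \<alpha> \<le> setback \<alpha>" using t setback[OF \<alpha>] mult_right_mono[of t 1 "setback \<alpha>"] by auto
    note U = line_backward[OF \<alpha> u, folded e]
    have "Re (phase \<alpha> (1 + of_real t * (turn \<alpha> - 1))) = line_exp \<alpha> (- (t * setback \<alpha>))" unfolding e by (simp add: line_exp_def[OF \<alpha>])
    also have "\<dots> \<le> - cl * (- (t * setback \<alpha>))\<^sup>2" using u setback[OF \<alpha>] by (intro cl(2)) auto
    also have "\<dots> = - (c' * t\<^sup>2)" by (simp add: c'_def w1_def power2_eq_square mult_ac)
    finally have p: "Re (phase \<alpha> (1 + of_real t * (turn \<alpha> - 1))) \<le> - (c' * t\<^sup>2)" .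
    have n: "cmod (turn \<alpha> - 1) \<le> 1" using setback[OF \<alpha>] by (simp add: turn_def norm_mult tilt_def)
    show ?thesis using Gb[OF U(1) p U(5) n] by (simp add: b1_def a_def mult_ac)
   qed
   show "b3 integrable_on {0..}" unfolding b3_def by (intro integrable_add has_integral_integrable[OF f2hk] f3hk)
   show b30: "b3 t \<ge> 0" for t using k0 C by (auto simp: b3_def f2_def f3_def hh_def)
   show "cmod (G (1 + of_real t * tilt \<alpha>) * tilt \<alpha>) \<le> b3 t" if t: "0 \<le> t" for t
   proof (cases "t \<le> 1")
    case True
    have "Re (phase \<alpha> (1 + of_real t * tilt \<alpha>)) = line_exp \<alpha> t" by (simp add: line_exp_def[OF \<alpha>])
    also have "\<dots> \<le> - cl * t\<^sup>2" using t True setback[OF \<alpha>] by (intro cl(2)) auto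
    also have "\<dots> \<le> - (c' * t\<^sup>2)" using c' by (simp add: mult_right_mono)
    finally have p: "Re (phase \<alpha> (1 + of_real t * tilt \<alpha>)) \<le> - (c' * t\<^sup>2)" .
    have n: "cmod (1 + of_real t * tilt \<alpha>) \<le> 2" using line_forward(6)[OF \<alpha> t] True by simp
    have "cmod (G (1 + of_real t * tilt \<alpha>) * tilt \<alpha>) \<le> f2 t"
     using Gb[OF line_forward(1)[OF \<alpha> t] p n, of "tilt \<alpha>"] by (simp add: f2_def a_def mult_ac tilt_def)
    moreover have "f3 t \<ge> 0" using k0 C by (auto simp: f3_def hh_def)
    ultimately show ?thesis using True t by (simp add: b3_def)
   next
    case False
    have "Re (phase \<alpha> (1 + of_real t * tilt \<alpha>)) = line_exp \<alpha> t" by (simp add: line_exp_def[OF \<alpha>])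
    also have "\<dots> \<le> - cl * t powr (2 * \<alpha>)" using False by (intro cl(3)) auto
    also have "\<dots> \<le> - (c' * t powr (2 * \<alpha>))" using c' by (simp add: mult_right_mono)
    finally have p: "Re (phase \<alpha> (1 + of_real t * tilt \<alpha>)) \<le> - (c' * t powr (2 * \<alpha>))" .
    have n: "cmod (1 + of_real t * tilt \<alpha>) \<le> 2 * t" using line_forward(6)[OF \<alpha> t] False by simp
    have ex: "\<mu> * - (c' * t powr (2 * \<alpha>)) = - (c' * cmod c * (k0 * t) powr (2 * \<alpha>))" by (simp add: \<mu>_def powr_mult)
    have "cmod (G (1 + of_real t * tilt \<alpha>) * tilt \<alpha>) \<le> f3 t"
     using Gb[OF line_forward(1)[OF \<alpha> t] p n, of "tilt \<alpha>"] t k0 unfolding ex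
     by (simp add: f3_def hh_def mult_ac tilt_def)
    thus ?thesis using False by (simp add: b3_def)
   qed
  qed
  also have "integral {0..} b3 = (k0 * C * (1 + k0 * 2) powr M) * integral {0..1} (\<lambda>t. exp (- (a * t\<^sup>2))) + C * (LINT y|lborel. hh y)"
   unfolding b3_def by (subst Henstock_Kurzweil_Integration.integral_add[OF has_integral_integrable[OF f2hk] f3hk(1)]) (simp only: integral_unique[OF f2hk] f3hk(2))
  also have "integral {0..1} b1 = (k0 * C * (1 + k0 * 1) powr M) * integral {0..1} (\<lambda>t. exp (- (a * t\<^sup>2)))" by (rule integral_unique[OF b1hk])
  finally have main: "cmod (LINT t|lborel. indicator {0<..} t *\<^sub>R G (of_real t)) \<le>
   2 * ((k0 * C * (1 + k0 * 1) powr M) * integral {0..1} (\<lambda>t. exp (- (a * t\<^sup>2)))) +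
   ((k0 * C * (1 + k0 * 2) powr M) * integral {0..1} (\<lambda>t. exp (- (a * t\<^sup>2))) + C * (LINT y|lborel. hh y))" by linarith
  define X where "X = integral {0..1} (\<lambda>t. exp (- (a * t\<^sup>2)))"
  note X = gaussian_unit_interval(2,3,4)[OF a, folded X_def]
  define P where "P = (1 + k0) powr M"
  have P: "P \<ge> 1" using k0 C by (auto simp: P_def intro!: ge_one_powr_ge_zero)
  have R: "(1 + k0) powr d \<ge> 1" using k0 d by (intro ge_one_powr_ge_zero) auto
  \<comment> \<open>For large k0 the saddle has width of order \<mu>^(-1/2), hence k0^(- \<alpha>).
    Together with the Jacobian k0 this gives k0^(1 - \<alpha>), the source of the exponent
    \<open>d\<close>.\<close>
  have kX: "k0 * X \<le> Q * (1 + k0) powr d"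
  proof (cases "k0 \<le> 1")
   case True
   have "k0 * X \<le> 1 * 1" using True X k0 by (intro mult_mono) auto
   also have "\<dots> \<le> Q * (1 + k0) powr d" using Q R by (intro mult_mono) auto
   finally show ?thesis .
  next
   case False
   have "sqrt (k0 powr (2 * \<alpha>)) = k0 powr \<alpha>" using k0 by (simp add: powr_half_sqrt[symmetric] powr_powr)
   moreover have "pi / a = pi / (c' * cmod c) / k0 powr (2 * \<alpha>)" by (simp add: a_def \<mu>_def)
   ultimately have sq: "sqrt (pi / a) = sqrt (pi / (c' * cmod c)) * k0 powr (- \<alpha>)"
    by (simp only: real_sqrt_divide[of _ "k0 powr (2 * \<alpha>)"] powr_minus divide_inverse[of _ "k0 powr \<alpha>"])
   have "k0 * X \<le> k0 * (sqrt (pi / (c' * cmod c)) * k0 powr (- \<alpha>))" using X(2) k0 unfolding sq[symmetric] by (intro mult_left_mono) auto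
   also have "\<dots> = sqrt (pi / (c' * cmod c)) * k0 powr (1 - \<alpha>)" using k0 powr_add[of k0 1 "- \<alpha>"] by simp
   also have "\<dots> \<le> Q * (1 + k0) powr d"
   proof (rule mult_mono)
    have "pi / (c' * cmod c) \<le> pi / (c' * c1)" using cc c1 c' c0 by (intro divide_left_mono mult_left_mono mult_pos_pos) auto
    thus "sqrt (pi / (c' * cmod c)) \<le> Q" unfolding Q_def by (simp add: add_increasing)
    have "k0 powr (1 - \<alpha>) \<le> k0 powr d" using False d by (intro powr_mono) auto
    also have "\<dots> \<le> (1 + k0) powr d" using k0 d by (intro powr_mono2) auto
    finally show "k0 powr (1 - \<alpha>) \<le> (1 + k0) powr d" .
   qed (use Q in auto)
   finally show ?thesis .
  qed
  have P2: "(1 + k0 * 2) powr M \<le> 2 powr M * P"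
   unfolding P_def powr_mult[symmetric] using k0 C by (intro powr_mono2) auto
  have "2 * ((k0 * C * (1 + k0 * 1) powr M) * X) + ((k0 * C * (1 + k0 * 2) powr M) * X + C * (LINT y|lborel. hh y))
   \<le> 2 * (C * P * (k0 * X)) + (C * (2 powr M * P) * (k0 * X) + C * J1)"
  proof (intro add_mono)
   show "2 * (k0 * C * (1 + k0 * 1) powr M * X) \<le> 2 * (C * P * (k0 * X))" by (simp add: P_def mult_ac)
   have "(k0 * C * X) * (1 + k0 * 2) powr M \<le> (k0 * C * X) * (2 powr M * P)" using P2 k0 C X by (intro mult_left_mono) auto
   thus "k0 * C * (1 + k0 * 2) powr M * X \<le> C * (2 powr M * P) * (k0 * X)" by (simp add: mult_ac)
   show "C * (LINT y|lborel. hh y) \<le> C * J1" using hle C by (intro mult_left_mono) auto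
  qed
  also have "\<dots> = C * (2 + 2 powr M) * P * (k0 * X) + C * J1" by (simp add: algebra_simps)
  also have "\<dots> \<le> C * (2 + 2 powr M) * P * (Q * (1 + k0) powr d) + C * J1 * (P * (1 + k0) powr d)"
  proof (intro add_mono)
   show "C * (2 + 2 powr M) * P * (k0 * X) \<le> C * (2 + 2 powr M) * P * (Q * (1 + k0) powr d)"
    using kX C P by (intro mult_left_mono) auto
   have "1 * 1 \<le> P * (1 + k0) powr d" using P R by (intro mult_mono) auto
   thus "C * J1 \<le> C * J1 * (P * (1 + k0) powr d)" using C J1 mult_left_mono[of 1 "P * (1 + k0) powr d" "C * J1"] by simp
  qed
  also have "\<dots> = C' * (P * (1 + k0) powr d)" by (simp add: C'_def algebra_simps)
  also have "P * (1 + k0) powr d = (1 + k0) powr (M + d)" by (simp add: P_def powr_add)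
  finally have fin: "cmod (LINT t|lborel. indicator {0<..} t *\<^sub>R G (of_real t)) \<le> C' * (1 + k0) powr (M + d)"
   using main unfolding X_def[symmetric] by linarith
  define FF where "FF t = indicator {0<..} t *\<^sub>R (exp (\<i> * of_real r * of_real t - c * of_real t powr of_real (2 * \<alpha>)) * B (of_real t))" for t :: real
  have "indicator {0<..} t *\<^sub>R G (of_real t) = k0 *\<^sub>R FF (0 + k0 * t)" for t
  proof (cases "t > 0")
   case True
   have "of_real (k0 * t) powr of_real (2 * \<alpha>) = of_real (k0 powr (2 * \<alpha>)) * complex_of_real t powr of_real (2 * \<alpha>)"
    using powr_scale[OF k0, of "of_real t" "2 * \<alpha>"] True by simp
   thus ?thesis using True k0 by (simp add: FF_def G_def E_def B2_def c2_def scaleR_conv_of_real mult_ac)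
  qed (use k0 in \<open>simp add: FF_def zero_less_mult_iff\<close>)
  hence "(LINT t|lborel. indicator {0<..} t *\<^sub>R G (of_real t)) = (LINT t|lborel. FF t)"
   using lborel_integral_real_affine[of k0 FF 0] k0 by simp
  thus "cmod (LINT t|lborel. indicator {0<..} t *\<^sub>R (exp (\<i> * of_real r * of_real t - c * of_real t powr of_real (2 * \<alpha>)) * B (of_real t)))
    \<le> C' * (1 + (r / (2 * \<alpha> * cmod c)) powr (1 / (2 * \<alpha> - 1))) powr (M + max 0 (1 - \<alpha>))"
   using fin by (simp add: FF_def[abs_def] k0_def d_def)
 qed
qed

text \<open>The half-axis k > 0 carries the outgoing wave and, as \<open>radial_amp\<close> is even,
  k < 0 carries the incoming one after reflection. With d = max 0 (1 - \<alpha>) the amplitude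
  contributes (n - 1) d to the exponent of the saddle frequency and the saddle contributes d, in
  total n d; that frequency is of order r^(1/(2\<alpha> - 1)).\<close>

lemma kernel_bound_pos:
 fixes \<alpha> T :: real
 assumes \<alpha>: "\<alpha> > 1 / 2" and T: "T > 0"
 obtains C where "C \<ge> 0" "\<And>\<epsilon> (x :: 'a::euclidean_space). 0 < \<epsilon> \<Longrightarrow> \<epsilon> \<le> T \<Longrightarrow>
   cmod (LINT \<xi>|lborel. cis (x \<bullet> \<xi>) * exp (- (Complex \<epsilon> T * of_real (norm \<xi> powr (2 * \<alpha>)))))
    \<le> C * (1 + norm x) powr (real DIM('a) * max 0 (1 - \<alpha>) / (2 * \<alpha> - 1))"
proof -
 define m where "m = real DIM('a) - 1"
 define d where "d = max 0 (1 - \<alpha>)"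
 define M where "M = m * d"
 have m: "m \<ge> 0" by (simp add: m_def)
 have M: "M \<ge> 0" "d \<ge> 0" using m by (auto simp: M_def d_def)
 obtain C where C: "C \<ge> 0" "\<And>c z. oscillatory \<alpha> c \<Longrightarrow> T \<le> cmod c \<Longrightarrow> z \<in> sector \<alpha> \<Longrightarrow>
  cmod (amplitude \<alpha> m c z) \<le> C * (1 + cmod z) powr M"
  using amplitude_bound[OF \<alpha> m T] unfolding M_def d_def by blast
 obtain C1 where C1: "C1 \<ge> 0" "\<And>c B r. oscillatory \<alpha> c \<Longrightarrow> T \<le> cmod c \<Longrightarrow> (\<And>z. z \<in> sector \<alpha> \<Longrightarrow> cmod (B z) \<le> C * (1 + cmod z) powr M) \<Longrightarrow>
   B holomorphic_on sector \<alpha> \<Longrightarrow> r > 0 \<Longrightarrow>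
   cmod (LINT t|lborel. indicator {0<..} t *\<^sub>R (exp (\<i> * of_real r * of_real t - c * of_real t powr of_real (2 * \<alpha>)) * B (of_real t)))
    \<le> C1 * (1 + (r / (2 * \<alpha> * cmod c)) powr (1 / (2 * \<alpha> - 1))) powr (M + d)"
  using outgoing_bound[OF \<alpha> C(1) M(1) T] unfolding d_def by blast
 define J where "J = C * (LINT t|lborel. indicator {0..} t * ((1 + 2 * t) powr M * exp (- (T * sin (pi / 16) * t powr (2 * \<alpha>)))))"
 have J: "J \<ge> 0" unfolding J_def using C by (intro mult_nonneg_nonneg integral_nonneg_AE AE_I2) auto
 define p where "p = 1 / (2 * \<alpha> - 1)"
 have p: "p > 0" using \<alpha> by (simp add: p_def)
 define K where "K = 1 + (2 * \<alpha> * T) powr (- p)"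
 have K: "K \<ge> 1" by (simp add: K_def)
 define b where "b = unit_ball_vol m"
 have b: "b \<ge> 0" using m by (simp add: b_def)
 define e where "e = real DIM('a) * d / (2 * \<alpha> - 1)"
 have e: "e \<ge> 0" using M \<alpha> by (simp add: e_def)
 have Md: "M + d = real DIM('a) * d" by (simp add: M_def m_def algebra_simps)
 show thesis
 proof (rule that[of "b * (C1 * K powr (M + d) + 2 * J)"])
  show "b * (C1 * K powr (M + d) + 2 * J) \<ge> 0" using b C1(1) J by simp
  fix \<epsilon> and x :: 'a assume \<epsilon>: "0 < \<epsilon>" "\<epsilon> \<le> T"
  define c where "c = Complex \<epsilon> T"
  have c: "Re c > 0" "Re c \<le> Im c" using \<epsilon> by (auto simp: c_def)
  interpret oscillatory \<alpha> c by unfold_locales (use \<alpha> c in auto)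
  have osc: "oscillatory \<alpha> c" by unfold_locales
  have Tc: "T \<le> cmod c" using abs_Im_le_cmod[of c] T by (simp add: c_def)
  define r where "r = norm x"
  have r: "r \<ge> 0" by (simp add: r_def)
  define A where "A = amplitude \<alpha> m c"
  have Ab: "\<And>z. z \<in> sector \<alpha> \<Longrightarrow> cmod (A z) \<le> C * (1 + cmod z) powr M" unfolding A_def by (rule C(2)[OF osc Tc])
  have Ah: "A holomorphic_on sector \<alpha>" unfolding A_def by (rule amplitude_holomorphic[OF m])
  define I where "I s = (LINT t|lborel. indicator {0<..} t *\<^sub>R (exp (\<i> * of_real s * of_real t - c * of_real t powr of_real (2 * \<alpha>)) * A (of_real t)))" for s
  have Im: "cmod (I (- s)) \<le> J" if "s \<ge> 0" for s
   unfolding I_def J_def by (rule incoming_bound[OF Ab C(1) M(1) Ah that T Tc])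
  have g1: "(1 + r) powr e \<ge> 1" using r e by (intro ge_one_powr_ge_zero) auto
  have Ip: "cmod (I r) \<le> C1 * K powr (M + d) * (1 + r) powr e + J"
  proof (cases "r > 0")
   case True
   have "(r / (2 * \<alpha> * cmod c)) powr p \<le> (r / (2 * \<alpha> * T)) powr p"
    using True T Tc \<alpha> p by (intro powr_mono2 divide_left_mono mult_left_mono mult_pos_pos) auto
   also have "\<dots> = r powr p * (2 * \<alpha> * T) powr (- p)" unfolding powr_divide powr_minus_divide by simp
   also have "\<dots> \<le> (1 + r) powr p * (2 * \<alpha> * T) powr (- p)" using r p by (intro mult_right_mono powr_mono2) auto
   finally have "(r / (2 * \<alpha> * cmod c)) powr p \<le> (1 + r) powr p * (2 * \<alpha> * T) powr (- p)" .
   moreover have "1 \<le> (1 + r) powr p" using r p by (intro ge_one_powr_ge_zero) auto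
   ultimately have "1 + (r / (2 * \<alpha> * cmod c)) powr p \<le> K * (1 + r) powr p" by (simp add: K_def algebra_simps)
   hence "(1 + (r / (2 * \<alpha> * cmod c)) powr p) powr (M + d) \<le> (K * (1 + r) powr p) powr (M + d)"
    using M by (intro powr_mono2) (auto intro: add_nonneg_nonneg)
   also have "\<dots> = K powr (M + d) * (1 + r) powr e" unfolding powr_mult powr_powr by (simp add: e_def p_def Md)
   finally have "C1 * (1 + (r / (2 * \<alpha> * cmod c)) powr p) powr (M + d) \<le> C1 * (K powr (M + d) * (1 + r) powr e)"
    using C1(1) by (intro mult_left_mono) auto
   moreover have "cmod (I r) \<le> C1 * (1 + (r / (2 * \<alpha> * cmod c)) powr p) powr (M + d)"
    unfolding I_def p_def by (rule C1(2)[OF osc Tc Ab Ah True])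
   ultimately show ?thesis using J by (simp add: mult.assoc)
  next
   case False
   \<comment> \<open>At r = 0 there is no saddle point, but the outgoing integral coincides with the
     incoming one.\<close>
   hence "I r = I (- r)" using r by simp
   thus ?thesis using Im[OF r] C1(1) K by (simp add: add_increasing)
  qed
  define f where "f k = cis (k * r) * radial_amp \<alpha> m c k" for k
  have fint: "integrable lborel f" using fourier_kernel_radial(2)[of \<alpha> c x] \<alpha> c by (simp add: f_def[abs_def] r_def m_def)
  have pos: "indicator {0<..} k *\<^sub>R f k = indicator {0<..} k *\<^sub>R (exp (\<i> * of_real r * of_real k - c * of_real k powr of_real (2 * \<alpha>)) * A (of_real k))" for k
  proof (cases "k > 0")
   case True
   have "cis (k * r) = exp (\<i> * of_real r * of_real k)" by (simp add: cis_conv_exp mult_ac)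
   thus ?thesis unfolding f_def A_def amplitude_radial[OF \<alpha> m True c] by (simp add: exp_diff exp_minus divide_inverse mult_ac)
  qed simp
  have neg: "indicator {..<0} (0 + - 1 * k) *\<^sub>R f (0 + - 1 * k) = indicator {0<..} k *\<^sub>R (exp (\<i> * of_real (- r) * of_real k - c * of_real k powr of_real (2 * \<alpha>)) * A (of_real k))" for k
  proof (cases "k > 0")
   case True
   have "cis (- k * r) = exp (\<i> * of_real (- r) * of_real k)" by (simp add: cis_conv_exp mult_ac)
   moreover have "radial_amp \<alpha> m c (- k) = radial_amp \<alpha> m c k" by (simp add: radial_amp_def)
   ultimately show ?thesis using True unfolding f_def A_def by (simp add: amplitude_radial[OF \<alpha> m True c] exp_diff exp_minus divide_inverse mult_ac)
  qed simp
  have i1: "integrable lborel (\<lambda>k. indicator {0<..} k *\<^sub>R f k)" "integrable lborel (\<lambda>k. indicator {..<0} k *\<^sub>R f k)"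
   by (intro integrable_mult_indicator fint, simp)+
  have "(LINT k|lborel. f k) = (LINT k|lborel. indicator {0<..} k *\<^sub>R f k + indicator {..<0} k *\<^sub>R f k)"
  proof (rule integral_cong_AE)
   show "AE k in lborel. f k = indicator {0<..} k *\<^sub>R f k + indicator {..<0} k *\<^sub>R f k"
    using AE_lborel_singleton[of "0::real"] by eventually_elim (auto simp: indicator_def)
  qed (use fint i1 in auto)
  also have "\<dots> = (LINT k|lborel. indicator {0<..} k *\<^sub>R f k) + (LINT k|lborel. indicator {..<0} k *\<^sub>R f k)"
   by (rule Bochner_Integration.integral_add[OF i1])
  also have "(LINT k|lborel. indicator {0<..} k *\<^sub>R f k) = I r" unfolding I_def pos ..
  also have "(LINT k|lborel. indicator {..<0} k *\<^sub>R f k) = I (- r)"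
   using lborel_integral_real_affine[of "-1" "\<lambda>k. indicator {..<0} k *\<^sub>R f k" 0] unfolding neg I_def by simp
  finally have "cmod (LINT k|lborel. f k) \<le> C1 * K powr (M + d) * (1 + r) powr e + J + J"
   using Ip Im[OF r] norm_triangle_ineq[of "I r" "I (- r)"] by simp
  also have "\<dots> \<le> C1 * K powr (M + d) * (1 + r) powr e + 2 * J * (1 + r) powr e"
   using g1 J mult_left_mono[of 1 "(1 + r) powr e" "2 * J"] by simp
  also have "\<dots> = (C1 * K powr (M + d) + 2 * J) * (1 + r) powr e" by (simp add: algebra_simps)
  finally have "b * cmod (LINT k|lborel. f k) \<le> b * ((C1 * K powr (M + d) + 2 * J) * (1 + r) powr e)" using b by (rule mult_left_mono)
  moreover have "(LINT \<xi>|lborel. cis (x \<bullet> \<xi>) * exp (- (c * of_real (norm \<xi> powr (2 * \<alpha>))))) = of_real b * (LINT k|lborel. f k)"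
   using fourier_kernel_radial(3)[of \<alpha> c x] \<alpha> c by (simp add: f_def r_def m_def b_def)
  ultimately show "cmod (LINT \<xi>|lborel. cis (x \<bullet> \<xi>) * exp (- (Complex \<epsilon> T * of_real (norm \<xi> powr (2 * \<alpha>)))))
    \<le> b * (C1 * K powr (M + d) + 2 * J) * (1 + norm x) powr (real DIM('a) * max 0 (1 - \<alpha>) / (2 * \<alpha> - 1))"
   using b unfolding c_def[symmetric] by (simp add: norm_mult e_def r_def d_def mult.assoc)
 qed
qed

text \<open>The sign of \<open>T\<close> is immaterial, since complex conjugation amounts to \<open>T \<mapsto> -T\<close>, \<open>x \<mapsto> -x\<close>.\<close>

lemma kernel_bound:
 fixes \<alpha> T :: real
 assumes \<alpha>: "\<alpha> > 1 / 2" and T: "T \<noteq> 0"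
 obtains C where "C \<ge> 0" "\<And>\<epsilon> (x :: 'a::euclidean_space). 0 < \<epsilon> \<Longrightarrow> \<epsilon> \<le> \<bar>T\<bar> \<Longrightarrow>
   cmod (LINT \<xi>|lborel. cis (x \<bullet> \<xi>) * exp (- (Complex \<epsilon> T * of_real (norm \<xi> powr (2 * \<alpha>)))))
    \<le> C * (1 + norm x) powr (real DIM('a) * max 0 (1 - \<alpha>) / (2 * \<alpha> - 1))"
proof -
 obtain C where C: "C \<ge> 0" "\<And>\<epsilon> (x :: 'a::euclidean_space). 0 < \<epsilon> \<Longrightarrow> \<epsilon> \<le> \<bar>T\<bar> \<Longrightarrow>
   cmod (LINT \<xi>|lborel. cis (x \<bullet> \<xi>) * exp (- (Complex \<epsilon> \<bar>T\<bar> * of_real (norm \<xi> powr (2 * \<alpha>)))))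
    \<le> C * (1 + norm x) powr (real DIM('a) * max 0 (1 - \<alpha>) / (2 * \<alpha> - 1))"
  using kernel_bound_pos[OF \<alpha>, of "\<bar>T\<bar>", where 'a='a] T by auto
 show thesis
 proof (rule that[OF C(1)])
  fix \<epsilon> and x :: 'a assume \<epsilon>: "0 < \<epsilon>" "\<epsilon> \<le> \<bar>T\<bar>"
  show "cmod (LINT \<xi>|lborel. cis (x \<bullet> \<xi>) * exp (- (Complex \<epsilon> T * of_real (norm \<xi> powr (2 * \<alpha>)))))
    \<le> C * (1 + norm x) powr (real DIM('a) * max 0 (1 - \<alpha>) / (2 * \<alpha> - 1))"
  proof (cases "T > 0")
   case True
   thus ?thesis using C(2)[OF \<epsilon>, of x] by simp
  next
   case False
   hence "Complex \<epsilon> T = cnj (Complex \<epsilon> \<bar>T\<bar>)" by (simp add: complex_eq_iff)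
   hence eq: "cis (x \<bullet> \<xi>) * exp (- (Complex \<epsilon> T * of_real (norm \<xi> powr (2 * \<alpha>)))) = cnj (cis ((- x) \<bullet> \<xi>) * exp (- (Complex \<epsilon> \<bar>T\<bar> * of_real (norm \<xi> powr (2 * \<alpha>)))))" for \<xi>
    by (simp add: cis_cnj exp_cnj del: Complex_eq)
   show ?thesis using C(2)[OF \<epsilon>, of "- x"] unfolding eq Bochner_Integration.integral_cnj complex_mod_cnj norm_minus_cancel .
  qed
 qed
qed

section \<open>Hilbert-Schmidt operators\<close>

lemma finite_family_convergent_subseq:
 fixes a :: "'e \<Rightarrow> nat \<Rightarrow> real"
 assumes "finite S" "\<And>e. e \<in> S \<Longrightarrow> bounded (range (a e))"
 shows "\<exists>r::nat \<Rightarrow> nat. strict_mono r \<and> (\<forall>e\<in>S. convergent (a e \<circ> r))"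
 using assms
proof (induction S rule: finite_induct)
 case empty
 show ?case by (intro exI[of _ id]) (auto simp: strict_mono_def)
next
 case (insert x S)
 have "\<exists>r::nat \<Rightarrow> nat. strict_mono r \<and> (\<forall>e\<in>S. convergent (a e \<circ> r))"
  by (rule insert.IH) (use insert.prems in auto)
 then obtain r :: "nat \<Rightarrow> nat" where r: "strict_mono r" "\<forall>e\<in>S. convergent (a e \<circ> r)" by blast
 have "bounded (range (a x \<circ> r))" using insert.prems[of x] by (auto intro: bounded_subset)
 then obtain l s where s: "strict_mono s" "((a x \<circ> r) \<circ> s) \<longlonglongrightarrow> l"
  using bounded_imp_convergent_subsequence by blast
 have "convergent (a e \<circ> (r \<circ> s))" if "e \<in> insert x S" for e
 proof (cases "e = x")
  case True
  thus ?thesis using s by (auto simp: convergent_def o_assoc)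
 next
  case False
  hence "convergent (a e \<circ> r)" using that r by auto
  thus ?thesis using s(1) convergent_subseq_convergent[of "a e \<circ> r" s] by (simp add: o_assoc)
 qed
 moreover have "strict_mono (r \<circ> s)" using r s by (simp add: strict_mono_o)
 ultimately show ?case by blast
qed

text \<open>Finiteness is part of the notion: Hilbert-Schmidt norms enter only through bounds for
  sums over such sets, so no infinite bases are required.\<close>

definition orthonormal :: "'h::real_inner set \<Rightarrow> bool" where
 "orthonormal S \<longleftrightarrow> finite S \<and> pairwise orthogonal S \<and> (\<forall>e\<in>S. norm e = 1)"

lemma bessel_decomp:
 fixes d :: "'h::real_inner"
 assumes S: "orthonormal S"
 defines "v \<equiv> \<Sum>e\<in>S. (d \<bullet> e) *\<^sub>R e"
 shows "\<And>e. e \<in> S \<Longrightarrow> (d - v) \<bullet> e = 0" "norm (d - v) \<le> norm d" "(\<Sum>e\<in>S. (d \<bullet> e)\<^sup>2) \<le> (norm d)\<^sup>2"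
proof -
 have ee: "e \<bullet> e' = (if e = e' then 1 else 0)" if "e \<in> S" "e' \<in> S" for e e'
 proof (cases "e = e'")
  case True
  have "e \<bullet> e = (norm e)\<^sup>2" by (simp add: power2_norm_eq_inner)
  thus ?thesis using True S that by (simp add: orthonormal_def)
 next
  case False
  thus ?thesis using S that by (auto simp: orthonormal_def pairwise_def orthogonal_def)
 qed
 show 1: "(d - v) \<bullet> e = 0" if "e \<in> S" for e
 proof -
  have "v \<bullet> e = (\<Sum>e'\<in>S. (d \<bullet> e') * (if e' = e then 1 else 0))"
   unfolding v_def inner_sum_left by (intro sum.cong) (auto simp: ee that)
  also have "\<dots> = d \<bullet> e" using that S by (simp add: orthonormal_def if_distrib[of "(*) _"] sum.delta cong: if_cong)
  finally show ?thesis by (simp add: inner_diff_left)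
 qed
 have "(d - v) \<bullet> v = 0" using 1 unfolding v_def[symmetric] by (subst v_def, subst inner_sum_right) (simp add: v_def)
 hence pyth: "(norm d)\<^sup>2 = (norm (d - v))\<^sup>2 + (norm v)\<^sup>2"
  by (simp add: power2_norm_eq_inner inner_diff_left inner_diff_right inner_commute)
 have "(norm (d - v))\<^sup>2 \<le> (norm d)\<^sup>2" unfolding pyth by simp
 thus "norm (d - v) \<le> norm d" by (rule power2_le_imp_le) simp
 have "(norm v)\<^sup>2 = v \<bullet> v" by (simp add: power2_norm_eq_inner)
 also have "\<dots> = (\<Sum>e\<in>S. (d \<bullet> e) * (v \<bullet> e))" by (subst (2) v_def) (simp add: inner_sum_right)
 also have "\<dots> = (\<Sum>e\<in>S. (d \<bullet> e)\<^sup>2)" using 1 by (intro sum.cong) (auto simp: inner_diff_left power2_eq_square)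
 finally show "(\<Sum>e\<in>S. (d \<bullet> e)\<^sup>2) \<le> (norm d)\<^sup>2" using pyth by simp
qed

text \<open>\<open>P\<close> and \<open>Q\<close> stand for the restrictions to \<open>E\<close> and \<open>F\<close>, and \<open>U\<close> for the propagator. If \<open>Q U P\<close> is
 a Hilbert-Schmidt operator, an inequality that fails must fail at a vector fixed by both projections.\<close>

lemma annihilating_estimate:
 fixes U P Q :: "'h::{real_inner,complete_space} \<Rightarrow> 'h"
 assumes lin: "linear U" "linear P" "linear Q"
  and U: "\<And>x. norm (U x) = norm x" and P: "\<And>x. norm (P x) \<le> norm x" and Q: "\<And>x. norm (Q x) \<le> norm x"
  and HS: "\<And>S. orthonormal S \<Longrightarrow> (\<Sum>e\<in>S. (norm (Q (U (P e))))\<^sup>2) \<le> M"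
  and uniq: "\<And>f. P f = f \<Longrightarrow> Q (U f) = U f \<Longrightarrow> f = 0"
 shows "\<exists>C. \<forall>f. norm f \<le> C * (norm (f - P f) + norm (U f - Q (U f)))"
proof (rule ccontr)
 assume neg: "\<not> ?thesis"
 have Lc: "bounded_linear U" "bounded_linear P" "bounded_linear Q"
  using lin U P Q by (auto simp: linear_0 intro!: bounded_linear_intro[where K=1] linear_add linear_scale)
 define D where "D f = norm (f - P f) + norm (U f - Q (U f))" for f
 have Dscale: "D (c *\<^sub>R f) = \<bar>c\<bar> * D f" for c f
  using lin by (simp add: D_def linear_scale flip: scaleR_diff_right) (simp add: algebra_simps)
 have Ddiff: "D (f - g) \<le> D f + D g" for f g
 proof -
  have e: "f - g - P (f - g) = (f - P f) - (g - P g)" "U (f - g) - Q (U (f - g)) = (U f - Q (U f)) - (U g - Q (U g))"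
   using lin by (simp_all add: linear_diff)
  show ?thesis unfolding D_def e using norm_triangle_ineq4[of "f - P f" "g - P g"] norm_triangle_ineq4[of "U f - Q (U f)" "U g - Q (U g)"] by linarith
 qed
 have "\<exists>f. norm f = 1 \<and> D f \<le> 1 / real (Suc k)" for k
 proof -
  obtain g where g: "norm g > real (Suc k) * D g" using neg unfolding D_def by (meson not_le)
  have "D g \<ge> 0" by (simp add: D_def)
  hence ng: "norm g > 0" using g by (intro le_less_trans[OF mult_nonneg_nonneg g]) auto
  have "real (Suc k) * D g / norm g \<le> 1" using g ng by simp
  hence "D g / norm g \<le> 1 / real (Suc k)" by (simp add: field_simps del: of_nat_Suc)
  thus ?thesis using ng by (intro exI[of _ "(1 / norm g) *\<^sub>R g"]) (simp add: Dscale)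
 qed
 then obtain f where f: "\<And>k. norm (f k) = 1" "\<And>k. D (f k) \<le> 1 / real (Suc k)" by metis
 \<comment> \<open>A family on which the operator has norm above 1/2 has at most 4 M members. A
   maximal one spans the finite-dimensional subspace off which the operator is small.\<close>
 define good where "good S \<longleftrightarrow> orthonormal S \<and> (\<forall>e\<in>S. norm (Q (U (P e))) > 1 / 2)" for S
 have cardS: "real (card S) \<le> 4 * M" if "good S" for S
 proof -
  have "(\<Sum>e\<in>S. (1 / 2)\<^sup>2) \<le> (\<Sum>e\<in>S. (norm (Q (U (P e))))\<^sup>2)"
   using that by (intro sum_mono power_mono) (auto simp: good_def less_imp_le)
  also have "\<dots> \<le> M" using HS that by (simp add: good_def)
  finally show ?thesis by (simp add: power2_eq_square)
 qed
 have "good {}" by (simp add: good_def orthonormal_def)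
 moreover have "\<forall>S. good S \<longrightarrow> card S < nat \<lceil>4 * M\<rceil> + 1"
 proof (intro allI impI)
  fix S assume "good S"
  from cardS[OF this] show "card S < nat \<lceil>4 * M\<rceil> + 1" by linarith
 qed
 ultimately obtain S where S: "good S" "\<And>S'. good S' \<Longrightarrow> card S' \<le> card S"
  using ex_has_greatest_nat[of good "{}" card] by blast
 have oS: "orthonormal S" "finite S" using S(1) by (auto simp: good_def orthonormal_def)
 \<comment> \<open>Otherwise the normalised vector w could be added to S, against
   maximality.\<close>
 have perp: "norm (Q (U (P w))) \<le> 1 / 2 * norm w" if w: "\<And>e. e \<in> S \<Longrightarrow> w \<bullet> e = 0" for w
 proof (rule ccontr)
  assume c: "\<not> norm (Q (U (P w))) \<le> 1 / 2 * norm w"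
  have "w \<noteq> 0" using c lin by (auto simp: linear_0)
  define e where "e = (1 / norm w) *\<^sub>R w"
  have e1: "norm e = 1" using \<open>w \<noteq> 0\<close> by (simp add: e_def)
  have e2: "e \<bullet> e' = 0" if "e' \<in> S" for e' using w[OF that] by (simp add: e_def)
  have "e \<notin> S" using e2[of e] e1 by (auto simp: norm_eq_sqrt_inner)
  have "norm (Q (U (P e))) > 1 / 2" using c \<open>w \<noteq> 0\<close> lin by (simp add: e_def linear_scale field_simps)
  hence "good (insert e S)" using S(1) e1 e2
   by (auto simp: good_def orthonormal_def pairwise_insert orthogonal_def inner_commute)
  thus False using S(2)[of "insert e S"] \<open>e \<notin> S\<close> oS by simp
 qed
 have "bounded (range (\<lambda>k. f k \<bullet> e))" if "e \<in> S" for e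
 proof (rule boundedI)
  fix x assume "x \<in> range (\<lambda>k. f k \<bullet> e)"
  then obtain k where "x = f k \<bullet> e" by auto
  thus "norm x \<le> 1" using Cauchy_Schwarz_ineq2[of "f k" e] f(1) S that by (simp add: good_def orthonormal_def)
 qed
 then obtain r :: "nat \<Rightarrow> nat" where r: "strict_mono r" "\<forall>e\<in>S. convergent ((\<lambda>k. f k \<bullet> e) \<circ> r)"
  using finite_family_convergent_subseq[OF oS(2), of "\<lambda>e k. f k \<bullet> e"] by auto
 define g where "g = f \<circ> r"
 \<comment> \<open>The part of d orthogonal to S contributes at most half of \<open>norm d\<close>,
   which is absorbed on the left. So D and the finitely many coordinates along S control the norm,
   and a subsequence along which these coordinates converge is Cauchy.\<close>
 have est: "norm d \<le> 2 * D d + 2 * (\<Sum>e\<in>S. \<bar>d \<bullet> e\<bar>)" for d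
 proof -
  define v where "v = (\<Sum>e\<in>S. (d \<bullet> e) *\<^sub>R e)"
  note B = bessel_decomp[OF oS(1), where d=d, folded v_def]
  have "norm v \<le> (\<Sum>e\<in>S. norm ((d \<bullet> e) *\<^sub>R e))" unfolding v_def by (rule norm_sum)
  also have "\<dots> = (\<Sum>e\<in>S. \<bar>d \<bullet> e\<bar>)" using S by (intro sum.cong) (auto simp: good_def orthonormal_def)
  finally have v: "norm v \<le> (\<Sum>e\<in>S. \<bar>d \<bullet> e\<bar>)" .
  have "norm (Q (U (P (d - v)))) \<le> 1 / 2 * norm (d - v)" by (rule perp) (rule B(1))
  hence w: "norm (Q (U (P (d - v)))) \<le> 1 / 2 * norm d" using B(2) by simp
  have QUP: "norm (Q (U (P x))) \<le> norm x" for x using P[of x] U[of "P x"] Q[of "U (P x)"] by simp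
  have QU: "norm (Q (U x)) \<le> norm x" for x using U[of x] Q[of "U x"] by simp
  have ud: "U d = (U d - Q (U d)) + Q (U (d - P d)) + Q (U (P v)) + Q (U (P (d - v)))"
   using lin by (simp add: linear_diff)
  have "norm d \<le> norm (U d - Q (U d)) + norm (Q (U (d - P d))) + norm (Q (U (P v))) + norm (Q (U (P (d - v))))"
   using arg_cong[OF ud, of norm] U[of d] norm_triangle_ineq[of "(U d - Q (U d)) + Q (U (d - P d)) + Q (U (P v))" "Q (U (P (d - v)))"]
    norm_triangle_ineq[of "(U d - Q (U d)) + Q (U (d - P d))" "Q (U (P v))"] norm_triangle_ineq[of "U d - Q (U d)" "Q (U (d - P d))"] by linarith
  also have "\<dots> \<le> norm (U d - Q (U d)) + norm (d - P d) + (\<Sum>e\<in>S. \<bar>d \<bullet> e\<bar>) + 1 / 2 * norm d"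
   by (intro add_mono order_refl QU order_trans[OF QUP v] w)
  finally show ?thesis by (simp add: D_def)
 qed
 have D0: "(\<lambda>k. D (g k)) \<longlonglongrightarrow> 0"
 proof (rule tendsto_sandwich[OF _ _ tendsto_const])
  show "(\<lambda>k. 1 / real (Suc (r k))) \<longlonglongrightarrow> 0"
   using LIMSEQ_subseq_LIMSEQ[OF lim_inverse_n'[THEN LIMSEQ_Suc] r(1)] by (simp add: o_def inverse_eq_divide)
 qed (use f(2) in \<open>auto simp: g_def D_def intro!: always_eventually\<close>)
 have "Cauchy g"
 proof (rule metric_CauchyI)
  fix \<epsilon> :: real assume \<epsilon>: "\<epsilon> > 0"
  define s where "s k = (\<Sum>e\<in>S. \<bar>g k \<bullet> e - lim (\<lambda>k. g k \<bullet> e)\<bar>)" for k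
  have "(\<lambda>k. D (g k) + s k) \<longlonglongrightarrow> 0 + (\<Sum>e\<in>S. \<bar>lim (\<lambda>k. g k \<bullet> e) - lim (\<lambda>k. g k \<bullet> e)\<bar>)"
   unfolding s_def by (intro tendsto_intros D0 convergent_LIMSEQ_iff[THEN iffD1]) (use r(2) in \<open>auto simp: g_def o_def\<close>)
  hence "(\<lambda>k. D (g k) + s k) \<longlonglongrightarrow> 0" by simp
  then obtain N where N: "\<And>k. k \<ge> N \<Longrightarrow> D (g k) + s k < \<epsilon> / 4"
   using order_tendstoD(2)[of _ 0 sequentially "\<epsilon> / 4"] \<epsilon> by (force simp: eventually_sequentially)
  have "dist (g i) (g j) < \<epsilon>" if "i \<ge> N" "j \<ge> N" for i j
  proof -
   have "(\<Sum>e\<in>S. \<bar>(g i - g j) \<bullet> e\<bar>) \<le> s i + s j"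
    unfolding s_def sum.distrib[symmetric] by (intro sum_mono) (simp add: inner_diff_left)
   moreover have "D (g i - g j) \<le> D (g i) + D (g j)" by (rule Ddiff)
   ultimately have "norm (g i - g j) \<le> 2 * (D (g i) + s i) + 2 * (D (g j) + s j)" using est[of "g i - g j"] by simp
   thus ?thesis using N[OF that(1)] N[OF that(2)] by (simp add: dist_norm)
  qed
  thus "\<exists>N. \<forall>i\<ge>N. \<forall>j\<ge>N. dist (g i) (g j) < \<epsilon>" by blast
 qed
 then obtain h where h: "g \<longlonglongrightarrow> h" using Cauchy_convergent by (auto simp: convergent_def)
 have "(\<lambda>k. norm (g k)) \<longlonglongrightarrow> norm h" by (intro tendsto_intros h)
 hence n1: "norm h = 1" using f(1) by (simp add: g_def LIMSEQ_const_iff)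
 have "(\<lambda>k. D (g k)) \<longlonglongrightarrow> D h" unfolding D_def
  by (intro tendsto_intros h bounded_linear.tendsto[OF Lc(1)] bounded_linear.tendsto[OF Lc(2)] bounded_linear.tendsto[OF Lc(3)])
 hence "D h = 0" using D0 LIMSEQ_unique by blast
 hence "norm (h - P h) = 0" "norm (U h - Q (U h)) = 0" using norm_ge_zero[of "h - P h"] norm_ge_zero[of "U h - Q (U h)"] unfolding D_def by linarith+
 hence "h = 0" by (intro uniq) auto
 thus False using n1 by simp
qed

text \<open>On the span of S the operator Q U P preserves norms, so an orthonormal basis of it
  contributes one per dimension to the Hilbert-Schmidt sum.\<close>

lemma card_fixed_independent_le:
 fixes U P Q :: "'h::real_inner \<Rightarrow> 'h"
 assumes lin: "linear U" "linear P" "linear Q" and U: "\<And>x. norm (U x) = norm x"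
  and HS: "\<And>S. orthonormal S \<Longrightarrow> (\<Sum>e\<in>S. (norm (Q (U (P e))))\<^sup>2) \<le> M"
  and S: "finite S" "independent S" and fixed: "\<And>x. x \<in> S \<Longrightarrow> P x = x \<and> Q (U x) = U x"
 shows "real (card S) \<le> M"
proof -
 obtain C where C: "finite C" "card C \<le> card S" "span C = span S" "pairwise orthogonal C"
  using basis_orthogonal[OF S(1)] by blast
 define C' where "C' = C - {0}"
 have C': "finite C'" "span C' = span S" "pairwise orthogonal C'" "0 \<notin> C'"
  using C by (auto simp: C'_def span_delete_0 intro: pairwise_subset)
 define h where "h x = (1 / norm x) *\<^sub>R x" for x :: 'h
 have inj: "inj_on h C'"
 proof (rule inj_onI)
  fix x y assume xy: "x \<in> C'" "y \<in> C'" "h x = h y"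
  hence "x \<noteq> 0" "y \<noteq> 0" using C'(4) by auto
  show "x = y"
  proof (rule ccontr)
   assume "x \<noteq> y"
   hence "x \<bullet> y = 0" using C'(3) xy by (auto simp: pairwise_def orthogonal_def)
   hence "h x \<bullet> h y = 0" by (simp add: h_def)
   hence "h x \<bullet> h x = 0" using xy by simp
   thus False using \<open>x \<noteq> 0\<close> by (simp add: h_def)
  qed
 qed
 have on: "orthonormal (h ` C')"
  unfolding orthonormal_def
 proof (intro conjI)
  show "pairwise orthogonal (h ` C')"
   using C'(3) by (auto simp: pairwise_def orthogonal_def h_def)
 qed (use C' in \<open>auto simp: h_def\<close>)
 have "subspace {x. P x = x \<and> Q (U x) = U x}"
  using lin by (auto simp: subspace_def linear_0 linear_add linear_scale)
 hence fx: "P x = x \<and> Q (U x) = U x" if "x \<in> span S" for x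
  using span_minimal[of S "{x. P x = x \<and> Q (U x) = U x}"] fixed that by auto
 have fe: "norm (Q (U (P e))) = 1" if e: "e \<in> h ` C'" for e
 proof -
  obtain x where x: "x \<in> C'" "e = h x" using e by blast
  have "x \<in> span S" using span_base[OF x(1)] C'(2) by simp
  hence "e \<in> span S" unfolding x(2) h_def by (rule span_scale)
  moreover have "norm e = 1" using on e by (auto simp: orthonormal_def)
  ultimately show ?thesis using fx[of e] U[of e] by simp
 qed
 have "card S \<le> card C'" using independent_span_bound[OF C'(1) S(2)] C'(2) span_superset[of S] by auto
 also have "real (card C') = (\<Sum>e\<in>h ` C'. (norm (Q (U (P e))))\<^sup>2)" using fe by (simp add: card_image[OF inj])
 also have "\<dots> \<le> M" by (rule HS[OF on])
 finally show ?thesis by simp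
qed

section \<open>The Hilbert space of square integrable functions\<close>

text \<open>Borel rather than Lebesgue measurable representatives, so that translates, kernels on
  products and Fubini's theorem stay within Borel sets; Lebesgue measurable functions are attached
  at the end by \<open>rep\<close>.\<close>

definition sq_integrable :: "('a::euclidean_space \<Rightarrow> complex) set" where
 "sq_integrable = {f \<in> borel_measurable borel. integrable lborel (\<lambda>x. (cmod (f x))\<^sup>2)}"

lemma sq_measurable[measurable_dest]: "f \<in> sq_integrable \<Longrightarrow> f \<in> borel_measurable borel"
 by (simp add: sq_integrable_def)

lemma sq_integrableD: "f \<in> sq_integrable \<Longrightarrow> integrable lborel (\<lambda>x. (cmod (f x))\<^sup>2)"
 by (simp add: sq_integrable_def)

lemma sq_integrable_dominated:
 assumes g: "g \<in> sq_integrable" and f: "f \<in> borel_measurable borel" and le: "AE x in lborel. cmod (f x) \<le> K * cmod (g x)"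
 shows "f \<in> sq_integrable"
proof -
 have "integrable lborel (\<lambda>x. (cmod (f x))\<^sup>2)"
 proof (rule Bochner_Integration.integrable_bound[OF integrable_mult_right[OF sq_integrableD[OF g], of "K\<^sup>2"]])
  show "(\<lambda>x. (cmod (f x))\<^sup>2) \<in> borel_measurable lborel" using f by measurable
  show "AE x in lborel. norm ((cmod (f x))\<^sup>2) \<le> norm (K\<^sup>2 * (cmod (g x))\<^sup>2)"
   using le
  proof eventually_elim
   case (elim x)
   have "(cmod (f x))\<^sup>2 \<le> (K * cmod (g x))\<^sup>2" using elim by (intro power_mono) auto
   thus ?case by (simp add: power_mult_distrib)
  qed
 qed
 thus ?thesis using f by (simp add: sq_integrable_def)
qed

lemma sq_integrable_add:
 assumes f: "f \<in> sq_integrable" and g: "g \<in> sq_integrable"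
 shows "(\<lambda>x. f x + g x) \<in> sq_integrable"
proof -
 have "integrable lborel (\<lambda>x. (cmod (f x + g x))\<^sup>2)"
 proof (rule Bochner_Integration.integrable_bound)
  show "integrable lborel (\<lambda>x. 2 * (cmod (f x))\<^sup>2 + 2 * (cmod (g x))\<^sup>2)"
   using f g by (intro Bochner_Integration.integrable_add integrable_mult_right sq_integrableD)
  show "(\<lambda>x. (cmod (f x + g x))\<^sup>2) \<in> borel_measurable lborel" using f g by measurable
  show "AE x in lborel. norm ((cmod (f x + g x))\<^sup>2) \<le> norm (2 * (cmod (f x))\<^sup>2 + 2 * (cmod (g x))\<^sup>2)"
  proof (intro AE_I2)
   fix x
   have "(cmod (f x + g x))\<^sup>2 \<le> (cmod (f x) + cmod (g x))\<^sup>2" by (intro power_mono norm_triangle_ineq) auto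
   also have "\<dots> \<le> 2 * (cmod (f x))\<^sup>2 + 2 * (cmod (g x))\<^sup>2"
    using sum_squares_bound[of "cmod (f x)" "cmod (g x)"] by (simp add: power2_sum)
   finally show "norm ((cmod (f x + g x))\<^sup>2) \<le> norm (2 * (cmod (f x))\<^sup>2 + 2 * (cmod (g x))\<^sup>2)" by simp
  qed
 qed
 moreover have "(\<lambda>x. f x + g x) \<in> borel_measurable borel" using f g by measurable
 ultimately show ?thesis by (simp add: sq_integrable_def)
qed

lemma sq_integrable_mult:
 assumes f: "f \<in> sq_integrable" and m: "m \<in> borel_measurable borel" "\<And>x. cmod (m x) \<le> K"
 shows "(\<lambda>x. m x * f x) \<in> sq_integrable"
 by (rule sq_integrable_dominated[OF f, of _ K]) (use f m in \<open>auto simp: norm_mult intro!: mult_right_mono borel_measurable_times sq_measurable\<close>)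

lemma sq_integrable_cmult: "f \<in> sq_integrable \<Longrightarrow> (\<lambda>x. c * f x) \<in> sq_integrable"
 by (rule sq_integrable_mult[where K="cmod c"]) auto

lemma sq_integrable_scaleR: "f \<in> sq_integrable \<Longrightarrow> (\<lambda>x. r *\<^sub>R f x) \<in> sq_integrable"
 using sq_integrable_cmult[of f "of_real r"] by (simp add: scaleR_conv_of_real)

lemma sq_integrable_diff: "f \<in> sq_integrable \<Longrightarrow> g \<in> sq_integrable \<Longrightarrow> (\<lambda>x. f x - g x) \<in> sq_integrable"
 using sq_integrable_add[of f "\<lambda>x. - 1 * g x"] sq_integrable_cmult[of g "-1"] by simp

lemma sq_integrable_uminus: "f \<in> sq_integrable \<Longrightarrow> (\<lambda>x. - f x) \<in> sq_integrable"
 using sq_integrable_cmult[of f "-1"] by simp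

lemma borel_measurable_cnj[measurable]:
 "f \<in> borel_measurable M \<Longrightarrow> (\<lambda>x. cnj (f x)) \<in> borel_measurable M"
 by (rule measurable_compose[where g=cnj]) (auto intro!: borel_measurable_continuous_onI continuous_intros)

lemma sq_integrable_cnj: "f \<in> sq_integrable \<Longrightarrow> (\<lambda>x. cnj (f x)) \<in> sq_integrable"
 by (rule sq_integrable_dominated[of f _ 1]) (auto intro: sq_measurable)

lemma sq_integrable_0: "(\<lambda>_. 0) \<in> sq_integrable" by (simp add: sq_integrable_def)

lemma integrable_mult_sq:
 assumes f: "f \<in> sq_integrable" and g: "g \<in> sq_integrable"
 shows "integrable lborel (\<lambda>x. f x * g x)"
proof (rule Bochner_Integration.integrable_bound)
 show "integrable lborel (\<lambda>x. (cmod (f x))\<^sup>2 + (cmod (g x))\<^sup>2)"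
  using f g by (intro Bochner_Integration.integrable_add sq_integrableD)
 show "(\<lambda>x. f x * g x) \<in> borel_measurable lborel" using f g by measurable
 show "AE x in lborel. norm (f x * g x) \<le> norm ((cmod (f x))\<^sup>2 + (cmod (g x))\<^sup>2)"
 proof (intro AE_I2)
  fix x
  have "0 \<le> cmod (f x) * cmod (g x)" by simp
  moreover have "2 * (cmod (f x) * cmod (g x)) \<le> (cmod (f x))\<^sup>2 + (cmod (g x))\<^sup>2"
   using sum_squares_bound[of "cmod (f x)" "cmod (g x)"] by simp
  ultimately have "cmod (f x) * cmod (g x) \<le> (cmod (f x))\<^sup>2 + (cmod (g x))\<^sup>2" by linarith
  thus "norm (f x * g x) \<le> norm ((cmod (f x))\<^sup>2 + (cmod (g x))\<^sup>2)" by (simp add: norm_mult)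
 qed
qed

definition l2_rel :: "('a::euclidean_space \<Rightarrow> complex) \<Rightarrow> ('a \<Rightarrow> complex) \<Rightarrow> bool" where
 "l2_rel f g \<longleftrightarrow> f \<in> sq_integrable \<and> g \<in> sq_integrable \<and> (AE x in lborel. f x = g x)"

quotient_type (overloaded) 'a l2 = "'a::euclidean_space \<Rightarrow> complex" / partial: l2_rel
 morphisms fun_l2 mk
proof (rule part_equivpI)
 show "\<exists>x. l2_rel x x" by (intro exI[of _ "\<lambda>_. 0"]) (simp add: l2_rel_def sq_integrable_0)
 show "symp l2_rel" by (auto simp: symp_def l2_rel_def elim: eventually_mono)
 show "transp l2_rel"
 proof (rule transpI)
  fix f g h assume "l2_rel f g" "l2_rel g h"
  hence fh: "f \<in> sq_integrable" "h \<in> sq_integrable" "AE x in lborel. f x = g x" "AE x in lborel. g x = h x"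
   by (auto simp: l2_rel_def)
  from fh(3,4) have "AE x in lborel. f x = h x" by eventually_elim simp
  thus "l2_rel f h" using fh by (simp add: l2_rel_def)
 qed
qed

lemma mk_eq_iff: "f \<in> sq_integrable \<Longrightarrow> g \<in> sq_integrable \<Longrightarrow> mk f = mk g \<longleftrightarrow> (AE x in lborel. f x = g x)"
 using Quotient_rel[OF Quotient_l2, of f g] Quotient_refl1 by (auto simp: l2_rel_def)

definition fn :: "'a::euclidean_space l2 \<Rightarrow> 'a \<Rightarrow> complex" where
 "fn x = (SOME f. f \<in> sq_integrable \<and> mk f = x)"

lemma fn: "fn x \<in> sq_integrable" "mk (fn x) = x"
proof -
 have "\<exists>f. f \<in> sq_integrable \<and> mk f = x"
  using Quotient_rep_reflp[OF Quotient_l2, of x] Quotient_abs_rep[OF Quotient_l2, of x] unfolding l2_rel_def by blast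
 from someI_ex[OF this] show "fn x \<in> sq_integrable" "mk (fn x) = x" unfolding fn_def by auto
qed

lemma fn_mk: "f \<in> sq_integrable \<Longrightarrow> AE x in lborel. fn (mk f) x = f x"
 using mk_eq_iff[of "fn (mk f)" f] fn[of "mk f"] by simp

lemma l2_eq_iff: "x = y \<longleftrightarrow> (AE t in lborel. fn x t = fn y t)"
 using mk_eq_iff[OF fn(1) fn(1), of x y] by (simp add: fn)

lemma eq_mk_iff: "f \<in> sq_integrable \<Longrightarrow> x = mk f \<longleftrightarrow> (AE t in lborel. fn x t = f t)"
 using mk_eq_iff[OF fn(1), of f x] by (simp add: fn)

text \<open>Only real scalars belong to the vector space structure; complex ones act through
  multiplication by constant functions.\<close>

instantiation l2 :: (euclidean_space) real_vector
begin

definition zero_l2 :: "'a l2" where "zero_l2 = mk (\<lambda>_. 0)"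
definition plus_l2 :: "'a l2 \<Rightarrow> 'a l2 \<Rightarrow> 'a l2" where "plus_l2 x y = mk (\<lambda>t. fn x t + fn y t)"
definition minus_l2 :: "'a l2 \<Rightarrow> 'a l2 \<Rightarrow> 'a l2" where "minus_l2 x y = mk (\<lambda>t. fn x t - fn y t)"
definition uminus_l2 :: "'a l2 \<Rightarrow> 'a l2" where "uminus_l2 x = mk (\<lambda>t. - fn x t)"
definition scaleR_l2 :: "real \<Rightarrow> 'a l2 \<Rightarrow> 'a l2" where "scaleR_l2 r x = mk (\<lambda>t. r *\<^sub>R fn x t)"

lemma fn_ops:
 "AE t in lborel. fn (0 :: 'a l2) t = 0"
 "AE t in lborel. fn (x + y) t = fn x t + fn y t"
 "AE t in lborel. fn (x - y) t = fn x t - fn y t"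
 "AE t in lborel. fn (- x) t = - fn x t"
 "AE t in lborel. fn (r *\<^sub>R x) t = r *\<^sub>R fn x t"
 for x y :: "'a l2"
 unfolding zero_l2_def plus_l2_def minus_l2_def uminus_l2_def scaleR_l2_def
 by (intro fn_mk sq_integrable_0 sq_integrable_add sq_integrable_diff sq_integrable_uminus sq_integrable_scaleR fn(1))+

instance
proof
 fix x y z :: "'a l2" and r s :: real
 show "x + y + z = x + (y + z)" unfolding l2_eq_iff
  using fn_ops(2)[of "x + y" z] fn_ops(2)[of x "y + z"] fn_ops(2)[of x y] fn_ops(2)[of y z]
  by eventually_elim simp
 show "x + y = y + x" unfolding l2_eq_iff using fn_ops(2)[of x y] fn_ops(2)[of y x] by eventually_elim simp
 show "0 + x = x" unfolding l2_eq_iff using fn_ops(2)[of 0 x] fn_ops(1) by eventually_elim simp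
 show "- x + x = 0" unfolding l2_eq_iff using fn_ops(2)[of "- x" x] fn_ops(4)[of x] fn_ops(1) by eventually_elim simp
 show "x - y = x + - y" unfolding l2_eq_iff using fn_ops(2)[of x "- y"] fn_ops(4)[of y] fn_ops(3)[of x y] by eventually_elim simp
 show "r *\<^sub>R (x + y) = r *\<^sub>R x + r *\<^sub>R y" unfolding l2_eq_iff
  using fn_ops(2)[of x y] fn_ops(2)[of "r *\<^sub>R x" "r *\<^sub>R y"] fn_ops(5)[of r x] fn_ops(5)[of r y] fn_ops(5)[of r "x + y"]
  by eventually_elim (simp add: scaleR_add_right)
 show "(r + s) *\<^sub>R x = r *\<^sub>R x + s *\<^sub>R x" unfolding l2_eq_iff
  using fn_ops(5)[of "r + s" x] fn_ops(2)[of "r *\<^sub>R x" "s *\<^sub>R x"] fn_ops(5)[of r x] fn_ops(5)[of s x]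
  by eventually_elim (simp add: scaleR_add_left)
 show "r *\<^sub>R s *\<^sub>R x = (r * s) *\<^sub>R x" unfolding l2_eq_iff
  using fn_ops(5)[of "r * s" x] fn_ops(5)[of s x] fn_ops(5)[of r "s *\<^sub>R x"] by eventually_elim simp
 show "1 *\<^sub>R x = x" unfolding l2_eq_iff using fn_ops(5)[of 1 x] by eventually_elim simp
qed

end

instantiation l2 :: (euclidean_space) real_inner
begin

definition inner_l2 :: "'a l2 \<Rightarrow> 'a l2 \<Rightarrow> real" where "inner_l2 x y = Re (LINT t|lborel. fn x t * cnj (fn y t))"
definition norm_l2 :: "'a l2 \<Rightarrow> real" where "norm_l2 x = sqrt (inner x x)"
definition sgn_l2 :: "'a l2 \<Rightarrow> 'a l2" where "sgn_l2 x = x /\<^sub>R norm x"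
definition dist_l2 :: "'a l2 \<Rightarrow> 'a l2 \<Rightarrow> real" where "dist_l2 x y = norm (x - y)"
definition uniformity_l2 :: "('a l2 \<times> 'a l2) filter" where
 "uniformity_l2 = (INF e\<in>{0 <..}. principal {(x, y). dist x y < e})"
definition open_l2 :: "'a l2 set \<Rightarrow> bool" where
 "open_l2 U = (\<forall>x\<in>U. eventually (\<lambda>(x', y). x' = x \<longrightarrow> y \<in> U) uniformity)"

lemma inner_integrable: "integrable lborel (\<lambda>t. fn x t * cnj (fn y t))" for x y :: "'a l2"
 by (intro integrable_mult_sq sq_integrable_cnj fn)

lemma inner_l2_self: "inner x x = (LINT t|lborel. (cmod (fn x t))\<^sup>2)" for x :: "'a l2"
proof -
 have "inner x x = (LINT t|lborel. Re (fn x t * cnj (fn x t)))"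
  unfolding inner_l2_def by (rule integral_Re[OF inner_integrable, symmetric])
 also have "(\<lambda>t. Re (fn x t * cnj (fn x t))) = (\<lambda>t. (cmod (fn x t))\<^sup>2)"
  by (simp add: fun_eq_iff cmod_power2) (simp add: power2_eq_square)
 finally show ?thesis .
qed

instance
proof
 fix x y z :: "'a l2" and r s :: real
 show "sgn x = x /\<^sub>R norm x" by (rule sgn_l2_def)
 show "dist x y = norm (x - y)" by (rule dist_l2_def)
 show "(uniformity :: ('a l2 \<times> 'a l2) filter) = (INF e\<in>{0 <..}. principal {(x, y). dist x y < e})" by (rule uniformity_l2_def)
 show "open U \<longleftrightarrow> (\<forall>x\<in>U. eventually (\<lambda>(x', y). x' = x \<longrightarrow> y \<in> U) uniformity)" for U :: "'a l2 set" by (rule open_l2_def)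
 show "norm x = sqrt (inner x x)" by (rule norm_l2_def)
 have "Re (LINT t|lborel. fn x t * cnj (fn y t)) = Re (cnj (LINT t|lborel. fn x t * cnj (fn y t)))" by simp
 also have "cnj (LINT t|lborel. fn x t * cnj (fn y t)) = (LINT t|lborel. fn y t * cnj (fn x t))"
  unfolding Bochner_Integration.integral_cnj[symmetric] by (simp add: mult.commute)
 finally show "inner x y = inner y x" by (simp add: inner_l2_def)
 have "(LINT t|lborel. fn (x + y) t * cnj (fn z t)) = (LINT t|lborel. fn x t * cnj (fn z t) + fn y t * cnj (fn z t))"
  using fn[of x] fn[of y] fn[of z] fn[of "x + y"]
  by (intro integral_cong_AE borel_measurable_add borel_measurable_times borel_measurable_cnj)
    (use fn_ops(2)[of x y] in \<open>auto simp: algebra_simps sq_measurable elim: eventually_mono\<close>)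
 thus "inner (x + y) z = inner x z + inner y z"
  unfolding inner_l2_def by (simp add: Bochner_Integration.integral_add[OF inner_integrable inner_integrable])
 have "(LINT t|lborel. fn (r *\<^sub>R x) t * cnj (fn y t)) = (LINT t|lborel. of_real r * (fn x t * cnj (fn y t)))"
  by (intro integral_cong_AE) (use fn_ops(5)[of r x] fn[of x] fn[of y] fn[of "r *\<^sub>R x"] in \<open>auto simp: scaleR_conv_of_real algebra_simps sq_measurable elim: eventually_mono\<close>)
 thus "inner (r *\<^sub>R x) y = r * inner x y" unfolding inner_l2_def by simp
 show "0 \<le> inner x x" unfolding inner_l2_self by (intro integral_nonneg_AE AE_I2) auto
 show "inner x x = 0 \<longleftrightarrow> x = 0"
 proof -
  have "inner x x = 0 \<longleftrightarrow> (AE t in lborel. (cmod (fn x t))\<^sup>2 = 0)"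
   unfolding inner_l2_self by (rule integral_nonneg_eq_0_iff_AE[OF sq_integrableD[OF fn(1)]]) auto
  also have "\<dots> \<longleftrightarrow> x = 0" unfolding zero_l2_def eq_mk_iff[OF sq_integrable_0] by simp
  finally show ?thesis .
 qed
qed

end

lemma norm_l2_sq: "(norm (x :: 'a::euclidean_space l2))\<^sup>2 = (LINT t|lborel. (cmod (fn x t))\<^sup>2)"
 unfolding power2_norm_eq_inner[of x] by (rule inner_l2_self)

lemma mk_ops:
 fixes f g :: "'a::euclidean_space \<Rightarrow> complex"
 assumes f: "f \<in> sq_integrable" and g: "g \<in> sq_integrable"
 shows "mk f + mk g = mk (\<lambda>t. f t + g t)" "mk f - mk g = mk (\<lambda>t. f t - g t)" "r *\<^sub>R mk f = mk (\<lambda>t. r *\<^sub>R f t)"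
proof -
 show "mk f + mk g = mk (\<lambda>t. f t + g t)" unfolding eq_mk_iff[OF sq_integrable_add[OF f g]]
  using fn_ops(2)[of "mk f" "mk g"] fn_mk[OF f] fn_mk[OF g] by eventually_elim simp
 show "mk f - mk g = mk (\<lambda>t. f t - g t)" unfolding eq_mk_iff[OF sq_integrable_diff[OF f g]]
  using fn_ops(3)[of "mk f" "mk g"] fn_mk[OF f] fn_mk[OF g] by eventually_elim simp
 show "r *\<^sub>R mk f = mk (\<lambda>t. r *\<^sub>R f t)" unfolding eq_mk_iff[OF sq_integrable_scaleR[OF f]]
  using fn_ops(5)[of r "mk f"] fn_mk[OF f] by eventually_elim simp
qed

lemma norm_mk_sq:
 assumes f: "f \<in> sq_integrable"
 shows "(norm (mk f))\<^sup>2 = (LINT t|lborel. (cmod (f t))\<^sup>2)"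
 unfolding norm_l2_sq by (rule integral_cong_AE) (use fn_mk[OF f] fn(1)[of "mk f"] f in \<open>auto elim: eventually_mono\<close>)

lemma inner_mk:
 assumes f: "f \<in> sq_integrable" and g: "g \<in> sq_integrable"
 shows "inner (mk f) (mk g) = Re (LINT t|lborel. f t * cnj (g t))"
proof -
 have "(LINT t|lborel. fn (mk f) t * cnj (fn (mk g) t)) = (LINT t|lborel. f t * cnj (g t))"
 proof (rule integral_cong_AE)
  show "AE t in lborel. fn (mk f) t * cnj (fn (mk g) t) = f t * cnj (g t)"
   using fn_mk[OF f] fn_mk[OF g] by eventually_elim simp
 qed (use fn(1)[of "mk f"] fn(1)[of "mk g"] f g in measurable)
 thus ?thesis by (simp add: inner_l2_def)
qed

lemma nn_norm_mk:
 assumes f: "f \<in> sq_integrable"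
 shows "(\<integral>\<^sup>+ t. ennreal ((cmod (f t))\<^sup>2) \<partial>lborel) = ennreal ((norm (mk f))\<^sup>2)"
 unfolding norm_mk_sq[OF f] by (rule nn_integral_eq_integral[OF sq_integrableD[OF f]]) auto

lemma tendsto_nn_imp:
 assumes "\<And>n. f n \<in> sq_integrable" "g \<in> sq_integrable" "((\<lambda>n. \<integral>\<^sup>+ t. ennreal ((cmod (f n t - g t))\<^sup>2) \<partial>lborel) \<longlongrightarrow> 0) F"
 shows "((\<lambda>n. mk (f n)) \<longlongrightarrow> mk g) F"
proof -
 have "((\<lambda>n. ennreal ((norm (mk (f n) - mk g))\<^sup>2)) \<longlongrightarrow> ennreal 0) F"
  using assms(3) unfolding nn_norm_mk[OF sq_integrable_diff[OF assms(1,2)]] mk_ops(2)[OF assms(1,2)] by simp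
 hence "((\<lambda>n. (norm (mk (f n) - mk g))\<^sup>2) \<longlongrightarrow> 0) F" by (subst (asm) tendsto_ennreal_iff) auto
 hence "((\<lambda>n. sqrt ((norm (mk (f n) - mk g))\<^sup>2)) \<longlongrightarrow> sqrt 0) F" by (rule tendsto_real_sqrt)
 thus ?thesis by (simp add: tendsto_norm_zero_iff LIM_zero_iff)
qed

instantiation l2 :: (euclidean_space) complete_space
begin

instance
proof
 fix X :: "nat \<Rightarrow> 'a l2" assume X: "Cauchy X"
 \<comment> \<open>A square integrable positive weight turns an L2-Cauchy sequence into an L1-Cauchy
   one by Cauchy-Schwarz. This yields a subsequence converging almost everywhere, and division by
   the nonvanishing weight recovers the limit of the original functions.\<close>
 define w where "w t = complex_of_real (exp (- (1 * (norm t)\<^sup>2)))" for t :: 'a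
 have wb: "integrable lborel (\<lambda>t::'a. exp (- (2 * (norm t)\<^sup>2)))" by (rule integrable_gaussian) simp
 have w: "w \<in> sq_integrable"
 proof -
  have "(\<lambda>t. (cmod (w t))\<^sup>2) = (\<lambda>t::'a. exp (- (2 * (norm t)\<^sup>2)))" by (simp add: w_def fun_eq_iff exp_double[symmetric])
  moreover have "w \<in> borel_measurable borel" unfolding w_def by measurable
  ultimately show ?thesis using wb by (simp add: sq_integrable_def)
 qed
 define s where "s n t = fn (X n) t * w t" for n t
 have sint: "integrable lborel (s n)" for n unfolding s_def by (intro integrable_mult_sq fn w)
 have sd: "(LINT t|lborel. norm (s i t - s j t)) \<le> norm (X i - X j) * norm (mk w)" for i j
 proof -
  define u v where "u t = complex_of_real (cmod (fn (X i) t - fn (X j) t))" and "v t = complex_of_real (cmod (w t))" for t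
  have um: "u \<in> borel_measurable borel" unfolding u_def using fn(1)[of "X i"] fn(1)[of "X j"] by measurable
  have vm: "v \<in> borel_measurable borel" unfolding v_def using w by measurable
  have u: "u \<in> sq_integrable" by (rule sq_integrable_dominated[OF sq_integrable_diff[OF fn(1)[of "X i"] fn(1)[of "X j"]] um, of 1])
   (simp add: u_def)
  have v: "v \<in> sq_integrable" by (rule sq_integrable_dominated[OF w vm, of 1]) (simp add: v_def)
  have "(LINT t|lborel. norm (s i t - s j t)) = Re (LINT t|lborel. u t * cnj (v t))"
   by (subst integral_Re[OF integrable_mult_sq[OF u sq_integrable_cnj[OF v]], symmetric])
     (simp add: s_def u_def v_def norm_mult flip: left_diff_distrib)
  also have "\<dots> = inner (mk u) (mk v)" by (rule inner_mk[OF u v, symmetric])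
  also have "\<dots> \<le> norm (mk u) * norm (mk v)" by (rule norm_cauchy_schwarz)
  also have "norm (mk u) = norm (X i - X j)"
  proof -
   have "(LINT t|lborel. (cmod (u t))\<^sup>2) = (LINT t|lborel. (cmod (fn (X i - X j) t))\<^sup>2)"
   proof (rule integral_cong_AE)
    show "(\<lambda>t. (cmod (u t))\<^sup>2) \<in> borel_measurable lborel" using um by measurable
    show "(\<lambda>t. (cmod (fn (X i - X j) t))\<^sup>2) \<in> borel_measurable lborel" using fn(1)[of "X i - X j"] by measurable
    show "AE t in lborel. (cmod (u t))\<^sup>2 = (cmod (fn (X i - X j) t))\<^sup>2"
     using fn_ops(3)[of "X i" "X j"] by eventually_elim (simp add: u_def)
   qed
   hence "(norm (mk u))\<^sup>2 = (norm (X i - X j))\<^sup>2" by (simp only: norm_mk_sq[OF u] norm_l2_sq[of "X i - X j"])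
   thus ?thesis by simp
  qed
  also have "norm (mk v) = norm (mk w)"
  proof -
   have "(norm (mk v))\<^sup>2 = (norm (mk w))\<^sup>2" unfolding norm_mk_sq[OF v] norm_mk_sq[OF w] by (simp add: v_def)
   thus ?thesis by simp
  qed
  finally show ?thesis .
 qed
 obtain r where r: "strict_mono r" "AE t in lborel. Cauchy (\<lambda>i. s (r i) t)"
 proof (rule cauchy_L1_AE_cauchy_subseq[OF sint])
  fix e :: real assume e: "e > 0"
  have "e / (norm (mk w) + 1) > 0" using e by (simp add: add_nonneg_pos)
  then obtain N where N: "\<And>i j. i \<ge> N \<Longrightarrow> j \<ge> N \<Longrightarrow> norm (X i - X j) < e / (norm (mk w) + 1)"
   using X unfolding Cauchy_iff by blast
  show "\<exists>N. \<forall>i\<ge>N. \<forall>j\<ge>N. (LINT t|lborel. norm (s i t - s j t)) < e"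
  proof (intro exI allI impI)
   fix i j assume ij: "i \<ge> N" "j \<ge> N"
   have "(LINT t|lborel. norm (s i t - s j t)) \<le> norm (X i - X j) * norm (mk w)" by (rule sd)
   also have "\<dots> \<le> e / (norm (mk w) + 1) * norm (mk w)" using N[OF ij] by (intro mult_right_mono) auto
   also have "\<dots> < e"
   proof -
    have p: "norm (mk w) + 1 > 0" by (simp add: add_nonneg_pos)
    show ?thesis by (simp only: times_divide_eq_left pos_divide_less_eq[OF p]) (simp add: algebra_simps e)
   qed
   finally show "(LINT t|lborel. norm (s i t - s j t)) < e" .
  qed
 qed
 define f where "f t = lim (\<lambda>i. fn (X (r i)) t)" for t
 have fm: "f \<in> borel_measurable borel" unfolding f_def by (intro borel_measurable_lim_metric sq_measurable[OF fn(1)])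
 have lim: "AE t in lborel. (\<lambda>i. fn (X (r i)) t) \<longlonglongrightarrow> f t"
  using r(2)
 proof eventually_elim
  case (elim t)
  have "w t \<noteq> 0" by (simp add: w_def)
  obtain l where "(\<lambda>i. s (r i) t) \<longlonglongrightarrow> l" using elim Cauchy_convergent by (auto simp: convergent_def)
  hence "(\<lambda>i. s (r i) t / w t) \<longlonglongrightarrow> l / w t" using \<open>w t \<noteq> 0\<close> by (intro tendsto_intros)
  hence "(\<lambda>i. fn (X (r i)) t) \<longlonglongrightarrow> l / w t" using \<open>w t \<noteq> 0\<close> by (simp add: s_def)
  thus ?case unfolding f_def by (simp add: limI)
 qed
 \<comment> \<open>Fatou's lemma passes from Cauchy differences to the distance from the pointwise
   limit; it shows both that \<open>f\<close> is square integrable and that the subsequence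
   converges to it in norm.\<close>
 have fatou: "(\<integral>\<^sup>+ t. ennreal ((cmod (fn (X (r k)) t - f t))\<^sup>2) \<partial>lborel) \<le> ennreal (e\<^sup>2)"
  if e: "\<And>i. i \<ge> N \<Longrightarrow> norm (X (r k) - X (r i)) \<le> e" for k N e
 proof -
  have "(\<integral>\<^sup>+ t. ennreal ((cmod (fn (X (r k)) t - f t))\<^sup>2) \<partial>lborel) =
   (\<integral>\<^sup>+ t. liminf (\<lambda>i. ennreal ((cmod (fn (X (r k)) t - fn (X (r i)) t))\<^sup>2)) \<partial>lborel)"
   using lim
  proof (intro nn_integral_cong_AE, eventually_elim)
   case (elim t)
   have "(\<lambda>i. ennreal ((cmod (fn (X (r k)) t - fn (X (r i)) t))\<^sup>2)) \<longlonglongrightarrow> ennreal ((cmod (fn (X (r k)) t - f t))\<^sup>2)"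
    by (intro tendsto_ennrealI tendsto_intros elim)
   from lim_imp_Liminf[OF _ this] show ?case by simp
  qed
  also have "\<dots> \<le> liminf (\<lambda>i. \<integral>\<^sup>+ t. ennreal ((cmod (fn (X (r k)) t - fn (X (r i)) t))\<^sup>2) \<partial>lborel)"
  proof (rule nn_integral_liminf)
   show "(\<lambda>t. ennreal ((cmod (fn (X (r k)) t - fn (X (r i)) t))\<^sup>2)) \<in> borel_measurable lborel" for i
    using sq_measurable[OF sq_integrable_diff[OF fn(1)[of "X (r k)"] fn(1)[of "X (r i)"]]] by measurable
  qed
  also have "(\<lambda>i. \<integral>\<^sup>+ t. ennreal ((cmod (fn (X (r k)) t - fn (X (r i)) t))\<^sup>2) \<partial>lborel) = (\<lambda>i. ennreal ((norm (X (r k) - X (r i)))\<^sup>2))"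
   unfolding nn_norm_mk[OF sq_integrable_diff[OF fn(1) fn(1)]] mk_ops(2)[OF fn(1) fn(1), symmetric] fn(2) ..
  also have "liminf (\<lambda>i. ennreal ((norm (X (r k) - X (r i)))\<^sup>2)) \<le> ennreal (e\<^sup>2)"
  proof (rule Liminf_le)
   show "\<forall>\<^sub>F i in sequentially. ennreal ((norm (X (r k) - X (r i)))\<^sup>2) \<le> ennreal (e\<^sup>2)"
    using eventually_ge_at_top[of N] by eventually_elim (intro ennreal_leI power_mono e, auto)
  qed simp
  finally show ?thesis .
 qed
 have small: "\<exists>N. \<forall>k\<ge>N. \<forall>i\<ge>N. norm (X (r k) - X (r i)) \<le> e" if e: "e > 0" for e
 proof -
  obtain N where N: "\<forall>m\<ge>N. \<forall>n\<ge>N. norm (X m - X n) < e" using X e unfolding Cauchy_iff by blast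
  have "r k \<ge> N" if "k \<ge> N" for k using seq_suble[OF r(1), of k] that by simp
  thus ?thesis using N by (intro exI[of _ N]) (auto intro: less_imp_le)
 qed
 have fsq: "f \<in> sq_integrable"
 proof -
  obtain N where N: "\<forall>k\<ge>N. \<forall>i\<ge>N. norm (X (r k) - X (r i)) \<le> 1" using small[of 1] by auto
  have "(\<integral>\<^sup>+ t. ennreal ((cmod (fn (X (r N)) t - f t))\<^sup>2) \<partial>lborel) \<le> ennreal (1\<^sup>2)" by (rule fatou[of N]) (use N in auto)
  hence "(\<integral>\<^sup>+ t. ennreal ((cmod (fn (X (r N)) t - f t))\<^sup>2) \<partial>lborel) < \<infinity>" by (rule le_less_trans) simp
  hence "(\<lambda>t. fn (X (r N)) t - f t) \<in> sq_integrable"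
   unfolding sq_integrable_def using fm sq_measurable[OF fn(1)[of "X (r N)"]]
   by (auto intro!: integrableI_bounded)
  from sq_integrable_diff[OF fn(1)[of "X (r N)"] this] show ?thesis by simp
 qed
 have "(\<lambda>k. X (r k)) \<longlonglongrightarrow> mk f"
 proof (rule metric_LIMSEQ_I)
  fix e :: real assume e: "e > 0"
  obtain N where N: "\<forall>k\<ge>N. \<forall>i\<ge>N. norm (X (r k) - X (r i)) \<le> e / 2" using small[of "e / 2"] e by auto
  have "dist (X (r k)) (mk f) < e" if "k \<ge> N" for k
  proof -
   have "ennreal ((norm (X (r k) - mk f))\<^sup>2) \<le> ennreal ((e / 2)\<^sup>2)"
    using fatou[of N k "e / 2"] N that nn_norm_mk[OF sq_integrable_diff[OF fn(1)[of "X (r k)"] fsq]] mk_ops(2)[OF fn(1)[of "X (r k)"] fsq] by (simp add: fn)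
   hence "(norm (X (r k) - mk f))\<^sup>2 \<le> (e / 2)\<^sup>2" by simp
   hence "norm (X (r k) - mk f) \<le> e / 2" by (rule power2_le_imp_le) (use e in simp)
   thus ?thesis using e by (simp add: dist_norm)
  qed
  thus "\<exists>N. \<forall>k\<ge>N. dist (X (r k)) (mk f) < e" by blast
 qed
 hence "(X \<circ> r) \<longlonglongrightarrow> mk f" by (simp add: o_def)
 with X r(1) show "convergent X" using Cauchy_converges_subseq by (auto simp: convergent_def)
qed

end

lemma tendsto_dominated:
 assumes f: "\<And>n. f n \<in> borel_measurable borel" and h: "h \<in> sq_integrable" and g: "g \<in> borel_measurable borel"
  and le: "\<And>n. AE t in lborel. cmod (f n t) \<le> K * cmod (h t)"
  and lim: "AE t in lborel. (\<lambda>n. f n t) \<longlonglongrightarrow> g t"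
 shows "g \<in> sq_integrable" "(\<lambda>n. mk (f n)) \<longlonglongrightarrow> mk g"
proof -
 have fs: "f n \<in> sq_integrable" for n by (rule sq_integrable_dominated[OF h f le])
 have le': "AE t in lborel. \<forall>n. cmod (f n t) \<le> K * cmod (h t)" using le by (simp add: AE_all_countable)
 have gle: "AE t in lborel. cmod (g t) \<le> K * cmod (h t)"
  using le' lim
 proof eventually_elim
  case (elim t)
  show ?case by (rule LIMSEQ_le_const2[OF tendsto_norm[OF elim(2)]]) (use elim(1) in auto)
 qed
 show gs: "g \<in> sq_integrable" by (rule sq_integrable_dominated[OF h g gle])
 show "(\<lambda>n. mk (f n)) \<longlonglongrightarrow> mk g"
 proof (rule tendsto_nn_imp[OF fs gs])
  have "(\<lambda>n. \<integral>\<^sup>+ t. ennreal ((cmod (f n t - g t))\<^sup>2) \<partial>lborel) \<longlonglongrightarrow> (\<integral>\<^sup>+ t. 0 \<partial>(lborel :: 'a measure))"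
  proof (rule nn_integral_dominated_convergence[where w="\<lambda>t. ennreal ((2 * K)\<^sup>2 * (cmod (h t))\<^sup>2)"])
   show "(\<lambda>t. ennreal ((cmod (f n t - g t))\<^sup>2)) \<in> borel_measurable lborel" for n using f[of n] g by measurable
   show "(\<lambda>t. ennreal ((2 * K)\<^sup>2 * (cmod (h t))\<^sup>2)) \<in> borel_measurable lborel" using h by measurable
   show "(\<integral>\<^sup>+ t. ennreal ((2 * K)\<^sup>2 * (cmod (h t))\<^sup>2) \<partial>lborel) < \<infinity>"
    using integrable_mult_right[OF sq_integrableD[OF h], of "(2 * K)\<^sup>2"] by (subst nn_integral_eq_integral) auto
   show "AE t in lborel. ennreal ((cmod (f n t - g t))\<^sup>2) \<le> ennreal ((2 * K)\<^sup>2 * (cmod (h t))\<^sup>2)" for n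
    using le' gle
   proof eventually_elim
    case (elim t)
    have "cmod (f n t - g t) \<le> cmod (f n t) + cmod (g t)" by (rule norm_triangle_ineq4)
    also have "\<dots> \<le> K * cmod (h t) + K * cmod (h t)" using elim by (intro add_mono) auto
    finally have "cmod (f n t - g t) \<le> 2 * K * cmod (h t)" by simp
    hence "(cmod (f n t - g t))\<^sup>2 \<le> (2 * K * cmod (h t))\<^sup>2" by (intro power_mono) auto
    thus ?case by (intro ennreal_leI) (simp add: power_mult_distrib)
   qed
   show "AE t in lborel. (\<lambda>n. ennreal ((cmod (f n t - g t))\<^sup>2)) \<longlonglongrightarrow> 0"
    using lim
   proof eventually_elim
    case (elim t)
    have "(\<lambda>n. ennreal ((cmod (f n t - g t))\<^sup>2)) \<longlonglongrightarrow> ennreal ((cmod (g t - g t))\<^sup>2)"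
     by (intro tendsto_ennrealI tendsto_intros elim)
    thus ?case by simp
   qed
  qed simp
  thus "(\<lambda>n. \<integral>\<^sup>+ t. ennreal ((cmod (f n t - g t))\<^sup>2) \<partial>lborel) \<longlonglongrightarrow> 0" by simp
 qed
qed

section \<open>Bounded multiplication operators\<close>

definition bdd_measurable :: "('a::euclidean_space \<Rightarrow> complex) \<Rightarrow> bool" where
 "bdd_measurable m \<longleftrightarrow> m \<in> borel_measurable borel \<and> (\<exists>K. \<forall>x. cmod (m x) \<le> K)"

lemma bdd_measurable_const: "bdd_measurable (\<lambda>_. c)" by (auto simp: bdd_measurable_def)

lemma bdd_measurable_indicator: "A \<in> sets borel \<Longrightarrow> bdd_measurable (indicator A)"
 by (auto simp: bdd_measurable_def indicator_def intro!: exI[of _ 1])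

lemma bdd_measurable_mult:
 assumes "bdd_measurable m" "bdd_measurable k"
 shows "bdd_measurable (\<lambda>t. m t * k t)"
proof -
 obtain K L where "\<And>x. cmod (m x) \<le> K" "\<And>x. cmod (k x) \<le> L" using assms by (auto simp: bdd_measurable_def)
 hence "cmod (m x * k x) \<le> K * L" for x unfolding norm_mult by (intro mult_mono) (auto intro: order_trans[OF norm_ge_zero])
 thus ?thesis using assms by (auto simp: bdd_measurable_def)
qed

definition mul :: "('a::euclidean_space \<Rightarrow> complex) \<Rightarrow> 'a l2 \<Rightarrow> 'a l2" where
 "mul m x = mk (\<lambda>t. m t * fn x t)"

lemma mul_sq: "bdd_measurable m \<Longrightarrow> f \<in> sq_integrable \<Longrightarrow> (\<lambda>t. m t * f t) \<in> sq_integrable"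
 unfolding bdd_measurable_def using sq_integrable_mult by blast

lemma fn_mul: "bdd_measurable m \<Longrightarrow> AE t in lborel. fn (mul m x) t = m t * fn x t"
 unfolding mul_def by (intro fn_mk mul_sq fn)

lemma mul_mk:
 assumes m: "bdd_measurable m" and f: "f \<in> sq_integrable"
 shows "mul m (mk f) = mk (\<lambda>t. m t * f t)"
 unfolding eq_mk_iff[OF mul_sq[OF m f]] using fn_mul[OF m, of "mk f"] fn_mk[OF f] by eventually_elim simp

lemma mul_add:
 assumes m: "bdd_measurable m"
 shows "mul m (x + y) = mul m x + mul m y"
 unfolding l2_eq_iff using fn_mul[OF m, of "x + y"] fn_mul[OF m, of x] fn_mul[OF m, of y] fn_ops(2)[of x y] fn_ops(2)[of "mul m x" "mul m y"]
 by eventually_elim (simp add: algebra_simps)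

lemma mul_scaleR:
 assumes m: "bdd_measurable m"
 shows "mul m (r *\<^sub>R x) = r *\<^sub>R mul m x"
 unfolding l2_eq_iff using fn_mul[OF m, of "r *\<^sub>R x"] fn_mul[OF m, of x] fn_ops(5)[of r x] fn_ops(5)[of r "mul m x"]
 by eventually_elim simp

lemma linear_mul: "bdd_measurable m \<Longrightarrow> linear (mul m)"
 by (intro linearI mul_add mul_scaleR)

lemma mul_mul:
 assumes "bdd_measurable m" "bdd_measurable k"
 shows "mul m (mul k x) = mul (\<lambda>t. m t * k t) x"
 unfolding l2_eq_iff using fn_mul[OF assms(1), of "mul k x"] fn_mul[OF assms(2), of x] fn_mul[OF bdd_measurable_mult[OF assms], of x]
 by eventually_elim simp

lemma mul_one: "mul (\<lambda>_. 1) x = x" by (simp add: mul_def fn)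

lemma norm_mul_le:
 assumes m: "bdd_measurable m" and le: "\<And>t. cmod (m t) \<le> K"
 shows "norm (mul m x) \<le> K * norm x"
proof -
 have K: "K \<ge> 0" using le norm_ge_zero order_trans by blast
 have "(norm (mul m x))\<^sup>2 = (LINT t|lborel. (cmod (m t * fn x t))\<^sup>2)"
  unfolding mul_def by (rule norm_mk_sq[OF mul_sq[OF m fn(1)]])
 also have "\<dots> \<le> (LINT t|lborel. K\<^sup>2 * (cmod (fn x t))\<^sup>2)"
 proof (rule integral_mono)
  show "(cmod (m t * fn x t))\<^sup>2 \<le> K\<^sup>2 * (cmod (fn x t))\<^sup>2" for t
   unfolding norm_mult power_mult_distrib using le[of t] by (intro mult_right_mono power_mono) auto
 qed (intro sq_integrableD mul_sq m fn integrable_mult_right)+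
 also have "\<dots> = (K * norm x)\<^sup>2" by (simp add: norm_l2_sq power_mult_distrib)
 finally show ?thesis by (rule power2_le_imp_le) (use K in simp)
qed

lemma norm_mul_eq:
 assumes m: "bdd_measurable m" and le: "\<And>t. cmod (m t) = 1"
 shows "norm (mul m x) = norm x"
proof -
 have "(norm (mul m x))\<^sup>2 = (norm x)\<^sup>2"
  unfolding mul_def norm_mk_sq[OF mul_sq[OF m fn(1)]] norm_l2_sq[of x] by (simp add: norm_mult le)
 thus ?thesis by simp
qed

lemma mul_tendsto:
 assumes "bdd_measurable m" "X \<longlonglongrightarrow> x"
 shows "(\<lambda>n. mul m (X n)) \<longlonglongrightarrow> mul m x"
proof -
 obtain K where K: "\<And>t. cmod (m t) \<le> K" using assms by (auto simp: bdd_measurable_def)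
 have "bounded_linear (mul m)"
  by (rule bounded_linear_intro[where K=K]) (use mul_add[OF assms(1)] mul_scaleR[OF assms(1)] norm_mul_le[OF assms(1) K] in \<open>auto simp: mult.commute\<close>)
 from bounded_linear.tendsto[OF this assms(2)] show ?thesis .
qed

lemma mul_pointwise_tendsto:
 assumes m: "\<And>n. m n \<in> borel_measurable borel" "k \<in> borel_measurable borel" "\<And>n t. cmod (m n t) \<le> K" and lim: "\<And>t. (\<lambda>n. m n t) \<longlonglongrightarrow> k t"
 shows "(\<lambda>n. mul (m n) x) \<longlonglongrightarrow> mul k x"
 unfolding mul_def
proof (rule tendsto_dominated(2)[OF _ fn(1)[of x], of _ _ K])
 show "(\<lambda>t. m n t * fn x t) \<in> borel_measurable borel" for n using m(1)[of n] fn(1)[of x] by measurable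
 show "(\<lambda>t. k t * fn x t) \<in> borel_measurable borel" using m(2) fn(1)[of x] by measurable
 show "AE t in lborel. cmod (m n t * fn x t) \<le> K * cmod (fn x t)" for n
  using m(3) by (intro AE_I2) (auto simp: norm_mult intro: mult_right_mono)
 show "AE t in lborel. (\<lambda>n. m n t * fn x t) \<longlonglongrightarrow> k t * fn x t" using lim by (intro AE_I2 tendsto_intros)
qed

lemma indicator_sq:
 assumes "A \<in> sets borel" "emeasure lborel A < \<infinity>"
 shows "(indicator A :: 'a::euclidean_space \<Rightarrow> complex) \<in> sq_integrable"
proof -
 have "(\<lambda>x. (cmod (indicator A x))\<^sup>2) = (indicator A :: 'a \<Rightarrow> real)" by (auto simp: indicator_def)
 thus ?thesis using assms by (simp add: sq_integrable_def)
qed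

text \<open>Simple functions approximate a given representative pointwise with at most twice its
  modulus, hence also in norm, and they are finite complex combinations of indicator functions of
  sets of finite measure.\<close>

lemma l2_induct [case_names add scale ind lim]:
 fixes x :: "'a::euclidean_space l2"
 assumes add: "\<And>x y. P x \<Longrightarrow> P y \<Longrightarrow> P (x + y)" and scale: "\<And>c x. P x \<Longrightarrow> P (mul (\<lambda>_. c) x)"
  and ind: "\<And>A. A \<in> sets borel \<Longrightarrow> emeasure lborel A < \<infinity> \<Longrightarrow> P (mk (indicator A))"
  and lim: "\<And>X x. (\<And>n. P (X n)) \<Longrightarrow> X \<longlonglongrightarrow> x \<Longrightarrow> P x"
 shows "P x"
proof -
 have P0: "P 0"
 proof -
  have "mk (indicator {}) = (0 :: 'a l2)" by (simp add: zero_l2_def indicator_def[abs_def])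
  thus ?thesis using ind[of "{}"] by simp
 qed
 obtain F where F: "\<And>i. simple_function borel (F i)" "\<And>t. (\<lambda>i. F i t) \<longlonglongrightarrow> fn x t" "\<And>i t. dist (F i t) 0 \<le> 2 * dist (fn x t) 0"
  using borel_measurable_implies_sequence_metric[OF sq_measurable[OF fn(1)[of x]], of 0] by auto
 have Fm: "F i \<in> borel_measurable borel" for i by (rule borel_measurable_simple_function[OF F(1)])
 have Fs: "F i \<in> sq_integrable" for i by (rule sq_integrable_dominated[OF fn(1)[of x] Fm, of _ 2]) (use F(3)[of i] in auto)
 have "P (mk (F i))" for i
 proof -
  define Y where "Y = F i ` UNIV - {0}"
  define A where "A y = F i -` {y}" for y
  have Y: "finite Y" using F(1)[of i] by (auto simp: Y_def simple_function_def)
  have A: "A y \<in> sets borel" for y unfolding A_def using measurable_sets[OF Fm[of i], of "{y}"] by simp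
  have Af: "emeasure lborel (A y) < \<infinity>" if "y \<noteq> 0" for y
  proof -
   have "integrable lborel (\<lambda>t. indicator (A y) t * (cmod (F i t))\<^sup>2)"
    using integrable_mult_indicator[OF _ sq_integrableD[OF Fs[of i]], of "A y"] A by simp
   also have "(\<lambda>t. indicator (A y) t * (cmod (F i t))\<^sup>2) = (\<lambda>t. indicator (A y) t * (cmod y)\<^sup>2)" by (auto simp: A_def indicator_def)
   finally have "integrable lborel (indicator (A y) :: 'a \<Rightarrow> real)" using that by simp
   thus ?thesis using A by (simp add: integrable_indicator_iff)
  qed
  have "P (mk (\<lambda>t. \<Sum>y\<in>Z. y * indicator (A y) t)) \<and> (\<lambda>t. \<Sum>y\<in>Z. y * indicator (A y) t) \<in> sq_integrable" if "finite Z" "Z \<subseteq> Y" for Z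
   using that
  proof (induction Z rule: finite_induct)
   case empty
   show ?case using P0 by (simp add: zero_l2_def sq_integrable_0)
  next
   case (insert y Z)
   have y: "y \<noteq> 0" using insert.prems by (auto simp: Y_def)
   note i = indicator_sq[OF A Af[OF y]]
   have IH: "P (mk (\<lambda>t. \<Sum>y\<in>Z. y * indicator (A y) t))" "(\<lambda>t. \<Sum>y\<in>Z. y * indicator (A y) t) \<in> sq_integrable"
    using insert by auto
   have "P (mul (\<lambda>_. y) (mk (indicator (A y))) + mk (\<lambda>t. \<Sum>y\<in>Z. y * indicator (A y) t))"
    by (intro add scale ind A Af y IH)
   moreover have "mul (\<lambda>_. y) (mk (indicator (A y))) + mk (\<lambda>t. \<Sum>y\<in>Z. y * indicator (A y) t) = mk (\<lambda>t. y * indicator (A y) t + (\<Sum>y\<in>Z. y * indicator (A y) t))"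
    unfolding mul_mk[OF bdd_measurable_const i] by (rule mk_ops(1)[OF sq_integrable_cmult[OF i] IH(2)])
   ultimately have "P (mk (\<lambda>t. y * indicator (A y) t + (\<Sum>y\<in>Z. y * indicator (A y) t)))" by (simp only:)
   from this sq_integrable_add[OF sq_integrable_cmult[OF i, of y] IH(2)]
   show ?case unfolding sum.insert[OF insert.hyps] by (rule conjI)
  qed
  from this[OF Y] have "P (mk (\<lambda>t. \<Sum>y\<in>Y. y * indicator (A y) t))" by simp
  also have "(\<lambda>t. \<Sum>y\<in>Y. y * indicator (A y) t) = F i"
  proof
   fix t
   have "(\<Sum>y\<in>Y. y * indicator (A y) t) = (\<Sum>y\<in>Y. if y = F i t then F i t else 0)"
    by (intro sum.cong) (auto simp: A_def indicator_def)
   also have "\<dots> = F i t" using Y by (simp add: sum.delta' Y_def)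
   finally show "(\<Sum>y\<in>Y. y * indicator (A y) t) = F i t" .
  qed
  finally show ?thesis .
 qed
 moreover have "(\<lambda>i. mk (F i)) \<longlonglongrightarrow> mk (fn x)"
  by (rule tendsto_dominated(2)[OF Fm fn(1)[of x] sq_measurable[OF fn(1)], where K=2]) (use F in auto)
 ultimately show ?thesis using lim[of "\<lambda>i. mk (F i)" "mk (fn x)"] by (simp add: fn)
qed

section \<open>Translations and their strong continuity\<close>

lemma lborel_shift:
 fixes f :: "'a::euclidean_space \<Rightarrow> 'b::{banach, second_countable_topology}"
 assumes f: "f \<in> borel_measurable borel"
 shows "(LINT t|lborel. f (t - h)) = integral\<^sup>L lborel f" "integrable lborel (\<lambda>t. f (t - h)) \<longleftrightarrow> integrable lborel f"
proof -
 have m: "(+) (- h) \<in> measurable lborel (borel :: 'a measure)" by measurable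
 show "(LINT t|lborel. f (t - h)) = integral\<^sup>L lborel f"
  using integral_distr[OF m f] unfolding lborel_distr_plus by simp
 show "integrable lborel (\<lambda>t. f (t - h)) \<longleftrightarrow> integrable lborel f"
  using integrable_distr_eq[OF m f] unfolding lborel_distr_plus by simp
qed

lemma AE_shift:
 fixes f g :: "'a::euclidean_space \<Rightarrow> complex"
 assumes [measurable]: "f \<in> borel_measurable borel" "g \<in> borel_measurable borel" and eq: "AE t in lborel. f t = g t"
 shows "AE t in lborel. f (t - h) = g (t - h)"
proof -
 have m: "(+) (- h) \<in> measurable lborel (borel :: 'a measure)" by measurable
 have "AE t in distr lborel borel ((+) (- h)). f t = g t" unfolding lborel_distr_plus by (rule eq)
 hence "AE t in lborel. f ((+) (- h) t) = g ((+) (- h) t)" by (subst (asm) AE_distr_iff[OF m]) measurable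
 thus ?thesis by simp
qed

lemma shift_sq: "f \<in> sq_integrable \<Longrightarrow> (\<lambda>t. f (t - h)) \<in> sq_integrable"
proof -
 assume f: "f \<in> sq_integrable"
 have m: "(\<lambda>t. (cmod (f t))\<^sup>2) \<in> borel_measurable borel" using f by measurable
 have "(\<lambda>t. f (t - h)) \<in> borel_measurable borel" by (rule measurable_compose[OF _ sq_measurable[OF f]]) measurable
 thus ?thesis using lborel_shift(2)[OF m, of h] sq_integrableD[OF f] by (simp add: sq_integrable_def)
qed

definition translate :: "'a::euclidean_space \<Rightarrow> 'a l2 \<Rightarrow> 'a l2" where
 "translate h x = mk (\<lambda>t. fn x (t - h))"

lemma fn_translate: "AE t in lborel. fn (translate h x) t = fn x (t - h)"
 unfolding translate_def by (rule fn_mk[OF shift_sq[OF fn(1)]])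

lemma translate_mk:
 assumes f: "f \<in> sq_integrable"
 shows "translate h (mk f) = mk (\<lambda>t. f (t - h))"
 unfolding translate_def mk_eq_iff[OF shift_sq[OF fn(1)] shift_sq[OF f]]
 by (rule AE_shift[OF sq_measurable[OF fn(1)] sq_measurable[OF f] fn_mk[OF f]])

lemma translate_add: "translate h (x + y) = translate h x + translate h y"
 using translate_mk[OF sq_integrable_add[OF fn(1)[of x] fn(1)[of y]], of h] mk_ops(1)[OF fn(1)[of x] fn(1)[of y]]
  mk_ops(1)[OF shift_sq[OF fn(1)[of x]] shift_sq[OF fn(1)[of y]], of h h] by (simp add: fn translate_def)

lemma translate_mul_const: "translate h (mul (\<lambda>_. c) x) = mul (\<lambda>_. c) (translate h x)"
 using translate_mk[OF sq_integrable_cmult[OF fn(1)[of x], of c], of h] mul_mk[OF bdd_measurable_const shift_sq[OF fn(1)[of x]], of c h]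
 by (simp add: fn translate_def mul_def)

lemma norm_translate: "norm (translate h x) = norm x"
proof -
 have m: "(\<lambda>t. (cmod (fn x t))\<^sup>2) \<in> borel_measurable borel" using fn(1)[of x] by measurable
 have "(norm (translate h x))\<^sup>2 = (norm x)\<^sup>2"
  unfolding translate_def norm_mk_sq[OF shift_sq[OF fn(1)]] norm_l2_sq[of x] using lborel_shift(1)[OF m, of h] by simp
 thus ?thesis by simp
qed

lemma translate_scaleR: "translate h (r *\<^sub>R x) = r *\<^sub>R translate h x"
 using translate_mk[OF sq_integrable_scaleR[OF fn(1)[of x], of r], of h] mk_ops(3)[OF fn(1)[of x] fn(1)[of x], of r] mk_ops(3)[OF shift_sq[OF fn(1)[of x]] fn(1)[of x], of r h]
 by (simp add: fn translate_def)

lemma linear_translate: "linear (translate h)"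
 by (intro linearI translate_add translate_scaleR)

text \<open>On an open set \<open>O\<close> of finite measure the translates of the indicator converge by lower semicontinuity,
 and open sets approximate all sets of finite measure from outside.\<close>

lemma translate_indicator_open:
 fixes A :: "'a::euclidean_space set"
 assumes A: "open A" "emeasure lborel A < \<infinity>" and h: "h \<longlonglongrightarrow> 0"
 shows "(\<lambda>n. translate (h n) (mk (indicator A))) \<longlonglongrightarrow> mk (indicator A)"
proof -
 have Ab[measurable]: "A \<in> sets borel" using A by simp
 note i = indicator_sq[OF Ab A(2)]
 have ii: "integrable lborel (indicator A :: 'a \<Rightarrow> real)" using A Ab by (simp add: integrable_indicator_iff)
 have ish: "integrable lborel (\<lambda>t. indicator A (t - c) :: real)" "(LINT t|lborel. indicator A (t - c)) = (LINT t|lborel. (indicator A t :: real))" for c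
  using lborel_shift[of "indicator A :: 'a \<Rightarrow> real" c] ii by auto
 have ip: "integrable lborel (\<lambda>t. indicator A t * indicator A (t - c) :: real)" for c
  using integrable_mult_indicator[OF _ ish(1)[of c], of A] by simp
 have eq: "(norm (translate c (mk (indicator A)) - mk (indicator A)))\<^sup>2 = 2 * (LINT t|lborel. indicator A t) - 2 * (LINT t|lborel. indicator A t * indicator A (t - c))" for c
 proof -
  have "(norm (translate c (mk (indicator A)) - mk (indicator A)))\<^sup>2 = (LINT t|lborel. (cmod (indicator A (t - c) - indicator A t))\<^sup>2)"
   unfolding translate_mk[OF i] mk_ops(2)[OF shift_sq[OF i] i] by (rule norm_mk_sq[OF sq_integrable_diff[OF shift_sq[OF i] i]])
  also have "\<dots> = (LINT t|lborel. (indicator A (t - c) + indicator A t) - 2 * (indicator A t * indicator A (t - c)))"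
   by (intro Bochner_Integration.integral_cong) (auto simp: indicator_def)
  also have "\<dots> = 2 * (LINT t|lborel. indicator A t) - 2 * (LINT t|lborel. indicator A t * indicator A (t - c))"
   using ish[of c] ii ip[of c] by simp
  finally show ?thesis .
 qed
 have "(\<lambda>n. LINT t|lborel. indicator A t * indicator A (t - h n)) \<longlonglongrightarrow> (LINT t|lborel. (indicator A t :: real))"
 proof (rule integral_dominated_convergence[OF _ _ ii])
  show "AE t in lborel. (\<lambda>n. indicator A t * indicator A (t - h n)) \<longlonglongrightarrow> (indicator A t :: real)"
  proof (intro AE_I2)
   fix t :: 'a
   show "(\<lambda>n. indicator A t * indicator A (t - h n)) \<longlonglongrightarrow> (indicator A t :: real)"
   proof (cases "t \<in> A")
    case True
    have "(\<lambda>n. t - h n) \<longlonglongrightarrow> t - 0" by (intro tendsto_intros h)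
    hence "\<forall>\<^sub>F n in sequentially. t - h n \<in> A" using A(1) True topological_tendstoD by fastforce
    hence "\<forall>\<^sub>F n in sequentially. indicator A t * indicator A (t - h n) = (indicator A t :: real)" by eventually_elim (auto simp: True)
    thus ?thesis by (rule tendsto_eventually)
   qed simp
  qed
 qed (auto simp: indicator_def)
 hence "(\<lambda>n. (norm (translate (h n) (mk (indicator A)) - mk (indicator A)))\<^sup>2) \<longlonglongrightarrow> 2 * (LINT t|lborel. indicator A t) - 2 * (LINT t|lborel. (indicator A t :: real))"
  unfolding eq by (intro tendsto_intros)
 hence "(\<lambda>n. (norm (translate (h n) (mk (indicator A)) - mk (indicator A)))\<^sup>2) \<longlonglongrightarrow> 0" by simp
 hence "(\<lambda>n. sqrt ((norm (translate (h n) (mk (indicator A)) - mk (indicator A)))\<^sup>2)) \<longlonglongrightarrow> sqrt 0" by (rule tendsto_real_sqrt)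
 thus ?thesis by (simp add: tendsto_norm_zero_iff LIM_zero_iff)
qed

text \<open>Translations are isometries, so the error of replacing x by some X k is the same for all
  of them; three errors of size e / 3 add up.\<close>

lemma translate_tendsto_closed:
 assumes X: "\<And>k h. h \<longlonglongrightarrow> 0 \<Longrightarrow> (\<lambda>n. translate (h n) (X k)) \<longlonglongrightarrow> X k" and lim: "X \<longlonglongrightarrow> x" and h: "h \<longlonglongrightarrow> 0"
 shows "(\<lambda>n. translate (h n) x) \<longlonglongrightarrow> x"
proof (rule metric_LIMSEQ_I)
 fix e :: real assume e: "e > 0"
 obtain k where k: "norm (X k - x) < e / 3" using LIMSEQ_D[OF lim, of "e / 3"] e by auto
 obtain N where N: "\<And>n. n \<ge> N \<Longrightarrow> norm (translate (h n) (X k) - X k) < e / 3" using LIMSEQ_D[OF X[OF h], of "e / 3" k] e by auto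
 have "dist (translate (h n) x) x < e" if "n \<ge> N" for n
 proof -
  have "translate (h n) x - x = - translate (h n) (X k - x) + (translate (h n) (X k) - X k) + (X k - x)"
   using linear_diff[OF linear_translate, of "h n" "X k" x] by simp
  hence "norm (translate (h n) x - x) \<le> norm (translate (h n) (X k - x)) + norm (translate (h n) (X k) - X k) + norm (X k - x)"
   using norm_triangle_ineq[of "- translate (h n) (X k - x) + (translate (h n) (X k) - X k)" "X k - x"]
    norm_triangle_ineq[of "- translate (h n) (X k - x)" "translate (h n) (X k) - X k"] unfolding norm_minus_cancel by simp
  thus ?thesis using k N[OF that] by (simp add: dist_norm norm_translate)
 qed
 thus "\<exists>N. \<forall>n\<ge>N. dist (translate (h n) x) x < e" by blast
qed

lemma translate_tendsto:
 fixes x :: "'a::euclidean_space l2"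
 assumes h: "h \<longlonglongrightarrow> 0"
 shows "(\<lambda>n. translate (h n) x) \<longlonglongrightarrow> x"
 using h
proof (induction x arbitrary: h rule: l2_induct)
 case (add x y)
 thus ?case unfolding translate_add by (intro tendsto_intros)
next
 case (scale c x)
 thus ?case unfolding translate_mul_const by (intro mul_tendsto bdd_measurable_const)
next
 case (ind A)
 have "\<exists>T. open T \<and> A \<subseteq> T \<and> emeasure lborel (T - A) < ennreal ((1 / real (Suc k))\<^sup>2)" for k
 proof -
  have pos: "(1 / real (Suc k))\<^sup>2 > 0" by (intro zero_less_power) auto
  have "A \<in> sets lebesgue" using ind(1) by auto
  from sets_lebesgue_outer_open[OF this pos] obtain T where T: "open T" "A \<subseteq> T" "emeasure lebesgue (T - A) < ennreal ((1 / real (Suc k))\<^sup>2)" by metis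
  have "T - A \<in> sets lborel" using T(1) ind(1) by auto
  hence "emeasure lebesgue (T - A) = emeasure lborel (T - A)" by simp
  thus ?thesis using T by auto
 qed
 then obtain T where T: "\<And>k. open (T k)" "\<And>k. A \<subseteq> T k" "\<And>k. emeasure lborel (T k - A) < ennreal ((1 / real (Suc k))\<^sup>2)" by metis
 have Ts: "T k \<in> sets borel" "T k - A \<in> sets borel" for k using T(1)[of k] ind(1) by auto
 have TA: "emeasure lborel (T k - A) < \<infinity>" for k using T(3)[of k] by (rule less_trans) simp
 have Tf: "emeasure lborel (T k) < \<infinity>" for k
 proof -
  have "emeasure lborel (T k) = emeasure lborel (A \<union> (T k - A))" using T(2)[of k] by (simp add: Un_absorb1)
  also have "\<dots> \<le> emeasure lborel A + emeasure lborel (T k - A)" using ind(1) Ts by (intro emeasure_subadditive) auto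
  also have "\<dots> < \<infinity>" using ind(2) TA[of k] by simp
  finally show ?thesis .
 qed
 note i = indicator_sq[OF ind(1) ind(2)] and iT = indicator_sq[OF Ts(1) Tf] and iTA = indicator_sq[OF Ts(2) TA]
 have "norm (mk (indicator (T k)) - mk (indicator A)) \<le> 1 / real (Suc k)" for k
 proof -
  have "(\<lambda>t. indicator (T k) t - indicator A t :: complex) = indicator (T k - A)" using T(2)[of k] by (auto simp: indicator_def fun_eq_iff)
  hence "mk (indicator (T k)) - mk (indicator A) = mk (indicator (T k - A))" using mk_ops(2)[OF iT[of k] i] by simp
  hence "ennreal ((norm (mk (indicator (T k)) - mk (indicator A)))\<^sup>2) = (\<integral>\<^sup>+ t. ennreal ((cmod (indicator (T k - A) t))\<^sup>2) \<partial>lborel)"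
   using nn_norm_mk[OF iTA[of k]] by simp
  also have "\<dots> = (\<integral>\<^sup>+ t. indicator (T k - A) t \<partial>lborel)" by (intro nn_integral_cong) (auto simp: indicator_def)
  also have "\<dots> = emeasure lborel (T k - A)" using Ts(2) by simp
  also have "\<dots> \<le> ennreal ((1 / real (Suc k))\<^sup>2)" using T(3) by (rule less_imp_le)
  finally have "(norm (mk (indicator (T k)) - mk (indicator A)))\<^sup>2 \<le> (1 / real (Suc k))\<^sup>2" by (subst (asm) ennreal_le_iff) auto
  thus ?thesis by (rule power2_le_imp_le) simp
 qed
 hence "(\<lambda>k. mk (indicator (T k)) - mk (indicator A)) \<longlonglongrightarrow> 0"
  by (intro tendsto_norm_zero_cancel[OF tendsto_sandwich[OF _ _ tendsto_const LIMSEQ_Suc[OF lim_1_over_n]]]) auto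
 hence "(\<lambda>k. mk (indicator (T k))) \<longlonglongrightarrow> mk (indicator A)" by (simp add: LIM_zero_iff)
 from translate_tendsto_closed[OF translate_indicator_open[OF T(1) Tf] this ind(3)] show ?case .
next
 case (lim X x)
 from translate_tendsto_closed[OF lim(1) lim(2) lim(3)] show ?case .
qed

section \<open>The Plancherel transform\<close>

definition fourier :: "('a::euclidean_space \<Rightarrow> complex) \<Rightarrow> 'a \<Rightarrow> complex" where
 "fourier f \<xi> = complex_of_real ((2 * pi) powr (- real DIM('a) / 2)) * (LINT x|lborel. cis (- (x \<bullet> \<xi>)) * f x)"

text \<open>On this space the transform is an absolutely convergent integral; truncation to balls
  shows that it is dense.\<close>

definition l1_l2 :: "('a::euclidean_space \<Rightarrow> complex) set" where
 "l1_l2 = {f \<in> sq_integrable. integrable lborel f}"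

lemma l1_l2D: "f \<in> l1_l2 \<Longrightarrow> f \<in> sq_integrable" "f \<in> l1_l2 \<Longrightarrow> integrable lborel f"
 by (auto simp: l1_l2_def)

lemma cis_measurable[measurable]: "f \<in> borel_measurable M \<Longrightarrow> (\<lambda>x. cis (f x)) \<in> borel_measurable M"
 by (rule measurable_compose[where g=cis]) (auto intro!: borel_measurable_continuous_onI continuous_intros)

lemma integrable_cis_mult:
 assumes "integrable M f" "g \<in> borel_measurable M"
 shows "integrable M (\<lambda>x. cis (g x) * f x)"
 by (rule Bochner_Integration.integrable_bound[OF assms(1)]) (use assms in \<open>auto simp: norm_mult\<close>)

lemma norm_mult_le_sq: "norm (a * b) \<le> (cmod a)\<^sup>2 + (cmod b)\<^sup>2"
proof -
 have "2 * (cmod a * cmod b) \<le> (cmod a)\<^sup>2 + (cmod b)\<^sup>2" using sum_squares_bound[of "cmod a" "cmod b"] by simp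
 moreover have "0 \<le> cmod a * cmod b" by simp
 ultimately show ?thesis unfolding norm_mult by linarith
qed

lemma fubini_product:
 fixes f :: "'a::euclidean_space \<Rightarrow> complex" and g :: "'b::euclidean_space \<Rightarrow> complex"
 assumes f: "integrable lborel f" and g: "integrable lborel g" and k: "(\<lambda>(x, y). k x y) \<in> borel_measurable (lborel \<Otimes>\<^sub>M lborel)" "\<And>x y. cmod (k x y) \<le> K"
 shows "integrable (lborel \<Otimes>\<^sub>M lborel) (\<lambda>(x, y). f x * g y * k x y)"
  "(LINT x|lborel. LINT y|lborel. f x * g y * k x y) = (LINT y|lborel. LINT x|lborel. f x * g y * k x y)"
proof -
 have [measurable]: "f \<in> borel_measurable lborel" "g \<in> borel_measurable lborel" using f g by auto
 have 1: "integrable (lborel \<Otimes>\<^sub>M lborel) (\<lambda>(x, y). f x * g y)"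
 proof (rule lborel_pair.Fubini_integrable)
  show "(\<lambda>(x, y). f x * g y) \<in> borel_measurable (lborel \<Otimes>\<^sub>M lborel)" by measurable
  show "integrable lborel (\<lambda>x. LINT y|lborel. norm (case (x, y) of (x, y) \<Rightarrow> f x * g y))"
   using f by (simp add: norm_mult)
  show "AE x in lborel. integrable lborel (\<lambda>y. case (x, y) of (x, y) \<Rightarrow> f x * g y)" using g by simp
 qed
 show 2: "integrable (lborel \<Otimes>\<^sub>M lborel) (\<lambda>(x, y). f x * g y * k x y)"
 proof (rule Bochner_Integration.integrable_bound[OF integrable_mult_right[OF 1, of "of_real K"]])
  show "(\<lambda>(x, y). f x * g y * k x y) \<in> borel_measurable (lborel \<Otimes>\<^sub>M lborel)" using k(1) by measurable
  show "AE p in lborel \<Otimes>\<^sub>M lborel. norm (case p of (x, y) \<Rightarrow> f x * g y * k x y) \<le> norm (of_real K * (case p of (x, y) \<Rightarrow> f x * g y))"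
  proof (intro AE_I2)
   fix p :: "'a \<times> 'b"
   have "cmod (k (fst p) (snd p)) \<le> \<bar>K\<bar>" using k(2)[of "fst p" "snd p"] by linarith
   thus "norm (case p of (x, y) \<Rightarrow> f x * g y * k x y) \<le> norm (of_real K * (case p of (x, y) \<Rightarrow> f x * g y))"
    by (cases p) (auto simp: norm_mult mult.commute[of "\<bar>K\<bar>"] intro!: mult_left_mono)
  qed
 qed
 show "(LINT x|lborel. LINT y|lborel. f x * g y * k x y) = (LINT y|lborel. LINT x|lborel. f x * g y * k x y)"
  using lborel_pair.Fubini_integral[OF 2] by simp
qed

lemma fourier_measurable:
 assumes "integrable lborel f"
 shows "fourier f \<in> borel_measurable borel"
proof -
 have [measurable]: "f \<in> borel_measurable borel" using assms by auto
 show ?thesis unfolding fourier_def[abs_def] by measurable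
qed

lemma fourier_bounded: "cmod (fourier f \<xi>) \<le> (2 * pi) powr (- real DIM('a) / 2) * (LINT x|lborel. cmod (f x))"
 for f :: "'a::euclidean_space \<Rightarrow> complex"
proof -
 have "cmod (LINT x|lborel. cis (- (x \<bullet> \<xi>)) * f x) \<le> (LINT x|lborel. cmod (cis (- (x \<bullet> \<xi>)) * f x))" by (rule integral_norm_bound)
 thus ?thesis unfolding fourier_def norm_mult by (simp add: norm_mult mult_left_mono)
qed

lemma fourier_linear:
 assumes f: "integrable lborel f" and g: "integrable lborel g"
 shows "fourier (\<lambda>x. f x - g x) = (\<lambda>\<xi>. fourier f \<xi> - fourier g \<xi>)" "fourier (\<lambda>x. f x + g x) = (\<lambda>\<xi>. fourier f \<xi> + fourier g \<xi>)"
  "fourier (\<lambda>x. c * f x) = (\<lambda>\<xi>. c * fourier f \<xi>)"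
proof -
 have i: "integrable lborel (\<lambda>x. cis (- (x \<bullet> \<xi>)) * f x)" "integrable lborel (\<lambda>x. cis (- (x \<bullet> \<xi>)) * g x)" for \<xi>
  using f g by (auto intro!: integrable_cis_mult)
 show "fourier (\<lambda>x. f x - g x) = (\<lambda>\<xi>. fourier f \<xi> - fourier g \<xi>)"
  unfolding fourier_def fun_eq_iff right_diff_distrib Bochner_Integration.integral_diff[OF i] by simp
 show "fourier (\<lambda>x. f x + g x) = (\<lambda>\<xi>. fourier f \<xi> + fourier g \<xi>)"
  unfolding fourier_def fun_eq_iff distrib_left Bochner_Integration.integral_add[OF i] by simp
 show "fourier (\<lambda>x. c * f x) = (\<lambda>\<xi>. c * fourier f \<xi>)"
  unfolding fourier_def fun_eq_iff mult.left_commute[of "cis _" c] by simp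
qed

lemma lborel_scale:
 fixes f :: "'a::euclidean_space \<Rightarrow> 'b::{banach, second_countable_topology}"
 assumes c: "c > 0" and f: "f \<in> borel_measurable borel"
 shows "integral\<^sup>L lborel f = (LINT w|lborel. c ^ DIM('a) *\<^sub>R f (c *\<^sub>R w))"
proof -
 have m: "(\<lambda>x. 0 + c *\<^sub>R x) \<in> measurable lborel (borel :: 'a measure)" by measurable
 have c0: "c \<noteq> 0" using c by simp
 have "integral\<^sup>L lborel f = integral\<^sup>L (density (distr lborel borel (\<lambda>x. 0 + c *\<^sub>R x)) (\<lambda>_. ennreal (\<bar>c\<bar> ^ DIM('a)))) f"
  using lborel_affine[OF c0, of "0::'a"] by simp
 also have "\<dots> = integral\<^sup>L (distr lborel borel (\<lambda>x. 0 + c *\<^sub>R x)) (\<lambda>x. \<bar>c\<bar> ^ DIM('a) *\<^sub>R f x)"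
  by (rule integral_density) (use f c in auto)
 also have "\<dots> = (LINT w|lborel. \<bar>c\<bar> ^ DIM('a) *\<^sub>R f (0 + c *\<^sub>R w))"
  by (rule integral_distr[OF m]) (use f in measurable)
 finally show ?thesis using c by simp
qed

text \<open>The heat kernel at time \<epsilon>, of total mass 1; its Fourier transform is a multiple
  of exp(- \<epsilon> |\<xi>|^2).\<close>

definition heat :: "real \<Rightarrow> 'a::euclidean_space \<Rightarrow> real" where
 "heat \<epsilon> z = (4 * pi * \<epsilon>) powr (- real DIM('a) / 2) * exp (- ((norm z)\<^sup>2 / (4 * \<epsilon>)))"

lemma heat_measurable[measurable]: "heat \<epsilon> \<in> borel_measurable borel"
 unfolding heat_def[abs_def] by measurable

lemma heat_integral:
 assumes "\<epsilon> > 0"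
 shows "integrable lborel (heat \<epsilon> :: 'a::euclidean_space \<Rightarrow> real)" "integral\<^sup>L lborel (heat \<epsilon> :: 'a \<Rightarrow> real) = 1"
proof -
 have t: "1 / (4 * \<epsilon>) > 0" using assms by simp
 have e: "(norm z)\<^sup>2 / (4 * \<epsilon>) = 1 / (4 * \<epsilon>) * (norm z)\<^sup>2" for z :: 'a by simp
 show "integrable lborel (heat \<epsilon> :: 'a \<Rightarrow> real)" unfolding heat_def[abs_def] e
  by (intro integrable_mult_right integrable_gaussian t)
 have "complex_of_real (LINT z|lborel. exp (- (1 / (4 * \<epsilon>) * (norm (z::'a))\<^sup>2))) = complex_of_real ((pi / (1 / (4 * \<epsilon>))) powr (real DIM('a) / 2))"
  using gaussian_fourier(2)[OF t, of "0::'a"] by (simp add: integral_complex_of_real)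
 hence "(LINT z|lborel. exp (- (1 / (4 * \<epsilon>) * (norm (z::'a))\<^sup>2))) = (4 * pi * \<epsilon>) powr (real DIM('a) / 2)"
  unfolding of_real_eq_iff using assms by (simp add: mult_ac)
 thus "integral\<^sup>L lborel (heat \<epsilon> :: 'a \<Rightarrow> real) = 1" unfolding heat_def[abs_def] e
  using assms by (simp add: powr_minus field_simps)
qed

lemma heat_scale:
 assumes "\<epsilon> > 0"
 shows "sqrt \<epsilon> ^ DIM('a) * heat \<epsilon> (sqrt \<epsilon> *\<^sub>R w) = heat 1 (w :: 'a::euclidean_space)"
proof -
 have "sqrt \<epsilon> ^ DIM('a) = \<epsilon> powr (real DIM('a) / 2)"
  using assms by (simp add: powr_half_sqrt[symmetric] powr_realpow[symmetric] powr_powr)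
 moreover have "(4 * pi * \<epsilon>) powr (- real DIM('a) / 2) = (4 * pi) powr (- real DIM('a) / 2) * \<epsilon> powr (- (real DIM('a) / 2))"
  by (simp add: powr_mult)
 moreover have "\<epsilon> powr (real DIM('a) / 2) * \<epsilon> powr (- (real DIM('a) / 2)) = 1"
  using assms by (simp add: powr_add[symmetric])
 ultimately have "sqrt \<epsilon> ^ DIM('a) * (4 * pi * \<epsilon>) powr (- real DIM('a) / 2) = (4 * pi) powr (- real DIM('a) / 2)" by (simp add: mult_ac)
 moreover have "(norm (sqrt \<epsilon> *\<^sub>R w))\<^sup>2 / (4 * \<epsilon>) = (norm w)\<^sup>2 / 4" using assms by (simp add: power_mult_distrib)
 ultimately show ?thesis unfolding heat_def mult.assoc[symmetric] by simp
qed

text \<open>The Gaussian summability method turns \<open>\<integral> |fourier f|\<^sup>2\<close> into an average of the autocorrelation of \<open>f\<close>.\<close>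

lemma fourier_gaussian_mean:
 fixes f :: "'a::euclidean_space \<Rightarrow> complex"
 assumes f: "f \<in> l1_l2" and \<epsilon>: "\<epsilon> > 0"
 shows "integrable lborel (\<lambda>\<xi>. (cmod (fourier f \<xi>))\<^sup>2 * exp (- (\<epsilon> * (norm \<xi>)\<^sup>2)))"
  "(LINT \<xi>|lborel. (cmod (fourier f \<xi>))\<^sup>2 * exp (- (\<epsilon> * (norm \<xi>)\<^sup>2))) = (LINT z|lborel. heat \<epsilon> z * inner (translate (- z) (mk f)) (mk f))"
proof -
 note fs = l1_l2D(1)[OF f] and fi = l1_l2D(2)[OF f]
 have [measurable]: "f \<in> borel_measurable borel" "fourier f \<in> borel_measurable borel" using fi fourier_measurable[OF fi] by auto
 define c where "c = (2 * pi) powr (- real DIM('a) / 2)"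
 define K where "K = c * (LINT x|lborel. cmod (f x))"
 have K: "cmod (fourier f \<xi>) \<le> K" for \<xi> unfolding K_def c_def by (rule fourier_bounded)
 define w where "w \<xi> = complex_of_real (exp (- (\<epsilon> * (norm \<xi>)\<^sup>2)))" for \<xi> :: 'a
 have [measurable]: "w \<in> borel_measurable borel" unfolding w_def by measurable
 have wi: "integrable lborel w" unfolding w_def using integrable_gaussian[OF \<epsilon>, where 'a='a] by simp
 define h where "h \<xi> = fourier f \<xi> * w \<xi>" for \<xi>
 have hm[measurable]: "h \<in> borel_measurable borel" unfolding h_def by measurable
 have K': "cmod (fourier f \<xi>) \<le> \<bar>K\<bar>" for \<xi> using K[of \<xi>] by linarith
 have hi: "integrable lborel h"
  by (rule Bochner_Integration.integrable_bound[OF integrable_mult_right[OF wi, of "of_real K"]])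
    (use hm K' in \<open>auto simp: h_def norm_mult intro!: mult_right_mono\<close>)
 have hc: "integrable lborel (\<lambda>\<xi>. h \<xi> * cnj (fourier f \<xi>))"
  by (rule Bochner_Integration.integrable_bound[OF integrable_mult_right[OF hi, of "of_real K"]])
    (use hm K' in \<open>auto simp: norm_mult mult.commute[of _ "cmod (fourier f _)"] intro!: mult_right_mono\<close>)
 have sq: "h \<xi> * cnj (fourier f \<xi>) = complex_of_real ((cmod (fourier f \<xi>))\<^sup>2 * exp (- (\<epsilon> * (norm \<xi>)\<^sup>2)))" for \<xi>
  unfolding of_real_mult complex_norm_square by (simp add: h_def w_def mult_ac)
 show "integrable lborel (\<lambda>\<xi>. (cmod (fourier f \<xi>))\<^sup>2 * exp (- (\<epsilon> * (norm \<xi>)\<^sup>2)))"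
  using hc unfolding sq complex_of_real_integrable_eq .
 have fci: "integrable lborel (\<lambda>y. cnj (f y))" using fi by simp
 \<comment> \<open>Inverting the damped transform gives a Gaussian convolution of f, because the
   transform of the damping factor is explicit.\<close>
 have inner_int: "(LINT \<xi>|lborel. cis (y \<bullet> \<xi>) * h \<xi>) = c * (LINT x|lborel. f x * complex_of_real ((pi / \<epsilon>) powr (real DIM('a) / 2) * exp (- ((norm (y - x))\<^sup>2 / (4 * \<epsilon>)))))" for y
 proof -
  have "(LINT \<xi>|lborel. cis (y \<bullet> \<xi>) * h \<xi>) = (LINT \<xi>|lborel. c * (LINT x|lborel. w \<xi> * f x * cis ((y - x) \<bullet> \<xi>)))"
  proof (rule Bochner_Integration.integral_cong[OF refl])
   fix \<xi>
   have "cis (y \<bullet> \<xi>) * (cis (- (x \<bullet> \<xi>)) * f x) * w \<xi> = w \<xi> * f x * cis ((y - x) \<bullet> \<xi>)" for x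
   proof -
    have "cis ((y - x) \<bullet> \<xi>) = cis (y \<bullet> \<xi>) * cis (- (x \<bullet> \<xi>))" by (simp add: cis_mult inner_diff_left)
    thus ?thesis by (simp add: mult_ac)
   qed
   hence e: "(\<lambda>x. cis (y \<bullet> \<xi>) * (cis (- (x \<bullet> \<xi>)) * f x) * w \<xi>) = (\<lambda>x. w \<xi> * f x * cis ((y - x) \<bullet> \<xi>))" by (rule ext)
   show "cis (y \<bullet> \<xi>) * h \<xi> = c * (LINT x|lborel. w \<xi> * f x * cis ((y - x) \<bullet> \<xi>))"
    unfolding e[symmetric] h_def fourier_def c_def[symmetric] integral_mult_left_zero integral_mult_right_zero by (simp add: mult_ac)
  qed
  also have "\<dots> = c * (LINT \<xi>|lborel. LINT x|lborel. w \<xi> * f x * cis ((y - x) \<bullet> \<xi>))" by simp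
  also have "(LINT \<xi>|lborel. LINT x|lborel. w \<xi> * f x * cis ((y - x) \<bullet> \<xi>)) = (LINT x|lborel. LINT \<xi>|lborel. w \<xi> * f x * cis ((y - x) \<bullet> \<xi>))"
   using fubini_product(2)[OF wi fi, of "\<lambda>\<xi> x. cis ((y - x) \<bullet> \<xi>)" 1] by simp
  also have "\<dots> = (LINT x|lborel. f x * (LINT \<xi>|lborel. cis ((y - x) \<bullet> \<xi>) * w \<xi>))"
   by (simp add: mult_ac flip: integral_mult_right_zero)
  finally show ?thesis unfolding w_def gaussian_fourier(2)[OF \<epsilon>] .
 qed
 \<comment> \<open>The normalising factor (2 pi)^(-n/2) of the transform, taken twice, and the
   constant of the Gaussian integral combine to that of the heat kernel.\<close>
 have const: "c * c * (pi / \<epsilon>) powr (real DIM('a) / 2) = (4 * pi * \<epsilon>) powr (- real DIM('a) / 2)"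
 proof -
  have "c * c = (2 * pi) powr (- real DIM('a))" by (simp add: c_def powr_add[symmetric])
  also have "\<dots> = ((2 * pi) powr 2) powr (- real DIM('a) / 2)" unfolding powr_powr by simp
  also have "(2 * pi) powr 2 = 4 * pi * pi" by (simp add: powr_numeral power2_eq_square)
  finally have "c * c = (4 * pi * pi) powr (- real DIM('a) / 2)" .
  moreover have "(pi / \<epsilon>) powr (real DIM('a) / 2) = (\<epsilon> / pi) powr (- real DIM('a) / 2)"
   using \<epsilon> by (simp add: powr_divide powr_minus_divide)
  moreover have "(4 * pi * pi) * (\<epsilon> / pi) = 4 * pi * \<epsilon>" by simp
  ultimately show ?thesis by (metis powr_mult)
 qed
 have prod: "integrable (lborel \<Otimes>\<^sub>M lborel) (\<lambda>(z, y). heat \<epsilon> z *\<^sub>R (f (z + y) * cnj (f y)))"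
 proof (rule lborel_pair.Fubini_integrable)
  show "(\<lambda>(z, y). heat \<epsilon> z *\<^sub>R (f (z + y) * cnj (f y))) \<in> borel_measurable (lborel \<Otimes>\<^sub>M lborel)" by measurable
  have fsh: "(\<lambda>y. f (z + y)) \<in> sq_integrable" for z using shift_sq[OF fs, of "- z"] by (simp add: add.commute)
  show "AE z in lborel. integrable lborel (\<lambda>y. case (z, y) of (z, y) \<Rightarrow> heat \<epsilon> z *\<^sub>R (f (z + y) * cnj (f y)))"
   by (simp add: integrable_mult_sq[OF fsh sq_integrable_cnj[OF fs]])
  define L where "L = (LINT y|lborel. (cmod (f y))\<^sup>2)"
  have bd: "(LINT y|lborel. norm (f (z + y) * cnj (f y))) \<le> 2 * L" for z
  proof -
   have "(LINT y|lborel. norm (f (z + y) * cnj (f y))) \<le> (LINT y|lborel. (cmod (f (z + y)))\<^sup>2 + (cmod (f y))\<^sup>2)"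
   proof (rule integral_mono)
    show "integrable lborel (\<lambda>y. norm (f (z + y) * cnj (f y)))" by (rule integrable_norm[OF integrable_mult_sq[OF fsh sq_integrable_cnj[OF fs]]])
    show "integrable lborel (\<lambda>y. (cmod (f (z + y)))\<^sup>2 + (cmod (f y))\<^sup>2)" by (intro Bochner_Integration.integrable_add sq_integrableD fsh fs)
    show "norm (f (z + y) * cnj (f y)) \<le> (cmod (f (z + y)))\<^sup>2 + (cmod (f y))\<^sup>2" for y
     using norm_mult_le_sq[of "f (z + y)" "cnj (f y)"] by simp
   qed
   also have "\<dots> = (LINT y|lborel. (cmod (f (z + y)))\<^sup>2) + L"
    unfolding L_def by (rule Bochner_Integration.integral_add[OF sq_integrableD[OF fsh] sq_integrableD[OF fs]])
   also have "(LINT y|lborel. (cmod (f (z + y)))\<^sup>2) = L"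
    unfolding L_def using lborel_shift(1)[of "\<lambda>y. (cmod (f y))\<^sup>2" "- z"] by (simp add: add.commute)
   finally show ?thesis by simp
  qed
  show "integrable lborel (\<lambda>z. LINT y|lborel. norm (case (z, y) of (z, y) \<Rightarrow> heat \<epsilon> z *\<^sub>R (f (z + y) * cnj (f y))))"
  proof (rule Bochner_Integration.integrable_bound[OF integrable_mult_left[OF heat_integral(1)[OF \<epsilon>], of "2 * L"]])
   show "(\<lambda>z. LINT y|lborel. norm (case (z, y) of (z, y) \<Rightarrow> heat \<epsilon> z *\<^sub>R (f (z + y) * cnj (f y)))) \<in> borel_measurable lborel" by measurable
   show "AE z in lborel. norm (LINT y|lborel. norm (case (z, y) of (z, y) \<Rightarrow> heat \<epsilon> z *\<^sub>R (f (z + y) * cnj (f y)))) \<le> norm (heat \<epsilon> z * (2 * L))"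
   proof (intro AE_I2)
    fix z :: 'a
    have h0: "heat \<epsilon> z \<ge> 0" by (simp add: heat_def)
    have "(LINT y|lborel. norm (case (z, y) of (z, y) \<Rightarrow> heat \<epsilon> z *\<^sub>R (f (z + y) * cnj (f y)))) = heat \<epsilon> z * (LINT y|lborel. norm (f (z + y) * cnj (f y)))"
     using h0 by simp
    moreover have "heat \<epsilon> z * (LINT y|lborel. norm (f (z + y) * cnj (f y))) \<le> heat \<epsilon> z * (2 * L)" by (intro mult_left_mono bd h0)
    moreover have "0 \<le> heat \<epsilon> z * (LINT y|lborel. norm (f (z + y) * cnj (f y)))" using h0 by (intro mult_nonneg_nonneg integral_nonneg_AE AE_I2) auto
    ultimately show "norm (LINT y|lborel. norm (case (z, y) of (z, y) \<Rightarrow> heat \<epsilon> z *\<^sub>R (f (z + y) * cnj (f y)))) \<le> norm (heat \<epsilon> z * (2 * L))" by simp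
   qed
  qed
 qed
 have "complex_of_real (LINT \<xi>|lborel. (cmod (fourier f \<xi>))\<^sup>2 * exp (- (\<epsilon> * (norm \<xi>)\<^sup>2))) = (LINT \<xi>|lborel. h \<xi> * cnj (fourier f \<xi>))"
  unfolding sq integral_complex_of_real ..
 also have "\<dots> = (LINT \<xi>|lborel. c * (LINT y|lborel. h \<xi> * cnj (f y) * cis (y \<bullet> \<xi>)))"
 proof (rule Bochner_Integration.integral_cong[OF refl])
  fix \<xi>
  have "cnj (fourier f \<xi>) = c * (LINT y|lborel. cnj (cis (- (y \<bullet> \<xi>)) * f y))"
   unfolding fourier_def c_def[symmetric] Bochner_Integration.integral_cnj by simp
  thus "h \<xi> * cnj (fourier f \<xi>) = c * (LINT y|lborel. h \<xi> * cnj (f y) * cis (y \<bullet> \<xi>))"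
   by (simp add: cis_cnj mult_ac flip: integral_mult_right_zero)
 qed
 also have "\<dots> = c * (LINT \<xi>|lborel. LINT y|lborel. h \<xi> * cnj (f y) * cis (y \<bullet> \<xi>))" by simp
 also have "(LINT \<xi>|lborel. LINT y|lborel. h \<xi> * cnj (f y) * cis (y \<bullet> \<xi>)) = (LINT y|lborel. LINT \<xi>|lborel. h \<xi> * cnj (f y) * cis (y \<bullet> \<xi>))"
  using fubini_product(2)[OF hi fci, of "\<lambda>\<xi> y. cis (y \<bullet> \<xi>)" 1] by simp
 also have "\<dots> = (LINT y|lborel. cnj (f y) * (LINT \<xi>|lborel. cis (y \<bullet> \<xi>) * h \<xi>))"
  by (simp add: mult_ac flip: integral_mult_right_zero)
 also have "c * \<dots> = (LINT y|lborel. LINT z|lborel. heat \<epsilon> z *\<^sub>R (f (z + y) * cnj (f y)))"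
 proof -
  have "c * (cnj (f y) * (LINT \<xi>|lborel. cis (y \<bullet> \<xi>) * h \<xi>)) = (LINT z|lborel. heat \<epsilon> z *\<^sub>R (f (z + y) * cnj (f y)))" for y
  proof -
   have m: "(\<lambda>x. f x * complex_of_real ((pi / \<epsilon>) powr (real DIM('a) / 2) * exp (- ((norm (y - x))\<^sup>2 / (4 * \<epsilon>))))) \<in> borel_measurable borel" by measurable
   have "(LINT x|lborel. f x * complex_of_real ((pi / \<epsilon>) powr (real DIM('a) / 2) * exp (- ((norm (y - x))\<^sup>2 / (4 * \<epsilon>))))) =
     (LINT z|lborel. f (z + y) * complex_of_real ((pi / \<epsilon>) powr (real DIM('a) / 2) * exp (- ((norm z)\<^sup>2 / (4 * \<epsilon>)))))"
    using lborel_shift(1)[OF m, of "- y"] by simp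
   hence "c * (cnj (f y) * (LINT \<xi>|lborel. cis (y \<bullet> \<xi>) * h \<xi>)) = (LINT z|lborel. of_real (c * c) * (f (z + y) * complex_of_real ((pi / \<epsilon>) powr (real DIM('a) / 2) * exp (- ((norm z)\<^sup>2 / (4 * \<epsilon>))))) * cnj (f y))"
    unfolding inner_int by (simp add: mult_ac)
   also have "\<dots> = (LINT z|lborel. heat \<epsilon> z *\<^sub>R (f (z + y) * cnj (f y)))"
    unfolding heat_def const[symmetric] by (simp add: scaleR_conv_of_real mult_ac)
   finally show ?thesis .
  qed
  thus ?thesis by (simp flip: integral_mult_right_zero)
 qed
 also have "\<dots> = (LINT z|lborel. LINT y|lborel. heat \<epsilon> z *\<^sub>R (f (z + y) * cnj (f y)))"
  using lborel_pair.Fubini_integral[OF prod] by simp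
 finally have main: "complex_of_real (LINT \<xi>|lborel. (cmod (fourier f \<xi>))\<^sup>2 * exp (- (\<epsilon> * (norm \<xi>)\<^sup>2))) = (LINT z|lborel. heat \<epsilon> z *\<^sub>R (LINT y|lborel. f (z + y) * cnj (f y)))"
  by simp
 have inn: "inner (translate (- z) (mk f)) (mk f) = Re (LINT y|lborel. f (z + y) * cnj (f y))" for z
  unfolding translate_mk[OF fs] inner_mk[OF shift_sq[OF fs] fs] by (simp add: add.commute)
 show "(LINT \<xi>|lborel. (cmod (fourier f \<xi>))\<^sup>2 * exp (- (\<epsilon> * (norm \<xi>)\<^sup>2))) = (LINT z|lborel. heat \<epsilon> z * inner (translate (- z) (mk f)) (mk f))"
 proof -
  have "integrable lborel (\<lambda>z. heat \<epsilon> z *\<^sub>R (LINT y|lborel. f (z + y) * cnj (f y)))"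
   using lborel_pair.integrable_fst'[OF prod] by simp
  from integral_Re[OF this] arg_cong[OF main, of Re] show ?thesis unfolding inn by simp
 qed
qed

text \<open>As \<epsilon> tends to 0, the Gaussian mean increases to the integral of the squared
  modulus of the transform, while the averaged autocorrelation tends to its value at 0, the squared
  norm of f, because translations are strongly continuous. Square integrability of the transform and
  the isometry come out together.\<close>

lemma plancherel_l1_l2:
 fixes f :: "'a::euclidean_space \<Rightarrow> complex"
 assumes f: "f \<in> l1_l2"
 shows "fourier f \<in> sq_integrable" "norm (mk (fourier f)) = norm (mk f)"
proof -
 note fs = l1_l2D(1)[OF f] and fi = l1_l2D(2)[OF f]
 have fm[measurable]: "f \<in> borel_measurable borel" "fourier f \<in> borel_measurable borel" using fi fourier_measurable[OF fi] by auto
 define e where "e k = 1 / real (Suc k)" for k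
 have e: "e k > 0" for k by (simp add: e_def)
 have e0: "e \<longlonglongrightarrow> 0" unfolding e_def using LIMSEQ_Suc[OF lim_1_over_n] by simp
 define I where "I z = inner (translate (- z) (mk f)) (mk f)" for z
 have Im[measurable]: "I \<in> borel_measurable borel"
  unfolding I_def translate_mk[OF fs] inner_mk[OF shift_sq[OF fs] fs] by measurable
 have Ib: "\<bar>I z\<bar> \<le> (norm (mk f))\<^sup>2" for z
  unfolding I_def using Cauchy_Schwarz_ineq2[of "translate (- z) (mk f)" "mk f"] by (simp add: norm_translate power2_eq_square)
 have h0: "heat r z \<ge> 0" for r and z :: 'a by (simp add: heat_def)
 define G where "G k = (LINT \<xi>|lborel. (cmod (fourier f \<xi>))\<^sup>2 * exp (- (e k * (norm \<xi>)\<^sup>2)))" for k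
 \<comment> \<open>Rescaling by sqrt (e k) moves the parameter from the heat kernel into the
   argument of \<open>I\<close>, so that one fixed majorant serves for dominated
   convergence.\<close>
 have G: "G k = (LINT w|lborel. heat 1 w * I (sqrt (e k) *\<^sub>R w))" for k
 proof -
  have "G k = (LINT z|lborel. heat (e k) z * I z)" unfolding G_def fourier_gaussian_mean(2)[OF f e] I_def ..
  also have "\<dots> = (LINT w|lborel. sqrt (e k) ^ DIM('a) *\<^sub>R (heat (e k) (sqrt (e k) *\<^sub>R w) * I (sqrt (e k) *\<^sub>R w)))"
   by (rule lborel_scale) (use e[of k] in auto)
  also have "\<dots> = (LINT w|lborel. heat 1 w * I (sqrt (e k) *\<^sub>R w))"
   unfolding heat_scale[OF e, of k, symmetric] by (simp add: mult_ac)
  finally show ?thesis .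
 qed
 have "(\<lambda>k. G k) \<longlonglongrightarrow> (LINT w|lborel. heat 1 (w::'a) * (norm (mk f))\<^sup>2)"
  unfolding G
 proof (rule integral_dominated_convergence[where w="\<lambda>w. heat 1 w * (norm (mk f))\<^sup>2"])
  show "integrable lborel (\<lambda>w::'a. heat 1 w * (norm (mk f))\<^sup>2)" using heat_integral(1)[where 'a='a, of 1] by simp
  show "AE w in lborel. (\<lambda>k. heat 1 (w::'a) * I (sqrt (e k) *\<^sub>R w)) \<longlonglongrightarrow> heat 1 w * (norm (mk f))\<^sup>2"
  proof (intro AE_I2 tendsto_mult tendsto_const)
   fix w :: 'a
   have "(\<lambda>k. - (sqrt (e k) *\<^sub>R w)) \<longlonglongrightarrow> - (sqrt 0 *\<^sub>R w)" by (intro tendsto_intros e0)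
   hence "(\<lambda>k. translate (- (sqrt (e k) *\<^sub>R w)) (mk f)) \<longlonglongrightarrow> mk f" by (intro translate_tendsto) simp
   thus "(\<lambda>k. I (sqrt (e k) *\<^sub>R w)) \<longlonglongrightarrow> (norm (mk f))\<^sup>2"
    unfolding I_def power2_norm_eq_inner by (intro tendsto_intros)
  qed
  show "AE w in lborel. norm (heat 1 (w::'a) * I (sqrt (e k) *\<^sub>R w)) \<le> heat 1 w * (norm (mk f))\<^sup>2" for k
   using Ib h0 by (intro AE_I2) (auto simp: abs_mult intro!: mult_left_mono)
  show "(\<lambda>w. heat 1 w * I (sqrt (e k) *\<^sub>R w)) \<in> borel_measurable lborel" for k by measurable
 qed simp
 hence Glim: "G \<longlonglongrightarrow> (norm (mk f))\<^sup>2" using heat_integral(2)[where 'a='a, of 1] by simp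
 have "(\<lambda>k. \<integral>\<^sup>+ \<xi>. ennreal ((cmod (fourier f \<xi>))\<^sup>2 * exp (- (e k * (norm \<xi>)\<^sup>2))) \<partial>lborel) \<longlonglongrightarrow> (\<integral>\<^sup>+ \<xi>. ennreal ((cmod (fourier f \<xi>))\<^sup>2) \<partial>lborel)"
 proof (rule nn_integral_LIMSEQ)
  show "incseq (\<lambda>k \<xi>. ennreal ((cmod (fourier f \<xi>))\<^sup>2 * exp (- (e k * (norm \<xi>)\<^sup>2))))"
  proof (intro incseq_SucI le_funI ennreal_leI mult_left_mono)
   fix k and \<xi> :: 'a
   have "e (Suc k) \<le> e k" by (simp add: e_def field_simps)
   hence "e (Suc k) * (norm \<xi>)\<^sup>2 \<le> e k * (norm \<xi>)\<^sup>2" by (intro mult_right_mono) auto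
   thus "exp (- (e k * (norm \<xi>)\<^sup>2)) \<le> exp (- (e (Suc k) * (norm \<xi>)\<^sup>2))" by simp
  qed simp
  show "(\<lambda>k. ennreal ((cmod (fourier f \<xi>))\<^sup>2 * exp (- (e k * (norm \<xi>)\<^sup>2)))) \<longlonglongrightarrow> ennreal ((cmod (fourier f \<xi>))\<^sup>2)" for \<xi>
  proof (rule tendsto_ennrealI)
   have "(\<lambda>k. (cmod (fourier f \<xi>))\<^sup>2 * exp (- (e k * (norm \<xi>)\<^sup>2))) \<longlonglongrightarrow> (cmod (fourier f \<xi>))\<^sup>2 * exp (- (0 * (norm \<xi>)\<^sup>2))"
    by (intro tendsto_intros e0)
   thus "(\<lambda>k. (cmod (fourier f \<xi>))\<^sup>2 * exp (- (e k * (norm \<xi>)\<^sup>2))) \<longlonglongrightarrow> (cmod (fourier f \<xi>))\<^sup>2" by simp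
  qed
 qed measurable
 moreover have "(\<integral>\<^sup>+ \<xi>. ennreal ((cmod (fourier f \<xi>))\<^sup>2 * exp (- (e k * (norm \<xi>)\<^sup>2))) \<partial>lborel) = ennreal (G k)" for k
  unfolding G_def by (rule nn_integral_eq_integral[OF fourier_gaussian_mean(1)[OF f e]]) simp
 ultimately have "(\<lambda>k. ennreal (G k)) \<longlonglongrightarrow> (\<integral>\<^sup>+ \<xi>. ennreal ((cmod (fourier f \<xi>))\<^sup>2) \<partial>lborel)" by simp
 from LIMSEQ_unique[OF this tendsto_ennrealI[OF Glim]]
 have nn: "(\<integral>\<^sup>+ \<xi>. ennreal ((cmod (fourier f \<xi>))\<^sup>2) \<partial>lborel) = ennreal ((norm (mk f))\<^sup>2)" .
 have "integrable lborel (\<lambda>\<xi>. (cmod (fourier f \<xi>))\<^sup>2)"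
  by (rule integrableI_nonneg) (use nn fm in auto)
 thus s: "fourier f \<in> sq_integrable" using fm by (simp add: sq_integrable_def)
 have "(norm (mk (fourier f)))\<^sup>2 = (norm (mk f))\<^sup>2" using nn nn_norm_mk[OF s] by simp
 thus "norm (mk (fourier f)) = norm (mk f)" by simp
qed

section \<open>Extension of the transform to the Hilbert space, and its inverse\<close>

definition trunc :: "real \<Rightarrow> ('a::euclidean_space \<Rightarrow> complex) \<Rightarrow> 'a \<Rightarrow> complex" where
 "trunc R f x = indicator (cball 0 R) x * f x"

lemma emeasure_cball_finite: "emeasure lborel (cball (0::'a::euclidean_space) R) < \<infinity>"
 by (rule emeasure_bounded_finite) simp

lemma trunc_l1_l2: "f \<in> sq_integrable \<Longrightarrow> trunc R f \<in> l1_l2"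
 unfolding l1_l2_def trunc_def[abs_def] mem_Collect_eq
 by (intro conjI integrable_mult_sq indicator_sq emeasure_cball_finite mul_sq bdd_measurable_indicator) auto

lemma trunc_tendsto:
 assumes f: "f \<in> sq_integrable" and R: "filterlim R at_top sequentially"
 shows "(\<lambda>n. mk (trunc (R n) f)) \<longlonglongrightarrow> mk f"
proof (rule tendsto_dominated(2)[OF _ f, where K=1])
 show "trunc (R n) f \<in> borel_measurable borel" for n using l1_l2D(1)[OF trunc_l1_l2[OF f]] by (rule sq_measurable)
 show "AE t in lborel. cmod (trunc (R n) f t) \<le> 1 * cmod (f t)" for n by (auto simp: trunc_def indicator_def)
 show "AE t in lborel. (\<lambda>n. trunc (R n) f t) \<longlonglongrightarrow> f t"
 proof (intro AE_I2 tendsto_eventually)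
  fix t :: 'a
  have "\<forall>\<^sub>F n in sequentially. norm t \<le> R n" using R by (simp add: filterlim_at_top)
  thus "\<forall>\<^sub>F n in sequentially. trunc (R n) f t = f t" by eventually_elim (simp add: trunc_def)
 qed
qed (use f in measurable)

lemma l1_l2_dense:
 fixes x :: "'a::euclidean_space l2"
 obtains f where "\<And>n. f n \<in> l1_l2" "(\<lambda>n. mk (f n)) \<longlonglongrightarrow> x"
proof (rule that)
 show "trunc (real n) (fn x) \<in> l1_l2" for n by (rule trunc_l1_l2[OF fn(1)])
 show "(\<lambda>n. mk (trunc (real n) (fn x))) \<longlonglongrightarrow> x" using trunc_tendsto[OF fn(1)[of x] filterlim_real_sequentially] unfolding fn(2) .
qed

definition FT :: "'a::euclidean_space l2 \<Rightarrow> 'a l2" where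
 "FT x = lim (\<lambda>n. mk (fourier (trunc (real n) (fn x))))"

lemma fourier_isometry:
 assumes f: "f \<in> l1_l2" and g: "g \<in> l1_l2"
 shows "norm (mk (fourier f) - mk (fourier g)) = norm (mk f - mk g)"
proof -
 have d: "(\<lambda>x. f x - g x) \<in> l1_l2" using f g by (auto simp: l1_l2_def sq_integrable_diff)
 show ?thesis
  unfolding mk_ops(2)[OF plancherel_l1_l2(1)[OF f] plancherel_l1_l2(1)[OF g]] mk_ops(2)[OF l1_l2D(1)[OF f] l1_l2D(1)[OF g]]
   fourier_linear(1)[OF l1_l2D(2)[OF f] l1_l2D(2)[OF g], symmetric] by (rule plancherel_l1_l2(2)[OF d])
qed

text \<open>The transform is isometric on differences, so approximations with the same limit have
  transforms with the same limit; \<open>FT\<close> may be computed along any of them and not only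
  along truncations.\<close>

lemma FT_unique:
 fixes x :: "'a::euclidean_space l2"
 assumes f: "\<And>n. f n \<in> l1_l2" and lim: "(\<lambda>n. mk (f n)) \<longlonglongrightarrow> x"
 shows "(\<lambda>n. mk (fourier (f n))) \<longlonglongrightarrow> FT x"
proof -
 define t where "t n = trunc (real n) (fn x)" for n
 have t: "t n \<in> l1_l2" for n unfolding t_def by (rule trunc_l1_l2[OF fn(1)])
 have tlim: "(\<lambda>n. mk (t n)) \<longlonglongrightarrow> x" using trunc_tendsto[OF fn(1) filterlim_real_sequentially, of x] unfolding t_def fn(2) .
 have "Cauchy (\<lambda>n. mk (t n))" using tlim by (rule LIMSEQ_imp_Cauchy)
 hence "Cauchy (\<lambda>n. mk (fourier (t n)))" unfolding Cauchy_def dist_norm fourier_isometry[OF t t] .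
 hence 1: "(\<lambda>n. mk (fourier (t n))) \<longlonglongrightarrow> FT x" unfolding FT_def t_def by (simp add: Cauchy_convergent_iff convergent_LIMSEQ_iff)
 have "(\<lambda>n. mk (f n) - mk (t n)) \<longlonglongrightarrow> x - x" by (intro tendsto_diff lim tlim)
 hence "(\<lambda>n. norm (mk (f n) - mk (t n))) \<longlonglongrightarrow> 0" by (simp add: tendsto_norm_zero)
 hence "(\<lambda>n. mk (fourier (f n)) - mk (fourier (t n))) \<longlonglongrightarrow> 0" unfolding fourier_isometry[OF f t, symmetric] by (rule tendsto_norm_zero_cancel)
 from tendsto_add[OF this 1] show ?thesis by simp
qed

lemma FT_mk: "f \<in> l1_l2 \<Longrightarrow> FT (mk f) = mk (fourier f)"
 by (rule LIMSEQ_unique[OF FT_unique[of "\<lambda>_. f"] tendsto_const]) auto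

lemma norm_FT: "norm (FT x) = norm x"
proof -
 obtain f where f: "\<And>n. f n \<in> l1_l2" "(\<lambda>n. mk (f n)) \<longlonglongrightarrow> x" using l1_l2_dense by blast
 show ?thesis
  using LIMSEQ_unique[OF tendsto_norm[OF FT_unique[OF f]]] tendsto_norm[OF f(2)] by (simp add: plancherel_l1_l2(2)[OF f(1)])
qed

lemma FT_add: "FT (x + y) = FT x + FT y"
proof -
 obtain f where f: "\<And>n. f n \<in> l1_l2" "(\<lambda>n. mk (f n)) \<longlonglongrightarrow> x" using l1_l2_dense by blast
 obtain g where g: "\<And>n. g n \<in> l1_l2" "(\<lambda>n. mk (g n)) \<longlonglongrightarrow> y" using l1_l2_dense by blast
 have s: "(\<lambda>x. f n x + g n x) \<in> l1_l2" for n using f(1)[of n] g(1)[of n] by (auto simp: l1_l2_def sq_integrable_add)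
 have "(\<lambda>n. mk (\<lambda>x. f n x + g n x)) \<longlonglongrightarrow> x + y"
  using tendsto_add[OF f(2) g(2)] unfolding mk_ops(1)[OF l1_l2D(1)[OF f(1)] l1_l2D(1)[OF g(1)]] .
 from FT_unique[OF s this] have "(\<lambda>n. mk (fourier (f n)) + mk (fourier (g n))) \<longlonglongrightarrow> FT (x + y)"
  unfolding fourier_linear(2)[OF l1_l2D(2)[OF f(1)] l1_l2D(2)[OF g(1)]] mk_ops(1)[OF plancherel_l1_l2(1)[OF f(1)] plancherel_l1_l2(1)[OF g(1)]] .
 from LIMSEQ_unique[OF this tendsto_add[OF FT_unique[OF f] FT_unique[OF g]]] show ?thesis .
qed

lemma FT_mul_const: "FT (mul (\<lambda>_. c) x) = mul (\<lambda>_. c) (FT x)"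
proof -
 obtain f where f: "\<And>n. f n \<in> l1_l2" "(\<lambda>n. mk (f n)) \<longlonglongrightarrow> x" using l1_l2_dense by blast
 have s: "(\<lambda>x. c * f n x) \<in> l1_l2" for n using f(1)[of n] by (auto simp: l1_l2_def sq_integrable_cmult)
 have "(\<lambda>n. mk (\<lambda>x. c * f n x)) \<longlonglongrightarrow> mul (\<lambda>_. c) x"
  using mul_tendsto[OF bdd_measurable_const f(2), of c] unfolding mul_mk[OF bdd_measurable_const l1_l2D(1)[OF f(1)]] .
 from FT_unique[OF s this] have "(\<lambda>n. mul (\<lambda>_. c) (mk (fourier (f n)))) \<longlonglongrightarrow> FT (mul (\<lambda>_. c) x)"
  unfolding fourier_linear(3)[OF l1_l2D(2)[OF f(1)] l1_l2D(2)[OF f(1)]] mul_mk[OF bdd_measurable_const plancherel_l1_l2(1)[OF f(1)]] .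
 from LIMSEQ_unique[OF this mul_tendsto[OF bdd_measurable_const FT_unique[OF f]]] show ?thesis .
qed

lemma scaleR_eq_mul: "r *\<^sub>R x = mul (\<lambda>_. complex_of_real r) x"
 using mk_ops(3)[OF fn(1)[of x] fn(1)[of x], of r] by (simp add: fn mul_def scaleR_conv_of_real)

lemma linear_FT: "linear FT"
 by (rule linearI[OF FT_add]) (simp add: scaleR_eq_mul FT_mul_const)

lemma isometry_tendsto:
 fixes V :: "'b::real_normed_vector \<Rightarrow> 'c::real_normed_vector"
 assumes "linear V" "\<And>x. norm (V x) = norm x" "X \<longlonglongrightarrow> x"
 shows "(\<lambda>n. V (X n)) \<longlonglongrightarrow> V x"
proof -
 have "bounded_linear V" using assms by (intro bounded_linear_intro[of _ 1]) (auto simp: linear_add linear_scale)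
 from bounded_linear.tendsto[OF this assms(3)] show ?thesis .
qed

definition cj :: "'a::euclidean_space l2 \<Rightarrow> 'a l2" where
 "cj x = mk (\<lambda>t. cnj (fn x t))"

lemma cj_mk: "f \<in> sq_integrable \<Longrightarrow> cj (mk f) = mk (\<lambda>t. cnj (f t))"
 unfolding cj_def using fn_mk[of f] by (subst mk_eq_iff) (auto intro: sq_integrable_cnj fn elim: eventually_mono)

lemma cj_cj: "cj (cj x) = x"
 using cj_mk[OF sq_integrable_cnj[OF fn(1)[of x]]] by (simp add: cj_def[of x] fn)

lemma norm_cj: "norm (cj x) = norm x"
proof -
 have "(norm (cj x))\<^sup>2 = (norm x)\<^sup>2" unfolding cj_def norm_mk_sq[OF sq_integrable_cnj[OF fn(1)]] norm_l2_sq[of x] by simp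
 thus ?thesis by simp
qed

lemma linear_cj: "linear cj"
proof (rule linearI)
 show "cj (x + y) = cj x + cj y" for x y :: "'a l2"
  using cj_mk[OF sq_integrable_add[OF fn(1)[of x] fn(1)[of y]]] mk_ops(1)[OF fn(1)[of x] fn(1)[of y]]
   mk_ops(1)[OF sq_integrable_cnj[OF fn(1)[of x]] sq_integrable_cnj[OF fn(1)[of y]]] by (simp add: fn cj_def)
 show "cj (r *\<^sub>R x) = r *\<^sub>R cj x" for r and x :: "'a l2"
  using cj_mk[OF sq_integrable_scaleR[OF fn(1)[of x], of r]] mk_ops(3)[OF fn(1)[of x] fn(1)[of x], of r]
   mk_ops(3)[OF sq_integrable_cnj[OF fn(1)[of x]] fn(1)[of x], of r] by (simp add: fn cj_def)
qed

lemma fourier_multiplication: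
 fixes f g :: "'a::euclidean_space \<Rightarrow> complex"
 assumes f: "integrable lborel f" and g: "integrable lborel g"
 shows "(LINT \<xi>|lborel. fourier f \<xi> * g \<xi>) = (LINT \<xi>|lborel. f \<xi> * fourier g \<xi>)"
proof -
 define c where "c = complex_of_real ((2 * pi) powr (- real DIM('a) / 2))"
 have "(LINT \<xi>|lborel. fourier f \<xi> * g \<xi>) = (LINT \<xi>|lborel. LINT x|lborel. c * (g \<xi> * f x * cis (- (x \<bullet> \<xi>))))"
  unfolding fourier_def c_def[symmetric] by (simp add: mult_ac flip: integral_mult_left_zero integral_mult_right_zero)
 also have "\<dots> = c * (LINT \<xi>|lborel. LINT x|lborel. g \<xi> * f x * cis (- (x \<bullet> \<xi>)))" by simp
 also have "(LINT \<xi>|lborel. LINT x|lborel. g \<xi> * f x * cis (- (x \<bullet> \<xi>))) = (LINT x|lborel. LINT \<xi>|lborel. g \<xi> * f x * cis (- (x \<bullet> \<xi>)))"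
  using fubini_product(2)[OF g f, of "\<lambda>\<xi> x. cis (- (x \<bullet> \<xi>))" 1] by simp
 also have "c * \<dots> = (LINT x|lborel. LINT \<xi>|lborel. c * (g \<xi> * f x * cis (- (x \<bullet> \<xi>))))" by simp
 also have "\<dots> = (LINT \<xi>|lborel. f \<xi> * fourier g \<xi>)"
  unfolding fourier_def c_def[symmetric] by (simp add: mult_ac inner_commute flip: integral_mult_left_zero integral_mult_right_zero)
 finally show ?thesis .
qed

text \<open>Conjugating one argument turns the Hermitian product into the bilinear pairing, for
  which Fubini's theorem makes the transform symmetric; density and continuity extend the identity
  to all vectors.\<close>

lemma FT_multiplication: "inner (FT x) (cj y) = inner x (cj (FT y))"
proof -
 obtain f where f: "\<And>n. f n \<in> l1_l2" "(\<lambda>n. mk (f n)) \<longlonglongrightarrow> x" using l1_l2_dense by blast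
 obtain g where g: "\<And>n. g n \<in> l1_l2" "(\<lambda>n. mk (g n)) \<longlonglongrightarrow> y" using l1_l2_dense by blast
 note cl = isometry_tendsto[OF linear_cj norm_cj]
 have eq: "inner (mk (fourier (f n))) (cj (mk (g n))) = inner (mk (f n)) (cj (mk (fourier (g n))))" for n
  unfolding cj_mk[OF l1_l2D(1)[OF g(1)]] cj_mk[OF plancherel_l1_l2(1)[OF g(1)]]
   inner_mk[OF plancherel_l1_l2(1)[OF f(1)] sq_integrable_cnj[OF l1_l2D(1)[OF g(1)]]]
   inner_mk[OF l1_l2D(1)[OF f(1)] sq_integrable_cnj[OF plancherel_l1_l2(1)[OF g(1)]]]
  using fourier_multiplication[OF l1_l2D(2)[OF f(1)] l1_l2D(2)[OF g(1)]] by simp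
 have "(\<lambda>n. inner (mk (fourier (f n))) (cj (mk (g n)))) \<longlonglongrightarrow> inner (FT x) (cj y)"
  by (intro tendsto_inner FT_unique f cl g)
 moreover have "(\<lambda>n. inner (mk (f n)) (cj (mk (fourier (g n))))) \<longlonglongrightarrow> inner x (cj (FT y))"
  by (intro tendsto_inner FT_unique f cl g)
 ultimately show ?thesis unfolding eq by (rule LIMSEQ_unique)
qed

text \<open>Conjugation before and after replaces the kernel exp(- i x \<bullet> \<xi>) by exp(i x
  \<bullet> \<xi>).\<close>

definition iFT :: "'a::euclidean_space l2 \<Rightarrow> 'a l2" where
 "iFT y = cj (FT (cj y))"

lemma linear_iFT: "linear iFT"
 unfolding iFT_def[abs_def] using linear_compose[OF linear_compose[OF linear_cj linear_FT] linear_cj] by (simp add: o_def)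

lemma norm_iFT: "norm (iFT y) = norm y"
 by (simp add: iFT_def norm_cj norm_FT)

text \<open>The vectors FT (iFT y) and y have the same norm, and by the multiplication formula their
  inner product is the square of that norm; hence they coincide. The inversion thus comes from the
  isometry and not from an inversion integral.\<close>

lemma FT_iFT: "FT (iFT y) = y"
proof -
 have n: "inner (iFT y) (iFT y) = inner y y" by (simp add: norm_iFT flip: power2_norm_eq_inner)
 have 1: "inner (FT (iFT y)) y = inner y y"
  using FT_multiplication[of "iFT y" "cj y"] n unfolding cj_cj iFT_def by simp
 have 2: "inner (FT (iFT y)) (FT (iFT y)) = inner y y" by (simp add: norm_FT norm_iFT flip: power2_norm_eq_inner)
 have "inner (FT (iFT y) - y) (FT (iFT y) - y) = 0"
  unfolding inner_diff_left inner_diff_right 2 1 inner_commute[of y "FT (iFT y)"] by simp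
 thus ?thesis by simp
qed

text \<open>An isometry is injective, so its right inverse is also a left inverse.\<close>

lemma iFT_FT: "iFT (FT x) = x"
proof -
 have "norm (iFT (FT x) - x) = norm (FT (iFT (FT x) - x))" by (simp add: norm_FT)
 also have "\<dots> = 0" by (simp add: linear_diff[OF linear_FT] FT_iFT)
 finally show ?thesis by simp
qed

lemma iFT_mk:
 fixes g :: "'a::euclidean_space \<Rightarrow> complex"
 assumes g: "g \<in> l1_l2"
 shows "iFT (mk g) = mk (\<lambda>x. complex_of_real ((2 * pi) powr (- real DIM('a) / 2)) * (LINT \<xi>|lborel. cis (x \<bullet> \<xi>) * g \<xi>))"
  "(\<lambda>x. complex_of_real ((2 * pi) powr (- real DIM('a) / 2)) * (LINT \<xi>|lborel. cis (x \<bullet> \<xi>) * g \<xi>)) \<in> sq_integrable"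
proof -
 have c: "(\<lambda>t. cnj (g t)) \<in> l1_l2" using g by (simp add: l1_l2_def sq_integrable_cnj)
 have eq: "(\<lambda>x. cnj (fourier (\<lambda>t. cnj (g t)) x)) = (\<lambda>x. complex_of_real ((2 * pi) powr (- real DIM('a) / 2)) * (LINT \<xi>|lborel. cis (x \<bullet> \<xi>) * g \<xi>))"
  unfolding fourier_def complex_cnj_mult Bochner_Integration.integral_cnj[symmetric] by (simp add: cis_cnj inner_commute)
 show "iFT (mk g) = mk (\<lambda>x. complex_of_real ((2 * pi) powr (- real DIM('a) / 2)) * (LINT \<xi>|lborel. cis (x \<bullet> \<xi>) * g \<xi>))"
  unfolding iFT_def cj_mk[OF l1_l2D(1)[OF g]] FT_mk[OF c] cj_mk[OF plancherel_l1_l2(1)[OF c]] eq ..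
 show "(\<lambda>x. complex_of_real ((2 * pi) powr (- real DIM('a) / 2)) * (LINT \<xi>|lborel. cis (x \<bullet> \<xi>) * g \<xi>)) \<in> sq_integrable"
  using sq_integrable_cnj[OF plancherel_l1_l2(1)[OF c]] unfolding eq .
qed

lemma bdd_measurable_cis: "bdd_measurable (\<lambda>\<xi>. cis (- (h \<bullet> \<xi>)))"
 unfolding bdd_measurable_def by (auto intro!: exI[of _ 1])

lemma FT_translate: "FT (translate h x) = mul (\<lambda>\<xi>. cis (- (h \<bullet> \<xi>))) (FT x)"
proof -
 obtain f where f: "\<And>n. f n \<in> l1_l2" "(\<lambda>n. mk (f n)) \<longlonglongrightarrow> x" using l1_l2_dense by blast
 have fm: "f n \<in> borel_measurable borel" for n by (rule sq_measurable[OF l1_l2D(1)[OF f(1)]])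
 have s: "(\<lambda>t. f n (t - h)) \<in> l1_l2" for n
  using f(1)[of n] lborel_shift(2)[OF fm[of n], of h] by (auto simp: l1_l2_def shift_sq)
 have "(\<lambda>n. mk (\<lambda>t. f n (t - h))) \<longlonglongrightarrow> translate h x"
  using isometry_tendsto[OF linear_translate norm_translate f(2), of h] unfolding translate_mk[OF l1_l2D(1)[OF f(1)]] .
 note 1 = FT_unique[OF s this]
 have "fourier (\<lambda>t. f n (t - h)) \<xi> = cis (- (h \<bullet> \<xi>)) * fourier (f n) \<xi>" for n \<xi>
 proof -
  have m: "(\<lambda>t. cis (- ((t + h) \<bullet> \<xi>)) * f n t) \<in> borel_measurable borel" using fm[of n] by measurable
  have "(LINT t|lborel. cis (- (t \<bullet> \<xi>)) * f n (t - h)) = (LINT t|lborel. cis (- ((t + h) \<bullet> \<xi>)) * f n t)"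
   using lborel_shift(1)[OF m, of h] by simp
  also have "(\<lambda>t. cis (- ((t + h) \<bullet> \<xi>)) * f n t) = (\<lambda>t. cis (- (h \<bullet> \<xi>)) * (cis (- (t \<bullet> \<xi>)) * f n t))"
  proof
   fix t
   have "cis (- ((t + h) \<bullet> \<xi>)) = cis (- (h \<bullet> \<xi>)) * cis (- (t \<bullet> \<xi>))" unfolding cis_mult by (rule arg_cong[where f=cis]) (simp add: inner_add_left)
   thus "cis (- ((t + h) \<bullet> \<xi>)) * f n t = cis (- (h \<bullet> \<xi>)) * (cis (- (t \<bullet> \<xi>)) * f n t)" by simp
  qed
  finally show ?thesis unfolding fourier_def by simp
 qed
 hence "fourier (\<lambda>t. f n (t - h)) = (\<lambda>\<xi>. cis (- (h \<bullet> \<xi>)) * fourier (f n) \<xi>)" for n by (rule ext)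
 hence eq: "mk (fourier (\<lambda>t. f n (t - h))) = mul (\<lambda>\<xi>. cis (- (h \<bullet> \<xi>))) (mk (fourier (f n)))" for n
  unfolding mul_mk[OF bdd_measurable_cis plancherel_l1_l2(1)[OF f(1)]] by simp
 from LIMSEQ_unique[OF 1[unfolded eq] mul_tendsto[OF bdd_measurable_cis FT_unique[OF f]]] show ?thesis .
qed

section \<open>The localised propagator\<close>

definition multiplier :: "('a::euclidean_space \<Rightarrow> complex) \<Rightarrow> 'a l2 \<Rightarrow> 'a l2" where
 "multiplier m x = iFT (mul m (FT x))"

lemma linear_multiplier: "bdd_measurable m \<Longrightarrow> linear (multiplier m)"
 unfolding multiplier_def[abs_def]
 using linear_compose[OF linear_compose[OF linear_FT linear_mul] linear_iFT, of m] by (simp add: o_def)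

lemma norm_multiplier: "bdd_measurable m \<Longrightarrow> (\<And>t. cmod (m t) = 1) \<Longrightarrow> norm (multiplier m x) = norm x"
 by (simp add: multiplier_def norm_iFT norm_mul_eq norm_FT)

lemma multiplier_translate:
 assumes m: "bdd_measurable m"
 shows "multiplier m (translate h x) = translate h (multiplier m x)"
proof -
 have "FT (multiplier m (translate h x)) = FT (translate h (multiplier m x))"
  unfolding multiplier_def FT_translate FT_iFT mul_mul[OF m bdd_measurable_cis] mul_mul[OF bdd_measurable_cis m]
  by (simp add: mult.commute)
 hence "iFT (FT (multiplier m (translate h x))) = iFT (FT (translate h (multiplier m x)))" by simp
 thus ?thesis unfolding iFT_FT .
qed

text \<open>By Fubini's theorem an integrable multiplier acts as convolution with its inverse
  transform; the factor c c is (2 pi)^(-n).\<close>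

lemma multiplier_kernel:
 fixes m f :: "'a::euclidean_space \<Rightarrow> complex"
 assumes m: "bdd_measurable m" "integrable lborel m" and f: "f \<in> l1_l2"
 defines "k \<equiv> \<lambda>z. LINT \<xi>|lborel. cis (z \<bullet> \<xi>) * m \<xi>" and "c \<equiv> complex_of_real ((2 * pi) powr (- real DIM('a) / 2))"
 shows "multiplier m (mk f) = mk (\<lambda>x. c * c * (LINT y|lborel. k (x - y) * f y))"
  "(\<lambda>x. c * c * (LINT y|lborel. k (x - y) * f y)) \<in> sq_integrable"
proof -
 note fs = l1_l2D(1)[OF f] and fi = l1_l2D(2)[OF f]
 have gi: "integrable lborel (\<lambda>\<xi>. m \<xi> * fourier f \<xi>)"
 proof (rule Bochner_Integration.integrable_bound[OF integrable_mult_left[OF m(2)]])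
  show "(\<lambda>\<xi>. m \<xi> * fourier f \<xi>) \<in> borel_measurable lborel" using m(2) fourier_measurable[OF fi] by measurable
  show "AE \<xi> in lborel. norm (m \<xi> * fourier f \<xi>) \<le> norm (m \<xi> * of_real ((2 * pi) powr (- real DIM('a) / 2) * (LINT x|lborel. cmod (f x))))"
   unfolding norm_mult norm_of_real
   by (intro AE_I2 mult_left_mono order_trans[OF fourier_bounded abs_ge_self]) auto
 qed
 have g: "(\<lambda>\<xi>. m \<xi> * fourier f \<xi>) \<in> l1_l2"
  unfolding l1_l2_def using gi mul_sq[OF m(1) plancherel_l1_l2(1)[OF f]] by simp
 have eq: "c * (LINT \<xi>|lborel. cis (x \<bullet> \<xi>) * (m \<xi> * fourier f \<xi>)) = c * c * (LINT y|lborel. k (x - y) * f y)" for x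
 proof -
  have e: "(\<lambda>y. c * (m \<xi> * f y * cis ((x - y) \<bullet> \<xi>))) = (\<lambda>y. cis (x \<bullet> \<xi>) * m \<xi> * c * (cis (- (y \<bullet> \<xi>)) * f y))" for \<xi>
  proof
   fix y
   have "cis ((x - y) \<bullet> \<xi>) = cis (x \<bullet> \<xi>) * cis (- (y \<bullet> \<xi>))" by (simp add: cis_mult inner_diff_left)
   thus "c * (m \<xi> * f y * cis ((x - y) \<bullet> \<xi>)) = cis (x \<bullet> \<xi>) * m \<xi> * c * (cis (- (y \<bullet> \<xi>)) * f y)" by simp
  qed
  have "cis (x \<bullet> \<xi>) * (m \<xi> * fourier f \<xi>) = c * (LINT y|lborel. m \<xi> * f y * cis ((x - y) \<bullet> \<xi>))" for \<xi>
   unfolding integral_mult_right_zero[symmetric] e unfolding integral_mult_right_zero fourier_def c_def[symmetric] by simp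
  hence "(LINT \<xi>|lborel. cis (x \<bullet> \<xi>) * (m \<xi> * fourier f \<xi>)) = c * (LINT \<xi>|lborel. LINT y|lborel. m \<xi> * f y * cis ((x - y) \<bullet> \<xi>))" by simp
  also have "(LINT \<xi>|lborel. LINT y|lborel. m \<xi> * f y * cis ((x - y) \<bullet> \<xi>)) = (LINT y|lborel. LINT \<xi>|lborel. m \<xi> * f y * cis ((x - y) \<bullet> \<xi>))"
   using fubini_product(2)[OF m(2) fi, of "\<lambda>\<xi> y. cis ((x - y) \<bullet> \<xi>)" 1] by simp
  also have "\<dots> = (LINT y|lborel. k (x - y) * f y)"
  proof (rule Bochner_Integration.integral_cong[OF refl])
   fix y
   have "(\<lambda>\<xi>. m \<xi> * f y * cis ((x - y) \<bullet> \<xi>)) = (\<lambda>\<xi>. cis ((x - y) \<bullet> \<xi>) * m \<xi> * f y)" by (simp add: mult_ac)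
   thus "(LINT \<xi>|lborel. m \<xi> * f y * cis ((x - y) \<bullet> \<xi>)) = k (x - y) * f y" unfolding k_def by simp
  qed
  finally show ?thesis by simp
 qed
 show "multiplier m (mk f) = mk (\<lambda>x. c * c * (LINT y|lborel. k (x - y) * f y))"
  unfolding multiplier_def FT_mk[OF f] mul_mk[OF m(1) plancherel_l1_l2(1)[OF f]] iFT_mk(1)[OF g] c_def[symmetric] eq ..
 show "(\<lambda>x. c * c * (LINT y|lborel. k (x - y) * f y)) \<in> sq_integrable"
  using iFT_mk(2)[OF g] unfolding c_def[symmetric] eq .
qed

text \<open>The inner product of \<open>l2\<close> is the real part of the Hermitian one, which costs the factor 2.\<close>

lemma bessel_kernel:
 fixes \<kappa> :: "'a::euclidean_space \<Rightarrow> complex"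
 assumes S: "orthonormal S" and \<kappa>: "\<kappa> \<in> sq_integrable"
 shows "(\<Sum>e\<in>S. (cmod (LINT y|lborel. \<kappa> y * fn e y))\<^sup>2) \<le> 2 * (norm (mk \<kappa>))\<^sup>2"
proof -
 define d where "d c = mk (\<lambda>y. cnj (c * \<kappa> y))" for c
 have dn: "norm (d c) = norm (mk \<kappa>)" if "cmod c = 1" for c
 proof -
  have "(norm (d c))\<^sup>2 = (norm (mk \<kappa>))\<^sup>2"
   unfolding d_def norm_mk_sq[OF sq_integrable_cnj[OF sq_integrable_cmult[OF \<kappa>]]] norm_mk_sq[OF \<kappa>]
   using that by (simp add: norm_mult)
  thus ?thesis by simp
 qed
 have di: "inner (d c) e = Re (c * (LINT y|lborel. \<kappa> y * fn e y))" for c e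
 proof -
  have "inner e (d c) = Re (LINT y|lborel. fn e y * (c * \<kappa> y))"
   unfolding d_def using inner_mk[OF fn(1)[of e] sq_integrable_cnj[OF sq_integrable_cmult[OF \<kappa>]], of c] by (simp add: fn)
  also have "(\<lambda>y. fn e y * (c * \<kappa> y)) = (\<lambda>y. c * (\<kappa> y * fn e y))" by (simp add: mult_ac)
  finally show ?thesis by (simp add: inner_commute)
 qed
 have "(\<Sum>e\<in>S. (cmod (LINT y|lborel. \<kappa> y * fn e y))\<^sup>2) = (\<Sum>e\<in>S. (inner (d 1) e)\<^sup>2) + (\<Sum>e\<in>S. (inner (d \<i>) e)\<^sup>2)"
  unfolding di by (simp add: cmod_power2 sum.distrib)
 also have "\<dots> \<le> (norm (d 1))\<^sup>2 + (norm (d \<i>))\<^sup>2" by (intro add_mono bessel_decomp(3) S)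
 also have "\<dots> = 2 * (norm (mk \<kappa>))\<^sup>2" by (simp add: dn)
 finally show ?thesis .
qed

text \<open>Up to a constant the majorant of the regularised kernels restricted to F \<times> E.
  Being complex-valued it represents, when square integrable, a vector of the Hilbert space over the
  product, so that norms and translations are available for it.\<close>

definition kernel_weight :: "real \<Rightarrow> 'a::euclidean_space set \<Rightarrow> 'a set \<Rightarrow> 'a \<times> 'a \<Rightarrow> complex" where
 "kernel_weight g E F = (\<lambda>(x, y). indicator F x * indicator E y * complex_of_real ((1 + norm (x - y)) powr g))"

lemma kernel_weight_measurable:
 assumes [measurable]: "E \<in> sets borel" "F \<in> sets borel"
 shows "kernel_weight g E F \<in> borel_measurable borel"
proof -
 have "(\<lambda>(x, y). indicator F x * indicator E y * complex_of_real ((1 + norm (x - y)) powr g)) \<in> borel_measurable (borel \<Otimes>\<^sub>M borel)" by measurable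
 thus ?thesis unfolding kernel_weight_def borel_prod .
qed

lemma nn_kernel_weight:
 assumes E[measurable]: "E \<in> sets borel" and F[measurable]: "F \<in> sets borel"
 shows "(\<integral>\<^sup>+ x. \<integral>\<^sup>+ y. ennreal ((cmod (kernel_weight g E F (x, y)))\<^sup>2) \<partial>lborel \<partial>lborel) = (\<integral>\<^sup>+ p. ennreal ((cmod (kernel_weight g E F p))\<^sup>2) \<partial>lborel)"
proof -
 have [measurable]: "kernel_weight g E F \<in> borel_measurable borel" by (rule kernel_weight_measurable[OF E F])
 have m: "(\<lambda>p. ennreal ((cmod (kernel_weight g E F p))\<^sup>2)) \<in> borel_measurable (lborel \<Otimes>\<^sub>M lborel)"
  unfolding lborel_prod by measurable
 from lborel.nn_integral_fst[OF m] show ?thesis unfolding lborel_prod .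
qed

text \<open>For fixed x in F, Bessel's inequality is applied to k (x - y) as a function of y in E,
  and the result is integrated over x. So the sum over S is bounded by the squared L2-norm of the
  kernel, and that by the weight.\<close>

lemma hilbert_schmidt_kernel:
 fixes m :: "'a::euclidean_space \<Rightarrow> complex"
 assumes m: "bdd_measurable m" "integrable lborel m"
  and C: "C \<ge> 0" "\<And>z. cmod (LINT \<xi>|lborel. cis (z \<bullet> \<xi>) * m \<xi>) \<le> C * (1 + norm z) powr g"
  and E: "E \<in> sets borel" "emeasure lborel E < \<infinity>" and F: "F \<in> sets borel"
  and w: "kernel_weight g E F \<in> sq_integrable" and S: "orthonormal S"
 defines "b \<equiv> (2 * pi) powr (- real DIM('a))"
 shows "(\<Sum>e\<in>S. (norm (mul (indicator F) (multiplier m (mul (indicator E) e))))\<^sup>2) \<le> 2 * (b * C)\<^sup>2 * (norm (mk (kernel_weight g E F)))\<^sup>2"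
proof -
 note [measurable] = E(1) F
 define k where "k z = (LINT \<xi>|lborel. cis (z \<bullet> \<xi>) * m \<xi>)" for z
 define c where "c = complex_of_real ((2 * pi) powr (- real DIM('a) / 2))"
 have cc: "cmod (c * c) = b" unfolding c_def b_def by (simp add: norm_mult powr_add[symmetric])
 have [measurable]: "m \<in> borel_measurable borel" using m(2) by auto
 have km[measurable]: "k \<in> borel_measurable borel" unfolding k_def by measurable
 have kb: "cmod (k z) \<le> (LINT \<xi>|lborel. cmod (m \<xi>))" for z
  unfolding k_def using integral_norm_bound[of lborel "\<lambda>\<xi>. cis (z \<bullet> \<xi>) * m \<xi>"] by (simp add: norm_mult)
 have kE: "(\<lambda>y. k (x - y) * indicator E y) \<in> sq_integrable" for x
  by (rule sq_integrable_mult[OF indicator_sq[OF E] _ kb]) measurable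
 have fE: "(\<lambda>y. indicator E y * fn e y) \<in> l1_l2" for e :: "'a l2"
  unfolding l1_l2_def using mul_sq[OF bdd_measurable_indicator[OF E(1)] fn(1)] integrable_mult_sq[OF indicator_sq[OF E] fn(1)] by simp
 define I where "I e x = (LINT y|lborel. k (x - y) * (indicator E y * fn e y))" for e x
 have Ieq: "I e x = (LINT y|lborel. k (x - y) * indicator E y * fn e y)" for e x unfolding I_def mult.assoc ..
 have Um: "multiplier m (mul (indicator E) e) = mk (\<lambda>x. c * c * I e x)" "(\<lambda>x. c * c * I e x) \<in> sq_integrable" for e
  using multiplier_kernel[OF m fE, of e] unfolding c_def[symmetric] I_def k_def mul_def by auto
 have Is: "(\<lambda>x. indicator F x * (c * c * I e x)) \<in> sq_integrable" for e by (rule mul_sq[OF bdd_measurable_indicator[OF F] Um(2)])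
 note Ism = sq_measurable[OF Is]
 have "ennreal (\<Sum>e\<in>S. (norm (mul (indicator F) (multiplier m (mul (indicator E) e))))\<^sup>2)
   = (\<Sum>e\<in>S. \<integral>\<^sup>+ x. ennreal ((cmod (indicator F x * (c * c * I e x)))\<^sup>2) \<partial>lborel)"
  unfolding Um(1) mul_mk[OF bdd_measurable_indicator[OF F] Um(2)] nn_norm_mk[OF Is] by (rule sum_ennreal[symmetric]) simp
 also have "\<dots> = (\<integral>\<^sup>+ x. (\<Sum>e\<in>S. ennreal ((cmod (indicator F x * (c * c * I e x)))\<^sup>2)) \<partial>lborel)"
  by (rule nn_integral_sum[symmetric]) (use Ism in measurable)
 also have "\<dots> \<le> (\<integral>\<^sup>+ x. ennreal (2 * (b * C)\<^sup>2) * (\<integral>\<^sup>+ y. ennreal ((cmod (kernel_weight g E F (x, y)))\<^sup>2) \<partial>lborel) \<partial>lborel)"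
 proof (rule nn_integral_mono)
  fix x :: 'a
  show "(\<Sum>e\<in>S. ennreal ((cmod (indicator F x * (c * c * I e x)))\<^sup>2)) \<le> ennreal (2 * (b * C)\<^sup>2) * (\<integral>\<^sup>+ y. ennreal ((cmod (kernel_weight g E F (x, y)))\<^sup>2) \<partial>lborel)"
  proof (cases "x \<in> F")
   case True
   have "(\<Sum>e\<in>S. ennreal ((cmod (indicator F x * (c * c * I e x)))\<^sup>2)) = ennreal (b\<^sup>2 * (\<Sum>e\<in>S. (cmod (I e x))\<^sup>2))"
    using True by (simp add: norm_mult[of "c * c"] cc power_mult_distrib sum_ennreal sum_distrib_left)
   also have "\<dots> \<le> ennreal (b\<^sup>2 * (2 * (norm (mk (\<lambda>y. k (x - y) * indicator E y)))\<^sup>2))"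
    unfolding Ieq by (intro ennreal_leI mult_left_mono bessel_kernel S kE) simp
   also have "\<dots> = ennreal (2 * b\<^sup>2) * ennreal ((norm (mk (\<lambda>y. k (x - y) * indicator E y)))\<^sup>2)"
    by (subst ennreal_mult[symmetric]) (auto simp: mult_ac)
   also have "\<dots> = ennreal (2 * b\<^sup>2) * (\<integral>\<^sup>+ y. ennreal ((cmod (k (x - y) * indicator E y))\<^sup>2) \<partial>lborel)"
    unfolding nn_norm_mk[OF kE] ..
   also have "\<dots> \<le> ennreal (2 * b\<^sup>2) * (\<integral>\<^sup>+ y. ennreal (C\<^sup>2) * ennreal ((cmod (kernel_weight g E F (x, y)))\<^sup>2) \<partial>lborel)"
   proof (intro mult_left_mono nn_integral_mono)
    fix y
    have "cmod (k (x - y)) \<le> C * (1 + norm (x - y)) powr g" unfolding k_def by (rule C(2))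
    hence "cmod (k (x - y) * indicator E y) \<le> C * cmod (kernel_weight g E F (x, y))"
     using True by (auto simp: kernel_weight_def indicator_def)
    hence "(cmod (k (x - y) * indicator E y))\<^sup>2 \<le> (C * cmod (kernel_weight g E F (x, y)))\<^sup>2" by (intro power_mono) auto
    thus "ennreal ((cmod (k (x - y) * indicator E y))\<^sup>2) \<le> ennreal (C\<^sup>2) * ennreal ((cmod (kernel_weight g E F (x, y)))\<^sup>2)"
     by (subst ennreal_mult[symmetric]) (auto simp: power_mult_distrib intro: ennreal_leI)
   qed simp
   also have "\<dots> = ennreal (2 * b\<^sup>2) * (ennreal (C\<^sup>2) * (\<integral>\<^sup>+ y. ennreal ((cmod (kernel_weight g E F (x, y)))\<^sup>2) \<partial>lborel))"
   proof (subst nn_integral_cmult)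
    show "(\<lambda>y. ennreal ((cmod (kernel_weight g E F (x, y)))\<^sup>2)) \<in> borel_measurable lborel"
     unfolding kernel_weight_def prod.case by measurable
   qed simp
   also have "\<dots> = ennreal (2 * (b * C)\<^sup>2) * (\<integral>\<^sup>+ y. ennreal ((cmod (kernel_weight g E F (x, y)))\<^sup>2) \<partial>lborel)"
    unfolding mult.assoc[symmetric] by (subst ennreal_mult[symmetric]) (auto simp: power_mult_distrib mult_ac)
   finally show ?thesis .
  qed simp
 qed
 also have "\<dots> = ennreal (2 * (b * C)\<^sup>2) * (\<integral>\<^sup>+ x. \<integral>\<^sup>+ y. ennreal ((cmod (kernel_weight g E F (x, y)))\<^sup>2) \<partial>lborel \<partial>lborel)"
 proof (rule nn_integral_cmult)
  show "(\<lambda>x. \<integral>\<^sup>+ y. ennreal ((cmod (kernel_weight g E F (x, y)))\<^sup>2) \<partial>lborel) \<in> borel_measurable lborel"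
   unfolding kernel_weight_def prod.case by measurable
 qed
 also have "\<dots> = ennreal (2 * (b * C)\<^sup>2 * (norm (mk (kernel_weight g E F)))\<^sup>2)"
  unfolding nn_kernel_weight[OF E(1) F] nn_norm_mk[OF w] by (subst ennreal_mult[symmetric]) auto
 finally show ?thesis by (subst (asm) ennreal_le_iff) auto
qed

text \<open>The propagator at complex time: \<epsilon> > 0 makes the multiplier integrable,
  \<epsilon> = 0 gives the unitary group itself.\<close>

definition evolution :: "real \<Rightarrow> real \<Rightarrow> real \<Rightarrow> 'a::euclidean_space \<Rightarrow> complex" where
 "evolution \<alpha> \<epsilon> T \<xi> = exp (- (Complex \<epsilon> T * complex_of_real (norm \<xi> powr (2 * \<alpha>))))"

lemma norm_evolution: "cmod (evolution \<alpha> \<epsilon> T \<xi>) = exp (- (\<epsilon> * norm \<xi> powr (2 * \<alpha>)))"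
 by (simp add: evolution_def norm_exp)

lemma evolution_measurable[measurable]: "evolution \<alpha> \<epsilon> T \<in> borel_measurable borel"
 unfolding evolution_def[abs_def] by measurable

lemma bdd_measurable_evolution: "\<epsilon> \<ge> 0 \<Longrightarrow> bdd_measurable (evolution \<alpha> \<epsilon> T)"
 unfolding bdd_measurable_def by (auto simp: norm_evolution intro!: exI[of _ 1])

text \<open>The kernel estimate is available, uniformly, for 0 < \<epsilon> \<le> |T|. Each sum over
  an orthonormal set is finite, so it passes to the limit by strong convergence, and a kernel for
  \<epsilon> = 0 never has to be made sense of.\<close>

lemma hilbert_schmidt_bound:
 assumes \<alpha>: "\<alpha> > 1/2" and T: "T \<noteq> 0"
 obtains B where "B \<ge> 0" "\<And>(E :: 'a::euclidean_space set) F S.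
   E \<in> sets borel \<Longrightarrow> emeasure lborel E < \<infinity> \<Longrightarrow> F \<in> sets borel \<Longrightarrow>
   kernel_weight (real DIM('a) * max 0 (1 - \<alpha>) / (2 * \<alpha> - 1)) E F \<in> sq_integrable \<Longrightarrow> orthonormal S \<Longrightarrow>
   (\<Sum>e\<in>S. (norm (mul (indicator F) (multiplier (evolution \<alpha> 0 T) (mul (indicator E) e))))\<^sup>2)
    \<le> B * (norm (mk (kernel_weight (real DIM('a) * max 0 (1 - \<alpha>) / (2 * \<alpha> - 1)) E F)))\<^sup>2"
proof -
 define g where "g = real DIM('a) * max 0 (1 - \<alpha>) / (2 * \<alpha> - 1)"
 show thesis
 proof (rule kernel_bound[OF \<alpha> T, where 'a='a])
 fix C assume C': "C \<ge> 0" "\<And>\<epsilon> (x :: 'a). 0 < \<epsilon> \<Longrightarrow> \<epsilon> \<le> \<bar>T\<bar> \<Longrightarrow>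
   cmod (LINT \<xi>|lborel. cis (x \<bullet> \<xi>) * exp (- (Complex \<epsilon> T * of_real (norm \<xi> powr (2 * \<alpha>)))))
    \<le> C * (1 + norm x) powr (real DIM('a) * max 0 (1 - \<alpha>) / (2 * \<alpha> - 1))"
 note C = C'[folded evolution_def g_def]
 define B where "B = 2 * ((2 * pi) powr (- real DIM('a)) * C)\<^sup>2"
 have "(\<Sum>e\<in>S. (norm (mul (indicator F) (multiplier (evolution \<alpha> 0 T) (mul (indicator E) e))))\<^sup>2) \<le> B * (norm (mk (kernel_weight g E F)))\<^sup>2"
  if E: "E \<in> sets borel" "emeasure lborel E < \<infinity>" and F: "F \<in> sets borel" and w: "kernel_weight g E F \<in> sq_integrable" and S: "orthonormal S"
  for E F :: "'a set" and S
 proof -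
  define \<epsilon> where "\<epsilon> j = \<bar>T\<bar> / real (Suc j)" for j
  have \<epsilon>: "\<epsilon> j > 0" "\<epsilon> j \<le> \<bar>T\<bar>" for j using T by (auto simp: \<epsilon>_def field_simps)
  have \<epsilon>0: "\<epsilon> \<longlonglongrightarrow> 0" unfolding \<epsilon>_def by real_asymp
  have b: "(\<Sum>e\<in>S. (norm (mul (indicator F) (multiplier (evolution \<alpha> (\<epsilon> j) T) (mul (indicator E) e))))\<^sup>2) \<le> B * (norm (mk (kernel_weight g E F)))\<^sup>2" for j
   unfolding B_def
  proof (rule hilbert_schmidt_kernel[OF bdd_measurable_evolution _ C(1) C(2)[OF \<epsilon>] E F w S])
   show "\<epsilon> j \<ge> 0" using \<epsilon>[of j] by simp
   show "integrable lborel (evolution \<alpha> (\<epsilon> j) T :: 'a \<Rightarrow> complex)"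
   proof (rule Bochner_Integration.integrable_bound)
    show "integrable lborel (\<lambda>\<xi>::'a. exp (- (\<epsilon> j * norm \<xi> powr (2 * \<alpha>))))" using \<epsilon>(1)[of j] \<alpha> by (intro integrable_exp_powr) auto
   qed (auto simp: norm_evolution)
  qed
  have lim: "(\<lambda>j. mul (evolution \<alpha> (\<epsilon> j) T) x) \<longlonglongrightarrow> mul (evolution \<alpha> 0 T) x" for x :: "'a l2"
  proof (rule mul_pointwise_tendsto[where K=1])
   show "cmod (evolution \<alpha> (\<epsilon> j) T t) \<le> 1" for j and t :: 'a using \<epsilon>(1)[of j] by (simp add: norm_evolution)
   show "(\<lambda>j. evolution \<alpha> (\<epsilon> j) T t) \<longlonglongrightarrow> evolution \<alpha> 0 T t" for t :: 'a
    unfolding evolution_def Complex_eq by (intro tendsto_intros tendsto_of_real \<epsilon>0)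
  qed measurable
  have "(\<lambda>j. (norm (mul (indicator F) (multiplier (evolution \<alpha> (\<epsilon> j) T) x)))\<^sup>2) \<longlonglongrightarrow> (norm (mul (indicator F) (multiplier (evolution \<alpha> 0 T) x)))\<^sup>2" for x
   unfolding multiplier_def
   by (rule tendsto_power[OF tendsto_norm[OF mul_tendsto[OF bdd_measurable_indicator[OF F] isometry_tendsto[OF linear_iFT norm_iFT lim]]]])
  hence "(\<lambda>j. \<Sum>e\<in>S. (norm (mul (indicator F) (multiplier (evolution \<alpha> (\<epsilon> j) T) (mul (indicator E) e))))\<^sup>2)
    \<longlonglongrightarrow> (\<Sum>e\<in>S. (norm (mul (indicator F) (multiplier (evolution \<alpha> 0 T) (mul (indicator E) e))))\<^sup>2)"
   by (rule tendsto_sum)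
  from LIMSEQ_le_const2[OF this] b show ?thesis by blast
 qed
 thus thesis unfolding g_def by (intro that[of B]) (auto simp: B_def)
 qed
qed

section \<open>Functions localised together with their evolution\<close>

lemma mul_add_left:
 assumes "bdd_measurable m" "bdd_measurable k"
 shows "mul (\<lambda>t. m t + k t) x = mul m x + mul k x"
 unfolding mul_def mk_ops(1)[OF mul_sq[OF assms(1) fn(1)] mul_sq[OF assms(2) fn(1)]] distrib_right ..

text \<open>A nonzero polynomial has finitely many roots, and cis(- v \<bullet> \<xi>) takes a given
  value only on countably many parallel hyperplanes.\<close>

lemma AE_trigonometric_poly_nonzero:
 fixes v :: "'a::euclidean_space"
 assumes p: "p \<noteq> 0" and v: "v \<noteq> 0"
 shows "AE \<xi> in lborel. poly p (cis (- (v \<bullet> \<xi>))) \<noteq> 0"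
proof -
 have hyp: "AE \<xi> in lborel. v \<bullet> \<xi> \<noteq> r" for r
 proof -
  have "{\<xi>. v \<bullet> \<xi> = r} \<in> null_sets lebesgue" using negligible_hyperplane[of v r] v by (simp add: negligible_iff_null_sets)
  moreover have "{\<xi>. v \<bullet> \<xi> = r} \<in> sets lborel" using closed_hyperplane[of v r] by simp
  ultimately have "{\<xi>. v \<bullet> \<xi> = r} \<in> null_sets lborel" by (simp add: null_sets_completion_iff)
  from AE_not_in[OF this] show ?thesis by simp
 qed
 have z: "AE \<xi> in lborel. cis (- (v \<bullet> \<xi>)) \<noteq> z" for z
 proof (cases "\<exists>\<xi>0. cis (- (v \<bullet> \<xi>0)) = z")
  case True
  then obtain \<xi>0 where \<xi>0: "cis (- (v \<bullet> \<xi>0)) = z" by blast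
  have "AE \<xi> in lborel. \<forall>m::int. v \<bullet> \<xi> \<noteq> v \<bullet> \<xi>0 + 2 * pi * m" unfolding AE_all_countable using hyp by simp
  thus ?thesis
  proof eventually_elim
   case (elim \<xi>)
   show ?case
   proof
    assume "cis (- (v \<bullet> \<xi>)) = z"
    hence "cnj (cis (v \<bullet> \<xi>)) = cnj (cis (v \<bullet> \<xi>0))" using \<xi>0 by (simp only: cis_cnj)
    hence "cis (v \<bullet> \<xi>) = cis (v \<bullet> \<xi>0)" by (simp only: complex_cnj_cancel_iff)
    hence "sin (v \<bullet> \<xi>) = sin (v \<bullet> \<xi>0) \<and> cos (v \<bullet> \<xi>) = cos (v \<bullet> \<xi>0)" by (simp add: complex_eq_iff)
    thus False using elim unfolding sin_cos_eq_iff by blast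
   qed
  qed
 qed auto
 have "AE \<xi> in lborel. \<forall>z\<in>{z. poly p z = 0}. cis (- (v \<bullet> \<xi>)) \<noteq> z"
  using z by (intro AE_finite_allI poly_roots_finite p)
 thus ?thesis by eventually_elim auto
qed

lemma bdd_measurable_cis_power: "bdd_measurable (\<lambda>\<xi>. c * cis (- (v \<bullet> \<xi>)) ^ k)"
 unfolding bdd_measurable_def by (auto simp: norm_mult norm_power intro!: exI[of _ "cmod c"])

lemma bdd_measurable_cis_sum: "bdd_measurable (\<lambda>\<xi>. \<Sum>k<N. complex_of_real (c k) * cis (- (v \<bullet> \<xi>)) ^ k)"
proof -
 have "cmod (\<Sum>k<N. complex_of_real (c k) * cis (- (v \<bullet> \<xi>)) ^ k) \<le> (\<Sum>k<N. \<bar>c k\<bar>)" for \<xi>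
  by (rule order_trans[OF norm_sum]) (simp add: norm_mult norm_power)
 thus ?thesis unfolding bdd_measurable_def by (intro conjI exI[of _ "\<Sum>k<N. \<bar>c k\<bar>"] allI) measurable
qed

lemma FT_sum_translates:
 "FT (\<Sum>k<N. c k *\<^sub>R translate (real k *\<^sub>R v) f) = mul (\<lambda>\<xi>. \<Sum>k<N. complex_of_real (c k) * cis (- (v \<bullet> \<xi>)) ^ k) (FT f)"
proof (induction N)
 case 0
 have "mul (\<lambda>_. 0) (FT f) = 0" by (simp add: mul_def zero_l2_def)
 thus ?case by (simp add: linear_0[OF linear_FT])
next
 case (Suc N)
 have "cis (- ((real N *\<^sub>R v) \<bullet> \<xi>)) = cis (- (v \<bullet> \<xi>)) ^ N" for \<xi> using Complex.DeMoivre[of "- (v \<bullet> \<xi>)" N] by simp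
 hence "FT (c N *\<^sub>R translate (real N *\<^sub>R v) f) = mul (\<lambda>\<xi>. complex_of_real (c N) * cis (- (v \<bullet> \<xi>)) ^ N) (FT f)"
  unfolding scaleR_eq_mul FT_mul_const FT_translate mul_mul[OF bdd_measurable_const bdd_measurable_cis] by simp
 thus ?case unfolding sum.lessThan_Suc FT_add Suc mul_add_left[OF bdd_measurable_cis_sum bdd_measurable_cis_power] by simp
qed

text \<open>On the Fourier side the combination is the product of FT f with a polynomial in cis(- v
  \<bullet> \<xi>). If some coefficient is nonzero, the polynomial vanishes only on a null set,
  which forces f = 0.\<close>

lemma translates_scalars_zero:
 assumes f: "f \<noteq> 0" and v: "v \<noteq> 0" and s: "(\<Sum>k<N. c k *\<^sub>R translate (real k *\<^sub>R v) f) = 0" and k: "k < N"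
 shows "c k = 0"
proof (rule ccontr)
 assume ck: "c k \<noteq> 0"
 define p where "p = (\<Sum>k<N. monom (complex_of_real (c k)) k)"
 have "coeff p k = complex_of_real (c k)" using k by (simp add: p_def coeff_sum)
 hence p0: "p \<noteq> 0" using ck by auto
 have pe: "poly p z = (\<Sum>k<N. complex_of_real (c k) * z ^ k)" for z by (simp add: p_def poly_sum poly_monom)
 have bp: "bdd_measurable (\<lambda>\<xi>. poly p (cis (- (v \<bullet> \<xi>))))" unfolding pe by (rule bdd_measurable_cis_sum)
 have mz: "mul (\<lambda>\<xi>. poly p (cis (- (v \<bullet> \<xi>)))) (FT f) = 0"
  unfolding pe FT_sum_translates[symmetric] s by (rule linear_0[OF linear_FT])
 have "AE \<xi> in lborel. poly p (cis (- (v \<bullet> \<xi>))) * fn (FT f) \<xi> = 0"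
  using fn_mul[OF bp, of "FT f", unfolded mz] fn_ops(1) by eventually_elim simp
 hence "AE \<xi> in lborel. fn (FT f) \<xi> = 0" using AE_trigonometric_poly_nonzero[OF p0 v] by eventually_elim auto
 hence "FT f = 0" unfolding zero_l2_def eq_mk_iff[OF sq_integrable_0] .
 hence "norm f = 0" using norm_FT[of f] by simp
 thus False using f by simp
qed

lemma translates_independent:
 fixes v :: "'a::euclidean_space"
 assumes f: "f \<noteq> 0" and v: "v \<noteq> 0"
 shows "card ((\<lambda>k. translate (real k *\<^sub>R v) f) ` {..<N}) = N" "independent ((\<lambda>k. translate (real k *\<^sub>R v) f) ` {..<N})"
proof -
 let ?t = "\<lambda>k. translate (real k *\<^sub>R v) f"
 have inj: "inj_on ?t {..<N}"
 proof (rule inj_onI, rule ccontr)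
  fix i j assume ij: "i \<in> {..<N}" "j \<in> {..<N}" "?t i = ?t j" "i \<noteq> j"
  define c where "c k = (if k = i then 1 else 0) - (if k = j then 1 else 0 :: real)" for k
  have "(\<Sum>k<N. c k *\<^sub>R ?t k) = (\<Sum>k<N. (if k = i then ?t k else 0)) - (\<Sum>k<N. (if k = j then ?t k else 0))"
   unfolding sum_subtractf[symmetric] by (intro sum.cong) (auto simp: c_def)
  also have "\<dots> = 0" using ij by simp
  finally have "c i = 0" using translates_scalars_zero[OF f v] ij(1) by blast
  thus False using ij by (simp add: c_def)
 qed
 show "card (?t ` {..<N}) = N" using card_image[OF inj] by simp
 show "independent (?t ` {..<N})"
 proof (rule independent_if_scalars_zero)
  fix u x assume "(\<Sum>x\<in>?t ` {..<N}. u x *\<^sub>R x) = 0" and x: "x \<in> ?t ` {..<N}"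
  hence "(\<Sum>k<N. u (?t k) *\<^sub>R ?t k) = 0" by (simp add: sum.reindex[OF inj])
  with x show "u x = 0" using translates_scalars_zero[OF f v, of "\<lambda>k. u (?t k)"] by auto
 qed simp
qed

lemma support_translate:
 assumes A: "A \<in> sets borel" and B: "B \<in> sets borel" and f: "mul (indicator A) f = f" and AB: "\<And>t. t - v \<in> A \<Longrightarrow> t \<in> B"
 shows "mul (indicator B) (translate v f) = translate v f"
proof -
 have m: "(\<lambda>t. indicator A t * fn f t) \<in> borel_measurable borel" using A fn(1)[of f] by measurable
 have "AE t in lborel. fn f t = indicator A t * fn f t" using fn_mul[OF bdd_measurable_indicator[OF A], of f] unfolding f .
 from AE_shift[OF sq_measurable[OF fn(1)] m this, of v]
 show ?thesis unfolding l2_eq_iff using fn_mul[OF bdd_measurable_indicator[OF B], of "translate v f"] fn_translate[of v f]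
 proof eventually_elim
  case (elim t)
  show ?case
  proof (cases "t - v \<in> A")
   case True
   thus ?thesis using elim AB[of t] by simp
  next
   case False
   hence "fn (translate v f) t = 0" using elim by simp
   thus ?thesis using elim by simp
  qed
 qed
qed

text \<open>A set that carries at once the N translates of any function supported in A.\<close>

definition spread :: "nat \<Rightarrow> 'a::euclidean_space \<Rightarrow> 'a set \<Rightarrow> 'a set" where
 "spread N v A = (\<Union>k<N. {t. t - real k *\<^sub>R v \<in> A})"

lemma spread_borel: "A \<in> sets borel \<Longrightarrow> spread N v A \<in> sets borel"
proof -
 assume [measurable]: "A \<in> sets borel"
 have "{t \<in> space borel. t - real k *\<^sub>R v \<in> A} \<in> sets borel" for k by measurable
 thus ?thesis unfolding spread_def by (intro sets.finite_UN) auto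
qed

lemma spread_finite:
 assumes A: "A \<in> sets borel" "emeasure lborel A < \<infinity>"
 shows "emeasure lborel (spread N v A) < \<infinity>"
proof -
 note [measurable] = spread_borel[OF A(1)]
 have "integrable lborel (indicator A :: 'a \<Rightarrow> real)" using A by (simp add: integrable_indicator_iff)
 hence "integrable lborel (\<lambda>t. indicator A (t - real k *\<^sub>R v) :: real)" for k
  using lborel_shift(2)[of "indicator A :: 'a \<Rightarrow> real" "real k *\<^sub>R v"] A by simp
 hence "integrable lborel (\<lambda>t. \<Sum>k<N. indicator A (t - real k *\<^sub>R v) :: real)" by (intro Bochner_Integration.integrable_sum)
 hence "integrable lborel (indicator (spread N v A) :: 'a \<Rightarrow> real)"
 proof (rule Bochner_Integration.integrable_bound)
  show "AE t in lborel. norm (indicator (spread N v A) t :: real) \<le> norm (\<Sum>k<N. indicator A (t - real k *\<^sub>R v) :: real)"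
  proof (intro AE_I2)
   fix t
   show "norm (indicator (spread N v A) t :: real) \<le> norm (\<Sum>k<N. indicator A (t - real k *\<^sub>R v) :: real)"
   proof (cases "t \<in> spread N v A")
    case True
    then obtain k where k: "k < N" "t - real k *\<^sub>R v \<in> A" by (auto simp: spread_def)
    have "(1::real) = indicator A (t - real k *\<^sub>R v)" using k by simp
    also have "\<dots> \<le> (\<Sum>k<N. indicator A (t - real k *\<^sub>R v) :: real)"
     by (rule member_le_sum[where f="\<lambda>k. indicator A (t - real k *\<^sub>R v)"]) (use k in auto)
    finally show ?thesis using True by simp
   qed simp
  qed
 qed (use spread_borel[OF A(1)] in measurable)
 thus ?thesis using spread_borel[OF A(1)] by (simp add: integrable_indicator_iff)
qed

text \<open>Bounding the weight by the sum of all N^2 translated weights would let its norm grow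
  with N. Instead one translate is singled out and written as the original weight plus a difference;
  the norms of the differences become small with v. The prefactor accounts for the change of |x - y|
  by at most N |v|.\<close>

lemma kernel_weight_spread:
 assumes g: "g \<ge> 0"
 shows "cmod (kernel_weight g (spread N v E) (spread N v F) p) \<le> (1 + real N * norm v) powr g *
  (cmod (kernel_weight g E F p) + (\<Sum>i\<in>{..<N} \<times> {..<N}. cmod (kernel_weight g E F (p - (real (snd i) *\<^sub>R v, real (fst i) *\<^sub>R v)) - kernel_weight g E F p)))"
  (is "_ \<le> ?K * (_ + sum ?d _)")
proof (cases p)
 case (Pair x y)
 show ?thesis
 proof (cases "x \<in> spread N v F \<and> y \<in> spread N v E")
  case True
  then obtain k l where kl: "k < N" "l < N" "y - real k *\<^sub>R v \<in> E" "x - real l *\<^sub>R v \<in> F" by (auto simp: spread_def)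
  define z where "z = x - real l *\<^sub>R v - (y - real k *\<^sub>R v)"
  have q: "kernel_weight g E F (p - (real l *\<^sub>R v, real k *\<^sub>R v)) = complex_of_real ((1 + norm z) powr g)"
   using kl by (simp add: kernel_weight_def Pair z_def)
  have "x - y = z + (real l - real k) *\<^sub>R v" by (simp add: z_def algebra_simps)
  hence "norm (x - y) \<le> norm z + \<bar>real l - real k\<bar> * norm v" by (metis norm_triangle_ineq norm_scaleR)
  also have "\<dots> \<le> norm z + real N * norm v" using kl by (intro add_left_mono mult_right_mono) auto
  also have "\<dots> \<le> norm z + real N * norm v + real N * norm v * norm z" by simp
  finally have "1 + norm (x - y) \<le> (1 + real N * norm v) * (1 + norm z)" by (simp add: algebra_simps)
  hence "(1 + norm (x - y)) powr g \<le> ((1 + real N * norm v) * (1 + norm z)) powr g" by (intro powr_mono2 g) auto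
  also have "\<dots> = ?K * cmod (kernel_weight g E F (p - (real l *\<^sub>R v, real k *\<^sub>R v)))" by (simp add: q powr_mult)
  also have "\<dots> \<le> ?K * (cmod (kernel_weight g E F p) + sum ?d ({..<N} \<times> {..<N}))"
  proof (intro mult_left_mono)
   have "cmod (kernel_weight g E F (p - (real l *\<^sub>R v, real k *\<^sub>R v))) \<le> cmod (kernel_weight g E F p) + ?d (k, l)"
    using norm_triangle_sub[of "kernel_weight g E F (p - (real l *\<^sub>R v, real k *\<^sub>R v))" "kernel_weight g E F p"] by simp
   also have "?d (k, l) \<le> sum ?d ({..<N} \<times> {..<N})" using kl by (intro member_le_sum) auto
   finally show "cmod (kernel_weight g E F (p - (real l *\<^sub>R v, real k *\<^sub>R v))) \<le> cmod (kernel_weight g E F p) + sum ?d ({..<N} \<times> {..<N})" by simp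
  qed simp
  finally show ?thesis using True by (simp add: kernel_weight_def Pair)
 next
  case False
  hence "kernel_weight g (spread N v E) (spread N v F) p = 0" by (auto simp: kernel_weight_def Pair indicator_def)
  moreover have "0 \<le> sum ?d ({..<N} \<times> {..<N})" by (intro sum_nonneg) simp
  ultimately show ?thesis by simp
 qed
qed

lemma norm_mk_mono:
 assumes g: "g \<in> sq_integrable" and f: "f \<in> borel_measurable borel" and K: "K \<ge> 0" and le: "\<And>t. cmod (f t) \<le> K * cmod (g t)"
 shows "f \<in> sq_integrable" "norm (mk f) \<le> K * norm (mk g)"
proof -
 show fs: "f \<in> sq_integrable" by (rule sq_integrable_dominated[OF g f, of K]) (simp add: le)
 have "(norm (mk f))\<^sup>2 \<le> (LINT t|lborel. K\<^sup>2 * (cmod (g t))\<^sup>2)" unfolding norm_mk_sq[OF fs]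
 proof (rule integral_mono[OF sq_integrableD[OF fs] integrable_mult_right[OF sq_integrableD[OF g]]])
  show "(cmod (f t))\<^sup>2 \<le> K\<^sup>2 * (cmod (g t))\<^sup>2" for t unfolding power_mult_distrib[symmetric] by (intro power_mono le) simp
 qed
 also have "\<dots> = (K * norm (mk g))\<^sup>2" by (simp add: norm_mk_sq[OF g] power_mult_distrib)
 finally show "norm (mk f) \<le> K * norm (mk g)" by (rule power2_le_imp_le) (use K in simp)
qed

lemma norm_mk_le_sum:
 assumes g: "g \<in> sq_integrable" and f: "f \<in> borel_measurable borel" and K: "K \<ge> 0" and I: "finite I" and d: "\<And>i. i \<in> I \<Longrightarrow> d i \<in> sq_integrable"
  and le: "\<And>t. cmod (f t) \<le> K * (cmod (g t) + (\<Sum>i\<in>I. cmod (d i t)))"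
 shows "f \<in> sq_integrable" "norm (mk f) \<le> K * (norm (mk g) + (\<Sum>i\<in>I. norm (mk (d i))))"
proof -
 have ab: "(\<lambda>t. complex_of_real (cmod (h t))) \<in> sq_integrable" "norm (mk (\<lambda>t. complex_of_real (cmod (h t)))) \<le> norm (mk h)" if h: "h \<in> sq_integrable" for h
  using norm_mk_mono[OF h _ zero_le_one, of "\<lambda>t. complex_of_real (cmod (h t))"] sq_measurable[OF h] by auto
 define s where "s J t = complex_of_real (cmod (g t) + (\<Sum>i\<in>J. cmod (d i t)))" for J t
 have s: "s J \<in> sq_integrable \<and> norm (mk (s J)) \<le> norm (mk g) + (\<Sum>i\<in>J. norm (mk (d i)))" if "J \<subseteq> I" for J
  using finite_subset[OF that I] that
 proof (induction J rule: finite_induct)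
  case empty
  thus ?case using ab[OF g] by (simp add: s_def[abs_def])
 next
  case (insert i J)
  have IH: "s J \<in> sq_integrable" "norm (mk (s J)) \<le> norm (mk g) + (\<Sum>i\<in>J. norm (mk (d i)))" using insert by auto
  have di: "d i \<in> sq_integrable" using insert d by auto
  have e: "s (insert i J) = (\<lambda>t. s J t + complex_of_real (cmod (d i t)))" using insert by (auto simp: s_def)
  have *: "norm (mk (s (insert i J))) \<le> norm (mk (s J)) + norm (mk (\<lambda>t. complex_of_real (cmod (d i t))))"
   unfolding e mk_ops(1)[OF IH(1) ab(1)[OF di], symmetric] by (rule norm_triangle_ineq)
  show ?case unfolding sum.insert[OF insert.hyps]
  proof
   show "s (insert i J) \<in> sq_integrable" unfolding e by (rule sq_integrable_add[OF IH(1) ab(1)[OF di]])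
   show "norm (mk (s (insert i J))) \<le> norm (mk g) + (norm (mk (d i)) + (\<Sum>i\<in>J. norm (mk (d i))))" using * IH(2) ab(2)[OF di] by linarith
  qed
 qed
 have le': "cmod (f t) \<le> K * cmod (s I t)" for t
 proof -
  have "0 \<le> cmod (g t) + (\<Sum>i\<in>I. cmod (d i t))" by (intro add_nonneg_nonneg sum_nonneg) auto
  thus ?thesis using le[of t] unfolding s_def norm_of_real by simp
 qed
 show "f \<in> sq_integrable" by (rule norm_mk_mono(1)[OF conjunct1[OF s[OF subset_refl]] f K le'])
 show "norm (mk f) \<le> K * (norm (mk g) + (\<Sum>i\<in>I. norm (mk (d i))))"
  by (rule order_trans[OF norm_mk_mono(2)[OF conjunct1[OF s[OF subset_refl]] f K le'] mult_left_mono[OF conjunct2[OF s[OF subset_refl]] K]])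
qed

text \<open>Small translates of \<open>f\<close> are linearly independent and, as the multiplier commutes with translations, they
 are localised in slightly larger sets for which the Hilbert-Schmidt norm is still under control.\<close>

lemma localised_eq_0:
 fixes E F :: "'a::euclidean_space set"
 assumes \<alpha>: "\<alpha> > 1/2" and T: "T \<noteq> 0" and E: "E \<in> sets borel" "emeasure lborel E < \<infinity>" and F: "F \<in> sets borel"
  and w: "kernel_weight (real DIM('a) * max 0 (1 - \<alpha>) / (2 * \<alpha> - 1)) E F \<in> sq_integrable"
  and f: "mul (indicator E) f = f" "mul (indicator F) (multiplier (evolution \<alpha> 0 T) f) = multiplier (evolution \<alpha> 0 T) f"
 shows "f = 0"
proof (rule ccontr)
 assume f0: "f \<noteq> 0"
 define g where "g = real DIM('a) * max 0 (1 - \<alpha>) / (2 * \<alpha> - 1)"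
 have g: "g \<ge> 0" using \<alpha> by (simp add: g_def)
 define \<Gamma> where "\<Gamma> = kernel_weight g E F"
 have \<Gamma>: "\<Gamma> \<in> sq_integrable" using w by (simp add: \<Gamma>_def g_def)
 define U :: "'a l2 \<Rightarrow> 'a l2" where "U = multiplier (evolution \<alpha> 0 T)"
 have pb: "bdd_measurable (evolution \<alpha> 0 T :: 'a \<Rightarrow> complex)" by (rule bdd_measurable_evolution) simp
 show False
 proof (rule hilbert_schmidt_bound[OF \<alpha> T, where 'a='a])
  fix B assume B: "B \<ge> 0" and B': "\<And>(E :: 'a set) F S. E \<in> sets borel \<Longrightarrow> emeasure lborel E < \<infinity> \<Longrightarrow> F \<in> sets borel \<Longrightarrow>
   kernel_weight (real DIM('a) * max 0 (1 - \<alpha>) / (2 * \<alpha> - 1)) E F \<in> sq_integrable \<Longrightarrow> orthonormal S \<Longrightarrow>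
   (\<Sum>e\<in>S. (norm (mul (indicator F) (multiplier (evolution \<alpha> 0 T) (mul (indicator E) e))))\<^sup>2)
    \<le> B * (norm (mk (kernel_weight (real DIM('a) * max 0 (1 - \<alpha>) / (2 * \<alpha> - 1)) E F)))\<^sup>2"
  note HS = B'[folded g_def U_def]
  define R where "R = norm (mk \<Gamma>) + 1"
  \<comment> \<open>The number of translates is fixed here, before the step v is chosen, while R, a
    margin of 1 above the norm of the weight, does not depend on it. This order makes the
    contradiction possible.\<close>
  obtain N :: nat where N: "B * R\<^sup>2 < real N" using reals_Archimedean2 by blast
  obtain b :: 'a where b: "b \<in> Basis" using nonempty_Basis by blast
  define v where "v j = (1 / real (Suc j)) *\<^sub>R b" for j
  have v0: "v \<longlonglongrightarrow> 0"
  proof -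
   have "(\<lambda>j. 1 / real (Suc j)) \<longlonglongrightarrow> 0" using LIMSEQ_Suc[OF lim_1_over_n] by simp
   from tendsto_scaleR[OF this tendsto_const[of b]] show ?thesis unfolding v_def by simp
  qed
  define I where "I = {..<N} \<times> {..<N}"
  define X where "X j = (1 + real N * norm (v j)) powr g * (norm (mk \<Gamma>) +
   (\<Sum>i\<in>I. norm (translate (real (snd i) *\<^sub>R v j, real (fst i) *\<^sub>R v j) (mk \<Gamma>) - mk \<Gamma>)))" for j
  \<comment> \<open>The weight is a vector of the Hilbert space over the product, so strong
    continuity applies to shifts of both variables at once.\<close>
  have tr: "(\<lambda>j. norm (translate (real l *\<^sub>R v j, real k *\<^sub>R v j) (mk \<Gamma>) - mk \<Gamma>)) \<longlonglongrightarrow> 0" for l k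
  proof -
   have "(\<lambda>j. (real l *\<^sub>R v j, real k *\<^sub>R v j)) \<longlonglongrightarrow> (real l *\<^sub>R 0, real k *\<^sub>R 0)" by (intro tendsto_intros v0)
   hence "(\<lambda>j. (real l *\<^sub>R v j, real k *\<^sub>R v j)) \<longlonglongrightarrow> 0" by (simp add: zero_prod_def)
   from translate_tendsto[OF this, of "mk \<Gamma>"] show ?thesis by (simp add: LIM_zero tendsto_norm_zero)
  qed
  have "X \<longlonglongrightarrow> (1 + real N * norm (0::'a)) powr g * (norm (mk \<Gamma>) + (\<Sum>i\<in>I. 0))"
   unfolding X_def[abs_def] by (intro tendsto_mult tendsto_powr tendsto_add tendsto_const tendsto_norm v0 tendsto_sum tr) simp
  hence "X \<longlonglongrightarrow> norm (mk \<Gamma>)" by simp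
  hence "\<forall>\<^sub>F j in sequentially. X j < R" by (rule order_tendstoD) (simp add: R_def)
  then obtain j where j: "X j < R" by (auto simp: eventually_sequentially)
  define E' F' \<Gamma>' where "E' = spread N (v j) E" and "F' = spread N (v j) F" and "\<Gamma>' = kernel_weight g E' F'"
  have E': "E' \<in> sets borel" "emeasure lborel E' < \<infinity>" unfolding E'_def by (intro spread_borel spread_finite E)+
  have F': "F' \<in> sets borel" unfolding F'_def by (intro spread_borel F)
  define d where "d i p = \<Gamma> (p - (real (snd i) *\<^sub>R v j, real (fst i) *\<^sub>R v j)) - \<Gamma> p" for i p
  have ds: "d i \<in> sq_integrable" for i unfolding d_def by (intro sq_integrable_diff shift_sq \<Gamma>)
  have dn: "mk (d i) = translate (real (snd i) *\<^sub>R v j, real (fst i) *\<^sub>R v j) (mk \<Gamma>) - mk \<Gamma>" for i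
   unfolding translate_mk[OF \<Gamma>] mk_ops(2)[OF shift_sq[OF \<Gamma>] \<Gamma>] d_def ..
  have \<Gamma>'m: "\<Gamma>' \<in> borel_measurable borel" unfolding \<Gamma>'_def by (rule kernel_weight_measurable[OF E'(1) F'])
  have K: "0 \<le> (1 + real N * norm (v j)) powr g" by simp
  have le: "cmod (\<Gamma>' p) \<le> (1 + real N * norm (v j)) powr g * (cmod (\<Gamma> p) + (\<Sum>i\<in>I. cmod (d i p)))" for p
   unfolding \<Gamma>'_def E'_def F'_def \<Gamma>_def I_def d_def by (rule kernel_weight_spread[OF g])
  have fin: "finite I" by (simp add: I_def)
  have \<Gamma>': "\<Gamma>' \<in> sq_integrable" by (rule norm_mk_le_sum(1)[OF \<Gamma> \<Gamma>'m K fin ds le])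
  have "norm (mk \<Gamma>') \<le> X j" using norm_mk_le_sum(2)[OF \<Gamma> \<Gamma>'m K fin ds le] unfolding dn X_def .
  hence \<Gamma>'R: "(norm (mk \<Gamma>'))\<^sup>2 \<le> R\<^sup>2" using j by (intro power_mono) auto
  have HS': "(\<Sum>e\<in>S. (norm (mul (indicator F') (U (mul (indicator E') e))))\<^sup>2) \<le> B * R\<^sup>2" if "orthonormal S" for S
   using HS[OF E' F' \<Gamma>'[unfolded \<Gamma>'_def] that] mult_left_mono[OF \<Gamma>'R B] unfolding \<Gamma>'_def by linarith
  have vj: "v j \<noteq> 0" using b by (auto simp: v_def)
  have Un: "norm (U x) = norm x" for x unfolding U_def by (rule norm_multiplier[OF pb]) (simp add: norm_evolution)
  have fixed: "mul (indicator E') x = x \<and> mul (indicator F') (U x) = U x" if x: "x \<in> (\<lambda>k. translate (real k *\<^sub>R v j) f) ` {..<N}" for x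
  proof -
   obtain k where k: "k < N" "x = translate (real k *\<^sub>R v j) f" using x by auto
   have "mul (indicator E') x = x" unfolding k(2)
    by (rule support_translate[OF E(1) E'(1) f(1)]) (use k in \<open>auto simp: E'_def spread_def\<close>)
   moreover have "mul (indicator F') (U x) = U x" unfolding k(2) U_def multiplier_translate[OF pb]
    by (rule support_translate[OF F F' f(2)]) (use k in \<open>auto simp: F'_def spread_def\<close>)
   ultimately show ?thesis by blast
  qed
  have "real (card ((\<lambda>k. translate (real k *\<^sub>R v j) f) ` {..<N})) \<le> B * R\<^sup>2"
  proof (rule card_fixed_independent_le[where U=U, OF _ _ _ Un HS' _ translates_independent(2)[OF f0 vj] fixed])
   show "linear U" unfolding U_def by (rule linear_multiplier[OF pb])
  qed (auto intro!: linear_mul bdd_measurable_indicator E' F')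
  thus False unfolding translates_independent(1)[OF f0 vj] using N by simp
 qed
qed

section \<open>Square integrable functions up to null sets\<close>

lemma L2_borel_version:
 fixes f :: "'a::euclidean_space \<Rightarrow> complex"
 assumes f: "f \<in> L2"
 shows "\<exists>f'. f' \<in> sq_integrable \<and> (AE t in lborel. f' t = f t)"
proof -
 have m: "f \<in> borel_measurable lebesgue" and i: "integrable lebesgue (\<lambda>x. (cmod (f x))\<^sup>2)" using f by (auto simp: L2_def)
 obtain r where r: "r \<in> borel_measurable lborel" "AE x in lborel. Re (f x) = r x"
  using completion_ex_borel_measurable_real[of "\<lambda>x. Re (f x)" lborel] m by auto
 obtain s where s: "s \<in> borel_measurable lborel" "AE x in lborel. Im (f x) = s x"
  using completion_ex_borel_measurable_real[of "\<lambda>x. Im (f x)" lborel] m by auto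
 define f' where "f' x = complex_of_real (r x) + \<i> * complex_of_real (s x)" for x
 have f'm: "f' \<in> borel_measurable borel" unfolding f'_def[abs_def] using r(1) s(1) by simp
 have eq: "AE t in lborel. f' t = f t" using r(2) s(2) by eventually_elim (simp add: f'_def complex_eq_iff)
 have "(\<integral>\<^sup>+ t. ennreal ((cmod (f' t))\<^sup>2) \<partial>lborel) = (\<integral>\<^sup>+ t. ennreal ((cmod (f t))\<^sup>2) \<partial>lborel)"
  by (rule nn_integral_cong_AE) (use eq in eventually_elim, simp)
 also have "\<dots> = (\<integral>\<^sup>+ t. ennreal (norm ((cmod (f t))\<^sup>2)) \<partial>lebesgue)" by (simp add: nn_integral_completion)
 also have "\<dots> < \<infinity>" using i unfolding integrable_iff_bounded by blast
 finally have "integrable lborel (\<lambda>t. (cmod (f' t))\<^sup>2)" by (intro integrableI_nonneg) (use f'm in auto)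
 thus ?thesis using f'm eq unfolding sq_integrable_def by blast
qed

text \<open>Sends a Lebesgue measurable function in \<open>L2\<close> to the class of a Borel
  function equal to it almost everywhere; meaningful only on \<open>L2\<close>.\<close>

definition rep :: "('a::euclidean_space \<Rightarrow> complex) \<Rightarrow> 'a l2" where
 "rep f = mk (SOME f'. f' \<in> sq_integrable \<and> (AE t in lborel. f' t = f t))"

lemma rep_mk: "f \<in> L2 \<Longrightarrow> g \<in> sq_integrable \<Longrightarrow> AE t in lborel. g t = f t \<Longrightarrow> rep f = mk g"
proof -
 assume f: "f \<in> L2" and g: "g \<in> sq_integrable" "AE t in lborel. g t = f t"
 define f' where "f' = (SOME f'. f' \<in> sq_integrable \<and> (AE t in lborel. f' t = f t))"
 have f': "f' \<in> sq_integrable" "AE t in lborel. f' t = f t" using someI_ex[OF L2_borel_version[OF f]] unfolding f'_def by auto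
 have "AE t in lborel. f' t = g t" using f'(2) g(2) by eventually_elim simp
 thus "rep f = mk g" unfolding rep_def f'_def[symmetric] mk_eq_iff[OF f'(1) g(1)] .
qed

lemma fn_rep:
 assumes f: "f \<in> L2"
 shows "AE t in lborel. fn (rep f) t = f t"
proof -
 obtain g where g: "g \<in> sq_integrable" "AE t in lborel. g t = f t" using L2_borel_version[OF f] by blast
 show ?thesis unfolding rep_mk[OF f g] using fn_mk[OF g(1)] g(2) by eventually_elim simp
qed

lemma borel_lebesgue: "f \<in> borel_measurable borel \<Longrightarrow> f \<in> borel_measurable (lebesgue :: 'a::euclidean_space measure)"
 by (intro measurable_completion) simp

lemma L2_norm_on_rep:
 fixes f :: "'a::euclidean_space \<Rightarrow> complex"
 assumes f: "f \<in> L2" and A: "A \<in> sets lebesgue" "A' \<in> sets borel" "AE t in lborel. t \<in> A \<longleftrightarrow> t \<in> A'"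
 shows "L2_norm_on A f = norm (mul (indicator A') (rep f))"
proof -
 have [measurable]: "f \<in> borel_measurable lebesgue" using f by (auto simp: L2_def)
 have m: "(\<lambda>x. (cmod (indicator A' x * fn (rep f) x))\<^sup>2) \<in> borel_measurable borel" using A(2) fn(1)[of "rep f"] by measurable
 have "(LINT x:A|lebesgue. (cmod (f x))\<^sup>2) = (LINT x|lebesgue. (cmod (indicator A' x * fn (rep f) x))\<^sup>2)"
  unfolding set_lebesgue_integral_def
 proof (rule integral_cong_AE)
  show "(\<lambda>x. indicat_real A x *\<^sub>R (cmod (f x))\<^sup>2) \<in> borel_measurable lebesgue" using A(1) by measurable
  show "(\<lambda>x. (cmod (indicator A' x * fn (rep f) x))\<^sup>2) \<in> borel_measurable lebesgue" by (rule borel_lebesgue[OF m])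
  show "AE x in lebesgue. indicat_real A x *\<^sub>R (cmod (f x))\<^sup>2 = (cmod (indicator A' x * fn (rep f) x))\<^sup>2"
   unfolding AE_completion_iff using A(3) fn_rep[OF f] by eventually_elim (auto simp: indicator_def)
 qed
 also have "\<dots> = (LINT x|lborel. (cmod (indicator A' x * fn (rep f) x))\<^sup>2)" by (rule integral_completion) (use m in simp)
 also have "\<dots> = (norm (mul (indicator A') (rep f)))\<^sup>2"
  unfolding mul_def by (rule norm_mk_sq[OF mul_sq[OF bdd_measurable_indicator[OF A(2)] fn(1)], symmetric])
 finally show ?thesis by (simp add: L2_norm_on_def)
qed

lemma truncated_fourier_rep:
 fixes f :: "'a::euclidean_space \<Rightarrow> complex"
 assumes f: "f \<in> L2"
 shows "truncated_fourier R f \<xi> = fourier (trunc R (fn (rep f))) \<xi>"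
proof -
 have fm: "f \<in> borel_measurable lebesgue" using f by (auto simp: L2_def)
 have c: "(\<lambda>x. cis (- (x \<bullet> \<xi>))) \<in> borel_measurable lebesgue" by (rule borel_lebesgue) measurable
 have [measurable]: "trunc R (fn (rep f)) \<in> borel_measurable borel" by (rule sq_measurable[OF l1_l2D(1)[OF trunc_l1_l2[OF fn(1)]]])
 have m: "(\<lambda>x. cis (- (x \<bullet> \<xi>)) * trunc R (fn (rep f)) x) \<in> borel_measurable borel" by measurable
 have "(LINT x:cball 0 R|lebesgue. cis (- (x \<bullet> \<xi>)) * f x) = (LINT x|lebesgue. cis (- (x \<bullet> \<xi>)) * trunc R (fn (rep f)) x)"
  unfolding set_lebesgue_integral_def
 proof (rule integral_cong_AE)
  have [measurable]: "cball 0 R \<in> sets (lebesgue :: 'a measure)" by simp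
  show "(\<lambda>x. indicat_real (cball 0 R) x *\<^sub>R (cis (- (x \<bullet> \<xi>)) * f x)) \<in> borel_measurable lebesgue"
   by (intro borel_measurable_scaleR borel_measurable_times c fm borel_measurable_indicator) simp
  show "(\<lambda>x. cis (- (x \<bullet> \<xi>)) * trunc R (fn (rep f)) x) \<in> borel_measurable lebesgue" by (rule borel_lebesgue[OF m])
  show "AE x in lebesgue. indicat_real (cball 0 R) x *\<^sub>R (cis (- (x \<bullet> \<xi>)) * f x) = cis (- (x \<bullet> \<xi>)) * trunc R (fn (rep f)) x"
   unfolding AE_completion_iff using fn_rep[OF f] by eventually_elim (auto simp: trunc_def indicator_def)
 qed
 also have "\<dots> = (LINT x|lborel. cis (- (x \<bullet> \<xi>)) * trunc R (fn (rep f)) x)" by (rule integral_completion) (use m in simp)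
 finally show ?thesis by (simp add: truncated_fourier_def fourier_def)
qed

text \<open>Truncations to balls of integer radius are integrable and converge to f in norm, so the
  defining limit of the Fourier integrals must agree with \<open>FT\<close>.\<close>

lemma has_fourier_transform_rep:
 assumes "has_fourier_transform f h"
 shows "FT (rep f) = rep h"
proof -
 have f: "f \<in> L2" and h: "h \<in> L2"
  and lim: "((\<lambda>R. \<integral>\<^sup>+ \<xi>. ennreal ((cmod (truncated_fourier R f \<xi> - h \<xi>))\<^sup>2) \<partial>lebesgue) \<longlongrightarrow> 0) at_top"
  using assms by (auto simp: has_fourier_transform_def)
 define t where "t n = trunc (real n) (fn (rep f))" for n
 have t: "t n \<in> l1_l2" for n unfolding t_def by (rule trunc_l1_l2[OF fn(1)])
 have tlim: "(\<lambda>n. mk (t n)) \<longlonglongrightarrow> rep f"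
  using trunc_tendsto[OF fn(1)[of "rep f"] filterlim_real_sequentially] unfolding t_def fn(2) .
 have "(\<integral>\<^sup>+ \<xi>. ennreal ((cmod (truncated_fourier (real n) f \<xi> - h \<xi>))\<^sup>2) \<partial>lebesgue) = (\<integral>\<^sup>+ \<xi>. ennreal ((cmod (fourier (t n) \<xi> - fn (rep h) \<xi>))\<^sup>2) \<partial>lborel)" for n
  unfolding nn_integral_completion truncated_fourier_rep[OF f] t_def
  by (rule nn_integral_cong_AE) (use fn_rep[OF h] in eventually_elim, simp)
 hence "(\<lambda>n. \<integral>\<^sup>+ \<xi>. ennreal ((cmod (fourier (t n) \<xi> - fn (rep h) \<xi>))\<^sup>2) \<partial>lborel) \<longlonglongrightarrow> 0"
  using filterlim_compose[OF lim filterlim_real_sequentially] by simp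
 from tendsto_nn_imp[OF plancherel_l1_l2(1)[OF t] fn(1) this] have "(\<lambda>n. mk (fourier (t n))) \<longlonglongrightarrow> rep h" unfolding fn(2) .
 from LIMSEQ_unique[OF FT_unique[OF t tlim] this] show ?thesis .
qed

lemma solution_rep:
 assumes "frac_schrodinger_solution \<alpha> u"
 shows "u t \<in> L2" "rep (u t) = multiplier (evolution \<alpha> 0 t) (rep (u 0))"
proof -
 have pb: "bdd_measurable (evolution \<alpha> 0 t :: 'a \<Rightarrow> complex)" by (rule bdd_measurable_evolution) simp
 have m: "(\<lambda>\<xi>::'a. exp (- \<i> * complex_of_real (t * frac_laplacian_symbol \<alpha> \<xi>))) = evolution \<alpha> 0 t"
  by (auto simp: evolution_def frac_laplacian_symbol_def Complex_eq mult.assoc)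
 have "fourier_multiplier (\<lambda>\<xi>. exp (- \<i> * complex_of_real (t * frac_laplacian_symbol \<alpha> \<xi>))) (u 0) (u t)"
  using assms unfolding frac_schrodinger_solution_def by (rule spec)
 then obtain h where h: "has_fourier_transform (u 0) h" "has_fourier_transform (u t) (\<lambda>\<xi>. evolution \<alpha> 0 t \<xi> * h \<xi>)"
  unfolding m fourier_multiplier_def by blast
 show "u t \<in> L2" using h(2) by (simp add: has_fourier_transform_def)
 have hL: "h \<in> L2" "(\<lambda>\<xi>. evolution \<alpha> 0 t \<xi> * h \<xi>) \<in> L2" using h by (auto simp: has_fourier_transform_def)
 have "rep (\<lambda>\<xi>. evolution \<alpha> 0 t \<xi> * h \<xi>) = mul (evolution \<alpha> 0 t) (rep h)" unfolding mul_def
  by (rule rep_mk[OF hL(2) mul_sq[OF pb fn(1)]]) (use fn_rep[OF hL(1)] in eventually_elim, simp)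
 hence "FT (rep (u t)) = mul (evolution \<alpha> 0 t) (FT (rep (u 0)))"
  unfolding has_fourier_transform_rep[OF h(1)] has_fourier_transform_rep[OF h(2)] .
 hence "iFT (FT (rep (u t))) = multiplier (evolution \<alpha> 0 t) (rep (u 0))" unfolding multiplier_def by simp
 thus "rep (u t) = multiplier (evolution \<alpha> 0 t) (rep (u 0))" unfolding iFT_FT .
qed

lemma lmeasurable_borel_part:
 fixes A :: "'a::euclidean_space set"
 assumes "A \<in> lmeasurable"
 obtains A' where "A' \<in> sets borel" "A' \<subseteq> A" "AE t in lborel. t \<in> A \<longleftrightarrow> t \<in> A'" "emeasure lborel A' < \<infinity>"
proof -
 have A: "A \<in> sets lebesgue" "emeasure lebesgue A < \<infinity>" using assms by (auto simp: fmeasurable_def)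
 from sets_completionE[OF A(1)] obtain S N N' where S: "A = S \<union> N" "N \<subseteq> N'" "N' \<in> null_sets lborel" "S \<in> sets lborel" .
 have "AE t in lborel. t \<in> A \<longleftrightarrow> t \<in> S" using AE_not_in[OF S(3)] by eventually_elim (use S(1,2) in auto)
 moreover have "emeasure lborel S < \<infinity>"
 proof -
  have "emeasure lborel S = emeasure lebesgue S" using S(4) by simp
  also have "\<dots> \<le> emeasure lebesgue A" using S(1) A(1) by (intro emeasure_mono) auto
  finally show ?thesis using A(2) by simp
 qed
 ultimately show thesis using that[of S] S by auto
qed

lemma sigma_finite_lebesgue: "sigma_finite_measure (lebesgue :: 'a::euclidean_space measure)"
proof
 obtain \<A> :: "'a set set" where A: "countable \<A>" "\<A> \<subseteq> sets lborel" "\<Union>\<A> = space lborel" "\<And>a. a \<in> \<A> \<Longrightarrow> emeasure lborel a \<noteq> \<infinity>"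
  using lborel.sigma_finite_countable by metis
 show "\<exists>\<A>::'a set set. countable \<A> \<and> \<A> \<subseteq> sets lebesgue \<and> \<Union>\<A> = space lebesgue \<and> (\<forall>a\<in>\<A>. emeasure lebesgue a \<noteq> \<infinity>)"
  using A by (intro exI[of _ \<A>]) auto
qed

text \<open>Both sides are iterated integrals, and completing the measure does not change the
  integral in a single variable.\<close>

lemma nn_integral_lebesgue_pair:
 fixes f :: "'a::euclidean_space \<times> 'a \<Rightarrow> ennreal"
 assumes f: "f \<in> borel_measurable (borel \<Otimes>\<^sub>M borel)"
 shows "(\<integral>\<^sup>+ p. f p \<partial>(lebesgue \<Otimes>\<^sub>M lebesgue)) = (\<integral>\<^sup>+ p. f p \<partial>(lborel \<Otimes>\<^sub>M lborel))"
proof -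
 interpret L: sigma_finite_measure "lebesgue :: 'a measure" by (rule sigma_finite_lebesgue)
 have i: "(\<lambda>x. x) \<in> measurable lebesgue (borel :: 'a measure)" by (rule measurable_completion) simp
 have "(\<lambda>p. (fst p, snd p)) \<in> measurable (lebesgue \<Otimes>\<^sub>M lebesgue) (borel \<Otimes>\<^sub>M borel :: ('a \<times> 'a) measure)"
  by (rule measurable_Pair[OF measurable_compose[OF measurable_fst i] measurable_compose[OF measurable_snd i]])
 from measurable_compose[OF this f] have f1: "f \<in> borel_measurable (lebesgue \<Otimes>\<^sub>M lebesgue)" by simp
 have f2: "f \<in> borel_measurable (lborel \<Otimes>\<^sub>M lborel)"
  using f by (simp add: measurable_cong_sets[OF sets_pair_measure_cong[OF sets_lborel sets_lborel] refl])
 show ?thesis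
  unfolding L.nn_integral_fst[OF f1, symmetric] lborel.nn_integral_fst[OF f2, symmetric] nn_integral_completion ..
qed

text \<open>On F \<times> E the squared weight is at most 2^(2g) (1 + |x - y|^(2g)). The constant
  part is integrable because both sets have finite measure; the other part is so by assumption, or
  for g = 0 by comparison with the first.\<close>

lemma kernel_weight_sq_integrable:
 fixes E F :: "'a::euclidean_space set"
 assumes E: "E \<in> sets borel" "emeasure lborel E < \<infinity>" and F: "F \<in> sets borel" "emeasure lborel F < \<infinity>" and g: "g \<ge> 0"
  and fin: "g \<noteq> 0 \<Longrightarrow> (\<integral>\<^sup>+ (x, y). indicator F x * ennreal (norm (x - y) powr (2 * g)) * indicator E y \<partial>(lborel \<Otimes>\<^sub>M lborel)) < \<infinity>"
 shows "kernel_weight g E F \<in> sq_integrable"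
proof -
 note [measurable] = E(1) F(1)
 define J where "J = (\<lambda>(x, y). indicator F x * ennreal (norm (x - y) powr (2 * g)) * indicator E y)"
 have Jm[measurable]: "J \<in> borel_measurable (lborel \<Otimes>\<^sub>M lborel)" unfolding J_def by measurable
 have prod: "(\<integral>\<^sup>+ p. indicator (F \<times> E) p \<partial>(lborel \<Otimes>\<^sub>M lborel)) < \<infinity>"
  using E F by (simp add: lborel.emeasure_pair_measure_Times ennreal_mult_less_top)
 have Jfin: "(\<integral>\<^sup>+ p. J p \<partial>(lborel \<Otimes>\<^sub>M lborel)) < \<infinity>"
 proof (cases "g = 0")
  case True
  have "(\<integral>\<^sup>+ p. J p \<partial>(lborel \<Otimes>\<^sub>M lborel)) \<le> (\<integral>\<^sup>+ p. indicator (F \<times> E) p \<partial>(lborel \<Otimes>\<^sub>M lborel))"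
   by (rule nn_integral_mono) (auto simp: J_def True indicator_def)
  thus ?thesis using prod by (rule le_less_trans)
 next
  case False
  thus ?thesis using fin unfolding J_def by simp
 qed
 have le: "ennreal ((cmod (kernel_weight g E F p))\<^sup>2) \<le> ennreal (2 powr (2 * g)) * (indicator (F \<times> E) p + J p)" for p
 proof (cases "p \<in> F \<times> E")
  case True
  define r where "r = norm (fst p - snd p)"
  have r0: "r \<ge> 0" by (simp add: r_def)
  have b: "(1 + r) powr (2 * g) \<le> 2 powr (2 * g) * (1 + r powr (2 * g))"
  proof (cases "r \<le> 1")
   case True
   hence "(1 + r) powr (2 * g) \<le> 2 powr (2 * g)" using r0 g by (intro powr_mono2) auto
   also have "\<dots> = 2 powr (2 * g) * 1" by simp
   also have "\<dots> \<le> 2 powr (2 * g) * (1 + r powr (2 * g))" by (intro mult_left_mono) auto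
   finally show ?thesis .
  next
   case False
   hence "(1 + r) powr (2 * g) \<le> (2 * r) powr (2 * g)" using r0 g by (intro powr_mono2) auto
   also have "\<dots> = 2 powr (2 * g) * r powr (2 * g)" using r0 by (simp add: powr_mult)
   also have "\<dots> \<le> 2 powr (2 * g) * (1 + r powr (2 * g))" by (intro mult_left_mono) auto
   finally show ?thesis .
  qed
  have "(cmod (kernel_weight g E F p))\<^sup>2 = (1 + r) powr (2 * g)"
   using True r0 by (cases p) (simp add: kernel_weight_def r_def power2_eq_square powr_add[symmetric])
  moreover have "ennreal (2 powr (2 * g)) * (indicator (F \<times> E) p + J p) = ennreal (2 powr (2 * g) * (1 + r powr (2 * g)))"
  proof -
   have "indicator (F \<times> E) p + J p = ennreal 1 + ennreal (r powr (2 * g))" using True by (cases p) (simp add: J_def r_def)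
   also have "\<dots> = ennreal (1 + r powr (2 * g))" by (rule ennreal_plus[symmetric]) auto
   finally show ?thesis by (simp only: ennreal_mult'[symmetric] powr_ge_zero)
  qed
  ultimately show ?thesis using b by (simp add: ennreal_leI)
 next
  case False
  hence "kernel_weight g E F p = 0" by (cases p) (auto simp: kernel_weight_def indicator_def)
  thus ?thesis by simp
 qed
 have km: "kernel_weight g E F \<in> borel_measurable borel" by (rule kernel_weight_measurable[OF E(1) F(1)])
 have "(\<integral>\<^sup>+ p. ennreal ((cmod (kernel_weight g E F p))\<^sup>2) \<partial>(lborel \<Otimes>\<^sub>M lborel))
   \<le> (\<integral>\<^sup>+ p. ennreal (2 powr (2 * g)) * (indicator (F \<times> E) p + J p) \<partial>(lborel \<Otimes>\<^sub>M lborel))"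
  by (rule nn_integral_mono) (rule le)
 also have "\<dots> = ennreal (2 powr (2 * g)) * ((\<integral>\<^sup>+ p. indicator (F \<times> E) p \<partial>(lborel \<Otimes>\<^sub>M lborel)) + (\<integral>\<^sup>+ p. J p \<partial>(lborel \<Otimes>\<^sub>M lborel)))"
 proof -
  have i: "(\<lambda>p. indicator (F \<times> E) p :: ennreal) \<in> borel_measurable (lborel \<Otimes>\<^sub>M lborel)" by measurable
  have "(\<integral>\<^sup>+ p. ennreal (2 powr (2 * g)) * (indicator (F \<times> E) p + J p) \<partial>(lborel \<Otimes>\<^sub>M lborel)) = ennreal (2 powr (2 * g)) * (\<integral>\<^sup>+ p. indicator (F \<times> E) p + J p \<partial>(lborel \<Otimes>\<^sub>M lborel))"
   by (rule nn_integral_cmult) (use i Jm in measurable)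
  also have "(\<integral>\<^sup>+ p. indicator (F \<times> E) p + J p \<partial>(lborel \<Otimes>\<^sub>M lborel)) = (\<integral>\<^sup>+ p. indicator (F \<times> E) p \<partial>(lborel \<Otimes>\<^sub>M lborel)) + (\<integral>\<^sup>+ p. J p \<partial>(lborel \<Otimes>\<^sub>M lborel))"
   by (rule nn_integral_add[OF i Jm])
  finally show ?thesis .
 qed
 also have "\<dots> < \<infinity>" using prod Jfin by (simp add: ennreal_mult_less_top)
 finally have "(\<integral>\<^sup>+ p. ennreal ((cmod (kernel_weight g E F p))\<^sup>2) \<partial>lborel) < \<infinity>" unfolding lborel_prod .
 hence "integrable lborel (\<lambda>p. (cmod (kernel_weight g E F p))\<^sup>2)"
  by (intro integrableI_nonneg) (use km in auto)
 thus ?thesis using km by (simp add: sq_integrable_def)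
qed

lemma minus_mul_indicator:
 assumes A: "A \<in> sets borel"
 shows "x - mul (indicator A) x = mul (indicator (- A)) x"
proof -
 have "mul (\<lambda>t. indicator A t + indicator (- A) t) x = mul (indicator A) x + mul (indicator (- A)) x"
  using A by (intro mul_add_left bdd_measurable_indicator) auto
 moreover have "(\<lambda>t. indicator A t + indicator (- A) t :: complex) = (\<lambda>_. 1)" by (auto simp: indicator_def)
 ultimately have "mul (indicator A) x + mul (indicator (- A)) x = x" by (simp add: mul_one)
 thus ?thesis unfolding diff_eq_eq add.commute[of "mul (indicator (- A)) x"] by (rule sym)
qed

theorem theorem2p1:
  fixes \<alpha> \<gamma> T :: real and E F :: "(real^'n) set"
  assumes "\<alpha> > 1/2"
    and "E \<in> lmeasurable" and "F \<in> lmeasurable"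
    and "\<gamma> = real CARD('n) * (1 - \<alpha>) / (2 * \<alpha> - 1)"
    and "\<alpha> < 1 \<Longrightarrow>
      (\<integral>\<^sup>+ (x, y). indicator F x * ennreal (norm (x - y) powr (2 * \<gamma>)) * indicator E y
         \<partial>(lebesgue \<Otimes>\<^sub>M lebesgue)) < \<infinity>"
    and "T \<noteq> 0"
  shows "\<exists>C::real. \<forall>u::real \<Rightarrow> real^'n \<Rightarrow> complex. frac_schrodinger_solution \<alpha> u \<longrightarrow>
    (\<forall>t. L2_norm_on UNIV (u t) \<le> C * (L2_norm_on (- E) (u 0) + L2_norm_on (- F) (u T)))"
proof -
 \<comment> \<open>Borel subsets of E and F: inclusion hands on the integrability hypothesis, and
   equality up to null sets preserves the norms over the complements.\<close>
 obtain E' where E': "E' \<in> sets borel" "E' \<subseteq> E" "AE t in lborel. t \<in> E \<longleftrightarrow> t \<in> E'" "emeasure lborel E' < \<infinity>"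
  by (rule lmeasurable_borel_part[OF assms(2)])
 obtain F' where F': "F' \<in> sets borel" "F' \<subseteq> F" "AE t in lborel. t \<in> F \<longleftrightarrow> t \<in> F'" "emeasure lborel F' < \<infinity>"
  by (rule lmeasurable_borel_part[OF assms(3)])
 \<comment> \<open>Equals \<gamma> for \<alpha> < 1 and is 0 for \<alpha> \<ge> 1, where the formula
   for \<gamma> is nonpositive.\<close>
 define g where "g = real DIM(real^'n) * max 0 (1 - \<alpha>) / (2 * \<alpha> - 1)"
 have g: "g \<ge> 0" using assms(1) by (simp add: g_def)
 have w: "kernel_weight g E' F' \<in> sq_integrable"
 proof (rule kernel_weight_sq_integrable[OF E'(1,4) F'(1,4) g])
  assume "g \<noteq> 0"
  hence a: "\<alpha> < 1" by (auto simp: g_def max_def split: if_splits)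
  hence gg: "g = \<gamma>" by (simp add: g_def assms(4) max_def)
  note [measurable] = E'(1) F'(1)
  have "(\<integral>\<^sup>+ (x, y). indicator F' x * ennreal (norm (x - y) powr (2 * g)) * indicator E' y \<partial>(lborel \<Otimes>\<^sub>M lborel))
    = (\<integral>\<^sup>+ (x, y). indicator F' x * ennreal (norm (x - y) powr (2 * g)) * indicator E' y \<partial>(lebesgue \<Otimes>\<^sub>M lebesgue))"
   by (rule nn_integral_lebesgue_pair[symmetric]) measurable
  also have "\<dots> \<le> (\<integral>\<^sup>+ (x, y). indicator F x * ennreal (norm (x - y) powr (2 * \<gamma>)) * indicator E y \<partial>(lebesgue \<Otimes>\<^sub>M lebesgue))"
   unfolding gg using E'(2) F'(2) by (intro nn_integral_mono) (auto simp: indicator_def)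
  finally show "(\<integral>\<^sup>+ (x, y). indicator F' x * ennreal (norm (x - y) powr (2 * g)) * indicator E' y \<partial>(lborel \<Otimes>\<^sub>M lborel)) < \<infinity>"
   using assms(5)[OF a] by (rule le_less_trans)
 qed
 define U :: "(real^'n) l2 \<Rightarrow> (real^'n) l2" where "U = multiplier (evolution \<alpha> 0 T)"
 have pb: "bdd_measurable (evolution \<alpha> 0 t :: real^'n \<Rightarrow> complex)" for t by (rule bdd_measurable_evolution) simp
 have iso: "norm (multiplier (evolution \<alpha> 0 t) x) = norm x" for t and x :: "(real^'n) l2"
  by (rule norm_multiplier[OF pb]) (simp add: norm_evolution)
 have contr: "norm (mul (indicator A) x) \<le> norm x" if "A \<in> sets borel" for A and x :: "(real^'n) l2"
  using norm_mul_le[OF bdd_measurable_indicator[OF that], of 1 x] by (simp add: indicator_def)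
 have "\<exists>C. \<forall>f. norm f \<le> C * (norm (f - mul (indicator E') f) + norm (U f - mul (indicator F') (U f)))"
 proof (rule hilbert_schmidt_bound[OF assms(1) assms(6), where 'a="real^'n"])
  fix B assume HS: "\<And>(E :: (real^'n) set) F S. E \<in> sets borel \<Longrightarrow> emeasure lborel E < \<infinity> \<Longrightarrow> F \<in> sets borel \<Longrightarrow>
   kernel_weight (real DIM(real^'n) * max 0 (1 - \<alpha>) / (2 * \<alpha> - 1)) E F \<in> sq_integrable \<Longrightarrow> orthonormal S \<Longrightarrow>
   (\<Sum>e\<in>S. (norm (mul (indicator F) (multiplier (evolution \<alpha> 0 T) (mul (indicator E) e))))\<^sup>2)
    \<le> B * (norm (mk (kernel_weight (real DIM(real^'n) * max 0 (1 - \<alpha>) / (2 * \<alpha> - 1)) E F)))\<^sup>2"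
  show ?thesis
  proof (rule annihilating_estimate[where U=U and P="mul (indicator E')" and Q="mul (indicator F')" and M="B * (norm (mk (kernel_weight g E' F')))\<^sup>2"])
   show "linear U" unfolding U_def by (rule linear_multiplier[OF pb])
   show "linear (mul (indicator E') :: (real^'n) l2 \<Rightarrow> _)" "linear (mul (indicator F') :: (real^'n) l2 \<Rightarrow> _)"
    using E' F' by (auto intro!: linear_mul bdd_measurable_indicator)
   show "norm (U x) = norm x" for x unfolding U_def by (rule iso)
   show "norm (mul (indicator E') x) \<le> norm x" "norm (mul (indicator F') x) \<le> norm x" for x :: "(real^'n) l2"
    by (rule contr, rule E' F')+
   show "(\<Sum>e\<in>S. (norm (mul (indicator F') (U (mul (indicator E') e))))\<^sup>2) \<le> B * (norm (mk (kernel_weight g E' F')))\<^sup>2" if "orthonormal S" for S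
    unfolding U_def g_def by (rule HS[OF E'(1,4) F'(1) w[unfolded g_def] that])
   show "f = 0" if "mul (indicator E') f = f" "mul (indicator F') (U f) = U f" for f
    by (rule localised_eq_0[OF assms(1) assms(6) E'(1,4) F'(1) w[unfolded g_def] that[unfolded U_def]])
  qed
 qed
 then obtain C where C: "\<And>f. norm f \<le> C * (norm (f - mul (indicator E') f) + norm (U f - mul (indicator F') (U f)))" by blast
 show ?thesis
 proof (intro exI allI impI)
  fix u :: "real \<Rightarrow> real^'n \<Rightarrow> complex" and t assume u: "frac_schrodinger_solution \<alpha> u"
  note uL = solution_rep(1)[OF u] and ur = solution_rep(2)[OF u]
  have "L2_norm_on UNIV (u t) = norm (mul (indicator UNIV) (rep (u t)))" by (rule L2_norm_on_rep[OF uL]) auto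
  also have "\<dots> = norm (rep (u t))" unfolding indicator_UNIV mul_one ..
  \<comment> \<open>Conservation of the norm makes an estimate at time 0 valid for all t with the
    same constant.\<close>
  also have "\<dots> = norm (rep (u 0))" unfolding ur[of t] iso ..
  also have "\<dots> \<le> C * (norm (mul (indicator (- E')) (rep (u 0))) + norm (mul (indicator (- F')) (rep (u T))))"
   using C[of "rep (u 0)"] unfolding minus_mul_indicator[OF E'(1)] minus_mul_indicator[OF F'(1)] U_def ur[of T, symmetric] .
  also have "norm (mul (indicator (- E')) (rep (u 0))) = L2_norm_on (- E) (u 0)"
   by (rule L2_norm_on_rep[OF uL, symmetric])
    (use E'(1,3) fmeasurableD[OF assms(2)] in \<open>auto simp: Compl_in_sets_lebesgue\<close>)
  also have "norm (mul (indicator (- F')) (rep (u T))) = L2_norm_on (- F) (u T)"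
   by (rule L2_norm_on_rep[OF uL, symmetric])
    (use F'(1,3) fmeasurableD[OF assms(3)] in \<open>auto simp: Compl_in_sets_lebesgue\<close>)
  finally show "L2_norm_on UNIV (u t) \<le> C * (L2_norm_on (- E) (u 0) + L2_norm_on (- F) (u T))" .
 qed
qed

end
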